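(* Let $n\ge 1$. The monads $T^{(n)}_0,\ldots,T^{(n)}_{n-1}$ on the category $n\text{-}\mathbf{GSet}$ of $n$-globular sets, where $T^{(n)}_i$ is the monad for free $i$-composition, form a distributive series of monads, in which for all $n>i>j\geq 0$ the distributive law $$\lambda^{(n)}_{ij}:T^{(n)}_iT^{(n)}_j\Rightarrow T^{(n)}_jT^{(n)}_i$$ is given by interchange. The resulting composite monad $T^{(n)}_0T^{(n)}_1\cdots T^{(n)}_{n-1}$ is the free strict $n$-category monad on $n\text{-}\mathbf{GSet}$.
   Context: **Globular sets and graphs.** An $n$-globular set $A$ consists of sets $A(0),\ldots,A(n)$ and functions $s,t:A(m)\to A(m-1)$ ($1\le m\le n$) with $ss=st$, $ts=tt$; with the obvious morphisms these form $n\text{-}\mathbf{GSet}$, also written $n\text{-}\mathbf{Gph}$, with $0\text{-}\mathbf{Gph}=\mathbf{Set}$. For a category $\mathcal{V}$, a $\mathcal{V}$-graph $A$ is a set $A_0$ of objects together with, for each pair $a,a'\in A_0$, an object $A(a,a')\in\mathcal{V}$; a morphism $F:A\to B$ is a function $F:A_0\to B_0$ with morphisms $A(a,a')\to B(Fa,Fa')$ in $\mathcal{V}$. These form a category $\mathcal{V}\text{-}\mathbf{Gph}$. One identifies $((n-1)\text{-}\mathbf{Gph})\text{-}\mathbf{Gph}=n\text{-}\mathbf{Gph}$. There is a 2-functor $\mathbf{Cat}\to\mathbf{Cat}$, $\mathcal{V}\mapsto\mathcal{V}\text{-}\mathbf{Gph}$, $F\mapsto F_*$, $\alpha\mapsto\alpha_*$,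 where $(F_*A)_0=A_0$, $(F_*A)(a,a')=F(A(a,a'))$, and $\alpha_*$ is the identity on objects and $\alpha_{A(a,a')}$ on hom-objects; it sends monads to monads and distributive laws to distributive laws. **The monads $T^{(n)}_i$.** For a presheaf category $\mathcal{V}$ (with cartesian product), $\mathbf{fc}_{\mathcal{V}}$ is the free $\mathcal{V}$-category monad on $\mathcal{V}\text{-}\mathbf{Gph}$: $\mathbf{fc}_{\mathcal V}(A)$ has the same objects as $A$, and $$\mathbf{fc}_{\mathcal V}(A)(a,a')=\coprod_{k\ge0,\;a=a_0,a_1,\ldots,a_k=a'}A(a_{k-1},a_k)\times\cdots\times A(a_0,a_1).$$ For $n\ge1$ put $T^{(n)}_0=\mathbf{fc}_{(n-1)\text{-}\mathbf{Gph}}$, and for $0<i\le n-1$ put $T^{(n)}_i=(T^{(n-1)}_{i-1})_*$. Explicitly, $T^{(n)}_iA(m)=A(m)$ for $m\le i$, and for $m>i$ it is the set of strings of length $k\ge0$ of $m$-cells of $A$ composable along bounding $i$-cells. **Interchange laws.** For $0<i<n$, write $T=T^{(n-1)}_{i-1}$, so $T^{(n)}_i=T_*$. The transformation $\lambda^{(n)}_{i0}:T_*\circ\mathbf{fc}\Rightarrow\mathbf{fc}\circ T_*$ (with $\mathbf{fc}=\mathbf{fc}_{(n-1)\text{-}\mathbf{Gph}}$) is the identity on objects and on hom-objects is the coproduct, over $k\ge0$ and sequences $a_0,\ldots,a_k$ of objects, of the canonical maps $$T\big(A(a_{k-1},a_k)\times\cdots\times A(a_0,a_1)\big)\to T\big(A(a_{k-1},a_k)\big)\times\cdots\times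 T\big(A(a_0,a_1)\big)$$ induced by the universal property of the product (here $T$ preserves coproducts). For $0<j<i<n$, $\lambda^{(n)}_{ij}$ is obtained from $\lambda^{(n-j)}_{i-j,0}$ by applying $(-)_*$ $j$ times. **Distributive series.** A distributive law of a monad $S$ over a monad $T$ is a natural transformation $\lambda:ST\Rightarrow TS$ with $\lambda\circ\eta^ST=T\eta^S$, $\lambda\circ\mu^ST=T\mu^S\circ\lambda S\circ S\lambda$, $\lambda\circ S\eta^T=\eta^TS$, $\lambda\circ S\mu^T=\mu^TS\circ T\lambda\circ\lambda T$. A distributive series of monads is a finite sequence of monads $T_0,\ldots,T_{n-1}$ on one category with, for all $i>j$, a distributive law $\lambda_{ij}:T_iT_j\Rightarrow T_jT_i$ of $T_i$ over $T_j$, such that for all $i>j>k$ the Yang–Baxter equation holds: $$\lambda_{jk}T_i\circ T_j\lambda_{ik}\circ\lambda_{ij}T_k=T_k\lambda_{ij}\circ\lambda_{ik}T_j\circ T_i\lambda_{jk}.$$ The resulting composite monad $T_0T_1\cdots T_{n-1}$ has unit $\eta^{T_0}\cdots\eta^{T_{n-1}}$ and multiplication the composite $$T_0\cdots T_{n-1}T_0\cdots T_{n-1}\Rightarrow T_0T_0\cdots T_{n-1}T_{n-1}\xrightarrow{\mu^{T_0}\cdots\mu^{T_{n-1}}}T_0\cdots T_{n-1},$$ where the first map is the evident composite of whiskered $\lambda_{pq}$'s, each swapping an adjacent $T_pT_q$ with $p>q$ (independent of the order of swaps by naturality). **Strict $n$-categories.** $1\text{-}\mathbf{Cat}=\mathbf{Cat}$,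 and strict $n$-categories are categories enriched in strict $(n-1)$-categories (with cartesian product). The free strict $n$-category monad on $n\text{-}\mathbf{GSet}$ is the monad induced by the forgetful functor from strict $n$-categories to $n\text{-}\mathbf{GSet}$ and its left adjoint; "is" is understood up to canonical isomorphism of monads. *)

theory Defs
  imports "HOL-Library.FuncSet"
begin

section \<open>Categories, functors, adjunctions\<close>

record ('o, 'm) cat =
  Ob :: "'o set"
  Ar :: "'m set"
  Dom :: "'m \<Rightarrow> 'o"
  Cod :: "'m \<Rightarrow> 'o"
  Id :: "'o \<Rightarrow> 'm"
  Comp :: "'m \<Rightarrow> 'm \<Rightarrow> 'm" (infixl "\<cdot>\<index>" 70)

definition hom :: "('o, 'm, 'z) cat_scheme \<Rightarrow> 'o \<Rightarrow> 'o \<Rightarrow> 'm set" where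
  "hom C A B = {f \<in> Ar C. Dom C f = A \<and> Cod C f = B}"

locale category =
  fixes C :: "('o, 'm, 'z) cat_scheme" (structure)
  assumes Dom_Ob: "f \<in> Ar C \<Longrightarrow> Dom C f \<in> Ob C"
    and Cod_Ob: "f \<in> Ar C \<Longrightarrow> Cod C f \<in> Ob C"
    and Id_hom: "A \<in> Ob C \<Longrightarrow> Id C A \<in> hom C A A"
    and Comp_hom: "f \<in> hom C A B \<Longrightarrow> g \<in> hom C B D \<Longrightarrow> g \<cdot> f \<in> hom C A D"
    and Comp_Id: "f \<in> hom C A B \<Longrightarrow> f \<cdot> Id C A = f"
    and Id_Comp: "f \<in> hom C A B \<Longrightarrow> Id C B \<cdot> f = f"
    and Comp_assoc:
      "f \<in> hom C A B \<Longrightarrow> g \<in> hom C B D \<Longrightarrow> h \<in> hom C D E \<Longrightarrow> h \<cdot> g \<cdot> f = h \<cdot> (g \<cdot> f)"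

definition iso_arrow :: "('o, 'm, 'z) cat_scheme \<Rightarrow> 'm \<Rightarrow> bool" where
  "iso_arrow C f \<longleftrightarrow> f \<in> Ar C \<and>
     (\<exists>g \<in> hom C (Cod C f) (Dom C f).
        g \<cdot>\<^bsub>C\<^esub> f = Id C (Dom C f) \<and> f \<cdot>\<^bsub>C\<^esub> g = Id C (Cod C f))"

record ('o, 'm, 'p, 'q) fctr =
  fob :: "'o \<Rightarrow> 'p"
  far :: "'m \<Rightarrow> 'q"

definition id_fctr :: "('o, 'm, 'o, 'm) fctr" where
  "id_fctr = \<lparr>fob = \<lambda>A. A, far = \<lambda>f. f\<rparr>"

definition comp_fctr ::
    "('p, 'q, 'r, 's) fctr \<Rightarrow> ('o, 'm, 'p, 'q) fctr \<Rightarrow> ('o, 'm, 'r, 's) fctr" (infixr "\<odot>" 75) where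
  "G \<odot> F = \<lparr>fob = \<lambda>A. fob G (fob F A), far = \<lambda>f. far G (far F f)\<rparr>"

locale cat_functor = C: category C + D: category D
  for C :: "('o, 'm, 'z) cat_scheme" and D :: "('p, 'q, 'y) cat_scheme" +
  fixes F :: "('o, 'm, 'p, 'q) fctr"
  assumes fob_Ob: "A \<in> Ob C \<Longrightarrow> fob F A \<in> Ob D"
    and far_hom: "f \<in> hom C A B \<Longrightarrow> far F f \<in> hom D (fob F A) (fob F B)"
    and far_Id: "A \<in> Ob C \<Longrightarrow> far F (Id C A) = Id D (fob F A)"
    and far_Comp: "f \<in> hom C A B \<Longrightarrow> g \<in> hom C B E \<Longrightarrow>
      far F (g \<cdot>\<^bsub>C\<^esub> f) = far F g \<cdot>\<^bsub>D\<^esub> far F f"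

locale nat_trans = F: cat_functor C D F + G: cat_functor C D G
  for C :: "('o, 'm, 'z) cat_scheme" and D :: "('p, 'q, 'y) cat_scheme" and F G +
  fixes \<alpha> :: "'o \<Rightarrow> 'q"
  assumes component: "A \<in> Ob C \<Longrightarrow> \<alpha> A \<in> hom D (fob F A) (fob G A)"
    and natural: "f \<in> hom C A B \<Longrightarrow> \<alpha> B \<cdot>\<^bsub>D\<^esub> far F f = far G f \<cdot>\<^bsub>D\<^esub> \<alpha> A"

definition equivalence ::
    "('o, 'm, 'z) cat_scheme \<Rightarrow> ('p, 'q, 'y) cat_scheme \<Rightarrow> ('o, 'm, 'p, 'q) fctr \<Rightarrow> bool" where
  "equivalence C D F \<longleftrightarrow> cat_functor C D F \<and>
     (\<forall>A \<in> Ob C. \<forall>B \<in> Ob C. bij_betw (far F) (hom C A B) (hom D (fob F A) (fob F B))) \<and>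
     (\<forall>Y \<in> Ob D. \<exists>A \<in> Ob C. \<exists>f \<in> hom D (fob F A) Y. iso_arrow D f)"

locale adjunction =
  unit: nat_trans C C id_fctr "U \<odot> F" \<eta> + counit: nat_trans D D "F \<odot> U" id_fctr \<epsilon> +
  F: cat_functor C D F + U: cat_functor D C U
  for C :: "('o, 'm, 'z) cat_scheme" and D :: "('p, 'q, 'y) cat_scheme" and F U \<eta> \<epsilon> +
  assumes triangle_left: "A \<in> Ob C \<Longrightarrow> \<epsilon> (fob F A) \<cdot>\<^bsub>D\<^esub> far F (\<eta> A) = Id D (fob F A)"
    and triangle_right: "X \<in> Ob D \<Longrightarrow> far U (\<epsilon> X) \<cdot>\<^bsub>C\<^esub> \<eta> (fob U X) = Id C (fob U X)"


section \<open>Monads and distributive series\<close>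

record ('o, 'm) monad =
  Fun :: "('o, 'm, 'o, 'm) fctr"
  Unit :: "'o \<Rightarrow> 'm"
  Mult :: "'o \<Rightarrow> 'm"

abbreviation mob :: "('o, 'm, 'z) monad_scheme \<Rightarrow> 'o \<Rightarrow> 'o" where "mob T \<equiv> fob (Fun T)"
abbreviation mar :: "('o, 'm, 'z) monad_scheme \<Rightarrow> 'm \<Rightarrow> 'm" where "mar T \<equiv> far (Fun T)"

locale monad =
  unit: nat_trans C C id_fctr "Fun T" "Unit T" +
  mult: nat_trans C C "Fun T \<odot> Fun T" "Fun T" "Mult T"
  for C :: "('o, 'm, 'z) cat_scheme" (structure) and T :: "('o, 'm) monad" +
  assumes unit_left: "A \<in> Ob C \<Longrightarrow> Mult T A \<cdot> Unit T (mob T A) = Id C (mob T A)"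
    and unit_right: "A \<in> Ob C \<Longrightarrow> Mult T A \<cdot> mar T (Unit T A) = Id C (mob T A)"
    and assoc: "A \<in> Ob C \<Longrightarrow> Mult T A \<cdot> Mult T (mob T A) = Mult T A \<cdot> mar T (Mult T A)"

text \<open>\<open>distributive_law C S T l\<close>: \<open>l : ST \<Rightarrow> TS\<close> is a distributive law of \<open>S\<close> over \<open>T\<close>.\<close>

locale distributive_law =
  S: monad C S + T: monad C T + nat_trans C C "Fun S \<odot> Fun T" "Fun T \<odot> Fun S" l
  for C :: "('o, 'm, 'z) cat_scheme" (structure) and S T l +
  assumes unit_S: "A \<in> Ob C \<Longrightarrow> l A \<cdot> Unit S (mob T A) = mar T (Unit S A)"
    and mult_S: "A \<in> Ob C \<Longrightarrow>
      l A \<cdot> Mult S (mob T A) = mar T (Mult S A) \<cdot> l (mob S A) \<cdot> mar S (l A)"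
    and unit_T: "A \<in> Ob C \<Longrightarrow> l A \<cdot> mar S (Unit T A) = Unit T (mob S A)"
    and mult_T: "A \<in> Ob C \<Longrightarrow>
      l A \<cdot> mar S (Mult T A) = Mult T (mob S A) \<cdot> mar T (l A) \<cdot> l (mob T A)"

text \<open>A series \<open>T 0, \<dots>, T (n-1)\<close> with laws \<open>l i j : T\<^sub>i T\<^sub>j \<Rightarrow> T\<^sub>j T\<^sub>i\<close> for \<open>n > i > j\<close>;
  the values of \<open>T\<close> and \<open>l\<close> outside these ranges are irrelevant.\<close>

locale distributive_series = category C
  for C :: "('o, 'm, 'z) cat_scheme" (structure) +
  fixes n :: nat and T :: "nat \<Rightarrow> ('o, 'm) monad" and l :: "nat \<Rightarrow> nat \<Rightarrow> 'o \<Rightarrow> 'm"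
  assumes monads: "i < n \<Longrightarrow> monad C (T i)"
    and laws: "j < i \<Longrightarrow> i < n \<Longrightarrow> distributive_law C (T i) (T j) (l i j)"
    and Yang_Baxter: "k < j \<Longrightarrow> j < i \<Longrightarrow> i < n \<Longrightarrow> A \<in> Ob C \<Longrightarrow>
      l j k (mob (T i) A) \<cdot> mar (T j) (l i k A) \<cdot> l i j (mob (T k) A) =
      mar (T k) (l i j A) \<cdot> l i k (mob (T j) A) \<cdot> mar (T i) (l j k A)"

text \<open>\<open>series_fctr T k = T\<^sub>0 \<cdots> T\<^sub>k\<^sub>-\<^sub>1\<close>.\<close>

primrec series_fctr :: "(nat \<Rightarrow> ('o, 'm) monad) \<Rightarrow> nat \<Rightarrow> ('o, 'm, 'o, 'm) fctr" where
  "series_fctr T 0 = id_fctr"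
| "series_fctr T (Suc k) = series_fctr T k \<odot> Fun (T k)"

primrec series_unit ::
    "('o, 'm, 'z) cat_scheme \<Rightarrow> (nat \<Rightarrow> ('o, 'm) monad) \<Rightarrow> nat \<Rightarrow> 'o \<Rightarrow> 'm" where
  "series_unit C T 0 A = Id C A"
| "series_unit C T (Suc k) A = series_unit C T k (mob (T k) A) \<cdot>\<^bsub>C\<^esub> Unit (T k) A"

text \<open>\<open>move C T l i k : T\<^sub>i T\<^sub>0 \<cdots> T\<^sub>k\<^sub>-\<^sub>1 \<Rightarrow> T\<^sub>0 \<cdots> T\<^sub>k\<^sub>-\<^sub>1 T\<^sub>i\<close> for \<open>k \<le> i\<close>.\<close>

primrec move :: "('o, 'm, 'z) cat_scheme \<Rightarrow> (nat \<Rightarrow> ('o, 'm) monad) \<Rightarrow>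
    (nat \<Rightarrow> nat \<Rightarrow> 'o \<Rightarrow> 'm) \<Rightarrow> nat \<Rightarrow> nat \<Rightarrow> 'o \<Rightarrow> 'm" where
  "move C T l i 0 A = Id C (mob (T i) A)"
| "move C T l i (Suc k) A =
     far (series_fctr T k) (l i k A) \<cdot>\<^bsub>C\<^esub> move C T l i k (mob (T k) A)"

text \<open>\<open>shuffle C T l k : T\<^sub>0 \<cdots> T\<^sub>k\<^sub>-\<^sub>1 T\<^sub>0 \<cdots> T\<^sub>k\<^sub>-\<^sub>1 \<Rightarrow> T\<^sub>0 T\<^sub>0 \<cdots> T\<^sub>k\<^sub>-\<^sub>1 T\<^sub>k\<^sub>-\<^sub>1\<close>.\<close>

primrec shuffle :: "('o, 'm, 'z) cat_scheme \<Rightarrow> (nat \<Rightarrow> ('o, 'm) monad) \<Rightarrow>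
    (nat \<Rightarrow> nat \<Rightarrow> 'o \<Rightarrow> 'm) \<Rightarrow> nat \<Rightarrow> 'o \<Rightarrow> 'm" where
  "shuffle C T l 0 A = Id C A"
| "shuffle C T l (Suc k) A =
     shuffle C T l k (mob (T k) (mob (T k) A)) \<cdot>\<^bsub>C\<^esub>
     far (series_fctr T k) (move C T l k k (mob (T k) A))"

text \<open>\<open>doubled_mult C T k : T\<^sub>0 T\<^sub>0 \<cdots> T\<^sub>k\<^sub>-\<^sub>1 T\<^sub>k\<^sub>-\<^sub>1 \<Rightarrow> T\<^sub>0 \<cdots> T\<^sub>k\<^sub>-\<^sub>1\<close> is the horizontal composite of the
  multiplications.\<close>

primrec doubled_mult ::
    "('o, 'm, 'z) cat_scheme \<Rightarrow> (nat \<Rightarrow> ('o, 'm) monad) \<Rightarrow> nat \<Rightarrow> 'o \<Rightarrow> 'm" where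
  "doubled_mult C T 0 A = Id C A"
| "doubled_mult C T (Suc k) A =
     far (series_fctr T k) (Mult (T k) A) \<cdot>\<^bsub>C\<^esub> doubled_mult C T k (mob (T k) (mob (T k) A))"

definition composite_monad :: "('o, 'm, 'z) cat_scheme \<Rightarrow> nat \<Rightarrow> (nat \<Rightarrow> ('o, 'm) monad) \<Rightarrow>
    (nat \<Rightarrow> nat \<Rightarrow> 'o \<Rightarrow> 'm) \<Rightarrow> ('o, 'm) monad" where
  "composite_monad C n T l =
     \<lparr>Fun = series_fctr T n,
      Unit = series_unit C T n,
      Mult = \<lambda>A. doubled_mult C T n A \<cdot>\<^bsub>C\<^esub> shuffle C T l n A\<rparr>"

definition adjunction_monad ::
    "('o, 'm, 'p, 'q) fctr \<Rightarrow> ('p, 'q, 'o, 'm) fctr \<Rightarrow> ('o \<Rightarrow> 'm) \<Rightarrow> ('p \<Rightarrow> 'q) \<Rightarrow> ('o, 'm) monad" where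
  "adjunction_monad F U \<eta> \<epsilon> =
     \<lparr>Fun = U \<odot> F, Unit = \<eta>, Mult = \<lambda>A. far U (\<epsilon> (fob F A))\<rparr>"

definition isomorphic_monads ::
    "('o, 'm, 'z) cat_scheme \<Rightarrow> ('o, 'm) monad \<Rightarrow> ('o, 'm) monad \<Rightarrow> bool" where
  "isomorphic_monads C S T \<longleftrightarrow> monad C S \<and> monad C T \<and>
     (\<exists>\<theta>. nat_trans C C (Fun S) (Fun T) \<theta> \<and>
        (\<forall>A \<in> Ob C. iso_arrow C (\<theta> A) \<and>
           \<theta> A \<cdot>\<^bsub>C\<^esub> Unit S A = Unit T A \<and>
           \<theta> A \<cdot>\<^bsub>C\<^esub> Mult S A = Mult T A \<cdot>\<^bsub>C\<^esub> mar T (\<theta> A) \<cdot>\<^bsub>C\<^esub> \<theta> (mob S A)))"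


section \<open>Chosen products and coproducts\<close>

text \<open>Finite products are indexed by lists, coproducts by subsets of \<open>'i\<close>. The records only carry
  the objects, projections and injections; mediating arrows come from the universal property.\<close>

record ('o, 'm) pcat = "('o, 'm) cat" +
  Prod :: "'o list \<Rightarrow> 'o"
  Proj :: "'o list \<Rightarrow> nat \<Rightarrow> 'm"

record ('o, 'm, 'i) vcat = "('o, 'm) pcat" +
  Coprod :: "'i set \<Rightarrow> ('i \<Rightarrow> 'o) \<Rightarrow> 'o"
  Inj :: "'i set \<Rightarrow> ('i \<Rightarrow> 'o) \<Rightarrow> 'i \<Rightarrow> 'm"

definition tuple :: "('o, 'm, 'z) pcat_scheme \<Rightarrow> 'o \<Rightarrow> 'o list \<Rightarrow> 'm list \<Rightarrow> 'm" where
  "tuple V X Ys fs =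
     (THE h. h \<in> hom V X (Prod V Ys) \<and> (\<forall>r < length Ys. Proj V Ys r \<cdot>\<^bsub>V\<^esub> h = fs ! r))"

definition prod_map :: "('o, 'm, 'z) pcat_scheme \<Rightarrow> 'o list \<Rightarrow> 'o list \<Rightarrow> 'm list \<Rightarrow> 'm" where
  "prod_map V Xs Ys fs =
     tuple V (Prod V Xs) Ys (map (\<lambda>r. fs ! r \<cdot>\<^bsub>V\<^esub> Proj V Xs r) [0..<length Xs])"

definition flatten :: "('o, 'm, 'z) pcat_scheme \<Rightarrow> 'o list list \<Rightarrow> 'm" where
  "flatten V Xss =
     tuple V (Prod V (map (Prod V) Xss)) (concat Xss)
       [Proj V (Xss ! p) q \<cdot>\<^bsub>V\<^esub> Proj V (map (Prod V) Xss) p.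
          p \<leftarrow> [0..<length Xss], q \<leftarrow> [0..<length (Xss ! p)]]"

definition cotuple :: "('o, 'm, 'i, 'z) vcat_scheme \<Rightarrow> 'i set \<Rightarrow> ('i \<Rightarrow> 'o) \<Rightarrow> 'o \<Rightarrow> ('i \<Rightarrow> 'm) \<Rightarrow> 'm" where
  "cotuple V I X Y f =
     (THE h. h \<in> hom V (Coprod V I X) Y \<and> (\<forall>i \<in> I. h \<cdot>\<^bsub>V\<^esub> Inj V I X i = f i))"


section \<open>Objects and arrows\<close>

text \<open>All sets are subsets of \<open>'a cell\<close>, which is closed under finite sequences, so that all the
  products and coproducts below stay inside the same universe; \<open>'a\<close> is arbitrary.\<close>

datatype 'a cell = Atom 'a | Tup (untup: "'a cell list")

text \<open>One pair of types serves for sets, (iterated) graphs and (iterated) enriched categories.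
  \<open>hm X (a, b)\<close> is the hom-object from \<open>a\<close> to \<open>b\<close>; \<open>cmp X (a, b, c)\<close> is the composition
  \<open>X(b,c) \<times> X(a,b) \<rightarrow> X(a,c)\<close> and \<open>idt X a : 1 \<rightarrow> X(a,a)\<close>. Functions are kept extensional, so that
  equality of objects and of arrows is the mathematical one.\<close>

datatype 'a obj =
    SetOb (pts: "'a cell set")
  | GphOb (pts: "'a cell set") (hm: "'a cell \<times> 'a cell \<Rightarrow> 'a obj")
  | CatOb (pts: "'a cell set") (hm: "'a cell \<times> 'a cell \<Rightarrow> 'a obj")
      (cmp: "'a cell \<times> 'a cell \<times> 'a cell \<Rightarrow> 'a arr") (idt: "'a cell \<Rightarrow> 'a arr")
and 'a arr =
    SetAr (src: "'a obj") (tgt: "'a obj") (fn: "'a cell \<Rightarrow> 'a cell")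
  | GphAr (src: "'a obj") (tgt: "'a obj") (fn: "'a cell \<Rightarrow> 'a cell")
      (fm: "'a cell \<times> 'a cell \<Rightarrow> 'a arr")

type_synonym 'a cell_pcat = "('a obj, 'a arr) pcat"
type_synonym 'a cell_vcat = "('a obj, 'a arr, 'a cell) vcat"
type_synonym 'a endo = "('a obj, 'a arr, 'a obj, 'a arr) fctr"
type_synonym 'a cell_monad = "('a obj, 'a arr) monad"

definition prod_pts :: "'a obj list \<Rightarrow> 'a cell set" where
  "prod_pts Xs = {Tup xs | xs. list_all2 (\<lambda>x X. x \<in> pts X) xs Xs}"

definition coprod_pts :: "'a cell set \<Rightarrow> ('a cell \<Rightarrow> 'a obj) \<Rightarrow> 'a cell set" where
  "coprod_pts I X = {Tup [i, x] | i x. i \<in> I \<and> x \<in> pts (X i)}"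

definition set_cat :: "'a cell_vcat" where
  "set_cat =
     \<lparr>Ob = range SetOb,
      Ar = {SetAr (SetOb A) (SetOb B) f | A B f. f \<in> A \<rightarrow>\<^sub>E B},
      Dom = src,
      Cod = tgt,
      Id = \<lambda>X. SetAr X X (\<lambda>x\<in>pts X. x),
      Comp = \<lambda>g f. SetAr (src f) (tgt g) (\<lambda>x\<in>pts (src f). fn g (fn f x)),
      Prod = \<lambda>Xs. SetOb (prod_pts Xs),
      Proj = \<lambda>Xs r. SetAr (SetOb (prod_pts Xs)) (Xs ! r) (\<lambda>x\<in>prod_pts Xs. untup x ! r),
      Coprod = \<lambda>I X. SetOb (coprod_pts I X),
      Inj = \<lambda>I X i. SetAr (X i) (SetOb (coprod_pts I X)) (\<lambda>x\<in>pts (X i). Tup [i, x])\<rparr>"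


section \<open>The category of V-graphs\<close>

definition gph_id :: "('a obj, 'a arr, 'z) cat_scheme \<Rightarrow> 'a obj \<Rightarrow> 'a arr" where
  "gph_id V A = GphAr A A (\<lambda>a\<in>pts A. a) (\<lambda>p\<in>pts A \<times> pts A. Id V (hm A p))"

definition gph_comp :: "('a obj, 'a arr, 'z) cat_scheme \<Rightarrow> 'a arr \<Rightarrow> 'a arr \<Rightarrow> 'a arr" where
  "gph_comp V g f =
     GphAr (src f) (tgt g) (\<lambda>a\<in>pts (src f). fn g (fn f a))
       (\<lambda>(a, b)\<in>pts (src f) \<times> pts (src f). fm g (fn f a, fn f b) \<cdot>\<^bsub>V\<^esub> fm f (a, b))"

definition is_gph :: "('a obj, 'a arr, 'z) cat_scheme \<Rightarrow> 'a obj \<Rightarrow> bool" where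
  "is_gph V A \<longleftrightarrow> (\<exists>A0 h. A = GphOb A0 h \<and> h \<in> A0 \<times> A0 \<rightarrow>\<^sub>E Ob V)"

text \<open>The typing of \<open>f\<close> only depends on the underlying graphs, so this is also used for \<open>CatOb\<close>.\<close>

definition is_gph_map :: "('a obj, 'a arr, 'z) cat_scheme \<Rightarrow> 'a arr \<Rightarrow> bool" where
  "is_gph_map V F \<longleftrightarrow> (\<exists>A B f \<phi>. F = GphAr A B f \<phi> \<and>
     f \<in> pts A \<rightarrow>\<^sub>E pts B \<and>
     \<phi> \<in> (\<Pi>\<^sub>E (a, b)\<in>pts A \<times> pts A. hom V (hm A (a, b)) (hm B (f a, f b))))"

text \<open>The hom-objects \<open>A\<^sub>r(p\<^sub>r, q\<^sub>r)\<close> for points \<open>p, q\<close> of the product of the \<open>A\<^sub>r\<close>.\<close>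

definition prod_homs :: "'a obj list \<Rightarrow> 'a cell \<Rightarrow> 'a cell \<Rightarrow> 'a obj list" where
  "prod_homs As p q = map (\<lambda>r. hm (As ! r) (untup p ! r, untup q ! r)) [0..<length As]"

definition gph_prod :: "('a obj, 'a arr, 'z) pcat_scheme \<Rightarrow> 'a obj list \<Rightarrow> 'a obj" where
  "gph_prod V As =
     GphOb (prod_pts As) (\<lambda>(p, q)\<in>prod_pts As \<times> prod_pts As. Prod V (prod_homs As p q))"

definition gph_coprod ::
    "('a obj, 'a arr, 'a cell, 'z) vcat_scheme \<Rightarrow> 'a cell set \<Rightarrow> ('a cell \<Rightarrow> 'a obj) \<Rightarrow> 'a obj" where
  "gph_coprod V I A =
     GphOb (coprod_pts I A) (\<lambda>(p, q)\<in>coprod_pts I A \<times> coprod_pts I A.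
       if untup p ! 0 = untup q ! 0 then hm (A (untup p ! 0)) (untup p ! 1, untup q ! 1)
       else Coprod V {} (\<lambda>_. undefined))"

definition proj_homs ::
    "('a obj, 'a arr, 'z) pcat_scheme \<Rightarrow> 'a obj list \<Rightarrow> nat \<Rightarrow> 'a cell \<times> 'a cell \<Rightarrow> 'a arr" where
  "proj_homs V As r = (\<lambda>(p, q)\<in>prod_pts As \<times> prod_pts As. Proj V (prod_homs As p q) r)"

definition VGph :: "('a obj, 'a arr, 'a cell, 'z) vcat_scheme \<Rightarrow> 'a cell_vcat" where
  "VGph V =
     \<lparr>Ob = {A. is_gph V A},
      Ar = {F. is_gph_map V F \<and> is_gph V (src F) \<and> is_gph V (tgt F)},
      Dom = src,
      Cod = tgt,
      Id = gph_id V,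
      Comp = gph_comp V,
      Prod = gph_prod V,
      Proj = \<lambda>As r. GphAr (gph_prod V As) (As ! r)
        (\<lambda>p\<in>prod_pts As. untup p ! r) (proj_homs V As r),
      Coprod = gph_coprod V,
      Inj = \<lambda>I A i. GphAr (A i) (gph_coprod V I A)
        (\<lambda>a\<in>pts (A i). Tup [i, a]) (\<lambda>p\<in>pts (A i) \<times> pts (A i). Id V (hm (A i) p))\<rparr>"

primrec nGph :: "nat \<Rightarrow> 'a cell_vcat" where
  "nGph 0 = set_cat"
| "nGph (Suc n) = VGph (nGph n)"

text \<open>The 2-functor \<open>V \<mapsto> V-Gph\<close> on functors, transformations (\<open>\<alpha> : F \<Rightarrow> G\<close>) and monads.\<close>

definition star :: "'a endo \<Rightarrow> 'a endo" where
  "star F =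
     (let S = \<lambda>A. GphOb (pts A) (\<lambda>p\<in>pts A \<times> pts A. fob F (hm A p))
      in \<lparr>fob = S,
          far = \<lambda>f. GphAr (S (src f)) (S (tgt f)) (fn f)
            (\<lambda>p\<in>pts (src f) \<times> pts (src f). far F (fm f p))\<rparr>)"

definition star_trans :: "'a endo \<Rightarrow> 'a endo \<Rightarrow> ('a obj \<Rightarrow> 'a arr) \<Rightarrow> 'a obj \<Rightarrow> 'a arr" where
  "star_trans F G \<alpha> A =
     GphAr (fob (star F) A) (fob (star G) A) (\<lambda>a\<in>pts A. a) (\<lambda>p\<in>pts A \<times> pts A. \<alpha> (hm A p))"

definition star_monad :: "'a cell_monad \<Rightarrow> 'a cell_monad" where
  "star_monad T =
     \<lparr>Fun = star (Fun T),
      Unit = star_trans id_fctr (Fun T) (Unit T),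
      Mult = star_trans (Fun T \<odot> Fun T) (Fun T) (Mult T)\<rparr>"


section \<open>Globular sets\<close>

text \<open>\<open>gs A m, gt A m\<close> are the source and target maps \<open>A(m+1) \<rightarrow> A(m)\<close>.\<close>

record 'a glob =
  cells :: "nat \<Rightarrow> 'a cell set"
  gs :: "nat \<Rightarrow> 'a cell \<Rightarrow> 'a cell"
  gt :: "nat \<Rightarrow> 'a cell \<Rightarrow> 'a cell"

record 'a gmap =
  gdom :: "'a glob"
  gcod :: "'a glob"
  gfn :: "nat \<Rightarrow> 'a cell \<Rightarrow> 'a cell"

definition is_glob :: "nat \<Rightarrow> 'a glob \<Rightarrow> bool" where
  "is_glob n A \<longleftrightarrow>
     (\<forall>m > n. cells A m = {}) \<and>
     (\<forall>m. gs A m \<in> cells A (Suc m) \<rightarrow>\<^sub>E cells A m) \<and>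
     (\<forall>m. gt A m \<in> cells A (Suc m) \<rightarrow>\<^sub>E cells A m) \<and>
     (\<forall>m. \<forall>x \<in> cells A (Suc (Suc m)).
        gs A m (gs A (Suc m) x) = gs A m (gt A (Suc m) x) \<and>
        gt A m (gs A (Suc m) x) = gt A m (gt A (Suc m) x))"

definition is_gmap :: "'a gmap \<Rightarrow> bool" where
  "is_gmap f \<longleftrightarrow>
     (\<forall>m. gfn f m \<in> cells (gdom f) m \<rightarrow>\<^sub>E cells (gcod f) m) \<and>
     (\<forall>m. \<forall>x \<in> cells (gdom f) (Suc m).
        gs (gcod f) m (gfn f (Suc m) x) = gfn f m (gs (gdom f) m x) \<and>
        gt (gcod f) m (gfn f (Suc m) x) = gfn f m (gt (gdom f) m x))"

definition nGSet :: "nat \<Rightarrow> ('a glob, 'a gmap) cat" where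
  "nGSet n =
     \<lparr>Ob = {A. is_glob n A},
      Ar = {f. is_gmap f \<and> is_glob n (gdom f) \<and> is_glob n (gcod f)},
      Dom = gdom,
      Cod = gcod,
      Id = \<lambda>A. \<lparr>gdom = A, gcod = A, gfn = \<lambda>m. \<lambda>x\<in>cells A m. x\<rparr>,
      Comp = \<lambda>g f. \<lparr>gdom = gdom f, gcod = gcod g,
        gfn = \<lambda>m. \<lambda>x\<in>cells (gdom f) m. gfn g m (gfn f m x)\<rparr>\<rparr>"

primrec src0 :: "'a glob \<Rightarrow> nat \<Rightarrow> 'a cell \<Rightarrow> 'a cell" where
  "src0 A 0 x = x"
| "src0 A (Suc m) x = src0 A m (gs A m x)"

primrec tgt0 :: "'a glob \<Rightarrow> nat \<Rightarrow> 'a cell \<Rightarrow> 'a cell" where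
  "tgt0 A 0 x = x"
| "tgt0 A (Suc m) x = tgt0 A m (gt A m x)"

text \<open>The globular set \<open>A(a, b)\<close> of cells of dimension at least 1 with bounding 0-cells \<open>a, b\<close>.\<close>

definition hom_glob :: "'a glob \<Rightarrow> 'a cell \<Rightarrow> 'a cell \<Rightarrow> 'a glob" where
  "hom_glob A a b =
     (let H = \<lambda>m. {x \<in> cells A (Suc m). src0 A (Suc m) x = a \<and> tgt0 A (Suc m) x = b}
      in \<lparr>cells = H,
          gs = \<lambda>m. restrict (gs A (Suc m)) (H (Suc m)),
          gt = \<lambda>m. restrict (gt A (Suc m)) (H (Suc m))\<rparr>)"

definition hom_gmap :: "'a gmap \<Rightarrow> 'a cell \<Rightarrow> 'a cell \<Rightarrow> 'a gmap" where
  "hom_gmap f a b =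
     \<lparr>gdom = hom_glob (gdom f) a b,
      gcod = hom_glob (gcod f) (gfn f 0 a) (gfn f 0 b),
      gfn = \<lambda>m. restrict (gfn f (Suc m)) (cells (hom_glob (gdom f) a b) m)\<rparr>"

text \<open>The comparison \<open>n-GSet \<rightarrow> n-Gph\<close> along which the two categories are identified.\<close>

primrec glob_to_gph :: "nat \<Rightarrow> 'a glob \<Rightarrow> 'a obj" where
  "glob_to_gph 0 A = SetOb (cells A 0)"
| "glob_to_gph (Suc n) A =
     GphOb (cells A 0) (\<lambda>(a, b)\<in>cells A 0 \<times> cells A 0. glob_to_gph n (hom_glob A a b))"

primrec gmap_to_arr :: "nat \<Rightarrow> 'a gmap \<Rightarrow> 'a arr" where
  "gmap_to_arr 0 f = SetAr (glob_to_gph 0 (gdom f)) (glob_to_gph 0 (gcod f)) (gfn f 0)"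
| "gmap_to_arr (Suc n) f =
     GphAr (glob_to_gph (Suc n) (gdom f)) (glob_to_gph (Suc n) (gcod f)) (gfn f 0)
       (\<lambda>(a, b)\<in>cells (gdom f) 0 \<times> cells (gdom f) 0. gmap_to_arr n (hom_gmap f a b))"

definition comparison :: "nat \<Rightarrow> ('a glob, 'a gmap, 'a obj, 'a arr) fctr" where
  "comparison n = \<lparr>fob = glob_to_gph n, far = gmap_to_arr n\<rparr>"


section \<open>The free V-category monad\<close>

text \<open>A sequence \<open>a = a\<^sub>0, \<dots>, a\<^sub>k = b\<close> is stored as \<open>Tup [a\<^sub>k, \<dots>, a\<^sub>0]\<close>, so that \<open>legs h\<close> lists
  \<open>h(a\<^sub>k\<^sub>-\<^sub>1, a\<^sub>k), \<dots>, h(a\<^sub>0, a\<^sub>1)\<close> in the order of the product in the definition of \<open>fc\<close>.\<close>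

definition paths :: "'a cell set \<Rightarrow> 'a cell \<Rightarrow> 'a cell \<Rightarrow> 'a cell set" where
  "paths A0 a b = {Tup as | as. as \<noteq> [] \<and> set as \<subseteq> A0 \<and> last as = a \<and> hd as = b}"

fun legs :: "('b \<times> 'b \<Rightarrow> 'c) \<Rightarrow> 'b list \<Rightarrow> 'c list" where
  "legs h (b # a # as) = h (a, b) # legs h (a # as)"
| "legs h _ = []"

definition path_prod ::
    "('a obj, 'a arr, 'z) pcat_scheme \<Rightarrow> 'a obj \<Rightarrow> 'a cell \<Rightarrow> 'a obj" where
  "path_prod V A p = Prod V (legs (hm A) (untup p))"

definition fc_ob :: "('a obj, 'a arr, 'a cell, 'z) vcat_scheme \<Rightarrow> 'a obj \<Rightarrow> 'a obj" where
  "fc_ob V A =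
     GphOb (pts A) (\<lambda>(a, b)\<in>pts A \<times> pts A. Coprod V (paths (pts A) a b) (path_prod V A))"

abbreviation path_inj ::
    "('a obj, 'a arr, 'a cell, 'z) vcat_scheme \<Rightarrow> 'a obj \<Rightarrow> 'a cell \<Rightarrow> 'a cell \<Rightarrow> 'a cell \<Rightarrow> 'a arr" where
  "path_inj V A a b p \<equiv> Inj V (paths (pts A) a b) (path_prod V A) p"

definition fc_ar :: "('a obj, 'a arr, 'a cell, 'z) vcat_scheme \<Rightarrow> 'a arr \<Rightarrow> 'a arr" where
  "fc_ar V F =
     (let A = src F; B = tgt F; f = fn F in
      GphAr (fc_ob V A) (fc_ob V B) f
        (\<lambda>(a, b)\<in>pts A \<times> pts A.
           cotuple V (paths (pts A) a b) (path_prod V A) (hm (fc_ob V B) (f a, f b))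
             (\<lambda>p. path_inj V B (f a) (f b) (Tup (map f (untup p))) \<cdot>\<^bsub>V\<^esub>
                  prod_map V (legs (hm A) (untup p)) (legs (hm B) (map f (untup p)))
                    (legs (fm F) (untup p)))))"

definition fc_unit :: "('a obj, 'a arr, 'a cell, 'z) vcat_scheme \<Rightarrow> 'a obj \<Rightarrow> 'a arr" where
  "fc_unit V A =
     GphAr A (fc_ob V A) (\<lambda>a\<in>pts A. a)
       (\<lambda>(a, b)\<in>pts A \<times> pts A.
          path_inj V A a b (Tup [b, a]) \<cdot>\<^bsub>V\<^esub> tuple V (hm A (a, b)) [hm A (a, b)] [Id V (hm A (a, b))])"

text \<open>Since products distribute over coproducts, a map out of \<open>fc(fc A)(a,b)\<close> is determined by its
  restrictions to the products given by a path \<open>as\<close> and, for each step \<open>(a\<^sub>r\<^sub>-\<^sub>1, a\<^sub>r)\<close> of it, a path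
  \<open>qs\<^sub>r\<close> from \<open>a\<^sub>r\<^sub>-\<^sub>1\<close> to \<open>a\<^sub>r\<close>. The multiplication sends this summand to the one indexed by the
  concatenated path, by reassociating the product.\<close>

definition join :: "'a cell list \<Rightarrow> 'a cell list \<Rightarrow> 'a cell" where
  "join as qs = Tup (concat (map (butlast \<circ> untup) qs) @ [last as])"

definition fc_mult_hom ::
    "('a obj, 'a arr, 'a cell, 'z) vcat_scheme \<Rightarrow> 'a obj \<Rightarrow> 'a cell \<Rightarrow> 'a cell \<Rightarrow> 'a arr" where
  "fc_mult_hom V A a b =
     (THE m. m \<in> hom V (hm (fc_ob V (fc_ob V A)) (a, b)) (hm (fc_ob V A) (a, b)) \<and>
        (\<forall>as qs. Tup as \<in> paths (pts A) a b \<and>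
             list_all2 (\<in>) qs (legs (\<lambda>(x, y). paths (pts A) x y) as) \<longrightarrow>
           m \<cdot>\<^bsub>V\<^esub> (path_inj V (fc_ob V A) a b (Tup as) \<cdot>\<^bsub>V\<^esub>
             prod_map V (map (path_prod V A) qs) (legs (hm (fc_ob V A)) as)
               (map2 (\<lambda>j q. j q) (legs (\<lambda>(x, y). path_inj V A x y) as) qs)) =
           path_inj V A a b (join as qs) \<cdot>\<^bsub>V\<^esub> flatten V (map (legs (hm A) \<circ> untup) qs)))"

definition fc :: "('a obj, 'a arr, 'a cell, 'z) vcat_scheme \<Rightarrow> 'a cell_monad" where
  "fc V =
     \<lparr>Fun = \<lparr>fob = fc_ob V, far = fc_ar V\<rparr>,
      Unit = fc_unit V,
      Mult = \<lambda>A. GphAr (fc_ob V (fc_ob V A)) (fc_ob V A) (\<lambda>a\<in>pts A. a)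
        (\<lambda>(a, b)\<in>pts A \<times> pts A. fc_mult_hom V A a b)\<rparr>"


section \<open>The monads for free composition and the interchange laws\<close>

text \<open>\<open>comp_monad n i\<close> is the monad for free \<open>i\<close>-composition on \<open>nGph n\<close>, for \<open>i < n\<close>.\<close>

fun comp_monad :: "nat \<Rightarrow> nat \<Rightarrow> 'a cell_monad" where
  "comp_monad (Suc n) 0 = fc (nGph n)"
| "comp_monad (Suc n) (Suc i) = star_monad (comp_monad n i)"
| "comp_monad 0 i = undefined"

text \<open>The hom-component at \<open>(a, b)\<close> of \<open>T\<^sub>* \<circ> fc \<Rightarrow> fc \<circ> T\<^sub>*\<close>. As \<open>T\<close> preserves coproducts, its domain
  is the coproduct of the \<open>T(A(a\<^sub>k\<^sub>-\<^sub>1,a\<^sub>k) \<times> \<cdots> \<times> A(a\<^sub>0,a\<^sub>1))\<close>, with injections the images under \<open>T\<close>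
  of the original ones.\<close>

definition interchange0_hom :: "('a obj, 'a arr, 'a cell, 'z) vcat_scheme \<Rightarrow> 'a endo \<Rightarrow>
    'a obj \<Rightarrow> 'a cell \<Rightarrow> 'a cell \<Rightarrow> 'a arr" where
  "interchange0_hom V T A a b =
     (THE m. m \<in> hom V (fob T (hm (fc_ob V A) (a, b))) (hm (fc_ob V (fob (star T) A)) (a, b)) \<and>
        (\<forall>p \<in> paths (pts A) a b.
           m \<cdot>\<^bsub>V\<^esub> far T (path_inj V A a b p) =
           path_inj V (fob (star T) A) a b p \<cdot>\<^bsub>V\<^esub>
             (let Xs = legs (hm A) (untup p) in
              tuple V (fob T (Prod V Xs)) (map (fob T) Xs)
                (map (\<lambda>r. far T (Proj V Xs r)) [0..<length Xs]))))"

definition interchange0 :: "('a obj, 'a arr, 'a cell, 'z) vcat_scheme \<Rightarrow> 'a endo \<Rightarrow>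
    'a obj \<Rightarrow> 'a arr" where
  "interchange0 V T A =
     GphAr (fob (star T) (fc_ob V A)) (fc_ob V (fob (star T) A)) (\<lambda>a\<in>pts A. a)
       (\<lambda>(a, b)\<in>pts A \<times> pts A. interchange0_hom V T A a b)"

text \<open>\<open>interchange n i j\<close> is meaningful for \<open>n > i > j\<close>.\<close>

fun interchange :: "nat \<Rightarrow> nat \<Rightarrow> nat \<Rightarrow> 'a obj \<Rightarrow> 'a arr" where
  "interchange (Suc n) (Suc i) 0 = interchange0 (nGph n) (Fun (comp_monad n i))"
| "interchange (Suc n) (Suc i) (Suc j) =
     star_trans (Fun (comp_monad n i) \<odot> Fun (comp_monad n j))
       (Fun (comp_monad n j) \<odot> Fun (comp_monad n i)) (interchange n i j)"
| "interchange n 0 j = undefined"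
| "interchange 0 i j = undefined"


section \<open>Strict n-categories\<close>

text \<open>Associativity and the unit laws are stated with the unbiased ternary and nullary products.\<close>

definition is_vcategory :: "('a obj, 'a arr, 'z) pcat_scheme \<Rightarrow> 'a obj \<Rightarrow> bool" where
  "is_vcategory V X \<longleftrightarrow> (\<exists>A h c e. X = CatOb A h c e \<and>
     h \<in> A \<times> A \<rightarrow>\<^sub>E Ob V \<and>
     c \<in> (\<Pi>\<^sub>E (x, y, z)\<in>A \<times> A \<times> A. hom V (Prod V [h (y, z), h (x, y)]) (h (x, z))) \<and>
     e \<in> (\<Pi>\<^sub>E x\<in>A. hom V (Prod V []) (h (x, x))) \<and>
     (\<forall>w\<in>A. \<forall>x\<in>A. \<forall>y\<in>A. \<forall>z\<in>A.
        let Hs = [h (y, z), h (x, y), h (w, x)]; P = Prod V Hs in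
        c (w, x, z) \<cdot>\<^bsub>V\<^esub> tuple V P [h (x, z), h (w, x)]
          [c (x, y, z) \<cdot>\<^bsub>V\<^esub> tuple V P [h (y, z), h (x, y)] [Proj V Hs 0, Proj V Hs 1], Proj V Hs 2] =
        c (w, y, z) \<cdot>\<^bsub>V\<^esub> tuple V P [h (y, z), h (w, y)]
          [Proj V Hs 0, c (w, x, y) \<cdot>\<^bsub>V\<^esub> tuple V P [h (x, y), h (w, x)] [Proj V Hs 1, Proj V Hs 2]]) \<and>
     (\<forall>x\<in>A. \<forall>y\<in>A.
        let H = h (x, y); i = Id V H in
        c (x, y, y) \<cdot>\<^bsub>V\<^esub> tuple V H [h (y, y), H] [e y \<cdot>\<^bsub>V\<^esub> tuple V H [] [], i] = i \<and>
        c (x, x, y) \<cdot>\<^bsub>V\<^esub> tuple V H [H, h (x, x)] [i, e x \<cdot>\<^bsub>V\<^esub> tuple V H [] []] = i))"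

definition is_vfunctor :: "('a obj, 'a arr, 'z) pcat_scheme \<Rightarrow> 'a arr \<Rightarrow> bool" where
  "is_vfunctor V F \<longleftrightarrow> is_gph_map V F \<and>
     (let X = src F; Y = tgt F; f = fn F; \<phi> = fm F in
      (\<forall>x\<in>pts X. \<forall>y\<in>pts X. \<forall>z\<in>pts X.
         \<phi> (x, z) \<cdot>\<^bsub>V\<^esub> cmp X (x, y, z) =
         cmp Y (f x, f y, f z) \<cdot>\<^bsub>V\<^esub>
           prod_map V [hm X (y, z), hm X (x, y)] [hm Y (f y, f z), hm Y (f x, f y)]
             [\<phi> (y, z), \<phi> (x, y)]) \<and>
      (\<forall>x\<in>pts X. \<phi> (x, x) \<cdot>\<^bsub>V\<^esub> idt X x = idt Y (f x)))"

definition vcat_prod :: "('a obj, 'a arr, 'z) pcat_scheme \<Rightarrow> 'a obj list \<Rightarrow> 'a obj" where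
  "vcat_prod V Xs =
     (let P = prod_pts Xs; h = (\<lambda>(p, q)\<in>P \<times> P. Prod V (prod_homs Xs p q)) in
      CatOb P h
        (\<lambda>(p, q, r)\<in>P \<times> P \<times> P.
           let Hs = [h (q, r), h (p, q)]; D = Prod V Hs in
           tuple V D (prod_homs Xs p r)
             (map (\<lambda>s. let x = untup p ! s; y = untup q ! s; z = untup r ! s; X = Xs ! s in
                 cmp X (x, y, z) \<cdot>\<^bsub>V\<^esub> tuple V D [hm X (y, z), hm X (x, y)]
                   [Proj V (prod_homs Xs q r) s \<cdot>\<^bsub>V\<^esub> Proj V Hs 0,
                    Proj V (prod_homs Xs p q) s \<cdot>\<^bsub>V\<^esub> Proj V Hs 1])
               [0..<length Xs]))
        (\<lambda>p\<in>P. tuple V (Prod V []) (prod_homs Xs p p)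
           (map (\<lambda>s. idt (Xs ! s) (untup p ! s)) [0..<length Xs])))"

definition VCat :: "('a obj, 'a arr, 'z) pcat_scheme \<Rightarrow> 'a cell_pcat" where
  "VCat V =
     \<lparr>Ob = {X. is_vcategory V X},
      Ar = {F. is_vfunctor V F \<and> is_vcategory V (src F) \<and> is_vcategory V (tgt F)},
      Dom = src,
      Cod = tgt,
      Id = gph_id V,
      Comp = gph_comp V,
      Prod = vcat_prod V,
      Proj = \<lambda>Xs r. GphAr (vcat_prod V Xs) (Xs ! r)
        (\<lambda>p\<in>prod_pts Xs. untup p ! r) (proj_homs V Xs r)\<rparr>"

primrec nCat :: "nat \<Rightarrow> 'a cell_pcat" where
  "nCat 0 = pcat.truncate set_cat"
| "nCat (Suc n) = VCat (nCat n)"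

text \<open>The underlying V-graph of a V-category.\<close>

definition underlying :: "'a endo" where
  "underlying =
     \<lparr>fob = \<lambda>X. GphOb (pts X) (hm X),
      far = \<lambda>F. GphAr (GphOb (pts (src F)) (hm (src F))) (GphOb (pts (tgt F)) (hm (tgt F)))
        (fn F) (fm F)\<rparr>"

primrec forget :: "nat \<Rightarrow> 'a endo" where
  "forget 0 = id_fctr"
| "forget (Suc n) = star (forget n) \<odot> underlying"

definition is_free_ncat_monad :: "nat \<Rightarrow> 'a cell_monad \<Rightarrow> bool" where
  "is_free_ncat_monad n M \<longleftrightarrow>
     (\<exists>F \<eta> \<epsilon>. adjunction (nGph n) (nCat n) F (forget n) \<eta> \<epsilon> \<and>
        isomorphic_monads (nGph n) M (adjunction_monad F (forget n) \<eta> \<epsilon>))"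

end

theory Submission
  imports Defs
begin

text \<open>The interchange maps are determined on formal composites: an arrow out of \<open>T(fc(A)(a,b))\<close> is
  determined by its values at \<open>T(x)\<close>, where \<open>x\<close> runs through the generalized elements of \<open>fc(A)(a,b)\<close>
  given by a path and elements of the hom-objects along it, because \<open>T\<close> preserves coproducts. All
  axioms of the distributive series reduce to equations between such composites. For the second part,
  the free strict (n+1)-category on \<open>A\<close> is the free category enriched in strict n-categories on the graph
  obtained from \<open>A\<close> by applying the free n-category functor to the hom-objects. The forgetful functors
  preserve the chosen products and coproducts on the nose, so they commute with the free enriched
  category monads, and naturality of the counit of the n-dimensional adjunction turns its multiplication
  into the one that the interchange maps give to the composite.\<close>

section \<open>Category theory\<close>

text \<open>All structure is carried by chosen products and coproducts and by arrows fixed through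
  definite descriptions, and functors are total functions, so equations between functors hold only
  relative to a category. Two notions make an induction on dimension possible. A \<open>dcat\<close>
  has finite products that distribute over coproducts; this passes from \<open>V\<close> both to
  \<open>V\<close>-graphs and to \<open>V\<close>-categories, so the same lemmas apply in every
  dimension. A \<open>cocont\<close> functor preserves coproducts; this property, rather than being
  a monad, is what makes the interchange map with \<open>fc\<close> well defined, and it is
  inherited by \<open>fc\<close>, by \<open>star\<close> and by composites. The interchange map is
  then also natural in the functor and compatible with composition of functors; these two facts give
  half of the axioms of a distributive law and the Yang-Baxter equation. Finally, a free category
  enriched in n-categories is a coproduct over paths, while \<open>nCat\<close> carries no
  coproducts; hence the categories \<open>nVCat\<close>, which carry them, and whose truncations are
  \<open>nCat\<close>.\<close>

context category
begin

lemma homD: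
 assumes "f \<in> hom C A B"
 shows "f \<in> Ar C" "Dom C f = A" "Cod C f = B"
 using assms by (auto simp: hom_def)

lemma homA:
 assumes "f \<in> hom C A B"
 shows "f \<in> Ar C" "Dom C f = A" "Cod C f = B" "A \<in> Ob C" "B \<in> Ob C"
 using assms Dom_Ob Cod_Ob by (auto simp: hom_def)

lemma Ar_hom: "f \<in> Ar C ==> f \<in> hom C (Dom C f) (Cod C f)"
 by (simp add: hom_def)

lemma Comp_Ar [simp]:
 assumes "f \<in> Ar C" "g \<in> Ar C" "Cod C f = Dom C g"
 shows "g \<cdot> f \<in> Ar C" "Dom C (g \<cdot> f) = Dom C f" "Cod C (g \<cdot> f) = Cod C g"
 using Comp_hom[of f "Dom C f" "Cod C f" g "Cod C g"] assms by (auto simp: hom_def)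

lemma Id_Ar [simp]:
 assumes "A \<in> Ob C"
 shows "Id C A \<in> Ar C" "Dom C (Id C A) = A" "Cod C (Id C A) = A"
 using Id_hom[OF assms] by (auto simp: hom_def)

lemma Comp_Id_simp [simp]: "f \<in> Ar C ==> Dom C f = A ==> f \<cdot> Id C A = f"
 using Comp_Id Ar_hom by blast

lemma Id_Comp_simp [simp]: "f \<in> Ar C ==> Cod C f = A ==> Id C A \<cdot> f = f"
 using Id_Comp Ar_hom by blast

lemma Comp_assoc_simp [simp]:
 "f \<in> Ar C ==> g \<in> Ar C ==> h \<in> Ar C ==> Cod C f = Dom C g ==> Cod C g = Dom C h ==>
  h \<cdot> g \<cdot> f = h \<cdot> (g \<cdot> f)"
 using Comp_assoc[of f "Dom C f" "Cod C f" g "Cod C g" h "Cod C h"] by (simp add: hom_def)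

lemma whisker1:
 assumes "g \<cdot> f = k" "f \<in> hom C A B" "g \<in> hom C B D" "x \<in> hom C X A"
 shows "g \<cdot> (f \<cdot> x) = k \<cdot> x"
 by (simp only: assms(1) flip: Comp_assoc[OF assms(4,2,3)])

end

declare (in category) Dom_Ob [simp] Cod_Ob [simp]

context cat_functor
begin

lemma far_Ar [simp]:
 assumes "f \<in> Ar C"
 shows "far F f \<in> Ar D" "Dom D (far F f) = fob F (Dom C f)" "Cod D (far F f) = fob F (Cod C f)"
 using far_hom[OF C.Ar_hom[OF assms]] by (auto simp: hom_def)

lemma far_Comp_simp:
 "f \<in> Ar C ==> g \<in> Ar C ==> Cod C f = Dom C g ==>
  far F (g \<cdot>\<^bsub>C\<^esub> f) = far F g \<cdot>\<^bsub>D\<^esub> far F f"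
 using far_Comp[of f "Dom C f" "Cod C f" g "Cod C g"] by (simp add: hom_def)

end

section \<open>Functors and natural transformations, up to agreement on a category\<close>

lemma far_comp_fctr [simp]: "far (G \<odot> F) f = far G (far F f)" "fob (G \<odot> F) A = fob G (fob F A)"
 by (simp_all add: comp_fctr_def)

lemma id_fctr_simps [simp]: "fob id_fctr A = A" "far id_fctr f = f"
 by (simp_all add: id_fctr_def)

lemma comp_fctr_assoc: "(H \<odot> G) \<odot> F = H \<odot> (G \<odot> F)"
 by (simp add: comp_fctr_def)

lemma id_comp_fctr [simp]: "id_fctr \<odot> F = F" "F \<odot> id_fctr = F"
 by (simp_all add: comp_fctr_def id_fctr_def)

lemma fctr_eqI: "(!!A. fob F A = fob G A) ==> (!!f. far F f = far G f) ==> F = G"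
 for F :: "('o, 'm, 'p, 'q) fctr"
 by (cases F; cases G) auto

lemma cat_functor_id: "category C ==> cat_functor C C id_fctr"
 by (simp add: cat_functor_def cat_functor_axioms_def)

lemma cat_functor_comp:
 assumes "cat_functor C D F" "cat_functor D E G"
 shows "cat_functor C E (G \<odot> F)"
proof -
 interpret F: cat_functor C D F by fact
 interpret G: cat_functor D E G by fact
 show ?thesis
  by unfold_locales
   (auto simp: F.fob_Ob G.fob_Ob F.far_Id G.far_Id intro: F.far_hom G.far_hom
    simp: F.far_Comp G.far_Comp[OF F.far_hom F.far_hom])
qed

text \<open>Functors are total functions on HOL types, and for instance \<open>star id_fctr\<close>
  moves objects that are not graphs. Agreement on the objects and arrows of \<open>C\<close> is
  therefore the equality of functors that can be proved.\<close>

definition fctr_eq :: "('o, 'm, 'z) cat_scheme => ('o, 'm, 'p, 'q) fctr => ('o, 'm, 'p, 'q) fctr => bool" where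
 "fctr_eq C F G \<longleftrightarrow> (\<forall>A \<in> Ob C. fob F A = fob G A) & (\<forall>f \<in> Ar C. far F f = far G f)"

lemma cat_functor_cong:
 assumes F: "cat_functor C D F" and eq: "fctr_eq C F G"
 shows "cat_functor C D G"
proof -
 interpret F: cat_functor C D F by fact
 have o: "!!A. A \<in> Ob C ==> fob G A = fob F A" and a: "!!f. f \<in> Ar C ==> far G f = far F f"
  using eq by (auto simp: fctr_eq_def)
 show ?thesis
 proof unfold_locales
  fix f A B assume f: "f \<in> hom C A B"
  note d = F.C.homA[OF f]
  show "far G f \<in> hom D (fob G A) (fob G B)" using F.far_hom[OF f] d by (simp add: o a)
  fix g E assume g: "g \<in> hom C B E"
  show "far G (g \<cdot>\<^bsub>C\<^esub> f) = far G g \<cdot>\<^bsub>D\<^esub> far G f"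
   using F.far_Comp[OF f g] d F.C.homA[OF g] by (simp add: a)
 qed (auto simp: o a F.fob_Ob F.far_Id)
qed

lemma nat_transI:
 assumes "cat_functor C D F" "cat_functor C D G"
  "!!A. A \<in> Ob C ==> \<alpha> A \<in> hom D (fob F A) (fob G A)"
  "!!f A B. f \<in> hom C A B ==> \<alpha> B \<cdot>\<^bsub>D\<^esub> far F f = far G f \<cdot>\<^bsub>D\<^esub> \<alpha> A"
 shows "nat_trans C D F G \<alpha>"
 using assms by (simp add: nat_trans_def nat_trans_axioms_def)

lemma nat_trans_cong:
 assumes "nat_trans C D F G \<alpha>" "fctr_eq C F F'" "fctr_eq C G G'" "!!A. A \<in> Ob C ==> \<alpha> A = \<beta> A"
 shows "nat_trans C D F' G' \<beta>"
proof -
 interpret nat_trans C D F G \<alpha> by fact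
 show ?thesis
 proof (rule nat_transI)
  show "cat_functor C D F'" "cat_functor C D G'"
   using assms cat_functor_cong F.cat_functor_axioms G.cat_functor_axioms by blast+
 next
  fix A assume "A \<in> Ob C" then show "\<beta> A \<in> hom D (fob F' A) (fob G' A)"
   using component[of A] assms by (simp add: fctr_eq_def)
 next
  fix f A B assume f: "f \<in> hom C A B"
  show "\<beta> B \<cdot>\<^bsub>D\<^esub> far F' f = far G' f \<cdot>\<^bsub>D\<^esub> \<beta> A"
   using natural[OF f] F.C.homA[OF f] assms by (simp add: fctr_eq_def)
 qed
qed

lemma fctr_eq_refl [simp]: "fctr_eq C F F"
 by (simp add: fctr_eq_def)

lemma fctr_eq_comp:
 assumes "fctr_eq C F F'" "fctr_eq D G G'" "cat_functor C D F"
 shows "fctr_eq C (G \<odot> F) (G' \<odot> F')"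
proof -
 interpret cat_functor C D F by fact
 show ?thesis using assms(1,2) fob_Ob far_Ar by (simp add: fctr_eq_def)
qed

text \<open>Lets the monad laws be read off from an adjunction and moved to data given by explicit
  formulas. This is how they are obtained for \<open>fc\<close> and for the composites of the
  series.\<close>

lemma monad_cong:
 assumes "monad C T" "fctr_eq C (Fun T) (Fun T')"
  "!!A. A \<in> Ob C ==> Unit T' A = Unit T A" "!!A. A \<in> Ob C ==> Mult T' A = Mult T A"
 shows "monad C T'"
proof -
 interpret monad C T by fact
 note eqs = assms(2-)[unfolded fctr_eq_def]
 have ob: "!!A. A \<in> Ob C ==> mob T A \<in> Ob C" using unit.G.fob_Ob .
 have ob': "!!A. A \<in> Ob C ==> mob T' A = mob T A" using eqs by simp
 have u: "!!A. A \<in> Ob C ==> Unit T A \<in> Ar C"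
  using unit.component by (auto simp: hom_def)
 have m: "!!A. A \<in> Ob C ==> Mult T A \<in> Ar C"
  using mult.component by (auto simp: hom_def)
 show ?thesis
 proof (intro monad.intro monad_axioms.intro)
  show "nat_trans C C id_fctr (Fun T') (Unit T')"
   by (rule nat_trans_cong[OF unit.nat_trans_axioms]) (use assms in auto)
  show "nat_trans C C (Fun T' \<odot> Fun T') (Fun T') (Mult T')"
   by (rule nat_trans_cong[OF mult.nat_trans_axioms])
    (use assms fctr_eq_comp[OF assms(2) assms(2) unit.G.cat_functor_axioms] in auto)
 next
  fix A assume A: "A \<in> Ob C"
  show "Mult T' A \<cdot>\<^bsub>C\<^esub> Unit T' (mob T' A) = Id C (mob T' A)"
   using unit_left[OF A] eqs A ob by simp
  show "Mult T' A \<cdot>\<^bsub>C\<^esub> mar T' (Unit T' A) = Id C (mob T' A)"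
   using unit_right[OF A] eqs A ob u by simp
  show "Mult T' A \<cdot>\<^bsub>C\<^esub> Mult T' (mob T' A) = Mult T' A \<cdot>\<^bsub>C\<^esub> mar T' (Mult T' A)"
   using assoc[OF A] eqs A ob m by simp
 qed
qed

section \<open>Adjunctions: induced monads, universal arrows, composition\<close>

lemma adjunction_is_monad:
 assumes "adjunction C D F U \<eta> \<epsilon>"
 shows "monad C (adjunction_monad F U \<eta> \<epsilon>)"
proof -
 interpret adjunction C D F U \<eta> \<epsilon> by fact
 have e: "!!X. X \<in> Ob D ==> \<epsilon> X \<in> hom D (fob F (fob U X)) X"
  using counit.component by simp
 show ?thesis
 proof (intro monad.intro monad_axioms.intro, goal_cases)
  case 1
  then show ?case by (simp add: adjunction_monad_def unit.nat_trans_axioms)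
 next
  case 2
  show ?case unfolding adjunction_monad_def monad.simps
  proof (rule nat_transI)
   show "cat_functor C C ((U \<odot> F) \<odot> (U \<odot> F))"
    by (rule cat_functor_comp) (rule unit.G.cat_functor_axioms)+
   show "cat_functor C C (U \<odot> F)" by (rule unit.G.cat_functor_axioms)
  next
   fix A assume "A \<in> Ob C"
   then show "far U (\<epsilon> (fob F A)) \<in> hom C (fob ((U \<odot> F) \<odot> (U \<odot> F)) A) (fob (U \<odot> F) A)"
    using U.far_hom[OF e] F.fob_Ob by simp
  next
   fix f A B assume f: "f \<in> hom C A B"
   have "far U (\<epsilon> (fob F B) \<cdot>\<^bsub>D\<^esub> far F (far U (far F f))) = far U (far F f \<cdot>\<^bsub>D\<^esub> \<epsilon> (fob F A))"
    using counit.natural[OF F.far_hom[OF f]] by simp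
   then show "far U (\<epsilon> (fob F B)) \<cdot>\<^bsub>C\<^esub> far ((U \<odot> F) \<odot> (U \<odot> F)) f = far (U \<odot> F) f \<cdot>\<^bsub>C\<^esub> far U (\<epsilon> (fob F A))"
    using e[of "fob F A"] e[of "fob F B"] F.far_hom[OF f] unit.F.C.homA[OF f] F.fob_Ob
    by (subst (asm) (1 2) U.far_Comp_simp) (auto simp: hom_def)
  qed
 next
  case (3 A)
  then show ?case using triangle_right[OF F.fob_Ob] by (simp add: adjunction_monad_def)
 next
  case (4 A)
  have "far U (\<epsilon> (fob F A) \<cdot>\<^bsub>D\<^esub> far F (\<eta> A)) = Id C (fob U (fob F A))"
   using triangle_left[OF 4] U.far_Id F.fob_Ob 4 by simp
  then show ?case
   using 4 e[OF F.fob_Ob[OF 4]] unit.component[OF 4]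
   by (subst (asm) U.far_Comp_simp) (auto simp: adjunction_monad_def hom_def)
 next
  case (5 A)
  have h: "\<epsilon> (fob F A) \<in> hom D (fob F (fob U (fob F A))) (fob F A)" by (rule e[OF F.fob_Ob[OF 5]])
  have "far U (\<epsilon> (fob F A) \<cdot>\<^bsub>D\<^esub> far F (far U (\<epsilon> (fob F A)))) =
    far U (\<epsilon> (fob F A) \<cdot>\<^bsub>D\<^esub> \<epsilon> (fob F (fob U (fob F A))))"
   using counit.natural[OF h] by simp
  then show ?case
   using h e[of "fob F (fob U (fob F A))"] 5 F.fob_Ob U.fob_Ob
   by (subst (asm) (1 2) U.far_Comp_simp) (auto simp: adjunction_monad_def hom_def)
 qed
qed

text \<open>A left adjoint described object by object. Uniqueness of extensions forces its action on
  arrows and yields every equation of the adjunction, so for free enriched categories only the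
  extension \<open>ext\<close> has to be constructed.\<close>

locale universal_arrows = U: cat_functor D C U
 for C :: "('o, 'm, 'z) cat_scheme" and D :: "('p, 'q, 'y) cat_scheme" and U +
 fixes Fo :: "'o => 'p" and \<eta> :: "'o => 'm" and ext :: "'o => 'p => 'm => 'q"
 assumes Fo: "A \<in> Ob C ==> Fo A \<in> Ob D"
  and unit: "A \<in> Ob C ==> \<eta> A \<in> hom C A (fob U (Fo A))"
  and ext_hom: "A \<in> Ob C ==> X \<in> Ob D ==> g \<in> hom C A (fob U X) ==> ext A X g \<in> hom D (Fo A) X"
  and ext_unit: "A \<in> Ob C ==> X \<in> Ob D ==> g \<in> hom C A (fob U X) ==>
   far U (ext A X g) \<cdot>\<^bsub>C\<^esub> \<eta> A = g"
  and ext_unique: "A \<in> Ob C ==> X \<in> Ob D ==> h \<in> hom D (Fo A) X ==> k \<in> hom D (Fo A) X ==>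
   far U h \<cdot>\<^bsub>C\<^esub> \<eta> A = far U k \<cdot>\<^bsub>C\<^esub> \<eta> A ==> h = k"
begin

definition Ff :: "('o, 'm, 'p, 'q) fctr" where
 "Ff = \<lparr>fob = Fo, far = \<lambda>f. ext (Dom C f) (Fo (Cod C f)) (\<eta> (Cod C f) \<cdot>\<^bsub>C\<^esub> f)\<rparr>"

definition cou :: "'p => 'q" where
 "cou X = ext (fob U X) X (Id C (fob U X))"

lemma Ff_ob [simp]: "fob Ff A = Fo A" by (simp add: Ff_def)

lemma Ff_hom: "f \<in> hom C A B ==> far Ff f \<in> hom D (Fo A) (Fo B)"
 using U.D.homA[of f A B] unit[of B] Fo[of B]
 by (auto simp: Ff_def intro!: ext_hom U.D.Comp_hom)

lemma Ff_unit: "f \<in> hom C A B ==> far U (far Ff f) \<cdot>\<^bsub>C\<^esub> \<eta> A = \<eta> B \<cdot>\<^bsub>C\<^esub> f"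
 using U.D.homA[of f A B] unit[of B] Fo[of B]
 by (auto simp: Ff_def intro!: ext_unit U.D.Comp_hom)

lemma cou_hom: "X \<in> Ob D ==> cou X \<in> hom D (Fo (fob U X)) X"
 by (simp add: cou_def U.fob_Ob ext_hom U.D.Id_hom)

lemma cou_unit: "X \<in> Ob D ==> far U (cou X) \<cdot>\<^bsub>C\<^esub> \<eta> (fob U X) = Id C (fob U X)"
 by (simp add: cou_def U.fob_Ob ext_unit U.D.Id_hom)

lemma Ff_functor: "cat_functor C D Ff"
proof unfold_locales
 fix f A B E g assume f: "f \<in> hom C A B" and g: "g \<in> hom C B E"
 note [simp] = U.D.homA[OF f] U.D.homA[OF g]
 have gf: "g \<cdot>\<^bsub>C\<^esub> f \<in> hom C A E" by (rule U.D.Comp_hom[OF f g])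
 note F1 = Ff_hom[OF f] and F2 = Ff_hom[OF g]
 note [simp] = U.C.homA[OF F1] U.C.homA[OF F2]
  U.D.homD[OF unit[OF \<open>A \<in> Ob C\<close>]] U.D.homD[OF unit[OF \<open>B \<in> Ob C\<close>]]
 show "far Ff (g \<cdot>\<^bsub>C\<^esub> f) = far Ff g \<cdot>\<^bsub>D\<^esub> far Ff f"
 proof (rule ext_unique[OF \<open>A \<in> Ob C\<close> Fo[OF \<open>E \<in> Ob C\<close>] Ff_hom[OF gf] U.C.Comp_hom[OF F1 F2]])
  have "far U (far Ff g \<cdot>\<^bsub>D\<^esub> far Ff f) \<cdot>\<^bsub>C\<^esub> \<eta> A = far U (far Ff g) \<cdot>\<^bsub>C\<^esub> (\<eta> B \<cdot>\<^bsub>C\<^esub> f)"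
   using Ff_unit[OF f] by (simp add: U.far_Comp_simp)
  also have "\<dots> = \<eta> E \<cdot>\<^bsub>C\<^esub> (g \<cdot>\<^bsub>C\<^esub> f)"
   using Ff_unit[OF g] U.D.homD[OF unit[OF \<open>E \<in> Ob C\<close>]]
   by (simp flip: U.D.Comp_assoc_simp)
  finally show "far U (far Ff (g \<cdot>\<^bsub>C\<^esub> f)) \<cdot>\<^bsub>C\<^esub> \<eta> A = far U (far Ff g \<cdot>\<^bsub>D\<^esub> far Ff f) \<cdot>\<^bsub>C\<^esub> \<eta> A"
   using Ff_unit[OF gf] by simp
 qed
next
 fix A assume A: "A \<in> Ob C"
 show "far Ff (Id C A) = Id D (fob Ff A)"
  by (rule ext_unique[OF A Fo[OF A]])
   (use A unit[OF A] Fo[OF A] in \<open>auto simp: Ff_unit[OF U.D.Id_hom] U.far_Id U.D.homA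
    intro!: Ff_hom U.D.Id_hom U.C.Id_hom\<close>)
qed (simp_all add: Fo Ff_hom)

lemma adjunction: "adjunction C D Ff U \<eta> cou"
proof -
 have UF: "cat_functor C C (U \<odot> Ff)" and FU: "cat_functor D D (Ff \<odot> U)"
  using Ff_functor U.cat_functor_axioms cat_functor_comp by blast+
 interpret F: cat_functor C D Ff by (rule Ff_functor)
 show ?thesis
 proof (intro adjunction.intro adjunction_axioms.intro)
  show "nat_trans C C id_fctr (U \<odot> Ff) \<eta>"
   by (rule nat_transI[OF cat_functor_id[OF U.D.category_axioms] UF]) (auto simp: unit Ff_unit)
  show "nat_trans D D (Ff \<odot> U) id_fctr cou"
  proof (rule nat_transI[OF FU cat_functor_id[OF U.C.category_axioms]])
   fix f X Y assume f: "f \<in> hom D X Y"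
   note Uf = U.far_hom[OF f]
   note [simp] = U.C.homA[OF f] U.D.homA[OF Uf]
   note h1 = Ff_hom[OF Uf] and h2 = cou_hom[OF \<open>X \<in> Ob D\<close>] and h3 = cou_hom[OF \<open>Y \<in> Ob D\<close>]
   note [simp] = U.C.homA[OF h1] U.C.homA[OF h2] U.C.homA[OF h3] U.D.homD[OF unit[of "fob U X"]]
     U.D.homD[OF unit[of "fob U Y"]]
   have "cou Y \<cdot>\<^bsub>D\<^esub> far Ff (far U f) = f \<cdot>\<^bsub>D\<^esub> cou X"
   proof (rule ext_unique[OF _ _ U.C.Comp_hom[OF h1 h3] U.C.Comp_hom[OF h2 f]])
    have "far U (cou Y \<cdot>\<^bsub>D\<^esub> far Ff (far U f)) \<cdot>\<^bsub>C\<^esub> \<eta> (fob U X) =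
      far U (cou Y) \<cdot>\<^bsub>C\<^esub> \<eta> (fob U Y) \<cdot>\<^bsub>C\<^esub> far U f"
     using Ff_unit[OF Uf] by (simp add: U.far_Comp_simp)
    also have "\<dots> = far U f" using cou_unit[of Y] by (simp del: U.D.Comp_assoc_simp)
    also have "\<dots> = far U (f \<cdot>\<^bsub>D\<^esub> cou X) \<cdot>\<^bsub>C\<^esub> \<eta> (fob U X)"
     using cou_unit[of X] by (simp add: U.far_Comp_simp)
    finally show "far U (cou Y \<cdot>\<^bsub>D\<^esub> far Ff (far U f)) \<cdot>\<^bsub>C\<^esub> \<eta> (fob U X) = far U (f \<cdot>\<^bsub>D\<^esub> cou X) \<cdot>\<^bsub>C\<^esub> \<eta> (fob U X)" .
   qed simp_all
   then show "cou Y \<cdot>\<^bsub>D\<^esub> far (Ff \<odot> U) f = far id_fctr f \<cdot>\<^bsub>D\<^esub> cou X" by simp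
  qed (simp add: cou_hom)
  show "cat_functor C D Ff" "cat_functor D C U" by (rule Ff_functor U.cat_functor_axioms)+
 next
  fix A assume A [simp]: "A \<in> Ob C"
  note [simp] = Fo[OF A] U.fob_Ob
  note h1 = cou_hom[OF Fo[OF A]] and h2 = Ff_hom[OF unit[OF A]]
  note [simp] = U.C.homA[OF h1] U.C.homA[OF h2] U.D.homD[OF unit]
  have "cou (Fo A) \<cdot>\<^bsub>D\<^esub> far Ff (\<eta> A) = Id D (Fo A)"
  proof (rule ext_unique[OF A Fo[OF A] U.C.Comp_hom[OF h2 h1] U.C.Id_hom[OF Fo[OF A]]])
   have "far U (cou (Fo A) \<cdot>\<^bsub>D\<^esub> far Ff (\<eta> A)) \<cdot>\<^bsub>C\<^esub> \<eta> A =
     far U (cou (Fo A)) \<cdot>\<^bsub>C\<^esub> \<eta> (fob U (Fo A)) \<cdot>\<^bsub>C\<^esub> \<eta> A"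
    using Ff_unit[OF unit[OF A]] by (simp add: U.far_Comp_simp)
   also have "\<dots> = far U (Id D (Fo A)) \<cdot>\<^bsub>C\<^esub> \<eta> A"
    using cou_unit[of "Fo A"] by (simp add: U.far_Id del: U.D.Comp_assoc_simp)
   finally show "far U (cou (Fo A) \<cdot>\<^bsub>D\<^esub> far Ff (\<eta> A)) \<cdot>\<^bsub>C\<^esub> \<eta> A = far U (Id D (Fo A)) \<cdot>\<^bsub>C\<^esub> \<eta> A" .
  qed
  then show "cou (fob Ff A) \<cdot>\<^bsub>D\<^esub> far Ff (\<eta> A) = Id D (fob Ff A)" by simp
 next
  fix X assume "X \<in> Ob D" then show "far U (cou X) \<cdot>\<^bsub>C\<^esub> \<eta> (fob U X) = Id C (fob U X)"
   by (rule cou_unit)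
 qed
qed

end

text \<open>Used to stack the free enriched category adjunction on an adjunction applied to all
  hom-objects. In both triangle identities the counit of the first adjunction meets the unit of the
  second, and a naturality square exchanges them.\<close>

lemma adjunction_comp:
 assumes "adjunction C D F U \<eta> \<epsilon>" "adjunction D E G W \<eta>' \<epsilon>'"
 shows "adjunction C E (G \<odot> F) (U \<odot> W) (\<lambda>A. far U (\<eta>' (fob F A)) \<cdot>\<^bsub>C\<^esub> \<eta> A)
  (\<lambda>X. \<epsilon>' X \<cdot>\<^bsub>E\<^esub> far G (\<epsilon> (fob W X)))"
proof -
 interpret A: adjunction C D F U \<eta> \<epsilon> by fact
 interpret B: adjunction D E G W \<eta>' \<epsilon>' by fact
 note [simp] = A.F.fob_Ob A.U.fob_Ob B.F.fob_Ob B.U.fob_Ob A.F.far_Comp_simp A.U.far_Comp_simp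
  B.F.far_Comp_simp B.U.far_Comp_simp
 note [simp] = A.unit.F.C.homD[OF A.unit.component[simplified]] A.counit.F.C.homD[OF A.counit.component[simplified]]
  A.counit.F.C.homD[OF B.unit.component[simplified]] B.counit.F.C.homD[OF B.counit.component[simplified]]
 show ?thesis
 proof (intro adjunction.intro adjunction_axioms.intro)
  show f1: "cat_functor C E (G \<odot> F)" and f2: "cat_functor E C (U \<odot> W)"
   by (rule cat_functor_comp[OF A.F.cat_functor_axioms B.F.cat_functor_axioms]
     cat_functor_comp[OF B.U.cat_functor_axioms A.U.cat_functor_axioms])+
  show "nat_trans C C id_fctr ((U \<odot> W) \<odot> G \<odot> F) (\<lambda>A. far U (\<eta>' (fob F A)) \<cdot>\<^bsub>C\<^esub> \<eta> A)"
  proof (rule nat_transI[OF cat_functor_id[OF A.unit.F.C.category_axioms] cat_functor_comp[OF f1 f2]])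
   fix f X Y assume f: "f \<in> hom C X Y"
   note [simp] = A.unit.F.C.homA[OF f]
   have "far U (\<eta>' (fob F Y)) \<cdot>\<^bsub>C\<^esub> \<eta> Y \<cdot>\<^bsub>C\<^esub> f = far U (\<eta>' (fob F Y) \<cdot>\<^bsub>D\<^esub> far F f) \<cdot>\<^bsub>C\<^esub> \<eta> X"
    using A.unit.natural[OF f] by simp
   also have "\<dots> = far U (far W (far G (far F f)) \<cdot>\<^bsub>D\<^esub> \<eta>' (fob F X)) \<cdot>\<^bsub>C\<^esub> \<eta> X"
    using B.unit.natural[OF A.F.far_hom[OF f]] by simp
   finally show "far U (\<eta>' (fob F Y)) \<cdot>\<^bsub>C\<^esub> \<eta> Y \<cdot>\<^bsub>C\<^esub> far id_fctr f =
    far ((U \<odot> W) \<odot> G \<odot> F) f \<cdot>\<^bsub>C\<^esub> (far U (\<eta>' (fob F X)) \<cdot>\<^bsub>C\<^esub> \<eta> X)" by simp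
  qed (simp add: hom_def)
  show "nat_trans E E ((G \<odot> F) \<odot> U \<odot> W) id_fctr (\<lambda>X. \<epsilon>' X \<cdot>\<^bsub>E\<^esub> far G (\<epsilon> (fob W X)))"
  proof (rule nat_transI[OF cat_functor_comp[OF f2 f1] cat_functor_id[OF B.counit.F.C.category_axioms]])
   fix f X Y assume f: "f \<in> hom E X Y"
   note [simp] = B.counit.F.C.homA[OF f]
   have "\<epsilon>' Y \<cdot>\<^bsub>E\<^esub> far G (\<epsilon> (fob W Y) \<cdot>\<^bsub>D\<^esub> far F (far U (far W f))) =
    (\<epsilon>' Y \<cdot>\<^bsub>E\<^esub> far G (far W f)) \<cdot>\<^bsub>E\<^esub> far G (\<epsilon> (fob W X))"
    using A.counit.natural[OF B.U.far_hom[OF f]] by simp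
   also have "\<dots> = f \<cdot>\<^bsub>E\<^esub> \<epsilon>' X \<cdot>\<^bsub>E\<^esub> far G (\<epsilon> (fob W X))"
    using B.counit.natural[OF f] by simp
   finally show "\<epsilon>' Y \<cdot>\<^bsub>E\<^esub> far G (\<epsilon> (fob W Y)) \<cdot>\<^bsub>E\<^esub> far ((G \<odot> F) \<odot> U \<odot> W) f =
    far id_fctr f \<cdot>\<^bsub>E\<^esub> (\<epsilon>' X \<cdot>\<^bsub>E\<^esub> far G (\<epsilon> (fob W X)))" by simp
  qed (simp add: hom_def)
 next
  fix A assume [simp]: "A \<in> Ob C"
  have "far G (\<epsilon> (fob W (fob G (fob F A))) \<cdot>\<^bsub>D\<^esub> far F (far U (\<eta>' (fob F A)))) =
    far G (\<eta>' (fob F A) \<cdot>\<^bsub>D\<^esub> \<epsilon> (fob F A))"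
   using A.counit.natural[OF B.unit.component[of "fob F A"]] by simp
  then have 1: "far G (\<epsilon> (fob W (fob G (fob F A)))) \<cdot>\<^bsub>E\<^esub> far G (far F (far U (\<eta>' (fob F A)))) =
    far G (\<eta>' (fob F A)) \<cdot>\<^bsub>E\<^esub> far G (\<epsilon> (fob F A))"
   by simp
  have "\<epsilon>' (fob G (fob F A)) \<cdot>\<^bsub>E\<^esub> far G (\<epsilon> (fob W (fob G (fob F A)))) \<cdot>\<^bsub>E\<^esub> far G (far F (far U (\<eta>' (fob F A)) \<cdot>\<^bsub>C\<^esub> \<eta> A))
   = \<epsilon>' (fob G (fob F A)) \<cdot>\<^bsub>E\<^esub> (far G (\<epsilon> (fob W (fob G (fob F A)))) \<cdot>\<^bsub>E\<^esub> far G (far F (far U (\<eta>' (fob F A))))) \<cdot>\<^bsub>E\<^esub> far G (far F (\<eta> A))"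
   by simp
  also have "\<dots> = (\<epsilon>' (fob G (fob F A)) \<cdot>\<^bsub>E\<^esub> far G (\<eta>' (fob F A))) \<cdot>\<^bsub>E\<^esub> far G (\<epsilon> (fob F A) \<cdot>\<^bsub>D\<^esub> far F (\<eta> A))"
   unfolding 1 by simp
  also have "\<dots> = Id E (fob G (fob F A))"
   using A.triangle_left[of A] B.triangle_left[of "fob F A"] by (simp add: B.F.far_Id)
  finally show "\<epsilon>' (fob (G \<odot> F) A) \<cdot>\<^bsub>E\<^esub> far G (\<epsilon> (fob W (fob (G \<odot> F) A))) \<cdot>\<^bsub>E\<^esub>
     far (G \<odot> F) (far U (\<eta>' (fob F A)) \<cdot>\<^bsub>C\<^esub> \<eta> A) = Id E (fob (G \<odot> F) A)" by simp
 next
  fix X assume [simp]: "X \<in> Ob E"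
  have "far U (far W (far G (\<epsilon> (fob W X))) \<cdot>\<^bsub>D\<^esub> \<eta>' (fob F (fob U (fob W X)))) = far U (\<eta>' (fob W X) \<cdot>\<^bsub>D\<^esub> \<epsilon> (fob W X))"
   using B.unit.natural[OF A.counit.component[of "fob W X"]] by simp
  then have 1: "far U (far W (far G (\<epsilon> (fob W X)))) \<cdot>\<^bsub>C\<^esub> far U (\<eta>' (fob F (fob U (fob W X)))) = far U (\<eta>' (fob W X)) \<cdot>\<^bsub>C\<^esub> far U (\<epsilon> (fob W X))"
   by simp
  have "far U (far W (\<epsilon>' X)) \<cdot>\<^bsub>C\<^esub> far U (far W (far G (\<epsilon> (fob W X)))) \<cdot>\<^bsub>C\<^esub>
   far U (\<eta>' (fob F (fob U (fob W X)))) \<cdot>\<^bsub>C\<^esub> \<eta> (fob U (fob W X)) =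
   far U (far W (\<epsilon>' X)) \<cdot>\<^bsub>C\<^esub> (far U (far W (far G (\<epsilon> (fob W X)))) \<cdot>\<^bsub>C\<^esub>
   far U (\<eta>' (fob F (fob U (fob W X))))) \<cdot>\<^bsub>C\<^esub> \<eta> (fob U (fob W X))"
   by simp
  also have "\<dots> = far U (far W (\<epsilon>' X) \<cdot>\<^bsub>D\<^esub> \<eta>' (fob W X)) \<cdot>\<^bsub>C\<^esub> (far U (\<epsilon> (fob W X)) \<cdot>\<^bsub>C\<^esub> \<eta> (fob U (fob W X)))"
   unfolding 1 by simp
  also have "\<dots> = Id C (fob U (fob W X))"
   using A.triangle_right[of "fob W X"] B.triangle_right[of X] by (simp add: A.U.far_Id)
  finally show "far (U \<odot> W) (\<epsilon>' X \<cdot>\<^bsub>E\<^esub> far G (\<epsilon> (fob W X))) \<cdot>\<^bsub>C\<^esub>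
   (far U (\<eta>' (fob F (fob (U \<odot> W) X))) \<cdot>\<^bsub>C\<^esub> \<eta> (fob (U \<odot> W) X)) = Id C (fob (U \<odot> W) X)"
   by simp
 qed
qed

subsection \<open>Coproduct cocones\<close>

text \<open>Stated for an arbitrary object \<open>P\<close> with legs \<open>j\<close>, not for the
  chosen coproduct: a functor that preserves coproducts sends the chosen one to a cocone which is a
  coproduct but in general not the chosen one.\<close>

definition is_coprod :: "('o, 'm, 'z) cat_scheme => 'i set => ('i => 'o) => 'o => ('i => 'm) => bool" where
 "is_coprod C I X P j \<longleftrightarrow> P \<in> Ob C & (\<forall>i \<in> I. j i \<in> hom C (X i) P) &
   (\<forall>Y \<in> Ob C. \<forall>f. (\<forall>i \<in> I. f i \<in> hom C (X i) Y) -->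
    (\<exists>!h. h \<in> hom C P Y & (\<forall>i \<in> I. h \<cdot>\<^bsub>C\<^esub> j i = f i)))"

context category
begin

lemma is_coprod_eqI:
 assumes "is_coprod C I X P j" "h \<in> hom C P Y" "k \<in> hom C P Y" "!!i. i \<in> I ==> h \<cdot> j i = k \<cdot> j i"
 shows "h = k"
proof -
 have "Y \<in> Ob C" using homA[OF assms(2)] by simp
 moreover have "\<forall>i \<in> I. h \<cdot> j i \<in> hom C (X i) Y"
  using assms Comp_hom by (auto simp: is_coprod_def)
 ultimately have "\<exists>!u. u \<in> hom C P Y & (\<forall>i \<in> I. u \<cdot> j i = h \<cdot> j i)"
  using assms(1) by (simp add: is_coprod_def)
 moreover have "h \<in> hom C P Y & (\<forall>i \<in> I. h \<cdot> j i = h \<cdot> j i)" using assms(2) by simp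
 moreover have "k \<in> hom C P Y & (\<forall>i \<in> I. k \<cdot> j i = h \<cdot> j i)"
  using assms(3) assms(4)[symmetric] by simp
 ultimately show ?thesis by (metis (no_types, lifting) the1_equality)
qed

lemma is_coprod_ex:
 assumes "is_coprod C I X P j" "Y \<in> Ob C" "!!i. i \<in> I ==> f i \<in> hom C (X i) Y"
 obtains h where "h \<in> hom C P Y" "!!i. i \<in> I ==> h \<cdot> j i = f i"
 using assms unfolding is_coprod_def by blast

lemma is_coprodI:
 assumes "P \<in> Ob C" "!!i. i \<in> I ==> j i \<in> hom C (X i) P"
  "!!Y f. Y \<in> Ob C ==> (!!i. i \<in> I ==> f i \<in> hom C (X i) Y) ==>
    \<exists>h \<in> hom C P Y. \<forall>i \<in> I. h \<cdot> j i = f i"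
  "!!Y h k. h \<in> hom C P Y ==> k \<in> hom C P Y ==> (!!i. i \<in> I ==> h \<cdot> j i = k \<cdot> j i) ==> h = k"
 shows "is_coprod C I X P j"
 unfolding is_coprod_def
proof (intro conjI ballI allI impI)
 fix Y f assume "Y \<in> Ob C" "\<forall>i \<in> I. f i \<in> hom C (X i) Y"
 then obtain h where "h \<in> hom C P Y" "\<forall>i \<in> I. h \<cdot> j i = f i" using assms(3)[of Y f] by auto
 then show "\<exists>!h. h \<in> hom C P Y & (\<forall>i \<in> I. h \<cdot> j i = f i)"
  using assms(4)[of _ Y] by (intro ex1I[of _ h]) simp_all
qed (use assms(1,2) in auto)

lemma is_coprod_Ob: "is_coprod C I X P j ==> P \<in> Ob C" "is_coprod C I X P j ==> i \<in> I ==> X i \<in> Ob C"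
 and is_coprod_hom: "is_coprod C I X P j ==> i \<in> I ==> j i \<in> hom C (X i) P"
 by (auto simp: is_coprod_def dest: homA(4))

lemma is_coprod_iso:
 assumes P: "is_coprod C I X P j" and Q: "is_coprod C I X Q k"
 obtains u v where "u \<in> hom C P Q" "v \<in> hom C Q P" "v \<cdot> u = Id C P" "u \<cdot> v = Id C Q"
  "!!i. i \<in> I ==> u \<cdot> j i = k i" "!!i. i \<in> I ==> v \<cdot> k i = j i"
proof -
 obtain u where u: "u \<in> hom C P Q" "!!i. i \<in> I ==> u \<cdot> j i = k i"
  using is_coprod_ex[OF P, of Q k] is_coprod_Ob[OF Q] is_coprod_hom[OF Q] by blast
 obtain v where v: "v \<in> hom C Q P" "!!i. i \<in> I ==> v \<cdot> k i = j i"
  using is_coprod_ex[OF Q, of P j] is_coprod_Ob[OF P] is_coprod_hom[OF P] by blast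
 note [simp] = homA[OF u(1)] homA[OF v(1)] homD[OF is_coprod_hom[OF P]] homD[OF is_coprod_hom[OF Q]]
 have "v \<cdot> u = Id C P"
  by (rule is_coprod_eqI[OF P Comp_hom[OF u(1) v(1)] Id_hom]) (simp_all add: u v)
 moreover have "u \<cdot> v = Id C Q"
  by (rule is_coprod_eqI[OF Q Comp_hom[OF v(1) u(1)] Id_hom]) (simp_all add: u v)
 ultimately show ?thesis using that u v by blast
qed

text \<open>Coproducts are stable under isomorphism. The family may also change to one that agrees
  with it on \<open>I\<close>, since families are total functions whose values outside the index set
  are arbitrary.\<close>

lemma is_coprod_transport:
 assumes P: "is_coprod C I X P j" and u: "u \<in> hom C P Q" and v: "v \<in> hom C Q P"
  and vu: "v \<cdot> u = Id C P" and uv: "u \<cdot> v = Id C Q"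
  and k: "!!i. i \<in> I ==> k i = u \<cdot> j i" and Y: "!!i. i \<in> I ==> Y i = X i"
 shows "is_coprod C I Y Q k"
proof (rule is_coprodI)
 note [simp] = homA[OF u] homA[OF v] homD[OF is_coprod_hom[OF P]]
 show "Q \<in> Ob C" by simp
 show "k i \<in> hom C (Y i) Q" if "i \<in> I" for i
  using that by (simp add: k Y hom_def)
 fix Z f assume Z: "Z \<in> Ob C" and "!!i. i \<in> I ==> f i \<in> hom C (Y i) Z"
 then obtain h where h: "h \<in> hom C P Z" "!!i. i \<in> I ==> h \<cdot> j i = f i"
  using is_coprod_ex[OF P, of Z f] Y by metis
 show "\<exists>h\<in>hom C Q Z. \<forall>i\<in>I. h \<cdot> k i = f i"
 proof (intro bexI ballI)
  show "h \<cdot> v \<in> hom C Q Z" by (rule Comp_hom[OF v h(1)])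
  fix i assume i: "i \<in> I"
  have "(h \<cdot> v) \<cdot> k i = h \<cdot> ((v \<cdot> u) \<cdot> j i)" using homA[OF h(1)] i by (simp add: k)
  then show "(h \<cdot> v) \<cdot> k i = f i" using h i by (simp add: vu)
 qed
next
 fix Z h h' assume h: "h \<in> hom C Q Z" "h' \<in> hom C Q Z" and e: "!!i. i \<in> I ==> h \<cdot> k i = h' \<cdot> k i"
 note [simp] = homA[OF u] homA[OF v] homD[OF is_coprod_hom[OF P]] homA[OF h(1)] homA[OF h(2)]
 have "h \<cdot> u = h' \<cdot> u"
  by (rule is_coprod_eqI[OF P Comp_hom[OF u h(1)] Comp_hom[OF u h(2)]]) (use e in \<open>simp add: k\<close>)
 then have "(h \<cdot> u) \<cdot> v = (h' \<cdot> u) \<cdot> v" by simp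
 then show "h = h'" by (simp add: uv)
qed

end

section \<open>Preservation of coproducts by functors\<close>

lemma (in adjunction) left_adjoint_is_coprod:
 assumes P: "is_coprod C I X P j"
 shows "is_coprod D I (\<lambda>i. fob F (X i)) (fob F P) (\<lambda>i. far F (j i))"
proof (rule counit.F.C.is_coprodI)
 note [simp] = unit.F.C.homD[OF unit.F.C.is_coprod_hom[OF P]] unit.F.C.is_coprod_Ob[OF P] F.fob_Ob U.fob_Ob
 note [simp] = unit.F.C.homD[OF unit.component[simplified]] counit.F.C.homD[OF counit.component[simplified]]
 \<comment> \<open>Every arrow out of a free object is recovered from its transpose. Existence and
   uniqueness of mediating arrows in \<open>D\<close> are thereby reduced to the same in
   \<open>C\<close>.\<close>
 have *: "h = \<epsilon> Y \<cdot>\<^bsub>D\<^esub> far F (far U h \<cdot>\<^bsub>C\<^esub> \<eta> A)" if h: "h \<in> hom D (fob F A) Y" and [simp]: "A \<in> Ob C" for h A Y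
 proof -
  note [simp] = counit.F.C.homA[OF h]
  have "\<epsilon> Y \<cdot>\<^bsub>D\<^esub> far F (far U h \<cdot>\<^bsub>C\<^esub> \<eta> A) = (\<epsilon> Y \<cdot>\<^bsub>D\<^esub> far F (far U h)) \<cdot>\<^bsub>D\<^esub> far F (\<eta> A)"
   by (simp add: F.far_Comp_simp)
  also have "\<dots> = h"
   using counit.natural[OF h] triangle_left[of A] by simp
  finally show ?thesis by simp
 qed
 show "fob F P \<in> Ob D" by simp
 show "far F (j i) \<in> hom D (fob F (X i)) (fob F P)" if "i \<in> I" for i
  using that by (simp add: hom_def)
 {
  fix Y f assume Y [simp]: "Y \<in> Ob D" and f: "!!i. i \<in> I ==> f i \<in> hom D (fob F (X i)) Y"
  note [simp] = counit.F.C.homD[OF f]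
  have "far U (f i) \<cdot>\<^bsub>C\<^esub> \<eta> (X i) \<in> hom C (X i) (fob U Y)" if "i \<in> I" for i
   using that by (simp add: hom_def)
  then obtain h where h: "h \<in> hom C P (fob U Y)" "!!i. i \<in> I ==> h \<cdot>\<^bsub>C\<^esub> j i = far U (f i) \<cdot>\<^bsub>C\<^esub> \<eta> (X i)"
   using unit.F.C.is_coprod_ex[OF P U.fob_Ob[OF Y], of "\<lambda>i. far U (f i) \<cdot>\<^bsub>C\<^esub> \<eta> (X i)"] by blast
  note [simp] = unit.F.C.homA[OF h(1)]
  show "\<exists>h\<in>hom D (fob F P) Y. \<forall>i\<in>I. h \<cdot>\<^bsub>D\<^esub> far F (j i) = f i"
  proof (intro bexI ballI)
   show "\<epsilon> Y \<cdot>\<^bsub>D\<^esub> far F h \<in> hom D (fob F P) Y" by (simp add: hom_def)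
   fix i assume i: "i \<in> I"
   have "(\<epsilon> Y \<cdot>\<^bsub>D\<^esub> far F h) \<cdot>\<^bsub>D\<^esub> far F (j i) = \<epsilon> Y \<cdot>\<^bsub>D\<^esub> far F (h \<cdot>\<^bsub>C\<^esub> j i)"
    using i by (simp add: F.far_Comp_simp)
   also have "\<dots> = f i" using *[OF f[OF i]] i h by simp
   finally show "(\<epsilon> Y \<cdot>\<^bsub>D\<^esub> far F h) \<cdot>\<^bsub>D\<^esub> far F (j i) = f i" .
  qed
 }
 fix Y h k assume h: "h \<in> hom D (fob F P) Y" and k: "k \<in> hom D (fob F P) Y"
  and e: "!!i. i \<in> I ==> h \<cdot>\<^bsub>D\<^esub> far F (j i) = k \<cdot>\<^bsub>D\<^esub> far F (j i)"
 note [simp] = counit.F.C.homA[OF h] counit.F.C.homA[OF k]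
 have "far U h \<cdot>\<^bsub>C\<^esub> \<eta> P = far U k \<cdot>\<^bsub>C\<^esub> \<eta> P"
 proof (rule unit.F.C.is_coprod_eqI[OF P])
  fix i assume i: "i \<in> I"
  have n: "\<eta> P \<cdot>\<^bsub>C\<^esub> j i = far U (far F (j i)) \<cdot>\<^bsub>C\<^esub> \<eta> (X i)"
   using unit.natural[OF unit.F.C.is_coprod_hom[OF P i]] by simp
  have "far U (h \<cdot>\<^bsub>D\<^esub> far F (j i)) \<cdot>\<^bsub>C\<^esub> \<eta> (X i) = far U (k \<cdot>\<^bsub>D\<^esub> far F (j i)) \<cdot>\<^bsub>C\<^esub> \<eta> (X i)"
   using e i by simp
  then show "(far U h \<cdot>\<^bsub>C\<^esub> \<eta> P) \<cdot>\<^bsub>C\<^esub> j i = (far U k \<cdot>\<^bsub>C\<^esub> \<eta> P) \<cdot>\<^bsub>C\<^esub> j i"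
   using i by (simp add: n U.far_Comp_simp)
 qed (simp_all add: hom_def)
 then show "h = k" using *[OF h] *[OF k] by simp
qed

text \<open>Only coproducts indexed by sets of cells are considered. That is enough because the
  coproducts in \<open>fc\<close> are indexed by paths, which are cells, and it keeps the index type
  fixed.\<close>

definition cocont :: "('a obj, 'a arr, 'z) cat_scheme => ('a obj, 'a arr, 'y) cat_scheme => 'a endo => bool" where
 "cocont C D F \<longleftrightarrow> cat_functor C D F & (\<forall>(I :: 'a cell set) X P j. is_coprod C I X P j -->
   is_coprod D I (\<lambda>i. fob F (X i)) (fob F P) (\<lambda>i. far F (j i)))"

lemma cocont_functor: "cocont C D F ==> cat_functor C D F"
 by (simp add: cocont_def)

lemma cocont_is_coprod: fixes I :: "'a cell set" and F :: "'a endo" shows "cocont C D F ==> is_coprod C I X P j ==>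
   is_coprod D I (\<lambda>i. fob F (X i)) (fob F P) (\<lambda>i. far F (j i))"
 by (auto simp: cocont_def)

lemma cocont_id: "category C ==> cocont C C id_fctr"
 by (simp add: cocont_def cat_functor_id)

lemma cocont_comp: fixes F :: "'a endo" shows "cocont C D F ==> cocont D E G ==> cocont C E (G \<odot> F)"
 unfolding cocont_def by (auto intro: cat_functor_comp)

lemma is_coprod_cong:
 assumes "is_coprod C I X P j" "!!i. i \<in> I ==> X i = Y i" "!!i. i \<in> I ==> j i = k i"
 shows "is_coprod C I Y P k"
proof -
 have "is_coprod C I X P j = is_coprod C I Y P k"
  unfolding is_coprod_def using assms(2,3) by (simp cong: ball_cong conj_cong)
 then show ?thesis using assms(1) by simp
qed

lemma cocont_cong:
 assumes F: "cocont C D F" and e: "fctr_eq C F G"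
 shows "cocont C D G"
 unfolding cocont_def
proof (intro conjI allI impI)
 interpret F: cat_functor C D F using F by (rule cocont_functor)
 show "cat_functor C D G" by (rule cat_functor_cong[OF F.cat_functor_axioms e])
 fix I :: "'a cell set" and X P j assume c: "is_coprod C I X P j"
 show "is_coprod D I (\<lambda>i. fob G (X i)) (fob G P) (\<lambda>i. far G (j i))"
 proof -
  have "fob G P = fob F P" using e F.C.is_coprod_Ob[OF c] by (simp add: fctr_eq_def)
  moreover have "fob F (X i) = fob G (X i)" "far F (j i) = far G (j i)" if "i \<in> I" for i
   using e F.C.is_coprod_Ob(2)[OF c that] F.C.homD[OF F.C.is_coprod_hom[OF c that]]
   by (simp_all add: fctr_eq_def)
  ultimately show ?thesis using is_coprod_cong[OF cocont_is_coprod[OF F c]] by simp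
 qed
qed

text \<open>All coproduct cocones of one family are isomorphic, and a functor preserves the
  isomorphism; so preservation has to be checked on a single cocone per family, in practice the
  chosen one.\<close>

lemma cocontI:
 fixes F :: "'a endo"
 assumes F: "cat_functor C D F"
  and ch: "!!(I :: 'a cell set) X. (!!i. i \<in> I ==> X i \<in> Ob C) ==> \<exists>P j. is_coprod C I X P j &
   is_coprod D I (\<lambda>i. fob F (X i)) (fob F P) (\<lambda>i. far F (j i))"
 shows "cocont C D F"
 unfolding cocont_def
proof (intro conjI allI impI F)
 interpret F: cat_functor C D F by (rule F)
 fix I :: "'a cell set" and X Q k assume c: "is_coprod C I X Q k"
 obtain P j where P: "is_coprod C I X P j" "is_coprod D I (\<lambda>i. fob F (X i)) (fob F P) (\<lambda>i. far F (j i))"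
  using ch[of I X] F.C.is_coprod_Ob[OF c] by blast
 obtain u v where u: "u \<in> hom C P Q" and v: "v \<in> hom C Q P" and uv: "v \<cdot>\<^bsub>C\<^esub> u = Id C P" "u \<cdot>\<^bsub>C\<^esub> v = Id C Q"
  and e: "!!i. i \<in> I ==> u \<cdot>\<^bsub>C\<^esub> j i = k i"
  using F.C.is_coprod_iso[OF P(1) c] by metis
 show "is_coprod D I (\<lambda>i. fob F (X i)) (fob F Q) (\<lambda>i. far F (k i))"
 proof (rule F.D.is_coprod_transport[OF P(2) F.far_hom[OF u] F.far_hom[OF v]])
  show "far F v \<cdot>\<^bsub>D\<^esub> far F u = Id D (fob F P)" "far F u \<cdot>\<^bsub>D\<^esub> far F v = Id D (fob F Q)"
   using F.far_Comp[OF u v] F.far_Comp[OF v u] F.C.homA[OF u] by (simp_all add: uv F.far_Id)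
  show "far F (k i) = far F u \<cdot>\<^bsub>D\<^esub> far F (j i)" if "i \<in> I" for i
   using F.far_Comp[OF F.C.is_coprod_hom[OF P(1) that] u] e[OF that] by simp
 qed simp
qed

section \<open>Categories with finite products and distributive coproducts\<close>

lemmas all2_nth = list_all2_conv_all_nth

text \<open>Generalized elements at stage \<open>Z\<close>, listed factor by factor; by the
  universal property such a list is the same as one arrow from \<open>Z\<close> to the
  product.\<close>

definition elems :: "('o, 'm, 'z) cat_scheme => 'o => 'm list => 'o list => bool" where
 "elems V Z fs Xs \<longleftrightarrow> list_all2 (\<lambda>f X. f \<in> hom V Z X) fs Xs"

definition arrs :: "('o, 'm, 'z) cat_scheme => 'm list => 'o list => 'o list => bool" where
 "arrs V fs Xs Ys \<longleftrightarrow> length fs = length Xs & length Ys = length Xs &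
   (\<forall>r < length Xs. fs ! r \<in> hom V (Xs ! r) (Ys ! r))"

lemma elems_simps [simp]:
 "elems V Z [] Xs \<longleftrightarrow> Xs = []" "elems V Z fs [] \<longleftrightarrow> fs = []"
 "elems V Z (f # fs) (X # Xs) \<longleftrightarrow> f \<in> hom V Z X & elems V Z fs Xs"
 by (auto simp: elems_def)

lemma elems_length: "elems V Z fs Xs ==> length fs = length Xs"
 by (simp add: elems_def list_all2_lengthD)

lemma elems_nth: "elems V Z fs Xs ==> r < length Xs ==> fs ! r \<in> hom V Z (Xs ! r)"
 by (simp add: elems_def all2_nth)

lemma elemsI: "length fs = length Xs ==> (!!r. r < length Xs ==> fs ! r \<in> hom V Z (Xs ! r)) ==> elems V Z fs Xs"
 by (simp add: elems_def all2_nth)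

lemma elems_append: "elems V Z fs Xs ==> elems V Z hs Ys ==> elems V Z (fs @ hs) (Xs @ Ys)"
 by (simp add: elems_def list_all2_appendI)

lemma elems_concat: "list_all2 (elems V Z) fss Xss ==> elems V Z (concat fss) (concat Xss)"
 by (induction rule: list_all2_induct) (auto intro: elems_append)

lemma arrs_simps [simp]:
 "arrs V [] [] []" "arrs V (f # fs) (X # Xs) (Y # Ys) \<longleftrightarrow> f \<in> hom V X Y & arrs V fs Xs Ys"
 by (auto simp: arrs_def All_less_Suc2)

lemma arrs_nth: "arrs V fs Xs Ys ==> r < length Xs ==> fs ! r \<in> hom V (Xs ! r) (Ys ! r)"
 by (simp add: arrs_def)

lemma arrs_length: "arrs V fs Xs Ys ==> length fs = length Xs" "arrs V fs Xs Ys ==> length Ys = length Xs"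
 by (simp_all add: arrs_def)

abbreviation (input) comps :: "('o, 'm, 'z) cat_scheme => 'm list => 'm list => 'm list" where
 "comps V hs fs \<equiv> map2 (\<lambda>g f. g \<cdot>\<^bsub>V\<^esub> f) hs fs"

locale fprod = category V for V :: "('o, 'm, 'z) pcat_scheme" (structure) +
 assumes Prod_Ob: "set Xs <= Ob V ==> Prod V Xs \<in> Ob V"
  and Proj_hom: "set Xs <= Ob V ==> r < length Xs ==> Proj V Xs r \<in> hom V (Prod V Xs) (Xs ! r)"
  and Prod_ex: "Z \<in> Ob V ==> elems V Z fs Xs ==>
   \<exists>h \<in> hom V Z (Prod V Xs). \<forall>r < length Xs. Proj V Xs r \<cdot> h = fs ! r"
  and Prod_eqI: "set Xs <= Ob V ==> h \<in> hom V Z (Prod V Xs) ==> k \<in> hom V Z (Prod V Xs) ==>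
   (!!r. r < length Xs ==> Proj V Xs r \<cdot> h = Proj V Xs r \<cdot> k) ==> h = k"
begin

lemma nth_Ob [simp]: "set Xs <= Ob V ==> r < length Xs ==> Xs ! r \<in> Ob V"
 using nth_mem by blast

lemma elems_Ob: "elems V Z fs Xs ==> set Xs <= Ob V"
 by (force simp: elems_def all2_nth in_set_conv_nth dest: homA(5))

lemma arrs_Ob:
 assumes "arrs V fs Xs Ys" shows "set Xs <= Ob V" "set Ys <= Ob V"
proof -
 show "set Xs <= Ob V"
  using assms homA(4) unfolding arrs_def in_set_conv_nth subset_iff by blast
 have "Ys ! r \<in> Ob V" if "r < length Ys" for r
  using assms homA(5)[of "fs ! r"] that by (auto simp: arrs_def)
 then show "set Ys <= Ob V"
  by (auto simp: in_set_conv_nth)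
qed

lemma elems_comp:
 assumes "elems V Z fs Xs" "g \<in> hom V W Z"
 shows "elems V W (map (\<lambda>f. f \<cdot> g) fs) Xs"
 using assms Comp_hom by (auto simp: elems_def all2_nth)

lemma elems_map2:
 assumes "elems V Z fs Xs" "arrs V hs Xs Ys"
 shows "elems V Z (comps V hs fs) Ys"
 using assms Comp_hom by (auto simp: elems_def arrs_def all2_nth)

lemma tuple_props:
 assumes "Z \<in> Ob V" "elems V Z fs Xs"
 shows "tuple V Z Xs fs \<in> hom V Z (Prod V Xs) & (\<forall>r < length Xs. Proj V Xs r \<cdot> tuple V Z Xs fs = fs ! r)"
 unfolding tuple_def
proof (rule theI')
 obtain h where h: "h \<in> hom V Z (Prod V Xs)" "\<forall>r < length Xs. Proj V Xs r \<cdot> h = fs ! r"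
  using Prod_ex[OF assms] by blast
 then show "\<exists>!h. h \<in> hom V Z (Prod V Xs) & (\<forall>r < length Xs. Proj V Xs r \<cdot> h = fs ! r)"
  using Prod_eqI[OF elems_Ob[OF assms(2)] h(1)] by (intro ex1I[of _ h]) (auto simp: eq_commute)
qed

lemma tuple_hom: "Z \<in> Ob V ==> elems V Z fs Xs ==> tuple V Z Xs fs \<in> hom V Z (Prod V Xs)"
 and Proj_tuple: "Z \<in> Ob V ==> elems V Z fs Xs ==> r < length Xs ==> Proj V Xs r \<cdot> tuple V Z Xs fs = fs ! r"
 using tuple_props by blast+

lemma tuple_eqI:
 assumes "set Xs <= Ob V" "h \<in> hom V Z (Prod V Xs)" "length fs = length Xs"
  "!!r. r < length Xs ==> Proj V Xs r \<cdot> h = fs ! r"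
 shows "h = tuple V Z Xs fs"
proof -
 have "elems V Z fs Xs"
  using assms(2) Proj_hom[OF assms(1)] by (intro elemsI assms(3)) (metis Comp_hom assms(4))
 then show ?thesis
  using assms tuple_hom Proj_tuple homA(4)[OF assms(2)] by (intro Prod_eqI[OF assms(1,2)]) simp_all
qed

lemma elems_Proj:
 "set Xs <= Ob V ==> h \<in> hom V Z (Prod V Xs) ==> elems V Z (map (\<lambda>r. Proj V Xs r \<cdot> h) [0..<length Xs]) Xs"
 by (rule elemsI) (auto intro: Comp_hom Proj_hom)

lemma tuple_cases:
 assumes "set Xs <= Ob V" "h \<in> hom V Z (Prod V Xs)"
 obtains fs where "elems V Z fs Xs" "h = tuple V Z Xs fs"
 using elems_Proj[OF assms] tuple_eqI[OF assms, of "map (\<lambda>r. Proj V Xs r \<cdot> h) [0..<length Xs]"] by auto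

lemma tuple_comp:
 assumes "Z \<in> Ob V" "elems V Z fs Xs" "g \<in> hom V W Z"
 shows "tuple V Z Xs fs \<cdot> g = tuple V W Xs (map (\<lambda>f. f \<cdot> g) fs)"
proof (rule tuple_eqI)
 note ob = elems_Ob[OF assms(2)]
 show "set Xs <= Ob V" by (rule ob)
 show "tuple V Z Xs fs \<cdot> g \<in> hom V W (Prod V Xs)" by (rule Comp_hom[OF assms(3) tuple_hom[OF assms(1,2)]])
 show "length (map (\<lambda>f. f \<cdot> g) fs) = length Xs" using elems_length[OF assms(2)] by simp
 fix r assume r: "r < length Xs"
 show "Proj V Xs r \<cdot> (tuple V Z Xs fs \<cdot> g) = map (\<lambda>f. f \<cdot> g) fs ! r"
  using whisker1[OF Proj_tuple[OF assms(1,2) r] tuple_hom[OF assms(1,2)] Proj_hom[OF ob r] assms(3)]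
   elems_length[OF assms(2)] r by simp
qed

lemma tuple_Proj: "set Xs <= Ob V ==> tuple V (Prod V Xs) Xs (map (Proj V Xs) [0..<length Xs]) = Id V (Prod V Xs)"
 using homD[OF Proj_hom] by (intro tuple_eqI[symmetric]) (auto intro: Id_hom Prod_Ob)

lemma elems_projs: "set Xs <= Ob V ==> elems V (Prod V Xs) (map (Proj V Xs) [0..<length Xs]) Xs"
 by (rule elemsI) (auto intro: Proj_hom)

text \<open>Maps out of a product are tested on generalized elements.\<close>

lemma prod_ext:
 assumes Xs: "set Xs <= Ob V" and h: "h \<in> hom V (Prod V Xs) Y" "k \<in> hom V (Prod V Xs) Y"
  and e: "!!Z fs. Z \<in> Ob V ==> elems V Z fs Xs ==> h \<cdot> tuple V Z Xs fs = k \<cdot> tuple V Z Xs fs"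
 shows "h = k"
 using e[OF Prod_Ob[OF Xs] elems_projs[OF Xs]] by (simp add: tuple_Proj Xs homD[OF h(1)] homD[OF h(2)])

lemma prod_map_elems:
 assumes "arrs V fs Xs Ys"
 shows "elems V (Prod V Xs) (map (\<lambda>r. fs ! r \<cdot> Proj V Xs r) [0..<length Xs]) Ys"
 using assms Proj_hom[OF arrs_Ob(1)[OF assms]] by (intro elemsI) (auto simp: arrs_def intro: Comp_hom)

lemma prod_map_hom: "arrs V fs Xs Ys ==> prod_map V Xs Ys fs \<in> hom V (Prod V Xs) (Prod V Ys)"
 unfolding prod_map_def by (intro tuple_hom prod_map_elems Prod_Ob arrs_Ob)

lemma prod_map_tuple:
 assumes "arrs V hs Xs Ys" "Z \<in> Ob V" "elems V Z fs Xs"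
 shows "prod_map V Xs Ys hs \<cdot> tuple V Z Xs fs = tuple V Z Ys (comps V hs fs)"
proof -
 have "map ((\<lambda>f. f \<cdot> tuple V Z Xs fs) \<circ> (\<lambda>r. hs ! r \<cdot> Proj V Xs r)) [0..<length Xs] = comps V hs fs"
 proof (rule nth_equalityI)
  fix r assume "r < length (map ((\<lambda>f. f \<cdot> tuple V Z Xs fs) \<circ> (\<lambda>r. hs ! r \<cdot> Proj V Xs r)) [0..<length Xs])"
  then have r: "r < length Xs" by simp
  show "map ((\<lambda>f. f \<cdot> tuple V Z Xs fs) \<circ> (\<lambda>r. hs ! r \<cdot> Proj V Xs r)) [0..<length Xs] ! r = comps V hs fs ! r"
   using r elems_length[OF assms(3)] arrs_length[OF assms(1)] Proj_tuple[OF assms(2,3) r]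
    Comp_assoc[OF tuple_hom[OF assms(2,3)] Proj_hom[OF elems_Ob[OF assms(3)] r] arrs_nth[OF assms(1) r]]
   by simp
 qed (use elems_length[OF assms(3)] arrs_length[OF assms(1)] in simp)
 then show ?thesis
  unfolding prod_map_def
  using tuple_comp[OF Prod_Ob[OF arrs_Ob(1)[OF assms(1)]] prod_map_elems[OF assms(1)] tuple_hom[OF assms(2,3)]]
  by simp
qed

lemma Proj_prod_map:
 assumes "arrs V fs Xs Ys" "r < length Xs"
 shows "Proj V Ys r \<cdot> prod_map V Xs Ys fs = fs ! r \<cdot> Proj V Xs r"
 unfolding prod_map_def using assms
 by (subst Proj_tuple[OF Prod_Ob[OF arrs_Ob(1)[OF assms(1)]] prod_map_elems[OF assms(1)]]) (auto simp: arrs_def)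

lemma arrs_comp:
 assumes "arrs V fs Xs Ys" "arrs V hs Ys Zs"
 shows "arrs V (comps V hs fs) Xs Zs"
 using assms Comp_hom by (auto simp: arrs_def)

lemma map2_comp_assoc:
 assumes "arrs V fs Xs Ys" "arrs V hs Ys Zs" "elems V Z es Xs"
 shows "comps V hs (comps V fs es) = comps V (comps V hs fs) es"
proof (rule nth_equalityI)
 fix r assume r: "r < length (comps V hs (comps V fs es))"
 then have r': "r < length Xs" "r < length Ys" using assms by (auto simp: arrs_def)
 then show "comps V hs (comps V fs es) ! r = comps V (comps V hs fs) es ! r"
  using r Comp_assoc[OF elems_nth[OF assms(3)] arrs_nth[OF assms(1)] arrs_nth[OF assms(2)]] by simp
qed simp

lemma prod_map_comp:
 assumes f: "arrs V fs Xs Ys" and g: "arrs V hs Ys Zs"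
 shows "prod_map V Ys Zs hs \<cdot> prod_map V Xs Ys fs = prod_map V Xs Zs (comps V hs fs)"
proof (rule prod_ext)
 show "set Xs <= Ob V" by (rule arrs_Ob(1)[OF f])
 show "prod_map V Ys Zs hs \<cdot> prod_map V Xs Ys fs \<in> hom V (Prod V Xs) (Prod V Zs)"
  by (rule Comp_hom[OF prod_map_hom[OF f] prod_map_hom[OF g]])
 show "prod_map V Xs Zs (comps V hs fs) \<in> hom V (Prod V Xs) (Prod V Zs)"
  by (rule prod_map_hom[OF arrs_comp[OF f g]])
 fix Z es assume Z: "Z \<in> Ob V" and e: "elems V Z es Xs"
 show "prod_map V Ys Zs hs \<cdot> prod_map V Xs Ys fs \<cdot> tuple V Z Xs es =
  prod_map V Xs Zs (comps V hs fs) \<cdot> tuple V Z Xs es"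
  using Comp_assoc[OF tuple_hom[OF Z e] prod_map_hom[OF f] prod_map_hom[OF g]]
  by (simp only: prod_map_tuple[OF f Z e] prod_map_tuple[OF g Z elems_map2[OF e f]]
    prod_map_tuple[OF arrs_comp[OF f g] Z e] map2_comp_assoc[OF f g e])
qed

lemma arrs_Id: "set Xs <= Ob V ==> arrs V (map (Id V) Xs) Xs Xs"
 by (auto simp: arrs_def intro: Id_hom nth_Ob)

lemma prod_map_Id: "set Xs <= Ob V ==> prod_map V Xs Xs (map (Id V) Xs) = Id V (Prod V Xs)"
proof (rule Prod_eqI)
 assume Xs: "set Xs <= Ob V"
 show "Proj V Xs r \<cdot> prod_map V Xs Xs (map (Id V) Xs) = Proj V Xs r \<cdot> Id V (Prod V Xs)" if "r < length Xs" for r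
  using that Proj_prod_map[OF arrs_Id[OF Xs] that] homD[OF Proj_hom[OF Xs that]] by simp
qed (auto intro: Id_hom Prod_Ob prod_map_hom arrs_Id)

lemma flatten_elems:
 assumes "set (concat Xss) <= Ob V"
 shows "elems V (Prod V (map (Prod V) Xss)) [Proj V (Xss ! p) q \<cdot> Proj V (map (Prod V) Xss) p.
  p \<leftarrow> [0..<length Xss], q \<leftarrow> [0..<length (Xss ! p)]] (concat Xss)"
proof (rule elems_concat)
 have ob: "set (Xss ! p) <= Ob V" if "p < length Xss" for p
  using assms that by (force simp: subset_iff)
 have ob': "set (map (Prod V) Xss) <= Ob V"
  using assms by (auto intro!: Prod_Ob)
 have "Proj V (Xss ! p) q \<cdot> Proj V (map (Prod V) Xss) p \<in> hom V (Prod V (map (Prod V) Xss)) (Xss ! p ! q)"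
  if "p < length Xss" "q < length (Xss ! p)" for p q
  using Comp_hom[of "Proj V (map (Prod V) Xss) p"] Proj_hom[OF ob', of p] Proj_hom[OF ob, of p q] that by simp
 then show "list_all2 (elems V (Prod V (map (Prod V) Xss)))
   (map (\<lambda>p. map (\<lambda>q. Proj V (Xss ! p) q \<cdot> Proj V (map (Prod V) Xss) p) [0..<length (Xss ! p)]) [0..<length Xss]) Xss"
  by (auto simp: all2_nth intro!: elemsI)
qed

lemma flatten_hom: "set (concat Xss) <= Ob V ==> flatten V Xss \<in> hom V (Prod V (map (Prod V) Xss)) (Prod V (concat Xss))"
 unfolding flatten_def by (intro tuple_hom flatten_elems Prod_Ob) (auto intro!: Prod_Ob)

lemma elems_tuples:
 assumes "Z \<in> Ob V" "list_all2 (elems V Z) fss Xss"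
 shows "elems V Z (map2 (tuple V Z) Xss fss) (map (Prod V) Xss)"
 using assms by (auto simp: elems_def all2_nth intro!: tuple_hom)

text \<open>Seen on elements, the reassociation of a product of products is the concatenation of
  lists. Besides its type, this is all that is used about \<open>flatten\<close>.\<close>

lemma flatten_tuple:
 assumes "Z \<in> Ob V" "list_all2 (elems V Z) fss Xss"
 shows "flatten V Xss \<cdot> tuple V Z (map (Prod V) Xss) (map2 (tuple V Z) Xss fss) = tuple V Z (concat Xss) (concat fss)"
  (is "_ \<cdot> ?t = _")
proof -
 have ob: "set (concat Xss) <= Ob V" using elems_Ob[OF elems_concat[OF assms(2)]] .
 have ob1: "set (Xss ! p) <= Ob V" if "p < length Xss" for p
  using ob that by (force simp: subset_iff)
 have ob': "set (map (Prod V) Xss) <= Ob V"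
  using ob by (auto intro!: Prod_Ob)
 have len: "length fss = length Xss" using assms(2) by (simp add: list_all2_lengthD)
 have el: "elems V Z (fss ! p) (Xss ! p)" if "p < length Xss" for p
  using assms(2) that by (simp add: all2_nth)
 note t = tuple_hom[OF assms(1) elems_tuples[OF assms]]
 have "Proj V (Xss ! p) q \<cdot> Proj V (map (Prod V) Xss) p \<cdot> ?t = fss ! p ! q"
  if "p < length Xss" "q < length (Xss ! p)" for p q
 proof -
  have "Proj V (map (Prod V) Xss) p \<cdot> ?t = tuple V Z (Xss ! p) (fss ! p)"
   using Proj_tuple[OF assms(1) elems_tuples[OF assms], of p] that len by simp
  then show ?thesis
   using Comp_assoc[OF t, of "Proj V (map (Prod V) Xss) p"] Proj_hom[OF ob', of p] Proj_hom[OF ob1, of p q]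
    Proj_tuple[OF assms(1) el, of p q] that by simp
 qed
 then have "map (map (\<lambda>f. f \<cdot> ?t)) (map (\<lambda>p. map (\<lambda>q. Proj V (Xss ! p) q \<cdot> Proj V (map (Prod V) Xss) p) [0..<length (Xss ! p)]) [0..<length Xss]) = fss"
  using len elems_length[OF el] by (intro nth_equalityI) (auto intro!: nth_equalityI)
 then have "map (\<lambda>f. f \<cdot> ?t) [Proj V (Xss ! p) q \<cdot> Proj V (map (Prod V) Xss) p.
  p \<leftarrow> [0..<length Xss], q \<leftarrow> [0..<length (Xss ! p)]] = concat fss"
  by (simp only: map_concat)
 then show ?thesis
  unfolding flatten_def using tuple_comp[OF Prod_Ob[OF ob'] flatten_elems[OF ob] t] by simp
qed

end

text \<open>The graph constructions live on the types \<open>'a obj\<close> and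
  \<open>'a arr\<close>; these variants of the general locales fix the types accordingly.\<close>

locale obj_category = category C for C :: "('a obj, 'a arr, 'z) cat_scheme" (structure)

locale obj_fprod = fprod V for V :: "('a obj, 'a arr, 'z) pcat_scheme" (structure)

sublocale obj_fprod < obj_category V ..

text \<open>The invariant of the induction on dimension. Distributivity is required in one factor at
  a time and for the chosen coproduct only; with the empty index set it says that a product with an
  initial factor is initial. The congruence axioms say that chosen coproducts ignore the values of a
  family outside its index set.\<close>

locale dcat = obj_fprod V for V :: "('a obj, 'a arr, 'a cell, 'z) vcat_scheme" (structure) +
 assumes Coprod_is: "(!!i. i \<in> I ==> X i \<in> Ob V) ==> is_coprod V I X (Coprod V I X) (Inj V I X)"
  and Coprod_cong: "(!!i. i \<in> I ==> X i = Y i) ==> Coprod V I X = Coprod V I Y"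
  and Inj_cong: "(!!i. i \<in> I ==> X i = Y i) ==> i \<in> I ==> Inj V I X i = Inj V I Y i"
  and distrib: "set Xs <= Ob V ==> r < length Xs ==> (!!i. i \<in> I ==> X i \<in> Ob V) ==>
   Xs ! r = Coprod V I X ==>
   is_coprod V I (\<lambda>i. Prod V (Xs[r := X i])) (Prod V Xs)
    (\<lambda>i. prod_map V (Xs[r := X i]) Xs ((map (Id V) Xs)[r := Inj V I X i]))"
begin

lemma Coprod_Ob: "(!!i. i \<in> I ==> X i \<in> Ob V) ==> Coprod V I X \<in> Ob V"
 using Coprod_is is_coprod_Ob by blast

lemma cotuple_props:
 assumes "!!i. i \<in> I ==> f i \<in> hom V (X i) Y" "Y \<in> Ob V"
 shows "cotuple V I X Y f \<in> hom V (Coprod V I X) Y & (\<forall>i \<in> I. cotuple V I X Y f \<cdot> Inj V I X i = f i)"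
 unfolding cotuple_def
proof (rule theI')
 have "is_coprod V I X (Coprod V I X) (Inj V I X)" by (rule Coprod_is) (rule homA(4)[OF assms(1)])
 then show "\<exists>!h. h \<in> hom V (Coprod V I X) Y & (\<forall>i \<in> I. h \<cdot> Inj V I X i = f i)"
  using assms by (simp add: is_coprod_def)
qed

lemma cotuple_hom: "(!!i. i \<in> I ==> f i \<in> hom V (X i) Y) ==> Y \<in> Ob V ==> cotuple V I X Y f \<in> hom V (Coprod V I X) Y"
 and cotuple_Inj: "(!!i. i \<in> I ==> f i \<in> hom V (X i) Y) ==> Y \<in> Ob V ==> i \<in> I ==> cotuple V I X Y f \<cdot> Inj V I X i = f i"
 using cotuple_props by blast+

lemma arrs_Id_update:
 assumes "set Xs <= Ob V" "r < length Xs" "f \<in> hom V A (Xs ! r)"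
 shows "arrs V ((map (Id V) Xs)[r := f]) (Xs[r := A]) Xs"
 using assms by (auto simp: arrs_def nth_list_update intro!: Id_hom nth_Ob)

text \<open>The factor \<open>Xs ! r\<close> is exchanged for the isomorphic chosen coproduct
  \<open>C\<close>, distributivity is applied there, and the product map with this isomorphism in
  position \<open>r\<close> carries the result back.\<close>

lemma distrib_is_coprod:
 fixes I :: "'a cell set"
 assumes Xs: "set Xs <= Ob V" and r: "r < length Xs" and c: "is_coprod V I X (Xs ! r) j"
 shows "is_coprod V I (\<lambda>i. Prod V (Xs[r := X i])) (Prod V Xs)
    (\<lambda>i. prod_map V (Xs[r := X i]) Xs ((map (Id V) Xs)[r := j i]))"
proof -
 define C where "C = Coprod V I X"
 have C: "is_coprod V I X C (Inj V I X)" unfolding C_def by (rule Coprod_is) (rule is_coprod_Ob(2)[OF c])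
 obtain u v where u: "u \<in> hom V C (Xs ! r)" and v: "v \<in> hom V (Xs ! r) C" and
  vu: "v \<cdot> u = Id V C" and uv: "u \<cdot> v = Id V (Xs ! r)" and uj: "!!i. i \<in> I ==> u \<cdot> Inj V I X i = j i"
  using is_coprod_iso[OF C c] by metis
 define Ys where "Ys = Xs[r := C]"
 have Ys: "set Ys <= Ob V" using Xs is_coprod_Ob(1)[OF C] unfolding Ys_def by (meson insert_subset set_update_subset_insert subset_trans)
 have rY: "r < length Ys" "Ys ! r = C" using r by (simp_all add: Ys_def)
 have XY: "Xs = Ys[r := Xs ! r]" by (simp add: Ys_def)
 have U: "arrs V ((map (Id V) Xs)[r := u]) Ys Xs" unfolding Ys_def by (rule arrs_Id_update[OF Xs r u])
 have W: "arrs V ((map (Id V) Ys)[r := v]) Xs Ys"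
  using arrs_Id_update[OF Ys rY(1), of v "Xs ! r"] v by (simp flip: XY add: rY)
 have D: "is_coprod V I (\<lambda>i. Prod V (Ys[r := X i])) (Prod V Ys)
    (\<lambda>i. prod_map V (Ys[r := X i]) Ys ((map (Id V) Ys)[r := Inj V I X i]))"
  by (rule distrib[OF Ys rY(1)]) (use is_coprod_Ob(2)[OF c] in \<open>auto simp: rY C_def\<close>)
 have id: "comps V ((map (Id V) Ys)[r := v]) ((map (Id V) Xs)[r := u]) = map (Id V) Ys"
  "comps V ((map (Id V) Xs)[r := u]) ((map (Id V) Ys)[r := v]) = map (Id V) Xs"
  using Xs r by (auto intro!: nth_equalityI simp: Ys_def nth_list_update vu uv)
 show ?thesis
 proof (rule is_coprod_transport[OF D prod_map_hom[OF U] prod_map_hom[OF W]])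
  show "prod_map V Xs Ys ((map (Id V) Ys)[r := v]) \<cdot> prod_map V Ys Xs ((map (Id V) Xs)[r := u]) = Id V (Prod V Ys)"
   by (simp add: prod_map_comp[OF U W] id prod_map_Id[OF Ys])
  show "prod_map V Ys Xs ((map (Id V) Xs)[r := u]) \<cdot> prod_map V Xs Ys ((map (Id V) Ys)[r := v]) = Id V (Prod V Xs)"
   by (simp add: prod_map_comp[OF W U] id prod_map_Id[OF Xs])
  fix i assume i: "i \<in> I"
  have J: "arrs V ((map (Id V) Ys)[r := Inj V I X i]) (Ys[r := X i]) Ys"
   by (rule arrs_Id_update[OF Ys rY(1)]) (use is_coprod_hom[OF C i] rY in simp)
  have "comps V ((map (Id V) Xs)[r := u]) ((map (Id V) Ys)[r := Inj V I X i]) = (map (Id V) Xs)[r := j i]"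
   using Xs r i by (auto intro!: nth_equalityI simp: Ys_def nth_list_update uj)
  then show "prod_map V (Xs[r := X i]) Xs ((map (Id V) Xs)[r := j i]) =
   prod_map V Ys Xs ((map (Id V) Xs)[r := u]) \<cdot> prod_map V (Ys[r := X i]) Ys ((map (Id V) Ys)[r := Inj V I X i])"
   by (simp add: prod_map_comp[OF J U]) (simp add: Ys_def)
  show "Prod V (Xs[r := X i]) = Prod V (Ys[r := X i])" by (simp add: Ys_def)
 qed
qed

text \<open>Distributivity in all variables at once, proved one variable at a time: the variables
 below \<open>m\<close> have already been released.\<close>

lemma joint_epi:
 fixes I :: "nat => 'a cell set"
 assumes F: "cocont V W F"
  and c: "!!r. r < length Xs ==> is_coprod V (I r) (X r) (Xs ! r) (j r)"
  and h: "h \<in> hom W (fob F (Prod V Xs)) Y" and k: "k \<in> hom W (fob F (Prod V Xs)) Y"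
  and e: "!!is. length is = length Xs ==> (!!r. r < length Xs ==> is ! r \<in> I r) ==>
   h \<cdot>\<^bsub>W\<^esub> far F (prod_map V (map (\<lambda>r. X r (is ! r)) [0..<length Xs]) Xs (map (\<lambda>r. j r (is ! r)) [0..<length Xs])) =
   k \<cdot>\<^bsub>W\<^esub> far F (prod_map V (map (\<lambda>r. X r (is ! r)) [0..<length Xs]) Xs (map (\<lambda>r. j r (is ! r)) [0..<length Xs]))"
 shows "h = k"
proof -
 interpret F: cat_functor V W F using F by (rule cocont_functor)
 define n where "n = length Xs"
 have Xs: "set Xs <= Ob V" using is_coprod_Ob(1)[OF c] by (auto simp: in_set_conv_nth)
 define Zs where "Zs m is = map (\<lambda>r. if r < m then Xs ! r else X r (is ! r)) [0..<n]" for m "is"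
 define hs where "hs m is = map (\<lambda>r. if r < m then Id V (Xs ! r) else j r (is ! r)) [0..<n]" for m "is"
 have arrs: "arrs V (hs m is) (Zs m is) Xs" if "!!r. m \<le> r ==> r < n ==> is ! r \<in> I r" for m "is"
  using Xs that is_coprod_hom[OF c] by (auto simp: arrs_def hs_def Zs_def n_def intro: Id_hom nth_Ob)
 have step: "h \<cdot>\<^bsub>W\<^esub> far F (prod_map V (Zs m is) Xs (hs m is)) = k \<cdot>\<^bsub>W\<^esub> far F (prod_map V (Zs m is) Xs (hs m is))"
  if "m \<le> n" "length is = n" "!!r. m \<le> r ==> r < n ==> is ! r \<in> I r" for m "is"
  using that
 proof (induction m arbitrary: "is")
  case 0
  then show ?case using e[of "is"] by (simp add: Zs_def hs_def n_def)
 next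
  case (Suc m)
  let ?Z = "Zs (Suc m) is" and ?g = "hs (Suc m) is"
  have m: "m < n" using Suc by simp
  have a: "arrs V ?g ?Z Xs" using arrs[of "Suc m" "is"] Suc.prems by simp
  note Z = arrs_Ob(1)[OF a]
  have Zm: "?Z ! m = Xs ! m" "length ?Z = n" using m by (simp_all add: Zs_def)
  have cm: "is_coprod V (I m) (X m) (?Z ! m) (j m)" using c[of m] m Zm by (simp add: n_def)
  note pm = F.far_hom[OF prod_map_hom[OF a]]
  show ?case
  proof (rule F.D.is_coprod_eqI[OF cocont_is_coprod[OF F distrib_is_coprod[OF Z _ cm]]
     F.D.Comp_hom[OF pm h] F.D.Comp_hom[OF pm k]])
   show "m < length ?Z" using m Zm by simp
   fix i assume i: "i \<in> I m"
   have b: "arrs V ((map (Id V) ?Z)[m := j m i]) (?Z[m := X m i]) ?Z"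
    by (rule arrs_Id_update[OF Z]) (use m Zm is_coprod_hom[OF cm i] in auto)
   have is': "!!r. m \<le> r ==> r < n ==> is[m := i] ! r \<in> I r"
    using Suc.prems i m by (auto simp: nth_list_update)
   \<comment> \<open>Restricting the released variable \<open>m\<close> to the summand
     \<open>i\<close> gives the situation of stage \<open>m\<close> for the index list with
     \<open>i\<close> at position \<open>m\<close>, so that the induction hypothesis
     applies.\<close>
   have 1: "?Z[m := X m i] = Zs m (is[m := i])"
    using m Suc.prems by (intro nth_equalityI) (auto simp: Zs_def nth_list_update)
   have jm: "j m i \<in> Ar V" "Cod V (j m i) = Xs ! m"
    using homD[OF is_coprod_hom[OF cm i]] Zm by simp_all
   have jr: "j r (is ! r) \<in> Ar V" "Dom V (j r (is ! r)) = X r (is ! r)" if "r < n" "m \<le> r" "r ~= m" for r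
    using homD[OF is_coprod_hom[OF c, of r "is ! r"]] that Suc.prems by (simp_all add: n_def)
   have 2: "comps V ?g ((map (Id V) ?Z)[m := j m i]) = hs m (is[m := i])"
   proof (rule nth_equalityI)
    fix r assume "r < length (comps V ?g ((map (Id V) ?Z)[m := j m i]))"
    then have r: "r < n" by (simp add: hs_def Zs_def)
    then have "Xs ! r \<in> Ob V" using Xs by (simp add: n_def)
    then show "comps V ?g ((map (Id V) ?Z)[m := j m i]) ! r = hs m (is[m := i]) ! r"
     using m Suc.prems r jm jr[of r] by (cases "r < m"; cases "r = m") (simp_all add: Zs_def hs_def nth_list_update)
   qed (simp add: hs_def Zs_def)
   have 3: "far F (prod_map V ?Z Xs ?g) \<cdot>\<^bsub>W\<^esub> far F (prod_map V (?Z[m := X m i]) ?Z ((map (Id V) ?Z)[m := j m i])) =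
     far F (prod_map V (Zs m (is[m := i])) Xs (hs m (is[m := i])))"
    unfolding F.far_Comp[OF prod_map_hom[OF b] prod_map_hom[OF a], symmetric]
    unfolding prod_map_comp[OF b a] 2 unfolding 1 ..
   show "h \<cdot>\<^bsub>W\<^esub> far F (prod_map V ?Z Xs ?g) \<cdot>\<^bsub>W\<^esub> far F (prod_map V (?Z[m := X m i]) ?Z ((map (Id V) ?Z)[m := j m i])) =
     k \<cdot>\<^bsub>W\<^esub> far F (prod_map V ?Z Xs ?g) \<cdot>\<^bsub>W\<^esub> far F (prod_map V (?Z[m := X m i]) ?Z ((map (Id V) ?Z)[m := j m i]))"
    using Suc.IH[of "is[m := i]"] is' Suc.prems 3
     F.D.Comp_assoc[OF F.far_hom[OF prod_map_hom[OF b]] pm h]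
     F.D.Comp_assoc[OF F.far_hom[OF prod_map_hom[OF b]] pm k]
    by simp
  qed
 qed
 have "Zs n is = Xs" "hs n is = map (Id V) Xs" for "is"
  by (auto simp: Zs_def hs_def n_def intro!: nth_equalityI)
 then show ?thesis
  \<comment> \<open>With all variables released no index is consulted, so any list of length
    \<open>n\<close> will do.\<close>
  using step[of n "replicate n undefined"] prod_map_Id[OF Xs] F.far_Id Prod_Ob[OF Xs] F.D.homD[OF h] F.D.homD[OF k]
  by simp
qed

end

subsection \<open>Sets\<close>

lemma set_Ob: "X \<in> Ob set_cat \<longleftrightarrow> X = SetOb (pts X)"
 by (cases X) (auto simp: set_cat_def)

lemma set_hom: "f \<in> hom set_cat X Y \<longleftrightarrow>
  X \<in> Ob set_cat & Y \<in> Ob set_cat & f = SetAr X Y (fn f) & fn f \<in> pts X \<rightarrow>\<^sub>E pts Y"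
 unfolding set_Ob
proof
 assume "f \<in> hom set_cat X Y"
 then show "X = SetOb (pts X) & Y = SetOb (pts Y) & f = SetAr X Y (fn f) & fn f \<in> pts X \<rightarrow>\<^sub>E pts Y"
  by (auto simp: hom_def set_cat_def)
next
 assume r: "X = SetOb (pts X) & Y = SetOb (pts Y) & f = SetAr X Y (fn f) & fn f \<in> pts X \<rightarrow>\<^sub>E pts Y"
 obtain A B g where "X = SetOb A" "Y = SetOb B" "f = SetAr X Y g" using r by metis
 then show "f \<in> hom set_cat X Y" using r by (simp add: hom_def set_cat_def)
qed

lemma set_homI: "X \<in> Ob set_cat ==> Y \<in> Ob set_cat ==> g \<in> pts X \<rightarrow>\<^sub>E pts Y ==> SetAr X Y g \<in> hom set_cat X Y"
 by (simp add: set_hom)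

lemma set_hom_eqI:
 assumes "f \<in> hom set_cat X Y" "g \<in> hom set_cat X Y" "!!x. x \<in> pts X ==> fn f x = fn g x"
 shows "f = g"
proof -
 have "fn f = fn g" using assms by (intro PiE_ext[of _ "pts X" "\<lambda>_. pts Y"]) (simp_all add: set_hom)
 then show ?thesis using assms(1,2) unfolding set_hom by metis
qed

lemma set_hom_mem: "f \<in> hom set_cat X Y ==> x \<in> pts X ==> fn f x \<in> pts Y"
 by (auto simp: set_hom)

lemma set_comp:
 assumes "f \<in> hom set_cat X Y" "g \<in> hom set_cat Y Z"
 shows "g \<cdot>\<^bsub>set_cat\<^esub> f = SetAr X Z (\<lambda>x\<in>pts X. fn g (fn f x))"
proof -
 have "src f = X" "tgt g = Z" using assms unfolding set_hom by (metis arr.sel)+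
 then show ?thesis by (simp add: set_cat_def)
qed

lemma set_Id: "Id set_cat A = SetAr A A (\<lambda>x\<in>pts A. x)"
 by (simp add: set_cat_def)

lemma set_Id_hom: "A \<in> Ob set_cat ==> Id set_cat A \<in> hom set_cat A A"
 unfolding set_Id by (auto intro: set_homI)

lemma set_cat_category: "category set_cat"
proof
 fix f assume "f \<in> Ar set_cat" then show "Dom set_cat f \<in> Ob set_cat" "Cod set_cat f \<in> Ob set_cat"
  by (auto simp: set_cat_def)
next
 fix A assume "A \<in> Ob set_cat"
 then show "Id set_cat A \<in> hom set_cat A A" by (rule set_Id_hom)
next
 fix f g A B D assume f: "f \<in> hom set_cat A B" and g: "g \<in> hom set_cat B D"
 then show c: "g \<cdot>\<^bsub>set_cat\<^esub> f \<in> hom set_cat A D"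
  unfolding set_comp[OF f g] by (intro set_homI) (auto simp: set_hom)
 fix h E assume h: "h \<in> hom set_cat D E"
 have hg: "h \<cdot>\<^bsub>set_cat\<^esub> g \<in> hom set_cat B E"
  using g h unfolding set_comp[OF g h] by (intro set_homI) (auto simp: set_hom)
 show "h \<cdot>\<^bsub>set_cat\<^esub> g \<cdot>\<^bsub>set_cat\<^esub> f = h \<cdot>\<^bsub>set_cat\<^esub> (g \<cdot>\<^bsub>set_cat\<^esub> f)"
  unfolding set_comp[OF f hg] set_comp[OF c h] unfolding set_comp[OF f g] set_comp[OF g h]
  using set_hom_mem[OF f] by (simp cong: restrict_cong)
next
 fix f A B assume f: "f \<in> hom set_cat A B"
 have "A \<in> Ob set_cat" "B \<in> Ob set_cat" using f unfolding set_hom by blast+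
 then have i: "Id set_cat A \<in> hom set_cat A A" "Id set_cat B \<in> hom set_cat B B"
  using set_Id_hom by blast+
 show "f \<cdot>\<^bsub>set_cat\<^esub> Id set_cat A = f" "Id set_cat B \<cdot>\<^bsub>set_cat\<^esub> f = f"
  unfolding set_comp[OF i(1) f] set_comp[OF f i(2)] using f set_hom_mem[OF f]
  by (intro set_hom_eqI[of _ A B] set_homI; auto simp: set_Id set_hom)+
qed

lemma set_cat_simps [simp]:
 "Prod set_cat Xs = SetOb (prod_pts Xs)"
 "Proj set_cat Xs r = SetAr (SetOb (prod_pts Xs)) (Xs ! r) (\<lambda>x\<in>prod_pts Xs. untup x ! r)"
 "Coprod set_cat I X = SetOb (coprod_pts I X)"
 "Inj set_cat I X i = SetAr (X i) (SetOb (coprod_pts I X)) (\<lambda>x\<in>pts (X i). Tup [i, x])"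
 "SetOb A \<in> Ob set_cat"
 by (simp_all add: set_cat_def)

lemma prod_pts_nth: "p \<in> prod_pts Xs \<longleftrightarrow> p = Tup (untup p) & length (untup p) = length Xs &
  (\<forall>r < length Xs. untup p ! r \<in> pts (Xs ! r))"
 by (cases p) (auto simp: prod_pts_def all2_nth)

lemma prod_ptsD:
 assumes "p \<in> prod_pts Xs"
 shows "Tup (untup p) = p" "length (untup p) = length Xs" "r < length Xs ==> untup p ! r \<in> pts (Xs ! r)"
 using iffD1[OF prod_pts_nth assms] by simp_all

lemma prod_pts_eqI:
 assumes "p \<in> prod_pts Xs" "q \<in> prod_pts Xs" "!!r. r < length Xs ==> untup p ! r = untup q ! r"
 shows "p = q"
proof -
 have "untup p = untup q" using prod_ptsD(2)[OF assms(1)] prod_ptsD(2)[OF assms(2)] assms(3)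
  by (intro nth_equalityI) auto
 then show ?thesis using prod_ptsD(1)[OF assms(1)] prod_ptsD(1)[OF assms(2)] by metis
qed

lemma coprod_ptsE:
 assumes "p \<in> coprod_pts I X"
 obtains i x where "p = Tup [i, x]" "i \<in> I" "x \<in> pts (X i)"
 using assms by (auto simp: coprod_pts_def)

lemma coprod_pts_Tup [simp]: "Tup [i, x] \<in> coprod_pts I X \<longleftrightarrow> i \<in> I & x \<in> pts (X i)"
 by (auto simp: coprod_pts_def)

lemma coprod_pts_cong: "(!!i. i \<in> I ==> X i = Y i) ==> coprod_pts I X = coprod_pts I Y"
 by (auto simp: coprod_pts_def)

lemma set_fn_comp:
 assumes "f \<in> hom set_cat X Y" "g \<in> hom set_cat Y Z" "x \<in> pts X"
 shows "fn (g \<cdot>\<^bsub>set_cat\<^esub> f) x = fn g (fn f x)"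
 using set_comp[OF assms(1,2)] assms(3) by simp

lemma set_fprod: "fprod set_cat"
proof -
 interpret category set_cat by (rule set_cat_category)
 have Proj: "Proj set_cat Xs r \<in> hom set_cat (SetOb (prod_pts Xs)) (Xs ! r)" if "set Xs <= Ob set_cat" "r < length Xs" for Xs r
  using that nth_mem[OF that(2)] unfolding set_cat_simps by (intro set_homI) (auto intro: prod_ptsD)
 show ?thesis
 proof
  fix Xs :: "'a obj list" assume Xs: "set Xs <= Ob set_cat"
  show "Prod set_cat Xs \<in> Ob set_cat" by simp
  show "Proj set_cat Xs r \<in> hom set_cat (Prod set_cat Xs) (Xs ! r)" if "r < length Xs" for r
   using Proj[OF Xs that] by simp
  fix h k Z assume h: "h \<in> hom set_cat Z (Prod set_cat Xs)" and k: "k \<in> hom set_cat Z (Prod set_cat Xs)"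
   and e: "!!r. r < length Xs ==> Proj set_cat Xs r \<cdot>\<^bsub>set_cat\<^esub> h = Proj set_cat Xs r \<cdot>\<^bsub>set_cat\<^esub> k"
  show "h = k"
  proof (rule set_hom_eqI[OF h k])
   fix z assume z: "z \<in> pts Z"
   show "fn h z = fn k z"
   proof (rule prod_pts_eqI[of _ Xs])
    show m: "fn h z \<in> prod_pts Xs" "fn k z \<in> prod_pts Xs" using set_hom_mem[OF h z] set_hom_mem[OF k z] by simp_all
    fix r assume r: "r < length Xs"
    have "fn (Proj set_cat Xs r \<cdot>\<^bsub>set_cat\<^esub> h) z = fn (Proj set_cat Xs r \<cdot>\<^bsub>set_cat\<^esub> k) z" using e[OF r] by simp
    then show "untup (fn h z) ! r = untup (fn k z) ! r"
     using set_fn_comp[OF _ Proj[OF Xs r] z, of h] set_fn_comp[OF _ Proj[OF Xs r] z, of k] h k m by simp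
   qed
  qed
 next
  fix Z fs Xs assume Z: "Z \<in> Ob set_cat" and fs: "elems set_cat Z fs Xs"
  have Xs: "set Xs <= Ob set_cat"
   using fs by (force simp: elems_def all2_nth in_set_conv_nth set_hom)
  define h where "h = SetAr Z (SetOb (prod_pts Xs)) (\<lambda>z\<in>pts Z. Tup (map (\<lambda>f. fn f z) fs))"
  have h: "h \<in> hom set_cat Z (SetOb (prod_pts Xs))"
   unfolding h_def using elems_length[OF fs] set_hom_mem[OF elems_nth[OF fs]]
   by (intro set_homI Z) (auto simp: prod_pts_nth)
  show "\<exists>h\<in>hom set_cat Z (Prod set_cat Xs). \<forall>r<length Xs. Proj set_cat Xs r \<cdot>\<^bsub>set_cat\<^esub> h = fs ! r"
  proof (intro bexI allI impI)
   show "h \<in> hom set_cat Z (Prod set_cat Xs)" using h by simp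
   fix r assume r: "r < length Xs"
   note c = set_comp[OF h Proj[OF Xs r]]
   show "Proj set_cat Xs r \<cdot>\<^bsub>set_cat\<^esub> h = fs ! r"
   proof (rule set_hom_eqI[OF Comp_hom[OF h Proj[OF Xs r]] elems_nth[OF fs r]])
    fix z assume z: "z \<in> pts Z"
    then have "fn h z \<in> prod_pts Xs" using set_hom_mem[OF h] by simp
    then show "fn (Proj set_cat Xs r \<cdot>\<^bsub>set_cat\<^esub> h) z = fn (fs ! r) z"
     using z r elems_length[OF fs] unfolding c by (simp add: h_def)
   qed
  qed
 qed
qed

lemma set_fn_Proj:
 assumes "set Xs <= Ob set_cat" "r < length Xs" "h \<in> hom set_cat Z (Prod set_cat Xs)" "z \<in> pts Z"
 shows "fn (Proj set_cat Xs r \<cdot>\<^bsub>set_cat\<^esub> h) z = untup (fn h z) ! r"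
 using set_fn_comp[OF assms(3) fprod.Proj_hom[OF set_fprod assms(1,2)] assms(4)] set_hom_mem[OF assms(3,4)] by simp

lemma set_fn_prod_map:
 assumes "arrs set_cat fs Xs Ys" "p \<in> prod_pts Xs"
 shows "fn (prod_map set_cat Xs Ys fs) p = Tup (map2 (\<lambda>f x. fn f x) fs (untup p))"
proof -
 interpret fprod set_cat by (rule set_fprod)
 note h = prod_map_hom[OF assms(1)]
 show ?thesis
 proof (rule prod_pts_eqI[of _ Ys])
  show "fn (prod_map set_cat Xs Ys fs) p \<in> prod_pts Ys" using set_hom_mem[OF h] assms(2) by simp
  show "Tup (map2 (\<lambda>f x. fn f x) fs (untup p)) \<in> prod_pts Ys"
   using assms prod_ptsD[OF assms(2)] arrs_length[OF assms(1)] set_hom_mem[OF arrs_nth[OF assms(1)]]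
   by (simp add: prod_pts_nth)
  fix r assume r: "r < length Ys"
  then have r': "r < length Xs" using arrs_length[OF assms(1)] by simp
  have "untup (fn (prod_map set_cat Xs Ys fs) p) ! r = fn (fs ! r \<cdot>\<^bsub>set_cat\<^esub> Proj set_cat Xs r) p"
   using set_fn_Proj[OF arrs_Ob(2)[OF assms(1)] r h, of p] assms(2) Proj_prod_map[OF assms(1) r'] by simp
  also have "\<dots> = fn (fs ! r) (untup p ! r)"
   using set_fn_comp[OF Proj_hom[OF arrs_Ob(1)[OF assms(1)] r'] arrs_nth[OF assms(1) r'], of p] assms(2) by simp
  finally show "untup (fn (prod_map set_cat Xs Ys fs) p) ! r = untup (Tup (map2 (\<lambda>f x. fn f x) fs (untup p))) ! r"
   using r' arrs_length[OF assms(1)] prod_ptsD[OF assms(2)] by simp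
 qed
qed

lemma set_Inj_hom: "X i \<in> Ob set_cat ==> i \<in> I ==> Inj set_cat I X i \<in> hom set_cat (X i) (Coprod set_cat I X)"
 unfolding set_cat_simps by (intro set_homI) auto

text \<open>A coproduct of sets is a disjoint decomposition into images of injections. In this form
  distributivity becomes a check on tagged tuples.\<close>

lemma set_is_coprodI:
 assumes P: "P \<in> Ob set_cat" and J: "!!i. i \<in> I ==> j i \<in> hom set_cat (X i) P"
  and surj: "!!p. p \<in> pts P ==> \<exists>i \<in> I. \<exists>x \<in> pts (X i). fn (j i) x = p"
  and inj: "!!i k x y. i \<in> I ==> k \<in> I ==> x \<in> pts (X i) ==> y \<in> pts (X k) ==> fn (j i) x = fn (j k) y ==> i = k & x = y"
 shows "is_coprod set_cat I X P j"
proof -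
 interpret category set_cat by (rule set_cat_category)
 show ?thesis
 proof (rule is_coprodI[OF P J])
  fix Y f assume Y: "Y \<in> Ob set_cat" and f: "!!i. i \<in> I ==> f i \<in> hom set_cat (X i) Y"
  define h where "h = SetAr P Y (\<lambda>p\<in>pts P. THE y. \<exists>i \<in> I. \<exists>x \<in> pts (X i). fn (j i) x = p & y = fn (f i) x)"
  have e: "fn h (fn (j i) x) = fn (f i) x" if "i \<in> I" "x \<in> pts (X i)" for i x
  proof -
   have "(THE y. \<exists>k \<in> I. \<exists>z \<in> pts (X k). fn (j k) z = fn (j i) x & y = fn (f k) z) = fn (f i) x"
   proof (rule the_equality)
    fix y assume "\<exists>k \<in> I. \<exists>z \<in> pts (X k). fn (j k) z = fn (j i) x & y = fn (f k) z"
    then obtain k z where "k \<in> I" "z \<in> pts (X k)" "fn (j k) z = fn (j i) x" "y = fn (f k) z" by blast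
    then show "y = fn (f i) x" using inj[of k i z x] that by simp
   qed (use that in blast)
   then show ?thesis using set_hom_mem[OF J[OF that(1)] that(2)] by (simp add: h_def)
  qed
  have "fn h p \<in> pts Y" if p: "p \<in> pts P" for p
  proof -
   obtain i x where "i \<in> I" "x \<in> pts (X i)" "p = fn (j i) x" using surj[OF p] by blast
   then show ?thesis using e set_hom_mem[OF f] by simp
  qed
  then have h: "h \<in> hom set_cat P Y"
   unfolding h_def by (intro set_homI P Y) auto
  show "\<exists>h\<in>hom set_cat P Y. \<forall>i\<in>I. h \<cdot>\<^bsub>set_cat\<^esub> j i = f i"
  proof (intro bexI[OF _ h] ballI)
   fix i assume i: "i \<in> I"
   show "h \<cdot>\<^bsub>set_cat\<^esub> j i = f i"
    using set_fn_comp[OF J[OF i] h] e[OF i] by (intro set_hom_eqI[OF Comp_hom[OF J[OF i] h] f[OF i]]) simp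
  qed
 next
  fix Y h k assume h: "h \<in> hom set_cat P Y" and k: "k \<in> hom set_cat P Y"
   and e: "!!i. i \<in> I ==> h \<cdot>\<^bsub>set_cat\<^esub> j i = k \<cdot>\<^bsub>set_cat\<^esub> j i"
  show "h = k"
  proof (rule set_hom_eqI[OF h k])
   fix p assume "p \<in> pts P"
   then obtain i x where p: "i \<in> I" "x \<in> pts (X i)" "p = fn (j i) x" using surj by blast
   then show "fn h p = fn k p" using set_fn_comp[OF J[OF p(1)] h p(2)] set_fn_comp[OF J[OF p(1)] k p(2)] e[OF p(1)] by simp
  qed
 qed
qed

lemma set_dcat: "dcat set_cat"
proof -
 interpret fprod set_cat by (rule set_fprod)
 show ?thesis
 proof
  fix I :: "'a cell set" and X :: "'a cell => 'a obj" assume "!!i. i \<in> I ==> X i \<in> Ob set_cat"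
  then show "is_coprod set_cat I X (Coprod set_cat I X) (Inj set_cat I X)"
   by (intro set_is_coprodI set_Inj_hom) (auto elim!: coprod_ptsE)
 next
  fix I :: "'a cell set" and X Y :: "'a cell => 'a obj" assume e: "!!i. i \<in> I ==> X i = Y i"
  show "Coprod set_cat I X = Coprod set_cat I Y" using coprod_pts_cong[of I X Y] e by simp
  show "Inj set_cat I X i = Inj set_cat I Y i" if "i \<in> I" for i using coprod_pts_cong[of I X Y] e that by simp
 next
  fix Xs :: "'a obj list" and r and I :: "'a cell set" and X
  assume Xs: "set Xs <= Ob set_cat" and r: "r < length Xs" and X: "!!i. i \<in> I ==> X i \<in> Ob set_cat"
   and C: "Xs ! r = Coprod set_cat I X"
  let ?X = "\<lambda>i. Xs[r := X i]" and ?f = "\<lambda>i. (map (Id set_cat) Xs)[r := Inj set_cat I X i]"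
  let ?j = "\<lambda>i. prod_map set_cat (?X i) Xs (?f i)"
  have a: "arrs set_cat (?f i) (?X i) Xs" if i: "i \<in> I" for i
   using set_Inj_hom[of X i I] X[OF i] i r Xs C unfolding arrs_def by (auto simp: nth_list_update intro!: Id_hom nth_Ob)
  \<comment> \<open>The map replaces the coordinate \<open>r\<close> of a tuple by its tagged
    version, so the tag recovers the summand and the rest of the tuple is untouched.\<close>
  have fnJ: "fn (?j i) p = Tup ((untup p)[r := Tup [i, untup p ! r]])" if i: "i \<in> I" and p: "p \<in> prod_pts (?X i)" for i p
  proof -
   have "map2 (\<lambda>f x. fn f x) (?f i) (untup p) = (untup p)[r := Tup [i, untup p ! r]]"
   proof (rule nth_equalityI)
    fix s assume "s < length (map2 (\<lambda>f x. fn f x) (?f i) (untup p))"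
    then have s: "s < length Xs" by simp
    then show "map2 (\<lambda>f x. fn f x) (?f i) (untup p) ! s = (untup p)[r := Tup [i, untup p ! r]] ! s"
     using prod_ptsD(1,2)[OF p] prod_ptsD(3)[OF p, of s] r by (auto simp: nth_list_update, auto simp: set_cat_def)
   qed (use prod_ptsD[OF p] in simp)
   then show ?thesis using set_fn_prod_map[OF a[OF i] p] by simp
  qed
  show "is_coprod set_cat I (\<lambda>i. Prod set_cat (?X i)) (Prod set_cat Xs) ?j"
  proof (rule set_is_coprodI)
   show "?j i \<in> hom set_cat (Prod set_cat (?X i)) (Prod set_cat Xs)" if "i \<in> I" for i by (rule prod_map_hom[OF a[OF that]])
  next
   fix p assume "p \<in> pts (Prod set_cat Xs)"
   then have p: "p \<in> prod_pts Xs" by simp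
   obtain i x where ix: "untup p ! r = Tup [i, x]" "i \<in> I" "x \<in> pts (X i)"
    using prod_ptsD(3)[OF p r] C by (auto elim: coprod_ptsE)
   define q where "q = Tup ((untup p)[r := x])"
   have q: "q \<in> prod_pts (?X i)"
    using prod_ptsD[OF p] ix r by (auto simp: prod_pts_nth nth_list_update q_def)
   have "(untup p)[r := Tup [i, x]] = untup p" using ix(1) by (metis list_update_id)
   then have "fn (?j i) q = p" using r prod_ptsD(1,2)[OF p] unfolding fnJ[OF ix(2) q] by (simp add: q_def)
   then show "\<exists>i\<in>I. \<exists>x\<in>pts (Prod set_cat (?X i)). fn (?j i) x = p" using ix(2) q by auto
  next
   fix i k x y assume i: "i \<in> I" "k \<in> I" and "x \<in> pts (Prod set_cat (?X i))" "y \<in> pts (Prod set_cat (?X k))" and e: "fn (?j i) x = fn (?j k) y"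
   then have x: "x \<in> prod_pts (?X i)" and y: "y \<in> prod_pts (?X k)" by simp_all
   have u: "(untup x)[r := Tup [i, untup x ! r]] = (untup y)[r := Tup [k, untup y ! r]]"
    using e unfolding fnJ[OF i(1) x] fnJ[OF i(2) y] by simp
   have "i = k & untup x ! r = untup y ! r" using arg_cong[OF u, of "\<lambda>l. l ! r"] r prod_ptsD(2)[OF x] prod_ptsD(2)[OF y] by simp
   \<comment> \<open>Overwriting the tagged coordinate by the common value
     \<open>untup x ! r\<close> undoes the tagging in both tuples.\<close>
   moreover from this have "untup x = untup y" using arg_cong[OF u, of "\<lambda>l. l[r := untup x ! r]"] by (metis list_update_id list_update_overwrite)
   ultimately show "i = k & x = y" using prod_ptsD(1)[OF x] prod_ptsD(1)[OF y] by metis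
  qed simp
 qed
qed

section \<open>Graphs enriched in a distributive category\<close>

text \<open>Weaker than \<open>is_gph\<close>: nothing is said about the constructor or about
  extensionality of \<open>hm\<close>. Graphs and enriched categories both satisfy it, so lemmas
  about underlying graphs apply to either.\<close>

definition pre_gph :: "('a obj, 'a arr, 'z) cat_scheme => 'a obj => bool" where
 "pre_gph V X \<longleftrightarrow> (\<forall>a \<in> pts X. \<forall>b \<in> pts X. hm X (a, b) \<in> Ob V)"

definition gm :: "('a obj, 'a arr, 'z) cat_scheme => 'a obj => 'a obj => 'a arr set" where
 "gm V A B = {F. is_gph_map V F & src F = A & tgt F = B}"

lemma gmI:
 assumes "f \<in> pts A \<rightarrow>\<^sub>E pts B" "\<phi> \<in> extensional (pts A \<times> pts A)"
  "!!a b. a \<in> pts A ==> b \<in> pts A ==> \<phi> (a, b) \<in> hom V (hm A (a, b)) (hm B (f a, f b))"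
 shows "GphAr A B f \<phi> \<in> gm V A B"
 using assms by (auto simp: gm_def is_gph_map_def PiE_def)

lemma gmD:
 assumes "F \<in> gm V A B"
 shows "F = GphAr A B (fn F) (fm F)" "fn F \<in> pts A \<rightarrow>\<^sub>E pts B" "fm F \<in> extensional (pts A \<times> pts A)"
  "src F = A" "tgt F = B"
 using assms by (auto simp: gm_def is_gph_map_def PiE_def)

lemma gm_fn: "F \<in> gm V A B ==> a \<in> pts A ==> fn F a \<in> pts B"
 using gmD(2) by blast

lemma gm_fm: "F \<in> gm V A B ==> a \<in> pts A ==> b \<in> pts A ==>
  fm F (a, b) \<in> hom V (hm A (a, b)) (hm B (fn F a, fn F b))"
 by (auto simp: gm_def is_gph_map_def PiE_def Pi_def)

lemma gm_eqI:
 assumes F: "F \<in> gm V A B" and G: "G \<in> gm V A B" and 1: "!!a. a \<in> pts A ==> fn F a = fn G a"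
  and 2: "!!a b. a \<in> pts A ==> b \<in> pts A ==> fm F (a, b) = fm G (a, b)"
 shows "F = G"
proof -
 have "fn F = fn G" by (rule PiE_ext[OF gmD(2)[OF F] gmD(2)[OF G] 1])
 moreover have "fm F = fm G"
  by (rule extensionalityI[OF gmD(3)[OF F] gmD(3)[OF G]]) (auto simp: 2)
 ultimately show ?thesis using gmD(1)[OF F] gmD(1)[OF G] by metis
qed

lemma gph_comp_sel [simp]:
 "src (gph_comp V G F) = src F" "tgt (gph_comp V G F) = tgt G"
 by (simp_all add: gph_comp_def)

lemma gph_comp_fn: "F \<in> gm V A B ==> a \<in> pts A ==> fn (gph_comp V G F) a = fn G (fn F a)"
 and gph_comp_fm: "F \<in> gm V A B ==> a \<in> pts A ==> b \<in> pts A ==>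
  fm (gph_comp V G F) (a, b) = fm G (fn F a, fn F b) \<cdot>\<^bsub>V\<^esub> fm F (a, b)"
 by (simp_all add: gph_comp_def gmD(4))

lemma gph_id_fn: "a \<in> pts A ==> fn (gph_id V A) a = a"
 and gph_id_fm: "a \<in> pts A ==> b \<in> pts A ==> fm (gph_id V A) (a, b) = Id V (hm A (a, b))"
 by (simp_all add: gph_id_def)

context obj_category
begin

lemma gph_comp_gm:
 assumes F: "F \<in> gm C A B" and G: "G \<in> gm C B D"
 shows "gph_comp C G F \<in> gm C A D"
 unfolding gph_comp_def gmD(4,5)[OF F] gmD(4,5)[OF G]
 using gm_fn[OF F] gm_fn[OF G] gm_fm[OF F] gm_fm[OF G] by (intro gmI) (auto intro!: Comp_hom)

lemma gph_id_gm: "pre_gph C A ==> gph_id C A \<in> gm C A A"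
 unfolding gph_id_def by (intro gmI) (auto simp: pre_gph_def intro!: Id_hom)

lemma gph_comp_id:
 assumes F: "F \<in> gm C A B" "pre_gph C A"
 shows "gph_comp C F (gph_id C A) = F"
 by (rule gm_eqI[OF gph_comp_gm[OF gph_id_gm[OF F(2)] F(1)] F(1)])
  (use homD[OF gm_fm[OF F(1)]] in \<open>simp_all add: gph_comp_fn[OF gph_id_gm[OF F(2)]]
   gph_comp_fm[OF gph_id_gm[OF F(2)]] gph_id_fn gph_id_fm\<close>)

lemma gph_id_comp:
 assumes F: "F \<in> gm C A B" "pre_gph C B"
 shows "gph_comp C (gph_id C B) F = F"
 by (rule gm_eqI[OF gph_comp_gm[OF F(1) gph_id_gm[OF F(2)]] F(1)])
  (use homD[OF gm_fm[OF F(1)]] in \<open>simp_all add: gph_comp_fn[OF F(1)]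
   gph_comp_fm[OF F(1)] gph_id_fn gph_id_fm gm_fn[OF F(1)]\<close>)

lemma gph_comp_assoc:
 assumes F: "F \<in> gm C A B" and G: "G \<in> gm C B D" and H: "H \<in> gm C D E"
 shows "gph_comp C (gph_comp C H G) F = gph_comp C H (gph_comp C G F)"
proof (rule gm_eqI[OF gph_comp_gm[OF F gph_comp_gm[OF G H]] gph_comp_gm[OF gph_comp_gm[OF F G] H]])
 note GF = gph_comp_gm[OF F G]
 fix a assume a: "a \<in> pts A"
 show "fn (gph_comp C (gph_comp C H G) F) a = fn (gph_comp C H (gph_comp C G F)) a"
  using a gm_fn[OF F] by (simp add: gph_comp_fn[OF F] gph_comp_fn[OF G] gph_comp_fn[OF GF])
 fix b assume b: "b \<in> pts A"
 note ab = gm_fn[OF F a] gm_fn[OF F b]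
 show "fm (gph_comp C (gph_comp C H G) F) (a, b) = fm (gph_comp C H (gph_comp C G F)) (a, b)"
  using Comp_assoc[OF gm_fm[OF F a b] gm_fm[OF G ab] gm_fm[OF H gm_fn[OF G ab(1)] gm_fn[OF G ab(2)]]]
  by (simp add: gph_comp_fn[OF F] gph_comp_fm[OF F] gph_comp_fm[OF G] gph_comp_fm[OF GF] a b ab)
qed

end

subsection \<open>Products and coproducts of graphs\<close>

text \<open>Prescribes only the points and hom-objects of a product, so that it covers both
  \<open>gph_prod\<close> and the product \<open>vcat_prod\<close> of enriched categories.\<close>

definition is_gprod :: "('a obj, 'a arr, 'z) pcat_scheme => 'a obj list => 'a obj => bool" where
 "is_gprod V Xs P \<longleftrightarrow> pts P = prod_pts Xs &
   (\<forall>p \<in> prod_pts Xs. \<forall>q \<in> prod_pts Xs. hm P (p, q) = Prod V (prod_homs Xs p q))"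

definition gproj :: "('a obj, 'a arr, 'z) pcat_scheme => 'a obj list => 'a obj => nat => 'a arr" where
 "gproj V Xs P r = GphAr P (Xs ! r) (\<lambda>p\<in>prod_pts Xs. untup p ! r) (proj_homs V Xs r)"

definition gtuple :: "('a obj, 'a arr, 'z) pcat_scheme => 'a obj => 'a obj list => 'a obj => 'a arr list => 'a arr" where
 "gtuple V Z Xs P Fs = GphAr Z P (\<lambda>z\<in>pts Z. Tup (map (\<lambda>F. fn F z) Fs))
   (\<lambda>(a, b)\<in>pts Z \<times> pts Z. tuple V (hm Z (a, b))
    (prod_homs Xs (Tup (map (\<lambda>F. fn F a) Fs)) (Tup (map (\<lambda>F. fn F b) Fs))) (map (\<lambda>F. fm F (a, b)) Fs))"

lemma prod_homs_simps [simp]: "length (prod_homs Xs p q) = length Xs"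
 "r < length Xs ==> prod_homs Xs p q ! r = hm (Xs ! r) (untup p ! r, untup q ! r)"
 by (simp_all add: prod_homs_def)

context obj_fprod
begin

lemma prod_homs_Ob:
 assumes "!!X. X \<in> set Xs ==> pre_gph V X" "p \<in> prod_pts Xs" "q \<in> prod_pts Xs"
 shows "set (prod_homs Xs p q) <= Ob V"
 using assms prod_ptsD(3)[OF assms(2)] prod_ptsD(3)[OF assms(3)]
 by (auto simp: prod_homs_def pre_gph_def)

lemma is_gprod_pre: "(!!X. X \<in> set Xs ==> pre_gph V X) ==> is_gprod V Xs P ==> pre_gph V P"
 using prod_homs_Ob Prod_Ob by (auto simp: pre_gph_def is_gprod_def)

lemma gproj_gm:
 assumes "!!X. X \<in> set Xs ==> pre_gph V X" "is_gprod V Xs P" "r < length Xs"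
 shows "gproj V Xs P r \<in> gm V P (Xs ! r)"
 unfolding gproj_def
proof (rule gmI)
 show "(\<lambda>p\<in>prod_pts Xs. untup p ! r) \<in> pts P \<rightarrow>\<^sub>E pts (Xs ! r)"
  using assms(2,3) by (auto simp: is_gprod_def prod_ptsD)
 show "proj_homs V Xs r \<in> extensional (pts P \<times> pts P)"
  using assms(2) by (simp add: proj_homs_def is_gprod_def)
 fix p q assume "p \<in> pts P" "q \<in> pts P"
 then have pq: "p \<in> prod_pts Xs" "q \<in> prod_pts Xs" using assms(2) by (simp_all add: is_gprod_def)
 then show "proj_homs V Xs r (p, q) \<in> hom V (hm P (p, q)) (hm (Xs ! r) ((\<lambda>p\<in>prod_pts Xs. untup p ! r) p, (\<lambda>p\<in>prod_pts Xs. untup p ! r) q))"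
  using Proj_hom[OF prod_homs_Ob[OF assms(1) pq], of r] assms(2,3) by (simp add: is_gprod_def proj_homs_def)
qed

lemma gproj_fn: "p \<in> prod_pts Xs ==> fn (gproj V Xs P r) p = untup p ! r"
 and gproj_fm: "p \<in> prod_pts Xs ==> q \<in> prod_pts Xs ==> fm (gproj V Xs P r) (p, q) = Proj V (prod_homs Xs p q) r"
 by (simp_all add: gproj_def proj_homs_def)

lemma gtuple_props:
 assumes Xs: "!!X. X \<in> set Xs ==> pre_gph V X" and P: "is_gprod V Xs P" and Z: "pre_gph V Z"
  and Fs: "length Fs = length Xs" "!!r. r < length Xs ==> Fs ! r \<in> gm V Z (Xs ! r)"
 shows "gtuple V Z Xs P Fs \<in> gm V Z P" "r < length Xs ==> gph_comp V (gproj V Xs P r) (gtuple V Z Xs P Fs) = Fs ! r"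
proof -
 have pt: "Tup (map (\<lambda>F. fn F a) Fs) \<in> prod_pts Xs" if "a \<in> pts Z" for a
  using that Fs gm_fn[OF Fs(2)] by (simp add: prod_pts_nth)
 have el: "elems V (hm Z (a, b)) (map (\<lambda>F. fm F (a, b)) Fs)
   (prod_homs Xs (Tup (map (\<lambda>F. fn F a) Fs)) (Tup (map (\<lambda>F. fn F b) Fs)))" if "a \<in> pts Z" "b \<in> pts Z" for a b
  using that Fs gm_fm[OF Fs(2)] by (intro elemsI) simp_all
 have ob: "hm Z (a, b) \<in> Ob V" if "a \<in> pts Z" "b \<in> pts Z" for a b using Z that by (simp add: pre_gph_def)
 show G: "gtuple V Z Xs P Fs \<in> gm V Z P"
  unfolding gtuple_def
  using P pt tuple_hom[OF ob el] by (intro gmI) (auto simp: is_gprod_def)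
 assume r: "r < length Xs"
 show "gph_comp V (gproj V Xs P r) (gtuple V Z Xs P Fs) = Fs ! r"
 proof (rule gm_eqI[OF gph_comp_gm[OF G gproj_gm[OF Xs P r]] Fs(2)[OF r]])
  fix a assume a: "a \<in> pts Z"
  have f: "fn (gtuple V Z Xs P Fs) a = Tup (map (\<lambda>F. fn F a) Fs)" if "a \<in> pts Z" for a
   using that by (simp add: gtuple_def)
  show "fn (gph_comp V (gproj V Xs P r) (gtuple V Z Xs P Fs)) a = fn (Fs ! r) a"
   using a pt r Fs(1) by (simp add: gph_comp_fn[OF G] f gproj_fn)
  fix b assume b: "b \<in> pts Z"
  show "fm (gph_comp V (gproj V Xs P r) (gtuple V Z Xs P Fs)) (a, b) = fm (Fs ! r) (a, b)"
   using Proj_tuple[OF ob[OF a b] el[OF a b], of r] a b r Fs(1) pt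
   by (simp add: gph_comp_fm[OF G] f gproj_fm) (simp add: gtuple_def)
 qed
qed

lemma gprod_eqI:
 assumes Xs: "!!X. X \<in> set Xs ==> pre_gph V X" and P: "is_gprod V Xs P"
  and F: "F \<in> gm V Z P" and G: "G \<in> gm V Z P"
  and e: "!!r. r < length Xs ==> gph_comp V (gproj V Xs P r) F = gph_comp V (gproj V Xs P r) G"
 shows "F = G"
proof -
 have m: "fn F a \<in> prod_pts Xs" "fn G a \<in> prod_pts Xs" if "a \<in> pts Z" for a
  using gm_fn[OF F that] gm_fn[OF G that] P by (simp_all add: is_gprod_def)
 have fe: "fn F a = fn G a" if a: "a \<in> pts Z" for a
 proof (rule prod_pts_eqI[OF m[OF a]])
  fix r assume "r < length Xs"
  from e[OF this] have "fn (gph_comp V (gproj V Xs P r) F) a = fn (gph_comp V (gproj V Xs P r) G) a" by simp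
  then show "untup (fn F a) ! r = untup (fn G a) ! r"
   using m[OF a] a by (simp add: gph_comp_fn[OF F] gph_comp_fn[OF G] gproj_fn)
 qed
 show ?thesis
 proof (rule gm_eqI[OF F G fe])
  fix a b assume a: "a \<in> pts Z" and b: "b \<in> pts Z"
  have h: "hm P (fn F a, fn F b) = Prod V (prod_homs Xs (fn F a) (fn F b))"
   using P m a b by (simp add: is_gprod_def)
  show "fm F (a, b) = fm G (a, b)"
  proof (rule Prod_eqI[OF prod_homs_Ob[OF Xs m(1)[OF a] m(1)[OF b]]])
   show "fm F (a, b) \<in> hom V (hm Z (a, b)) (Prod V (prod_homs Xs (fn F a) (fn F b)))"
    using gm_fm[OF F a b] h by simp
   show "fm G (a, b) \<in> hom V (hm Z (a, b)) (Prod V (prod_homs Xs (fn F a) (fn F b)))"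
    using gm_fm[OF G a b] h fe a b by simp
   fix r assume "r < length (prod_homs Xs (fn F a) (fn F b))"
   then have "r < length Xs" by simp
   from e[OF this] have "fm (gph_comp V (gproj V Xs P r) F) (a, b) = fm (gph_comp V (gproj V Xs P r) G) (a, b)" by simp
   then show "Proj V (prod_homs Xs (fn F a) (fn F b)) r \<cdot> fm F (a, b) = Proj V (prod_homs Xs (fn F a) (fn F b)) r \<cdot> fm G (a, b)"
    using m a b fe by (simp add: gph_comp_fm[OF F] gph_comp_fm[OF G] gproj_fm)
  qed
 qed
qed

text \<open>The effect of a map \<open>M\<close> that commutes with the projections as \<open>prod_map\<close> does.\<close>

lemma gprod_map_props:
 assumes Xs: "!!X. X \<in> set Xs ==> pre_gph V X" and P: "is_gprod V Xs P"
  and Ys: "!!X. X \<in> set Ys ==> pre_gph V X" and Q: "is_gprod V Ys Q"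
  and M: "M \<in> gm V P Q" and len: "length Ys = length Xs" "length Fs = length Xs"
  and F: "!!r. r < length Xs ==> Fs ! r \<in> gm V (Xs ! r) (Ys ! r)"
  and e: "!!r. r < length Xs ==> gph_comp V (gproj V Ys Q r) M = gph_comp V (Fs ! r) (gproj V Xs P r)"
  and p: "p \<in> prod_pts Xs"
 shows "fn M p = Tup (map2 (\<lambda>F x. fn F x) Fs (untup p))"
  and "q \<in> prod_pts Xs ==> fm M (p, q) =
   prod_map V (prod_homs Xs p q) (prod_homs Ys (fn M p) (fn M q)) (map2 (\<lambda>F (x, y). fm F (x, y)) Fs (zip (untup p) (untup q)))"
proof -
 have pP: "p \<in> pts P" if "p \<in> prod_pts Xs" for p using P that by (simp add: is_gprod_def)
 have mQ: "fn M p \<in> prod_pts Ys" if "p \<in> prod_pts Xs" for p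
  using gm_fn[OF M pP[OF that]] Q by (simp add: is_gprod_def)
 have fnr: "untup (fn M p) ! r = fn (Fs ! r) (untup p ! r)" if p: "p \<in> prod_pts Xs" and r: "r < length Xs" for p r
 proof -
  have "fn (gph_comp V (gproj V Ys Q r) M) p = fn (gph_comp V (Fs ! r) (gproj V Xs P r)) p" using e[OF r] by simp
  then show ?thesis
   using p mQ[OF p] pP by (simp add: gph_comp_fn[OF M] gph_comp_fn[OF gproj_gm[OF Xs P r]] gproj_fn)
 qed
 show fnM: "fn M p = Tup (map2 (\<lambda>F x. fn F x) Fs (untup p))"
 proof (rule prod_pts_eqI[OF mQ[OF p]])
  show "Tup (map2 (\<lambda>F x. fn F x) Fs (untup p)) \<in> prod_pts Ys"
   using len prod_ptsD[OF p] gm_fn[OF F] by (simp add: prod_pts_nth)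
  show "untup (fn M p) ! r = untup (Tup (map2 (\<lambda>F x. fn F x) Fs (untup p))) ! r" if "r < length Ys" for r
   using that len prod_ptsD[OF p] fnr[OF p] by simp
 qed
 assume q: "q \<in> prod_pts Xs"
 let ?Fs = "map2 (\<lambda>F (x, y). fm F (x, y)) Fs (zip (untup p) (untup q))"
 have a: "arrs V ?Fs (prod_homs Xs p q) (prod_homs Ys (fn M p) (fn M q))"
  using len prod_ptsD[OF p] prod_ptsD[OF q] gm_fm[OF F] fnr[OF p] fnr[OF q] by (simp add: arrs_def)
 have h: "hm P (p, q) = Prod V (prod_homs Xs p q)" "hm Q (fn M p, fn M q) = Prod V (prod_homs Ys (fn M p) (fn M q))"
  using P Q p q mQ by (simp_all add: is_gprod_def)
 show "fm M (p, q) = prod_map V (prod_homs Xs p q) (prod_homs Ys (fn M p) (fn M q)) ?Fs"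
 proof (rule Prod_eqI[OF prod_homs_Ob[OF Ys mQ[OF p] mQ[OF q]] _ prod_map_hom[OF a]])
  show "fm M (p, q) \<in> hom V (Prod V (prod_homs Xs p q)) (Prod V (prod_homs Ys (fn M p) (fn M q)))"
   using gm_fm[OF M pP[OF p] pP[OF q]] h by simp
  fix r assume "r < length (prod_homs Ys (fn M p) (fn M q))"
  then have r: "r < length Xs" using len by simp
  have "fm (gph_comp V (gproj V Ys Q r) M) (p, q) = fm (gph_comp V (Fs ! r) (gproj V Xs P r)) (p, q)" using e[OF r] by simp
  then have "Proj V (prod_homs Ys (fn M p) (fn M q)) r \<cdot> fm M (p, q) = fm (Fs ! r) (untup p ! r, untup q ! r) \<cdot> Proj V (prod_homs Xs p q) r"
   using p q mQ pP by (simp add: gph_comp_fm[OF M] gph_comp_fm[OF gproj_gm[OF Xs P r]] gproj_fm gproj_fn)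
  then show "Proj V (prod_homs Ys (fn M p) (fn M q)) r \<cdot> fm M (p, q) =
    Proj V (prod_homs Ys (fn M p) (fn M q)) r \<cdot> prod_map V (prod_homs Xs p q) (prod_homs Ys (fn M p) (fn M q)) ?Fs"
   using Proj_prod_map[OF a, of r] r len prod_ptsD(2)[OF p] prod_ptsD(2)[OF q] by simp
 qed
qed

end

section \<open>Initial hom-objects and coproduct cocones of graphs\<close>

definition initial :: "('o, 'm, 'z) cat_scheme => 'o => bool" where
 "initial V Z \<longleftrightarrow> Z \<in> Ob V & (\<forall>Y \<in> Ob V. \<exists>!h. h \<in> hom V Z Y)"

text \<open>Lets preservation of coproducts and distributivity apply to initial objects without
  separate arguments.\<close>

lemma initial_is_coprod: "initial V Z \<longleftrightarrow> is_coprod V {} X Z j"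
 by (auto simp: initial_def is_coprod_def)

text \<open>A cocone \<open>J\<close> which decomposes the points of \<open>P\<close>, induces identities on the hom-objects inside
 one summand, and leaves only initial hom-objects between different summands.\<close>

definition gcocone :: "('a obj, 'a arr, 'z) cat_scheme => 'a cell set => ('a cell => 'a obj) => 'a obj =>
  ('a cell => 'a arr) => bool" where
 "gcocone V I Q P J \<longleftrightarrow>
   (\<forall>i \<in> I. J i \<in> gm V (Q i) P & pre_gph V (Q i)) &
   (\<forall>p \<in> pts P. \<exists>i \<in> I. \<exists>x \<in> pts (Q i). p = fn (J i) x) &
   (\<forall>i \<in> I. \<forall>k \<in> I. \<forall>x \<in> pts (Q i). \<forall>y \<in> pts (Q k).
    (fn (J i) x = fn (J k) y --> i = k & x = y) &
    (i ~= k --> initial V (hm P (fn (J i) x, fn (J k) y)))) &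
   (\<forall>i \<in> I. \<forall>x \<in> pts (Q i). \<forall>y \<in> pts (Q i).
    hm P (fn (J i) x, fn (J i) y) = hm (Q i) (x, y) & fm (J i) (x, y) = Id V (hm (Q i) (x, y)))"

lemma gcoconeD:
 assumes "gcocone V I Q P J" "i \<in> I" "x \<in> pts (Q i)"
 shows "J i \<in> gm V (Q i) P" "pre_gph V (Q i)" "fn (J i) x \<in> pts P"
  "y \<in> pts (Q i) ==> hm P (fn (J i) x, fn (J i) y) = hm (Q i) (x, y)"
  "y \<in> pts (Q i) ==> fm (J i) (x, y) = Id V (hm (Q i) (x, y))"
  "y \<in> pts (Q i) ==> hm (Q i) (x, y) \<in> Ob V"
  "k \<in> I ==> y \<in> pts (Q k) ==> fn (J i) x = fn (J k) y ==> i = k & x = y"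
  "k \<in> I ==> y \<in> pts (Q k) ==> i ~= k ==> initial V (hm P (fn (J i) x, fn (J k) y))"
proof -
 note c = assms(1)[unfolded gcocone_def]
 note c1 = bspec[OF conjunct1[OF c] assms(2)]
  and c3 = bspec[OF conjunct1[OF conjunct2[OF conjunct2[OF c]]] assms(2)]
  and c4 = bspec[OF bspec[OF conjunct2[OF conjunct2[OF conjunct2[OF c]]] assms(2)] assms(3)]
 show J: "J i \<in> gm V (Q i) P" and pre: "pre_gph V (Q i)" using c1 by simp_all
 show "fn (J i) x \<in> pts P" by (rule gm_fn[OF J assms(3)])
 show "hm P (fn (J i) x, fn (J i) y) = hm (Q i) (x, y)" "fm (J i) (x, y) = Id V (hm (Q i) (x, y))"
  "hm (Q i) (x, y) \<in> Ob V" if "y \<in> pts (Q i)"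
  using bspec[OF c4 that] pre assms(3) that by (simp_all add: pre_gph_def)
 assume k: "k \<in> I" "y \<in> pts (Q k)"
 note c3 = bspec[OF bspec[OF bspec[OF c3 k(1)] assms(3)] k(2)]
 show "fn (J i) x = fn (J k) y ==> i = k & x = y"
  "i ~= k ==> initial V (hm P (fn (J i) x, fn (J k) y))"
  using c3 by blast+
qed

lemma gcocone_gm: "gcocone V I Q P J ==> i \<in> I ==> J i \<in> gm V (Q i) P"
 by (simp add: gcocone_def)

lemma gcocone_cases:
 assumes "gcocone V I Q P J" "p \<in> pts P"
 obtains i x where "i \<in> I" "x \<in> pts (Q i)" "p = fn (J i) x"
 using assms unfolding gcocone_def by blast

context obj_category
begin

lemma initial_hom: "initial C Z ==> Y \<in> Ob C ==> (THE h. h \<in> hom C Z Y) \<in> hom C Z Y"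
 by (rule theI') (simp add: initial_def)

lemma initial_eqI: "initial C Z ==> h \<in> hom C Z Y ==> k \<in> hom C Z Y ==> h = k"
 using homA(5) unfolding initial_def by blast

lemma gcocone_pre:
 assumes c: "gcocone C I Q P J" shows "pre_gph C P"
 unfolding pre_gph_def
proof (intro ballI)
 fix p q assume "p \<in> pts P" "q \<in> pts P"
 then obtain i x k y where "i \<in> I" "x \<in> pts (Q i)" "p = fn (J i) x" "k \<in> I" "y \<in> pts (Q k)" "q = fn (J k) y"
  using gcocone_cases[OF c] by metis
 then show "hm P (p, q) \<in> Ob C"
  using gcoconeD(4,6,8)[OF c, of i x] by (cases "i = k") (auto simp: initial_def)
qed

lemma gcocone_eqI:
 assumes c: "gcocone C I Q P J" and F: "F \<in> gm C P Y" and G: "G \<in> gm C P Y"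
  and e: "!!i. i \<in> I ==> gph_comp C F (J i) = gph_comp C G (J i)"
 shows "F = G"
proof -
 have fe: "fn F (fn (J i) x) = fn G (fn (J i) x)" if i: "i \<in> I" and x: "x \<in> pts (Q i)" for i x
 proof -
  have "fn (gph_comp C F (J i)) x = fn (gph_comp C G (J i)) x" using e[OF i] by simp
  then show ?thesis using x by (simp add: gph_comp_fn[OF gcocone_gm[OF c i]])
 qed
 show ?thesis
 proof (rule gm_eqI[OF F G])
  fix p assume p: "p \<in> pts P"
  then show 1: "fn F p = fn G p" using gcocone_cases[OF c p] fe by metis
  obtain i x where i: "i \<in> I" "x \<in> pts (Q i)" "p = fn (J i) x" using gcocone_cases[OF c p] by metis
  fix q assume q: "q \<in> pts P"
  obtain k y where k: "k \<in> I" "y \<in> pts (Q k)" "q = fn (J k) y" using gcocone_cases[OF c q] by metis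
  note h = gm_fm[OF F p q] gm_fm[OF G p q]
  show "fm F (p, q) = fm G (p, q)"
  proof (cases "i = k")
   case True
   note D = gcoconeD[OF c i(1,2)]
   have y: "y \<in> pts (Q i)" and q': "q = fn (J i) y" using k True by simp_all
   have "fm (gph_comp C F (J i)) (x, y) = fm (gph_comp C G (J i)) (x, y)" using e[OF i(1)] by simp
   then have "fm F (p, q) \<cdot> Id C (hm (Q i) (x, y)) = fm G (p, q) \<cdot> Id C (hm (Q i) (x, y))"
    unfolding i(3) q' by (simp add: gph_comp_fm[OF gcocone_gm[OF c i(1)] i(2) y] D(5)[OF y])
   then show ?thesis using homD[OF h(1)] homD[OF h(2)] D(4)[OF y] i(3) q' by simp
  next
   case False
   then have "initial C (hm P (p, q))" using gcoconeD(8)[OF c i(1,2) k(1,2)] i k by simp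
   then show ?thesis using initial_eqI h fe[OF i(1,2)] fe[OF k(1,2)] i k by metis
  qed
 qed
qed

lemma gcocone_ex:
 assumes c: "gcocone C I Q P J" and Y: "pre_gph C Y" and F: "!!i. i \<in> I ==> F i \<in> gm C (Q i) Y"
 obtains H where "H \<in> gm C P Y" "!!i. i \<in> I ==> gph_comp C H (J i) = F i"
proof -
 \<comment> \<open>Every point of \<open>P\<close> lies in exactly one summand; \<open>ix\<close>
   and \<open>pt\<close> pick its index and its preimage. The decomposition of points gives
   existence, and injectivity of the legs makes the choice unique, which is \<open>ip\<close>
   below.\<close>
 define ix where "ix p = (SOME i. i \<in> I & (\<exists>x \<in> pts (Q i). p = fn (J i) x))" for p
 define pt where "pt p = (SOME x. x \<in> pts (Q (ix p)) & p = fn (J (ix p)) x)" for p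
 have ix0: "ix p \<in> I & (\<exists>x \<in> pts (Q (ix p)). p = fn (J (ix p)) x)" if "p \<in> pts P" for p
  unfolding ix_def by (rule someI_ex) (use gcocone_cases[OF c that] in blast)
 have pt0: "pt p \<in> pts (Q (ix p)) & p = fn (J (ix p)) (pt p)" if "p \<in> pts P" for p
  unfolding pt_def by (rule someI_ex) (use ix0[OF that] in blast)
 have ip: "ix (fn (J i) x) = i" "pt (fn (J i) x) = x" if "i \<in> I" "x \<in> pts (Q i)" for i x
  using gcoconeD(7)[OF c that, of "ix (fn (J i) x)" "pt (fn (J i) x)"]
   ix0[OF gcoconeD(3)[OF c that]] pt0[OF gcoconeD(3)[OF c that]] by simp_all
 define f where "f = (\<lambda>p\<in>pts P. fn (F (ix p)) (pt p))"
 \<comment> \<open>Between different summands the hom-object is initial, so the component there is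
   the unique arrow out of it.\<close>
 define \<phi> where "\<phi> = (\<lambda>(p, q)\<in>pts P \<times> pts P. if ix p = ix q then fm (F (ix p)) (pt p, pt q)
   else THE h. h \<in> hom C (hm P (p, q)) (hm Y (f p, f q)))"
 have fm: "f p \<in> pts Y" if "p \<in> pts P" for p
  using that ix0[OF that] pt0[OF that] gm_fn[OF F] by (simp add: f_def)
 have H: "GphAr P Y f \<phi> \<in> gm C P Y"
 proof (rule gmI)
  show "f \<in> pts P \<rightarrow>\<^sub>E pts Y" using fm by (auto simp: f_def)
  show "\<phi> \<in> extensional (pts P \<times> pts P)" by (simp add: \<phi>_def)
  fix p q assume p: "p \<in> pts P" and q: "q \<in> pts P"
  show "\<phi> (p, q) \<in> hom C (hm P (p, q)) (hm Y (f p, f q))"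
  proof (cases "ix p = ix q")
   case True
   then show ?thesis
    using p q ix0[OF p] pt0[OF p] pt0[OF q] gm_fm[OF F, of "ix p" "pt p" "pt q"] gcoconeD(4)[OF c, of "ix p" "pt p" "pt q"]
    by (simp add: \<phi>_def f_def)
  next
   case False
   then have "initial C (hm P (p, q))"
    using p q ix0[OF p] pt0[OF p] ix0[OF q] pt0[OF q] gcoconeD(8)[OF c, of "ix p" "pt p" "ix q" "pt q"] by simp
   then show ?thesis
    using p q False fm Y initial_hom by (simp add: \<phi>_def pre_gph_def)
  qed
 qed
 show ?thesis
 proof (rule that[OF H])
  fix i assume i: "i \<in> I"
  note Ji = gcocone_gm[OF c i]
  show "gph_comp C (GphAr P Y f \<phi>) (J i) = F i"
  proof (rule gm_eqI[OF gph_comp_gm[OF Ji H] F[OF i]])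
   fix x assume x: "x \<in> pts (Q i)"
   note xi = gcoconeD[OF c i x]
   show "fn (gph_comp C (GphAr P Y f \<phi>) (J i)) x = fn (F i) x"
    using x xi(3) ip[OF i x] by (simp add: gph_comp_fn[OF Ji] f_def)
   fix y assume y: "y \<in> pts (Q i)"
   show "fm (gph_comp C (GphAr P Y f \<phi>) (J i)) (x, y) = fm (F i) (x, y)"
    using x y xi(3) gcoconeD(3)[OF c i y] ip[OF i x] ip[OF i y] xi(5)[OF y] homD[OF gm_fm[OF F[OF i] x y]]
    by (simp add: gph_comp_fm[OF Ji] \<phi>_def)
  qed
 qed
qed

end

text \<open>The case of an empty family in distributivity: an initial factor is an empty coproduct,
  hence so is the product.\<close>

lemma (in dcat) initial_Prod:
 assumes "set Xs <= Ob V" "r < length Xs" "initial V (Xs ! r)"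
 shows "initial V (Prod V Xs)"
 using distrib_is_coprod[OF assms(1,2), of "{}" undefined undefined] assms(3)
 unfolding initial_is_coprod[symmetric] .

definition ginj :: "('a obj, 'a arr, 'z) cat_scheme => ('a cell => 'a obj) => 'a obj => 'a cell => 'a arr" where
 "ginj V X P i = GphAr (X i) P (\<lambda>a\<in>pts (X i). Tup [i, a]) (\<lambda>p\<in>pts (X i) \<times> pts (X i). Id V (hm (X i) p))"

text \<open>Only initiality is required of the hom-objects between different summands, so that
  coproducts of graphs and of enriched categories are both instances.\<close>

definition is_gcoprod :: "('a obj, 'a arr, 'z) cat_scheme => 'a cell set => ('a cell => 'a obj) => 'a obj => bool" where
 "is_gcoprod V I X P \<longleftrightarrow> pts P = coprod_pts I X & (\<forall>i \<in> I. \<forall>x \<in> pts (X i).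
   (\<forall>y \<in> pts (X i). hm P (Tup [i, x], Tup [i, y]) = hm (X i) (x, y)) &
   (\<forall>k \<in> I. \<forall>y \<in> pts (X k). i ~= k --> initial V (hm P (Tup [i, x], Tup [k, y]))))"

lemma (in obj_category) gcoprod_gcocone:
 assumes P: "is_gcoprod C I X P" and X: "!!i. i \<in> I ==> pre_gph C (X i)"
 shows "gcocone C I X P (ginj C X P)"
proof -
 have f: "fn (ginj C X P i) x = Tup [i, x]" if "x \<in> pts (X i)" for i x using that by (simp add: ginj_def)
 have "ginj C X P i \<in> gm C (X i) P" if "i \<in> I" for i
  unfolding ginj_def using P X[OF that] that
  by (intro gmI) (auto simp: is_gcoprod_def pre_gph_def intro!: Id_hom)
 then show ?thesis
  using P X unfolding gcocone_def is_gcoprod_def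
  by (auto simp: f elim!: coprod_ptsE) (auto simp: ginj_def f)
qed

subsection \<open>Categories of graphs with structure\<close>

text \<open>What \<open>V\<close>-graphs and \<open>V\<close>-categories have in common. Objects
  have hom-objects in \<open>V\<close>, and \<open>ok\<close> singles out the graph maps that count
  as arrows: all of them for graphs, the enriched functors for categories. Since \<open>ok\<close>
  can be tested on projections and on the legs of a cocone, products and coproducts are computed as
  for graphs, and distributivity is proved once for both.\<close>

locale gphlike = V: dcat V for V :: "('a obj, 'a arr, 'a cell, 'z) vcat_scheme" +
 fixes D :: "('a obj, 'a arr, 'a cell, 'y) vcat_scheme" and ok :: "'a arr => bool"
 assumes pre: "A \<in> Ob D ==> pre_gph V A"
  and Ar: "f \<in> Ar D \<longleftrightarrow> f \<in> gm V (src f) (tgt f) & src f \<in> Ob D & tgt f \<in> Ob D & ok f"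
  and D_sel: "Dom D = src" "Cod D = tgt" "Id D = gph_id V" "Comp D = gph_comp V"
  and ok_Id: "A \<in> Ob D ==> ok (gph_id V A)"
  and ok_Comp: "f \<in> Ar D ==> g \<in> Ar D ==> tgt f = src g ==> ok (gph_comp V g f)"
  and Prod_Ob: "set Xs <= Ob D ==> Prod D Xs \<in> Ob D"
  and Prod_gprod: "set Xs <= Ob D ==> is_gprod V Xs (Prod D Xs)"
  and Proj: "Proj D Xs r = gproj V Xs (Prod D Xs) r"
  and ok_Proj: "set Xs <= Ob D ==> r < length Xs ==> ok (Proj D Xs r)"
  and ok_tuple: "set Xs <= Ob D ==> Z \<in> Ob D ==> f \<in> gm V Z (Prod D Xs) ==>
   (!!r. r < length Xs ==> ok (gph_comp V (Proj D Xs r) f)) ==> ok f"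
  and Coprod_Ob: "(!!i. i \<in> I ==> X i \<in> Ob D) ==> Coprod D I X \<in> Ob D"
  and Coprod_gcoprod: "(!!i. i \<in> I ==> X i \<in> Ob D) ==> is_gcoprod V I X (Coprod D I X)"
  and Inj: "Inj D I X i = ginj V X (Coprod D I X) i"
  and ok_Inj: "(!!i. i \<in> I ==> X i \<in> Ob D) ==> i \<in> I ==> ok (Inj D I X i)"
  and ok_cotuple: "gcocone V I Q P J ==> (!!i. i \<in> I ==> J i \<in> Ar D) ==> P \<in> Ob D ==> Y \<in> Ob D ==>
   h \<in> gm V P Y ==> (!!i. i \<in> I ==> ok (gph_comp V h (J i))) ==> ok h"
  and Coprod_cong: "(!!i. i \<in> I ==> X i = X' i) ==> Coprod D I X = Coprod D I X'"
begin

lemma hom_iff: "f \<in> hom D A B \<longleftrightarrow> f \<in> gm V A B & A \<in> Ob D & B \<in> Ob D & ok f"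
 by (auto simp: hom_def Ar D_sel gm_def)

sublocale obj_category D
proof
 show "Dom D f \<in> Ob D" "Cod D f \<in> Ob D" if "f \<in> Ar D" for f
  using that by (simp_all add: Ar D_sel)
 show "Id D A \<in> hom D A A" if "A \<in> Ob D" for A
  using that by (simp add: hom_iff D_sel V.gph_id_gm pre ok_Id)
 fix f A B assume f: "f \<in> hom D A B"
 show "f \<cdot>\<^bsub>D\<^esub> Id D A = f" "Id D B \<cdot>\<^bsub>D\<^esub> f = f"
  using f V.gph_comp_id[of f A B] V.gph_id_comp[of f A B] pre by (simp_all add: hom_iff D_sel)
 fix g E assume g: "g \<in> hom D B E"
 show "g \<cdot>\<^bsub>D\<^esub> f \<in> hom D A E"
 proof -
  have "ok (gph_comp V g f)" using f g ok_Comp by (simp add: hom_def D_sel)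
  then show ?thesis using f g V.gph_comp_gm[of f A B g E] by (simp add: hom_iff D_sel)
 qed
 fix h H assume "h \<in> hom D E H"
 then show "h \<cdot>\<^bsub>D\<^esub> g \<cdot>\<^bsub>D\<^esub> f = h \<cdot>\<^bsub>D\<^esub> (g \<cdot>\<^bsub>D\<^esub> f)"
  using f g V.gph_comp_assoc[of f A B g E h H] by (simp add: hom_iff D_sel)
qed

lemma pre': "set Xs <= Ob D ==> X \<in> set Xs ==> pre_gph V X"
 using pre by blast

lemma Proj_hom': "set Xs <= Ob D ==> r < length Xs ==> Proj D Xs r \<in> hom D (Prod D Xs) (Xs ! r)"
proof -
 assume Xs: "set Xs <= Ob D" and r: "r < length Xs"
 show ?thesis
  using V.gproj_gm[OF pre'[OF Xs] Prod_gprod[OF Xs] r] ok_Proj[OF Xs r] Prod_Ob[OF Xs] subsetD[OF Xs nth_mem[OF r]]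
  by (simp add: hom_iff Proj)
qed

sublocale obj_fprod D
proof
 fix Xs assume Xs: "set Xs <= Ob D"
 show "Prod D Xs \<in> Ob D" by (rule Prod_Ob[OF Xs])
 show "Proj D Xs r \<in> hom D (Prod D Xs) (Xs ! r)" if "r < length Xs" for r by (rule Proj_hom'[OF Xs that])
 fix h k Z assume "h \<in> hom D Z (Prod D Xs)" "k \<in> hom D Z (Prod D Xs)"
  "!!r. r < length Xs ==> Proj D Xs r \<cdot>\<^bsub>D\<^esub> h = Proj D Xs r \<cdot>\<^bsub>D\<^esub> k"
 then show "h = k"
  using V.gprod_eqI[OF pre'[OF Xs] Prod_gprod[OF Xs], of h Z k] by (simp add: hom_iff D_sel Proj)
next
 fix Z fs Xs assume Z: "Z \<in> Ob D" and fs: "elems D Z fs Xs"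
 have Xs: "set Xs <= Ob D"
  using fs by (force simp: elems_def all2_nth in_set_conv_nth hom_iff)
 have "fs ! r \<in> gm V Z (Xs ! r)" if "r < length Xs" for r
  using elems_nth[OF fs that] by (simp add: hom_iff)
 note G = V.gtuple_props[OF pre'[OF Xs] Prod_gprod[OF Xs] pre[OF Z] elems_length[OF fs] this]
 let ?h = "gtuple V Z Xs (Prod D Xs) fs"
 have "ok (gph_comp V (Proj D Xs r) ?h)" if "r < length Xs" for r
  using G(2)[OF _ _ that] elems_nth[OF fs that] that Xs by (simp add: Proj hom_iff subset_iff)
 then have "?h \<in> hom D Z (Prod D Xs)"
  using G(1) ok_tuple[OF Xs Z G(1)] Z Prod_Ob[OF Xs] Xs by (simp add: hom_iff)
 moreover have "\<forall>r < length Xs. Proj D Xs r \<cdot>\<^bsub>D\<^esub> ?h = fs ! r"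
  using G(2) by (simp add: Proj D_sel)
 ultimately show "\<exists>h\<in>hom D Z (Prod D Xs). \<forall>r<length Xs. Proj D Xs r \<cdot>\<^bsub>D\<^esub> h = fs ! r" by blast
qed

text \<open>The mediating map is built on graphs and \<open>ok_cotuple\<close> makes it an arrow of
  \<open>D\<close>. This serves for the chosen coproducts, for distributivity, and for preservation
  by \<open>star\<close> and by \<open>underlying\<close>.\<close>

lemma gcocone_is_coprod:
 assumes c: "gcocone V I Q P J" and J: "!!i. i \<in> I ==> J i \<in> hom D (Q i) P" and P: "P \<in> Ob D"
 shows "is_coprod D I Q P J"
proof (rule is_coprodI[OF P J])
 fix Y f assume Y: "Y \<in> Ob D" and f: "!!i. i \<in> I ==> f i \<in> hom D (Q i) Y"
 have "!!i. i \<in> I ==> f i \<in> gm V (Q i) Y" using f by (simp add: hom_iff)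
 then obtain h where h: "h \<in> gm V P Y" "!!i. i \<in> I ==> gph_comp V h (J i) = f i"
  using V.gcocone_ex[OF c pre[OF Y]] by metis
 have "ok (gph_comp V h (J i))" if "i \<in> I" for i using h(2)[OF that] f[OF that] by (simp add: hom_iff)
 then have "ok h" using ok_cotuple[OF c homD(1)[OF J] P Y h(1)] by blast
 then show "\<exists>h\<in>hom D P Y. \<forall>i\<in>I. h \<cdot>\<^bsub>D\<^esub> J i = f i"
  using h P Y by (intro bexI[of _ h]) (auto simp: hom_iff D_sel)
next
 fix Y h k assume h: "h \<in> hom D P Y" and k: "k \<in> hom D P Y" and e: "!!i. i \<in> I ==> h \<cdot>\<^bsub>D\<^esub> J i = k \<cdot>\<^bsub>D\<^esub> J i"
 show "h = k" by (rule V.gcocone_eqI[OF c, of h Y k]) (use h k e in \<open>auto simp: hom_iff D_sel\<close>)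
qed

lemma Coprod_gcocone: "(!!i. i \<in> I ==> X i \<in> Ob D) ==> gcocone V I X (Coprod D I X) (Inj D I X)"
 unfolding Inj by (rule V.gcoprod_gcocone[OF Coprod_gcoprod pre]) auto

lemma Inj_hom': "(!!i. i \<in> I ==> X i \<in> Ob D) ==> i \<in> I ==> Inj D I X i \<in> hom D (X i) (Coprod D I X)"
 using gcocone_gm[OF Coprod_gcocone] ok_Inj Coprod_Ob by (simp add: hom_iff)

lemma Inj_fn: "x \<in> pts (X i) ==> fn (Inj D I X i) x = Tup [i, x]"
 and Inj_fm: "x \<in> pts (X i) ==> y \<in> pts (X i) ==> fm (Inj D I X i) (x, y) = Id V (hm (X i) (x, y))"
 by (simp_all add: Inj ginj_def)

lemma Prod_pts: "set Xs <= Ob D ==> pts (Prod D Xs) = prod_pts Xs"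
 and Prod_hm: "set Xs <= Ob D ==> p \<in> prod_pts Xs ==> q \<in> prod_pts Xs ==>
  hm (Prod D Xs) (p, q) = Prod V (prod_homs Xs p q)"
 using Prod_gprod by (simp_all add: is_gprod_def)

lemma prod_map_fn_fm:
 assumes a: "arrs D fs Xs Ys" and p: "p \<in> prod_pts Xs"
 shows "fn (prod_map D Xs Ys fs) p = Tup (map2 (\<lambda>F x. fn F x) fs (untup p))"
  and "q \<in> prod_pts Xs ==> fm (prod_map D Xs Ys fs) (p, q) =
   prod_map V (prod_homs Xs p q) (prod_homs Ys (fn (prod_map D Xs Ys fs) p) (fn (prod_map D Xs Ys fs) q))
    (map2 (\<lambda>F (x, y). fm F (x, y)) fs (zip (untup p) (untup q)))"
proof -
 note Xs = arrs_Ob(1)[OF a] and Ys = arrs_Ob(2)[OF a]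
 have M: "prod_map D Xs Ys fs \<in> gm V (Prod D Xs) (Prod D Ys)" using prod_map_hom[OF a] by (simp add: hom_iff)
 have 1: "fs ! r \<in> gm V (Xs ! r) (Ys ! r)" if "r < length Xs" for r
  using arrs_nth[OF a that] by (simp add: hom_iff)
 have 2: "gph_comp V (gproj V Ys (Prod D Ys) r) (prod_map D Xs Ys fs) = gph_comp V (fs ! r) (gproj V Xs (Prod D Xs) r)"
  if "r < length Xs" for r
  using Proj_prod_map[OF a that] by (simp add: D_sel Proj)
 note * = V.gprod_map_props[OF pre'[OF Xs] Prod_gprod[OF Xs] pre'[OF Ys] Prod_gprod[OF Ys] M
   arrs_length(2)[OF a] arrs_length(1)[OF a] 1 2 p]
 show "fn (prod_map D Xs Ys fs) p = Tup (map2 (\<lambda>F x. fn F x) fs (untup p))" using *(1) by blast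
 show "fm (prod_map D Xs Ys fs) (p, q) =
   prod_map V (prod_homs Xs p q) (prod_homs Ys (fn (prod_map D Xs Ys fs) p) (fn (prod_map D Xs Ys fs) q))
    (map2 (\<lambda>F (x, y). fm F (x, y)) fs (zip (untup p) (untup q)))" if "q \<in> prod_pts Xs" using *(2) that by blast
qed

text \<open>Points of the product are tuples, and the tag at position \<open>r\<close> tells the
  summand. For tuples of different summands the factor \<open>r\<close> of the hom-object is
  initial, and distributivity in \<open>V\<close> makes the whole hom-object initial. Within a
  summand the hom-objects agree factor by factor.\<close>

lemma distrib_gcocone:
 assumes Xs: "set Xs <= Ob D" and r: "r < length Xs" and X: "!!i. i \<in> I ==> X i \<in> Ob D"
  and C: "Xs ! r = Coprod D I X"
 defines "j \<equiv> \<lambda>i. prod_map D (Xs[r := X i]) Xs ((map (Id D) Xs)[r := Inj D I X i])"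
 shows "!!i. i \<in> I ==> j i \<in> hom D (Prod D (Xs[r := X i])) (Prod D Xs)"
  "gcocone V I (\<lambda>i. Prod D (Xs[r := X i])) (Prod D Xs) j"
proof -
 let ?X = "\<lambda>i. Xs[r := X i]" and ?f = "\<lambda>i. (map (Id D) Xs)[r := Inj D I X i]"
 have a: "arrs D (?f i) (?X i) Xs" if i: "i \<in> I" for i
  using Inj_hom'[of I X, OF X i] r Xs C unfolding arrs_def by (auto simp: nth_list_update intro!: Id_hom)
 have oX: "set (?X i) <= Ob D" if "i \<in> I" for i by (rule arrs_Ob(1)[OF a[OF that]])
 show J: "j i \<in> hom D (Prod D (?X i)) (Prod D Xs)" if "i \<in> I" for i
  unfolding j_def by (rule prod_map_hom[OF a[OF that]])
 have fnJ: "fn (j i) p = Tup ((untup p)[r := Tup [i, untup p ! r]])" if i: "i \<in> I" and p: "p \<in> prod_pts (?X i)" for i p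
 proof -
  have "map2 (\<lambda>F x. fn F x) (?f i) (untup p) = (untup p)[r := Tup [i, untup p ! r]]"
  proof (rule nth_equalityI)
   show "length (map2 (\<lambda>F x. fn F x) (?f i) (untup p)) = length ((untup p)[r := Tup [i, untup p ! r]])"
    using prod_ptsD[OF p] by simp
   fix s assume "s < length (map2 (\<lambda>F x. fn F x) (?f i) (untup p))"
   then have s: "s < length Xs" by simp
   then show "map2 (\<lambda>F x. fn F x) (?f i) (untup p) ! s = (untup p)[r := Tup [i, untup p ! r]] ! s"
    using prod_ptsD(1,2)[OF p] prod_ptsD(3)[OF p, of s] r
    by (cases "s = r") (simp_all add: nth_list_update D_sel gph_id_fn Inj_fn)
  qed
  then show ?thesis using prod_map_fn_fm(1)[OF a[OF i] p] by (simp add: j_def)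
 qed
 have mem: "p \<in> prod_pts (?X i) \<longleftrightarrow> p \<in> pts (Prod D (?X i))" if "i \<in> I" for i p
  using Prod_pts[OF oX[OF that]] by simp
 have hms: "prod_homs Xs (fn (j i) p) (fn (j i) q) = prod_homs (?X i) p q"
  if i: "i \<in> I" and p: "p \<in> prod_pts (?X i)" and q: "q \<in> prod_pts (?X i)" for i p q
 proof (rule nth_equalityI)
  fix s assume "s < length (prod_homs Xs (fn (j i) p) (fn (j i) q))"
  then have s: "s < length Xs" by simp
  have "hm (Coprod D I X) (Tup [i, untup p ! r], Tup [i, untup q ! r]) = hm (X i) (untup p ! r, untup q ! r)"
   using Coprod_gcoprod[of I X, OF X] i prod_ptsD(3)[OF p, of r] prod_ptsD(3)[OF q, of r] r
   by (simp add: is_gcoprod_def)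
  then show "prod_homs Xs (fn (j i) p) (fn (j i) q) ! s = prod_homs (?X i) p q ! s"
   using s prod_ptsD(2)[OF p] prod_ptsD(2)[OF q] r C
   by (cases "s = r") (simp_all add: fnJ[OF i p] fnJ[OF i q] nth_list_update)
 qed simp
 show "gcocone V I (\<lambda>i. Prod D (?X i)) (Prod D Xs) j"
  unfolding gcocone_def
 proof (intro conjI ballI impI)
  fix i assume i: "i \<in> I"
  show "j i \<in> gm V (Prod D (?X i)) (Prod D Xs)" using J[OF i] by (simp add: hom_iff)
  show "pre_gph V (Prod D (?X i))" using pre J[OF i] by (simp add: hom_iff)
  {
   fix k p q assume k: "k \<in> I" and "p \<in> pts (Prod D (?X i))" "q \<in> pts (Prod D (?X k))"
   then have p: "p \<in> prod_pts (?X i)" and q: "q \<in> prod_pts (?X k)" using mem i k by simp_all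
   {
    assume e: "fn (j i) p = fn (j k) q"
    have 1: "untup (fn (j i) p) ! s = untup (fn (j k) q) ! s" for s using e by simp
    have 2: "i = k & untup p ! r = untup q ! r"
     using 1[of r] r prod_ptsD(2)[OF p] prod_ptsD(2)[OF q] by (simp add: fnJ[OF i p] fnJ[OF k q])
    have "p = q"
    proof (rule prod_pts_eqI[OF p])
     show "q \<in> prod_pts (?X i)" using q 2 by simp
     show "untup p ! s = untup q ! s" if "s < length (?X i)" for s
      using 1[of s, unfolded fnJ[OF i p] fnJ[OF k q]] 2 that r prod_ptsD(2)[OF p] prod_ptsD(2)[OF q]
      by (cases "s = r") simp_all
    qed
    then show "i = k" "p = q" using 2 by simp_all
   }
   assume ik: "i ~= k"
   have m: "fn (j i) p \<in> prod_pts Xs" "fn (j k) q \<in> prod_pts Xs"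
    using gm_fn[of "j i" V "Prod D (?X i)" "Prod D Xs" p] gm_fn[of "j k" V "Prod D (?X k)" "Prod D Xs" q] J i k p q mem Prod_pts[OF Xs]
    by (simp_all add: hom_iff)
   have "initial V (Prod V (prod_homs Xs (fn (j i) p) (fn (j k) q)))"
   proof (rule V.initial_Prod)
    show "set (prod_homs Xs (fn (j i) p) (fn (j k) q)) <= Ob V" by (rule V.prod_homs_Ob[OF pre'[OF Xs] m])
    show "r < length (prod_homs Xs (fn (j i) p) (fn (j k) q))" using r by simp
    show "initial V (prod_homs Xs (fn (j i) p) (fn (j k) q) ! r)"
     using Coprod_gcoprod[of I X, OF X] i k ik prod_ptsD(2)[OF p] prod_ptsD(2)[OF q] prod_ptsD(3)[OF p, of r] prod_ptsD(3)[OF q, of r] r C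
     by (simp add: fnJ[OF i p] fnJ[OF k q] is_gcoprod_def)
   qed
   then show "initial V (hm (Prod D Xs) (fn (j i) p, fn (j k) q))"
    using Prod_hm[OF Xs m] by simp
  }
  fix p q assume "p \<in> pts (Prod D (?X i))" "q \<in> pts (Prod D (?X i))"
  then have p: "p \<in> prod_pts (?X i)" and q: "q \<in> prod_pts (?X i)" using mem i by simp_all
  have m: "fn (j i) p \<in> prod_pts Xs" "fn (j i) q \<in> prod_pts Xs"
   using gm_fn[of "j i" V "Prod D (?X i)" "Prod D Xs"] J i p q mem Prod_pts[OF Xs]
   by (simp_all add: hom_iff)
  show h: "hm (Prod D Xs) (fn (j i) p, fn (j i) q) = hm (Prod D (?X i)) (p, q)"
   using Prod_hm[OF Xs m] Prod_hm[OF oX[OF i] p q] hms[OF i p q] by simp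
  have "map2 (\<lambda>F (x, y). fm F (x, y)) (?f i) (zip (untup p) (untup q)) = map (Id V) (prod_homs (?X i) p q)"
  proof (rule nth_equalityI)
   show "length (map2 (\<lambda>F (x, y). fm F (x, y)) (?f i) (zip (untup p) (untup q))) = length (map (Id V) (prod_homs (?X i) p q))"
    using prod_ptsD(2)[OF p] prod_ptsD(2)[OF q] by simp
   fix s assume "s < length (map2 (\<lambda>F (x, y). fm F (x, y)) (?f i) (zip (untup p) (untup q)))"
   then have s: "s < length Xs" by simp
   then show "map2 (\<lambda>F (x, y). fm F (x, y)) (?f i) (zip (untup p) (untup q)) ! s = map (Id V) (prod_homs (?X i) p q) ! s"
    using prod_ptsD(2)[OF p] prod_ptsD(2)[OF q] prod_ptsD(3)[OF p, of s] prod_ptsD(3)[OF q, of s] r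
    by (cases "s = r") (simp_all add: nth_list_update D_sel gph_id_fm Inj_fm)
  qed
  then show "fm (j i) (p, q) = Id V (hm (Prod D (?X i)) (p, q))"
   using prod_map_fn_fm(2)[OF a[OF i] p q] hms[OF i p q] V.prod_map_Id[OF V.prod_homs_Ob[OF pre'[OF oX[OF i]] p q]] Prod_hm[OF oX[OF i] p q]
   by (simp add: j_def)
 next
  fix p assume "p \<in> pts (Prod D Xs)"
  then have p: "p \<in> prod_pts Xs" using Prod_pts[OF Xs] by simp
  have "untup p ! r \<in> coprod_pts I X"
   using prod_ptsD(3)[OF p r] C Coprod_gcoprod[of I X, OF X] by (simp add: is_gcoprod_def)
  then obtain i x where ix: "untup p ! r = Tup [i, x]" "i \<in> I" "x \<in> pts (X i)" by (auto elim: coprod_ptsE)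
  define q where "q = Tup ((untup p)[r := x])"
  have q: "q \<in> prod_pts (?X i)"
   using prod_ptsD[OF p] ix r by (auto simp: prod_pts_nth nth_list_update q_def)
  have "(untup p)[r := Tup [i, x]] = untup p" using ix(1) by (metis list_update_id)
  then have "fn (j i) q = p"
   using r prod_ptsD(1,2)[OF p] unfolding fnJ[OF ix(2) q] by (simp add: q_def)
  then show "\<exists>i\<in>I. \<exists>x\<in>pts (Prod D (?X i)). p = fn (j i) x"
   using ix q mem by blast
 qed
qed

sublocale dcat D
proof
 fix I :: "'a cell set" and X :: "'a cell => 'a obj"
 show "is_coprod D I X (Coprod D I X) (Inj D I X)" if "!!i. i \<in> I ==> X i \<in> Ob D"
  by (rule gcocone_is_coprod[OF Coprod_gcocone Inj_hom' Coprod_Ob]) (use that in auto)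
 fix Y assume e: "!!i. i \<in> I ==> X i = Y i"
 show "Coprod D I X = Coprod D I Y" by (rule Coprod_cong[OF e])
 show "Inj D I X i = Inj D I Y i" if "i \<in> I" for i
  using Coprod_cong[of I X Y, OF e] e[OF that] by (simp add: Inj ginj_def)
next
 fix Xs :: "'a obj list" and r and I :: "'a cell set" and X
 assume Xs: "set Xs <= Ob D" and r: "r < length Xs" and X: "!!i. i \<in> I ==> X i \<in> Ob D"
  and C: "Xs ! r = Coprod D I X"
 note * = distrib_gcocone[OF Xs r X C]
 show "is_coprod D I (\<lambda>i. Prod D (Xs[r := X i])) (Prod D Xs)
    (\<lambda>i. prod_map D (Xs[r := X i]) Xs ((map (Id D) Xs)[r := Inj D I X i]))"
  by (rule gcocone_is_coprod[OF *(2,1) Prod_Ob[OF Xs]]) auto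
qed

end

subsection \<open>The category of graphs\<close>

lemma VGph_sel [simp]:
 "Ob (VGph V) = {A. is_gph V A}" "Dom (VGph V) = src" "Cod (VGph V) = tgt"
 "Id (VGph V) = gph_id V" "Comp (VGph V) = gph_comp V" "Prod (VGph V) = gph_prod V"
 "Coprod (VGph V) = gph_coprod V"
 by (simp_all add: VGph_def)

lemma is_gphD:
 assumes "is_gph V A"
 shows "A = GphOb (pts A) (hm A)" "hm A \<in> extensional (pts A \<times> pts A)"
  "a \<in> pts A ==> b \<in> pts A ==> hm A (a, b) \<in> Ob V"
 using assms by (auto simp: is_gph_def PiE_iff)

lemma is_gphI:
 "\<phi> \<in> extensional (X \<times> X) ==> (!!a b. a \<in> X ==> b \<in> X ==> \<phi> (a, b) \<in> Ob V) ==> is_gph V (GphOb X \<phi>)"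
 by (auto simp: is_gph_def PiE_def)

lemma (in dcat) initial_Coprod: "initial V (Coprod V {} X)"
 using Coprod_is[of "{}" X] unfolding initial_is_coprod[symmetric] by simp

lemma VGph_gphlike:
 assumes "dcat V" shows "gphlike V (VGph V) (\<lambda>_. True)"
proof -
 interpret dcat V by (rule assms)
 have pre: "pre_gph V A" if "is_gph V A" for A using is_gphD(3)[OF that] by (simp add: pre_gph_def)
 have pre': "pre_gph V X" if "set Xs <= Ob (VGph V)" "X \<in> set Xs" for X Xs using that pre by auto
 show ?thesis
 proof unfold_locales
  fix A assume "A \<in> Ob (VGph V)" then show "pre_gph V A" using pre by simp
 next
  fix f show "f \<in> Ar (VGph V) \<longleftrightarrow> f \<in> gm V (src f) (tgt f) & src f \<in> Ob (VGph V) & tgt f \<in> Ob (VGph V) & True"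
   by (auto simp: VGph_def gm_def)
 next
  fix Xs assume Xs: "set Xs <= Ob (VGph V)"
  then show "Prod (VGph V) Xs \<in> Ob (VGph V)"
   unfolding VGph_sel gph_prod_def using Prod_Ob[OF prod_homs_Ob[OF pre'[OF Xs]]]
   by (intro CollectI is_gphI) auto
  show "is_gprod V Xs (Prod (VGph V) Xs)"
   unfolding VGph_sel gph_prod_def is_gprod_def by simp
 next
  fix Xs r show "Proj (VGph V) Xs r = gproj V Xs (Prod (VGph V) Xs) r"
   by (simp add: VGph_def gproj_def)
 next
  fix I :: "'a cell set" and X assume X: "!!i. i \<in> I ==> X i \<in> Ob (VGph V)"
  have i: "Coprod V {} (\<lambda>_. undefined) \<in> Ob V" using initial_Coprod by (simp add: initial_def)
  show "Coprod (VGph V) I X \<in> Ob (VGph V)"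
   unfolding VGph_sel gph_coprod_def
   using X is_gphD(3)[of V "X _"] i by (intro CollectI is_gphI) (auto elim!: coprod_ptsE)
  show "is_gcoprod V I X (Coprod (VGph V) I X)"
   unfolding VGph_sel gph_coprod_def is_gcoprod_def using initial_Coprod by simp
 next
  fix I :: "'a cell set" and X i
  show "Inj (VGph V) I X i = ginj V X (Coprod (VGph V) I X) i"
   by (simp add: VGph_def ginj_def)
 next
  fix I :: "'a cell set" and X X' assume e: "!!i. i \<in> I ==> X i = (X' :: 'a cell => 'a obj) i"
  have "coprod_pts I X = coprod_pts I X'" by (rule coprod_pts_cong[OF e])
  then show "Coprod (VGph V) I X = Coprod (VGph V) I X'"
   using e by (auto simp: gph_coprod_def intro!: restrict_ext elim!: coprod_ptsE)
 qed simp_all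
qed

lemma VGph_dcat:
 assumes "dcat V" shows "dcat (VGph V)"
proof -
 interpret gphlike V "VGph V" "\<lambda>_. True" by (rule VGph_gphlike[OF assms])
 show ?thesis by (rule dcat_axioms)
qed

lemma VGph_hom: "f \<in> hom (VGph V) A B \<longleftrightarrow> f \<in> gm V A B & is_gph V A & is_gph V B"
 by (auto simp: hom_def gm_def VGph_def)

subsection \<open>The 2-functor \<open>V \<mapsto> V-Gph\<close>\<close>

lemma star_ob: "fob (star F) A = GphOb (pts A) (\<lambda>p\<in>pts A \<times> pts A. fob F (hm A p))"
 by (simp add: star_def)

lemma star_ob_sel [simp]: "pts (fob (star F) A) = pts A"
 "a \<in> pts A ==> b \<in> pts A ==> hm (fob (star F) A) (a, b) = fob F (hm A (a, b))"
 by (simp_all add: star_ob)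

lemma star_ar: "far (star F) f = GphAr (fob (star F) (src f)) (fob (star F) (tgt f)) (fn f)
  (\<lambda>p\<in>pts (src f) \<times> pts (src f). far F (fm f p))"
 by (simp add: star_def)

lemma star_ar_sel [simp]: "fn (far (star F) f) = fn f"
 "src (far (star F) f) = fob (star F) (src f)" "tgt (far (star F) f) = fob (star F) (tgt f)"
 "a \<in> pts (src f) ==> b \<in> pts (src f) ==> fm (far (star F) f) (a, b) = far F (fm f (a, b))"
 by (simp_all add: star_ar)

lemma star_comp_ob: "fob (star G) (fob (star F) A) = fob (star (G \<odot> F)) A"
 by (simp add: star_ob cong: restrict_cong)

lemma star_comp: "star (G \<odot> F) = star G \<odot> star F"
 by (rule fctr_eqI) (simp_all add: star_ar star_comp_ob cong: restrict_cong)

lemma star_id_ob: "is_gph V A ==> fob (star id_fctr) A = A"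
proof -
 assume A: "is_gph V A"
 have "fob (star id_fctr) A = GphOb (pts A) (restrict (hm A) (pts A \<times> pts A))" by (simp add: star_ob)
 then show ?thesis using is_gphD(1)[OF A] extensional_restrict[OF is_gphD(2)[OF A]] by simp
qed

lemma star_id: "fctr_eq (VGph V) (star id_fctr) id_fctr"
proof -
 have "far (star id_fctr) f = f" if "f \<in> gm V A B" "is_gph V A" "is_gph V B" for f A B
 proof -
  have "far (star id_fctr) f = GphAr A B (fn f) (restrict (fm f) (pts A \<times> pts A))"
   by (simp add: star_ar gmD(4,5)[OF that(1)] star_id_ob[OF that(2)] star_id_ob[OF that(3)])
  then show ?thesis using gmD(1)[OF that(1)] extensional_restrict[OF gmD(3)[OF that(1)]] by simp
 qed
 then show ?thesis
  by (auto simp: fctr_eq_def star_id_ob) (auto simp: VGph_def gm_def)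
qed

text \<open>With the next two rules every composite of whiskered starred transformations becomes a
  single \<open>star_trans\<close>; an equation between such composites then reduces to the same
  equation between components at hom-objects.\<close>

lemma star_trans_comp:
 "gph_comp V (star_trans G' H \<beta> A) (star_trans F G \<alpha> A) = star_trans F H (\<lambda>X. \<beta> X \<cdot>\<^bsub>V\<^esub> \<alpha> X) A"
 by (auto simp: star_trans_def gph_comp_def cong: restrict_cong)

lemma star_trans_far:
 "far (star H) (star_trans F G \<alpha> A) = star_trans (H \<odot> F) (H \<odot> G) (\<lambda>X. far H (\<alpha> X)) A"
 by (simp add: star_trans_def star_ar star_comp_ob cong: restrict_cong)

lemma star_trans_fob:
 "star_trans F G \<alpha> (fob (star K) A) = star_trans (F \<odot> K) (G \<odot> K) (\<lambda>X. \<alpha> (fob K X)) A"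
 by (auto simp: star_trans_def star_comp_ob intro!: restrict_ext)

lemma star_trans_Id: "star_trans F G (\<lambda>X. Id V (fob F X)) A = gph_id V (fob (star F) A)" if "fob (star G) A = fob (star F) A"
 using that by (auto simp: star_trans_def gph_id_def intro!: restrict_ext)

lemma star_trans_cong:
 assumes "pre_gph V A" "!!X. X \<in> Ob V ==> \<alpha> X = \<beta> X" "fob (star F) A = fob (star F') A" "fob (star G) A = fob (star G') A"
 shows "star_trans F G \<alpha> A = star_trans F' G' \<beta> A"
 using assms by (auto simp: star_trans_def pre_gph_def intro!: restrict_ext)

lemma star_trans_sel [simp]:
 "a \<in> pts A ==> fn (star_trans F G \<alpha> A) a = a"
 "a \<in> pts A ==> b \<in> pts A ==> fm (star_trans F G \<alpha> A) (a, b) = \<alpha> (hm A (a, b))"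
 "src (star_trans F G \<alpha> A) = fob (star F) A" "tgt (star_trans F G \<alpha> A) = fob (star G) A"
 by (simp_all add: star_trans_def)

lemma star_is_gph:
 assumes "cat_functor V W F" "is_gph V A"
 shows "is_gph W (fob (star F) A)"
 unfolding star_ob using cat_functor.fob_Ob[OF assms(1)] is_gphD(3)[OF assms(2)]
 by (intro is_gphI) auto

lemma star_gm:
 assumes F: "cat_functor V W F" and f: "f \<in> gm V A B"
 shows "far (star F) f \<in> gm W (fob (star F) A) (fob (star F) B)"
 unfolding star_ar gmD(4,5)[OF f]
 using gmD(2)[OF f] gm_fn[OF f] cat_functor.far_hom[OF F gm_fm[OF f]]
 by (intro gmI) simp_all

lemma star_trans_gm:
 assumes "nat_trans V W F G \<alpha>" "pre_gph V A"
 shows "star_trans F G \<alpha> A \<in> gm W (fob (star F) A) (fob (star G) A)"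
 unfolding star_trans_def using assms(2) nat_trans.component[OF assms(1)]
 by (intro gmI) (auto simp: pre_gph_def)

lemma is_gph_pre: "is_gph V A ==> pre_gph V A"
 using is_gphD(3) by (auto simp: pre_gph_def)

locale two_dcats = V: dcat V + W: dcat W for V :: "('a obj, 'a arr, 'a cell, 'z) vcat_scheme"
  and W :: "('a obj, 'a arr, 'a cell, 'y) vcat_scheme"
begin

lemma star_functor:
 assumes F: "cat_functor V W F"
 shows "cat_functor (VGph V) (VGph W) (star F)"
proof -
 interpret F: cat_functor V W F by (rule F)
 interpret VG: dcat "VGph V" by (rule VGph_dcat[OF V.dcat_axioms])
 interpret WG: dcat "VGph W" by (rule VGph_dcat[OF W.dcat_axioms])
 show ?thesis
 proof
  fix A assume "A \<in> Ob (VGph V)"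
  then show "fob (star F) A \<in> Ob (VGph W)" using star_is_gph[OF F] by simp
  show "far (star F) (Id (VGph V) A) = Id (VGph W) (fob (star F) A)"
   using \<open>A \<in> Ob (VGph V)\<close> is_gphD(3) by (force simp: star_ar gph_id_def F.far_Id intro!: restrict_ext)
 next
  fix f A B assume f: "f \<in> hom (VGph V) A B"
  show "far (star F) f \<in> hom (VGph W) (fob (star F) A) (fob (star F) B)"
   using f star_gm[OF F] star_is_gph[OF F] by (auto simp: VGph_hom)
  fix g E assume g: "g \<in> hom (VGph V) B E"
  have f': "f \<in> gm V A B" and g': "g \<in> gm V B E" using f g by (simp_all add: VGph_hom)
  have "gph_comp V g f \<in> gm V A E" by (rule V.gph_comp_gm[OF f' g'])
  from star_gm[OF F this] show "far (star F) (g \<cdot>\<^bsub>VGph V\<^esub> f) = far (star F) g \<cdot>\<^bsub>VGph W\<^esub> far (star F) f"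
   unfolding VGph_sel
  proof (rule gm_eqI[OF _ W.gph_comp_gm[OF star_gm[OF F f'] star_gm[OF F g']]])
   fix a assume a: "a \<in> pts (fob (star F) A)"
   show "fn (far (star F) (gph_comp V g f)) a = fn (gph_comp W (far (star F) g) (far (star F) f)) a"
    using a by (simp add: gph_comp_fn[OF f'] gph_comp_fn[OF star_gm[OF F f']])
   fix b assume b: "b \<in> pts (fob (star F) A)"
   show "fm (far (star F) (gph_comp V g f)) (a, b) = fm (gph_comp W (far (star F) g) (far (star F) f)) (a, b)"
    using a b gm_fn[OF f'] gmD(4)[OF f'] gmD(4)[OF g'] F.far_Comp[OF gm_fm[OF f'] gm_fm[OF g']]
    by (simp add: gph_comp_fm[OF f'] gph_comp_fm[OF star_gm[OF F f']])
  qed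
 qed
qed

lemma star_nat_trans:
 assumes "nat_trans V W F G \<alpha>"
 shows "nat_trans (VGph V) (VGph W) (star F) (star G) (star_trans F G \<alpha>)"
proof -
 interpret nat_trans V W F G \<alpha> by (rule assms)
 note F = F.cat_functor_axioms and G = G.cat_functor_axioms
 show ?thesis
 proof (rule nat_transI[OF star_functor[OF F] star_functor[OF G]])
  fix A assume "A \<in> Ob (VGph V)"
  then show "star_trans F G \<alpha> A \<in> hom (VGph W) (fob (star F) A) (fob (star G) A)"
   using star_trans_gm[OF assms is_gph_pre] star_is_gph[OF F] star_is_gph[OF G] by (simp add: VGph_hom)
 next
  fix f A B assume "f \<in> hom (VGph V) A B"
  then have f: "f \<in> gm V A B" and A: "pre_gph V A" and B: "pre_gph V B" by (simp_all add: VGph_hom is_gph_pre)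
  show "star_trans F G \<alpha> B \<cdot>\<^bsub>VGph W\<^esub> far (star F) f = far (star G) f \<cdot>\<^bsub>VGph W\<^esub> star_trans F G \<alpha> A"
   unfolding VGph_sel
  proof (rule gm_eqI[OF W.gph_comp_gm[OF star_gm[OF F f] star_trans_gm[OF assms B]] W.gph_comp_gm[OF star_trans_gm[OF assms A] star_gm[OF G f]]])
   fix a assume a: "a \<in> pts (fob (star F) A)"
   show "fn (gph_comp W (star_trans F G \<alpha> B) (far (star F) f)) a = fn (gph_comp W (far (star G) f) (star_trans F G \<alpha> A)) a"
    using a gm_fn[OF f] by (simp add: gph_comp_fn[OF star_gm[OF F f]] gph_comp_fn[OF star_trans_gm[OF assms A]])
   fix b assume b: "b \<in> pts (fob (star F) A)"
   show "fm (gph_comp W (star_trans F G \<alpha> B) (far (star F) f)) (a, b) = fm (gph_comp W (far (star G) f) (star_trans F G \<alpha> A)) (a, b)"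
    using a b gm_fn[OF f] gmD(4)[OF f] natural[OF gm_fm[OF f]]
    by (simp add: gph_comp_fm[OF star_gm[OF F f]] gph_comp_fm[OF star_trans_gm[OF assms A]])
  qed
 qed
qed

text \<open>\<open>star T\<close> leaves points alone and applies \<open>T\<close> to hom-objects,
  so the only delicate condition is initiality between different summands, which \<open>T\<close>
  preserves because initial objects are empty coproducts.\<close>

lemma gcocone_star:
 assumes T: "cocont V W T" and c: "gcocone V I Q P J"
 shows "gcocone W I (\<lambda>i. fob (star T) (Q i)) (fob (star T) P) (\<lambda>i. far (star T) (J i))"
proof -
 interpret T: cat_functor V W T by (rule cocont_functor[OF T])
 have ini: "initial W (fob T Z)" if "initial V Z" for Z
  using cocont_is_coprod[OF T, of "{}" undefined Z undefined] that unfolding initial_is_coprod[symmetric] .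
 show ?thesis
  unfolding gcocone_def
 proof (intro conjI ballI impI)
  fix i assume i: "i \<in> I"
  note J = gcocone_gm[OF c i]
  have s: "src (J i) = Q i" by (rule gmD(4)[OF J])
  show "far (star T) (J i) \<in> gm W (fob (star T) (Q i)) (fob (star T) P)"
   by (rule star_gm[OF T.cat_functor_axioms J])
  show "pre_gph W (fob (star T) (Q i))"
   using gcoconeD(6)[OF c i] T.fob_Ob by (simp add: pre_gph_def)
  {
   fix k x y assume k: "k \<in> I" and "x \<in> pts (fob (star T) (Q i))" "y \<in> pts (fob (star T) (Q k))"
   then have x: "x \<in> pts (Q i)" and y: "y \<in> pts (Q k)" by simp_all
   note D = gcoconeD[OF c i x]
   show "fn (far (star T) (J i)) x = fn (far (star T) (J k)) y ==> i = k"
    "fn (far (star T) (J i)) x = fn (far (star T) (J k)) y ==> x = y"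
    using D(7)[OF k y] by simp_all
   show "i ~= k ==> initial W (hm (fob (star T) P) (fn (far (star T) (J i)) x, fn (far (star T) (J k)) y))"
    using D(8)[OF k y] ini D(3) gcoconeD(3)[OF c k y] by simp
  }
  fix x y assume "x \<in> pts (fob (star T) (Q i))" "y \<in> pts (fob (star T) (Q i))"
  then have x: "x \<in> pts (Q i)" and y: "y \<in> pts (Q i)" by simp_all
  note D = gcoconeD[OF c i x]
  show "hm (fob (star T) P) (fn (far (star T) (J i)) x, fn (far (star T) (J i)) y) = hm (fob (star T) (Q i)) (x, y)"
   using D(3) D(4)[OF y] gcoconeD(3)[OF c i y] x y by simp
  show "fm (far (star T) (J i)) (x, y) = Id W (hm (fob (star T) (Q i)) (x, y))"
   using D(5,6)[OF y] x y s T.far_Id by simp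
 next
  fix p assume "p \<in> pts (fob (star T) P)"
  then have "p \<in> pts P" by simp
  then show "\<exists>i\<in>I. \<exists>x\<in>pts (fob (star T) (Q i)). p = fn (far (star T) (J i)) x"
   by (rule gcocone_cases[OF c]) auto
 qed
qed

lemma star_cocont:
 assumes T: "cocont V W T"
 shows "cocont (VGph V) (VGph W) (star T)"
proof (rule cocontI)
 interpret VG: gphlike V "VGph V" "\<lambda>_. True" by (rule VGph_gphlike[OF V.dcat_axioms])
 interpret WG: gphlike W "VGph W" "\<lambda>_. True" by (rule VGph_gphlike[OF W.dcat_axioms])
 show F: "cat_functor (VGph V) (VGph W) (star T)" by (rule star_functor[OF cocont_functor[OF T]])
 interpret F: cat_functor "VGph V" "VGph W" "star T" by (rule F)
 fix I :: "'a cell set" and X assume X: "!!i. i \<in> I ==> X i \<in> Ob (VGph V)"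
 have c: "is_coprod (VGph V) I X (Coprod (VGph V) I X) (Inj (VGph V) I X)" by (rule VG.Coprod_is[OF X])
 have "is_coprod (VGph W) I (\<lambda>i. fob (star T) (X i)) (fob (star T) (Coprod (VGph V) I X)) (\<lambda>i. far (star T) (Inj (VGph V) I X i))"
  by (rule WG.gcocone_is_coprod[OF gcocone_star[OF T VG.Coprod_gcocone[OF X]] F.far_hom[OF VG.Inj_hom'[OF X]] F.fob_Ob[OF VG.Coprod_Ob[OF X]]])
 then show "\<exists>P j. is_coprod (VGph V) I X P j &
   is_coprod (VGph W) I (\<lambda>i. fob (star T) (X i)) (fob (star T) P) (\<lambda>i. far (star T) (j i))"
  using c by blast
qed

text \<open>A 2-functor preserves adjunctions. The identity functor has to be corrected along
  \<open>star_id\<close>, since \<open>star id_fctr\<close> is the identity on graphs only.\<close>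

lemma star_adjunction:
 assumes "adjunction V W F U \<eta> \<epsilon>"
 shows "adjunction (VGph V) (VGph W) (star F) (star U) (star_trans id_fctr (U \<odot> F) \<eta>) (star_trans (F \<odot> U) id_fctr \<epsilon>)"
proof -
 interpret adjunction V W F U \<eta> \<epsilon> by (rule assms)
 interpret VV: two_dcats V V by unfold_locales
 interpret WW: two_dcats W W by unfold_locales
 interpret WV: two_dcats W V by unfold_locales
 have fu: "fctr_eq (VGph C) (star (K \<odot> L)) (star K \<odot> star L)" for K L :: "'a endo" and C :: "('a obj, 'a arr, 'a cell, 'x) vcat_scheme"
  by (simp add: star_comp)
 show ?thesis
 proof (intro adjunction.intro adjunction_axioms.intro)
  show "nat_trans (VGph V) (VGph V) id_fctr (star U \<odot> star F) (star_trans id_fctr (U \<odot> F) \<eta>)"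
   by (rule nat_trans_cong[OF VV.star_nat_trans[OF unit.nat_trans_axioms] star_id]) (simp_all add: star_comp)
  show "nat_trans (VGph W) (VGph W) (star F \<odot> star U) id_fctr (star_trans (F \<odot> U) id_fctr \<epsilon>)"
   by (rule nat_trans_cong[OF WW.star_nat_trans[OF counit.nat_trans_axioms] _ star_id]) (simp_all add: star_comp)
  show "cat_functor (VGph V) (VGph W) (star F)" by (rule star_functor[OF F.cat_functor_axioms])
  show "cat_functor (VGph W) (VGph V) (star U)" by (rule WV.star_functor[OF U.cat_functor_axioms])
 qed (unfold VGph_sel star_trans_fob star_trans_far star_trans_comp mem_Collect_eq,
   (subst star_trans_cong[OF is_gph_pre triangle_left refl refl]; simp add: star_trans_Id),
   (subst star_trans_cong[OF is_gph_pre triangle_right refl refl]; simp add: star_trans_Id))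
qed

end

context dcat
begin

lemma two_dcats: "two_dcats V V"
 by unfold_locales

lemma star_monad:
 assumes "monad V T"
 shows "monad (VGph V) (star_monad T)"
proof -
 interpret monad V T by (rule assms)
 interpret two_dcats V V by (rule two_dcats)
 show ?thesis
  unfolding star_monad_def
 proof (intro monad.intro monad_axioms.intro, unfold monad.simps VGph_sel star_trans_fob star_trans_far star_trans_comp mem_Collect_eq, goal_cases)
  case 1
  show ?case by (rule nat_trans_cong[OF star_nat_trans[OF unit.nat_trans_axioms] star_id]) simp_all
 next
  case 2
  show ?case unfolding star_comp[symmetric] by (rule star_nat_trans[OF mult.nat_trans_axioms])
 next
  case (3 A)
  show ?case by (subst star_trans_cong[OF is_gph_pre[OF 3] unit_left refl refl]) (simp_all add: star_trans_Id)
 next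
  case (4 A)
  show ?case by (subst star_trans_cong[OF is_gph_pre[OF 4] unit_right refl refl]) (simp_all add: star_trans_Id)
 next
  case (5 A)
  show ?case by (rule star_trans_cong[OF is_gph_pre[OF 5] assoc]) (simp_all add: comp_fctr_assoc)
 qed
qed

lemma star_distributive_law:
 assumes "distributive_law V S T l"
 shows "distributive_law (VGph V) (star_monad S) (star_monad T) (star_trans (Fun S \<odot> Fun T) (Fun T \<odot> Fun S) l)"
proof -
 interpret distributive_law V S T l by (rule assms)
 interpret two_dcats V V by (rule two_dcats)
 note m = star_monad[OF S.monad_axioms] star_monad[OF T.monad_axioms]
 show ?thesis
 proof (intro distributive_law.intro distributive_law_axioms.intro m, unfold star_monad_def monad.simps VGph_sel star_trans_fob star_trans_far star_trans_comp mem_Collect_eq, goal_cases)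
  case 1
  show ?case unfolding star_comp[symmetric] by (rule star_nat_trans[OF nat_trans_axioms])
 next
  case (2 A)
  show ?case by (rule star_trans_cong[OF is_gph_pre[OF 2] unit_S]) (simp_all add: comp_fctr_assoc)
 next
  case (3 A)
  show ?case by (rule star_trans_cong[OF is_gph_pre[OF 3] mult_S]) (simp_all add: comp_fctr_assoc)
 next
  case (4 A)
  show ?case by (rule star_trans_cong[OF is_gph_pre[OF 4] unit_T]) (simp_all add: comp_fctr_assoc)
 next
  case (5 A)
  show ?case by (rule star_trans_cong[OF is_gph_pre[OF 5] mult_T]) (simp_all add: comp_fctr_assoc)
 qed
qed

end

section \<open>Enriched categories\<close>

text \<open>Composition and identities of an enriched category on generalized elements with domain \<open>Z\<close>.\<close>

definition mul :: "('a obj, 'a arr, 'z) pcat_scheme => 'a obj => 'a obj => 'a cell => 'a cell => 'a cell =>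
  'a arr => 'a arr => 'a arr" where
 "mul V X Z x y z u v = cmp X (x, y, z) \<cdot>\<^bsub>V\<^esub> tuple V Z [hm X (y, z), hm X (x, y)] [u, v]"

definition unt :: "('a obj, 'a arr, 'z) pcat_scheme => 'a obj => 'a obj => 'a cell => 'a arr" where
 "unt V X Z x = idt X x \<cdot>\<^bsub>V\<^esub> tuple V Z [] []"

text \<open>The typing part of \<open>is_vcategory\<close>, without associativity and unit laws. It
  suffices for computing with \<open>mul\<close> and \<open>unt\<close>, and so for setting up a
  candidate before its laws are known.\<close>

definition is_precat :: "('a obj, 'a arr, 'z) pcat_scheme => 'a obj => bool" where
 "is_precat V X \<longleftrightarrow> X = CatOb (pts X) (hm X) (cmp X) (idt X) &
   hm X \<in> extensional (pts X \<times> pts X) & cmp X \<in> extensional (pts X \<times> pts X \<times> pts X) &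
   idt X \<in> extensional (pts X) & pre_gph V X &
   (\<forall>x \<in> pts X. \<forall>y \<in> pts X. \<forall>z \<in> pts X.
    cmp X (x, y, z) \<in> hom V (Prod V [hm X (y, z), hm X (x, y)]) (hm X (x, z))) &
   (\<forall>x \<in> pts X. idt X x \<in> hom V (Prod V []) (hm X (x, x)))"

lemma is_vcategory_iff:
 "is_vcategory V X \<longleftrightarrow> is_precat V X &
   (\<forall>w \<in> pts X. \<forall>x \<in> pts X. \<forall>y \<in> pts X. \<forall>z \<in> pts X.
    let Hs = [hm X (y, z), hm X (x, y), hm X (w, x)]; P = Prod V Hs in
    mul V X P w x z (mul V X P x y z (Proj V Hs 0) (Proj V Hs 1)) (Proj V Hs 2) =
    mul V X P w y z (Proj V Hs 0) (mul V X P w x y (Proj V Hs 1) (Proj V Hs 2))) &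
   (\<forall>x \<in> pts X. \<forall>y \<in> pts X.
    let H = hm X (x, y) in
    mul V X H x y y (unt V X H y) (Id V H) = Id V H & mul V X H x x y (Id V H) (unt V X H x) = Id V H)"
 (is "_ \<longleftrightarrow> ?R")
proof
 assume "is_vcategory V X"
 then obtain A h c e where X: "X = CatOb A h c e" and *: "h \<in> A \<times> A \<rightarrow>\<^sub>E Ob V"
   "c \<in> (\<Pi>\<^sub>E (x, y, z)\<in>A \<times> A \<times> A. hom V (Prod V [h (y, z), h (x, y)]) (h (x, z)))"
   "e \<in> (\<Pi>\<^sub>E x\<in>A. hom V (Prod V []) (h (x, x)))"
   and l: "(\<forall>w\<in>A. \<forall>x\<in>A. \<forall>y\<in>A. \<forall>z\<in>A.
    let Hs = [h (y, z), h (x, y), h (w, x)]; P = Prod V Hs in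
    c (w, x, z) \<cdot>\<^bsub>V\<^esub> tuple V P [h (x, z), h (w, x)]
     [c (x, y, z) \<cdot>\<^bsub>V\<^esub> tuple V P [h (y, z), h (x, y)] [Proj V Hs 0, Proj V Hs 1], Proj V Hs 2] =
    c (w, y, z) \<cdot>\<^bsub>V\<^esub> tuple V P [h (y, z), h (w, y)]
     [Proj V Hs 0, c (w, x, y) \<cdot>\<^bsub>V\<^esub> tuple V P [h (x, y), h (w, x)] [Proj V Hs 1, Proj V Hs 2]])"
   "(\<forall>x\<in>A. \<forall>y\<in>A.
    let H = h (x, y); i = Id V H in
    c (x, y, y) \<cdot>\<^bsub>V\<^esub> tuple V H [h (y, y), H] [e y \<cdot>\<^bsub>V\<^esub> tuple V H [] [], i] = i &
    c (x, x, y) \<cdot>\<^bsub>V\<^esub> tuple V H [H, h (x, x)] [i, e x \<cdot>\<^bsub>V\<^esub> tuple V H [] []] = i)"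
  unfolding is_vcategory_def by (elim exE conjE) (rule that)
 show ?R
  using * l unfolding X is_precat_def pre_gph_def mul_def unt_def obj.sel Let_def PiE_iff by auto
next
 assume r: ?R
 then have X: "X = CatOb (pts X) (hm X) (cmp X) (idt X)" by (simp add: is_precat_def)
 show "is_vcategory V X"
  unfolding is_vcategory_def
  apply (rule exI[of _ "pts X"], rule exI[of _ "hm X"], rule exI[of _ "cmp X"], rule exI[of _ "idt X"])
  using r unfolding is_precat_def pre_gph_def mul_def unt_def Let_def PiE_iff by auto
qed

lemma is_precatD:
 assumes "is_precat V X"
 shows "X = CatOb (pts X) (hm X) (cmp X) (idt X)" "pre_gph V X"
  "x \<in> pts X ==> y \<in> pts X ==> hm X (x, y) \<in> Ob V"
  "x \<in> pts X ==> y \<in> pts X ==> z \<in> pts X ==>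
    cmp X (x, y, z) \<in> hom V (Prod V [hm X (y, z), hm X (x, y)]) (hm X (x, z))"
  "x \<in> pts X ==> idt X x \<in> hom V (Prod V []) (hm X (x, x))"
 using assms unfolding is_precat_def pre_gph_def by blast+

lemma vcategory_precat: "is_vcategory V X ==> is_precat V X"
 by (simp add: is_vcategory_iff)

lemma vcategory_pre: "is_vcategory V X ==> pre_gph V X"
 using vcategory_precat is_precatD(2) by blast

context obj_fprod
begin

lemma mul_hom:
 assumes "is_precat V X" "x \<in> pts X" "y \<in> pts X" "z \<in> pts X"
  "u \<in> hom V Z (hm X (y, z))" "v \<in> hom V Z (hm X (x, y))"
 shows "mul V X Z x y z u v \<in> hom V Z (hm X (x, z))"
 unfolding mul_def using is_precatD(4)[OF assms(1-4)] homA(4)[OF assms(5)] assms(5,6)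
 by (auto intro!: Comp_hom[OF tuple_hom])

lemma mul_comp:
 assumes "is_precat V X" "x \<in> pts X" "y \<in> pts X" "z \<in> pts X"
  "u \<in> hom V Z (hm X (y, z))" "v \<in> hom V Z (hm X (x, y))" "g \<in> hom V W Z"
 shows "mul V X Z x y z u v \<cdot> g = mul V X W x y z (u \<cdot> g) (v \<cdot> g)"
proof -
 have Z: "Z \<in> Ob V" using homA(4)[OF assms(5)] .
 have e: "elems V Z [u, v] [hm X (y, z), hm X (x, y)]" using assms by simp
 show ?thesis
  unfolding mul_def Comp_assoc[OF assms(7) tuple_hom[OF Z e] is_precatD(4)[OF assms(1-4)]] tuple_comp[OF Z e assms(7)]
  by simp
qed

lemma unt_hom: "is_precat V X ==> x \<in> pts X ==> Z \<in> Ob V ==> unt V X Z x \<in> hom V Z (hm X (x, x))"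
 unfolding unt_def by (auto intro!: Comp_hom[OF tuple_hom] dest: is_precatD(5))

lemma unt_comp:
 assumes "is_precat V X" "x \<in> pts X" "g \<in> hom V W Z"
 shows "unt V X Z x \<cdot> g = unt V X W x"
proof -
 have Z: "Z \<in> Ob V" using homA(5)[OF assms(3)] .
 have e: "elems V Z [] []" by simp
 show ?thesis
  unfolding unt_def Comp_assoc[OF assms(3) tuple_hom[OF Z e] is_precatD(5)[OF assms(1,2)]] tuple_comp[OF Z e assms(3)]
  by simp
qed

text \<open>The axiom is the instance where the three elements are the projections of the ternary
  product. Composing it with the tuple of \<open>a\<close>, \<open>b\<close>, \<open>c\<close> gives
  the general case, since \<open>mul\<close> commutes with change of stage.\<close>

lemma mul_assoc:
 assumes X: "is_vcategory V X" and p: "w \<in> pts X" "x \<in> pts X" "y \<in> pts X" "z \<in> pts X"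
  and a: "a \<in> hom V Z (hm X (y, z))" and b: "b \<in> hom V Z (hm X (x, y))" and c: "c \<in> hom V Z (hm X (w, x))"
 shows "mul V X Z w x z (mul V X Z x y z a b) c = mul V X Z w y z a (mul V X Z w x y b c)"
proof -
 note pc = vcategory_precat[OF X]
 define Hs where "Hs = [hm X (y, z), hm X (x, y), hm X (w, x)]"
 have Z: "Z \<in> Ob V" using homA(4)[OF a] .
 have e: "elems V Z [a, b, c] Hs" using a b c by (simp add: Hs_def)
 note ob = elems_Ob[OF e]
 define t where "t = tuple V Z Hs [a, b, c]"
 have t: "t \<in> hom V Z (Prod V Hs)" unfolding t_def by (rule tuple_hom[OF Z e])
 have pr: "Proj V Hs 0 \<cdot> t = a" "Proj V Hs 1 \<cdot> t = b" "Proj V Hs 2 \<cdot> t = c"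
  unfolding t_def using Proj_tuple[OF Z e, of 0] Proj_tuple[OF Z e, of 1] Proj_tuple[OF Z e, of 2]
  by (simp_all add: Hs_def)
 have ph: "Proj V Hs 0 \<in> hom V (Prod V Hs) (hm X (y, z))" "Proj V Hs 1 \<in> hom V (Prod V Hs) (hm X (x, y))"
  "Proj V Hs 2 \<in> hom V (Prod V Hs) (hm X (w, x))"
  using Proj_hom[OF ob, of 0] Proj_hom[OF ob, of 1] Proj_hom[OF ob, of 2] by (simp_all add: Hs_def)
 note mh = mul_hom[OF pc p(2,3,4) ph(1,2)] mul_hom[OF pc p(1,2,3) ph(2,3)]
 have "mul V X (Prod V Hs) w x z (mul V X (Prod V Hs) x y z (Proj V Hs 0) (Proj V Hs 1)) (Proj V Hs 2) =
    mul V X (Prod V Hs) w y z (Proj V Hs 0) (mul V X (Prod V Hs) w x y (Proj V Hs 1) (Proj V Hs 2))"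
  using X p unfolding is_vcategory_iff Let_def Hs_def by blast
 then have "mul V X (Prod V Hs) w x z (mul V X (Prod V Hs) x y z (Proj V Hs 0) (Proj V Hs 1)) (Proj V Hs 2) \<cdot> t =
    mul V X (Prod V Hs) w y z (Proj V Hs 0) (mul V X (Prod V Hs) w x y (Proj V Hs 1) (Proj V Hs 2)) \<cdot> t" by simp
 then show ?thesis
  unfolding mul_comp[OF pc p(1,2,4) mh(1) ph(3) t] mul_comp[OF pc p(1,3,4) ph(1) mh(2) t]
   mul_comp[OF pc p(2,3,4) ph(1,2) t] mul_comp[OF pc p(1,2,3) ph(2,3) t] pr .
qed

lemma mul_unt:
 assumes X: "is_vcategory V X" and p: "x \<in> pts X" "y \<in> pts X" and u: "u \<in> hom V Z (hm X (x, y))"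
 shows "mul V X Z x y y (unt V X Z y) u = u" "mul V X Z x x y u (unt V X Z x) = u"
proof -
 note pc = vcategory_precat[OF X]
 let ?H = "hm X (x, y)"
 have H: "?H \<in> Ob V" using homA(5)[OF u] .
 have "mul V X ?H x y y (unt V X ?H y) (Id V ?H) = Id V ?H" "mul V X ?H x x y (Id V ?H) (unt V X ?H x) = Id V ?H"
  using X p unfolding is_vcategory_iff Let_def by blast+
 then have "mul V X ?H x y y (unt V X ?H y) (Id V ?H) \<cdot> u = Id V ?H \<cdot> u" "mul V X ?H x x y (Id V ?H) (unt V X ?H x) \<cdot> u = Id V ?H \<cdot> u"
  by simp_all
 then show "mul V X Z x y y (unt V X Z y) u = u" "mul V X Z x x y u (unt V X Z x) = u"
  unfolding mul_comp[OF pc p(1,2,2) unt_hom[OF pc p(2) H] Id_hom[OF H] u] mul_comp[OF pc p(1,1,2) Id_hom[OF H] unt_hom[OF pc p(1) H] u]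
   unt_comp[OF pc p(1) u] unt_comp[OF pc p(2) u] using homD[OF u] by simp_all
qed

lemma is_vcategoryI:
 assumes pc: "is_precat V X"
  and a: "!!w x y z Hs Z. w \<in> pts X ==> x \<in> pts X ==> y \<in> pts X ==> z \<in> pts X ==>
    Hs = [hm X (y, z), hm X (x, y), hm X (w, x)] ==> set Hs <= Ob V ==> Z = Prod V Hs ==> Z \<in> Ob V ==>
    Proj V Hs 0 \<in> hom V Z (hm X (y, z)) ==> Proj V Hs 1 \<in> hom V Z (hm X (x, y)) ==> Proj V Hs 2 \<in> hom V Z (hm X (w, x)) ==>
    mul V X Z w x z (mul V X Z x y z (Proj V Hs 0) (Proj V Hs 1)) (Proj V Hs 2) =
    mul V X Z w y z (Proj V Hs 0) (mul V X Z w x y (Proj V Hs 1) (Proj V Hs 2))"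
  and u: "!!x y H. x \<in> pts X ==> y \<in> pts X ==> H = hm X (x, y) ==> H \<in> Ob V ==>
    mul V X H x y y (unt V X H y) (Id V H) = Id V H & mul V X H x x y (Id V H) (unt V X H x) = Id V H"
 shows "is_vcategory V X"
 unfolding is_vcategory_iff Let_def
proof (intro conjI ballI pc)
 fix w x y z assume p: "w \<in> pts X" "x \<in> pts X" "y \<in> pts X" "z \<in> pts X"
 let ?H = "[hm X (y, z), hm X (x, y), hm X (w, x)]"
 have ob: "set ?H <= Ob V" using is_precatD(3)[OF pc] p by simp
 show "mul V X (Prod V ?H) w x z (mul V X (Prod V ?H) x y z (Proj V ?H 0) (Proj V ?H 1)) (Proj V ?H 2) =
    mul V X (Prod V ?H) w y z (Proj V ?H 0) (mul V X (Prod V ?H) w x y (Proj V ?H 1) (Proj V ?H 2))"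
  using Proj_hom[OF ob, of 0] Proj_hom[OF ob, of 1] Proj_hom[OF ob, of 2]
  by (intro a[OF p refl ob refl Prod_Ob[OF ob]]) simp_all
qed (use u is_precatD(3)[OF pc] in auto)

text \<open>Compatibility with composition is an equation between arrows out of a binary product,
  and such arrows are determined by their values on pairs of generalized elements.\<close>

lemma is_vfunctor_iff:
 assumes X: "is_precat V X" and Y: "is_precat V Y" and F: "F \<in> gm V X Y"
 shows "is_vfunctor V F \<longleftrightarrow>
  (\<forall>x \<in> pts X. \<forall>y \<in> pts X. \<forall>z \<in> pts X. \<forall>Z u v. u \<in> hom V Z (hm X (y, z)) --> v \<in> hom V Z (hm X (x, y)) -->
    fm F (x, z) \<cdot> mul V X Z x y z u v = mul V Y Z (fn F x) (fn F y) (fn F z) (fm F (y, z) \<cdot> u) (fm F (x, y) \<cdot> v)) &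
  (\<forall>x \<in> pts X. fm F (x, x) \<cdot> idt X x = idt Y (fn F x))"
proof -
 have g: "is_gph_map V F" "src F = X" "tgt F = Y" using F by (simp_all add: gm_def)
 have "fm F (x, z) \<cdot> cmp X (x, y, z) = cmp Y (fn F x, fn F y, fn F z) \<cdot>
      prod_map V [hm X (y, z), hm X (x, y)] [hm Y (fn F y, fn F z), hm Y (fn F x, fn F y)] [fm F (y, z), fm F (x, y)] \<longleftrightarrow>
   (\<forall>Z u v. u \<in> hom V Z (hm X (y, z)) --> v \<in> hom V Z (hm X (x, y)) -->
    fm F (x, z) \<cdot> mul V X Z x y z u v = mul V Y Z (fn F x) (fn F y) (fn F z) (fm F (y, z) \<cdot> u) (fm F (x, y) \<cdot> v))"
  (is "?l = ?r \<longleftrightarrow> ?R") if p: "x \<in> pts X" "y \<in> pts X" "z \<in> pts X" for x y z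
 proof -
  note Fp = gm_fn[OF F p(1)] gm_fn[OF F p(2)] gm_fn[OF F p(3)]
  note c = is_precatD(4)[OF X p] and d = is_precatD(4)[OF Y Fp]
  have a: "arrs V [fm F (y, z), fm F (x, y)] [hm X (y, z), hm X (x, y)] [hm Y (fn F y, fn F z), hm Y (fn F x, fn F y)]"
   using gm_fm[OF F] p by simp
  have ev: "?l \<cdot> tuple V Z [hm X (y, z), hm X (x, y)] [u, v] = fm F (x, z) \<cdot> mul V X Z x y z u v"
   "?r \<cdot> tuple V Z [hm X (y, z), hm X (x, y)] [u, v] = mul V Y Z (fn F x) (fn F y) (fn F z) (fm F (y, z) \<cdot> u) (fm F (x, y) \<cdot> v)"
   if e: "elems V Z [u, v] [hm X (y, z), hm X (x, y)]" for Z u v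
  proof -
   have Z: "Z \<in> Ob V" using e homA(4) by auto
   note t = tuple_hom[OF Z e]
   show "?l \<cdot> tuple V Z [hm X (y, z), hm X (x, y)] [u, v] = fm F (x, z) \<cdot> mul V X Z x y z u v"
    unfolding mul_def Comp_assoc[OF t c gm_fm[OF F p(1,3)]] ..
   show "?r \<cdot> tuple V Z [hm X (y, z), hm X (x, y)] [u, v] = mul V Y Z (fn F x) (fn F y) (fn F z) (fm F (y, z) \<cdot> u) (fm F (x, y) \<cdot> v)"
    unfolding mul_def Comp_assoc[OF t prod_map_hom[OF a] d] prod_map_tuple[OF a Z e] by simp
  qed
  show ?thesis
  proof
   assume "?l = ?r"
   then show ?R using ev by simp
  next
   assume R: ?R
   have ob: "set [hm X (y, z), hm X (x, y)] <= Ob V" using is_precatD(3)[OF X] p by simp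
   show "?l = ?r"
   proof (rule prod_ext[OF ob Comp_hom[OF c gm_fm[OF F p(1,3)]] Comp_hom[OF prod_map_hom[OF a] d]])
    fix Z fs assume e: "elems V Z fs [hm X (y, z), hm X (x, y)]"
    then obtain u v where fs: "fs = [u, v]"
     using elems_length[OF e] by (auto simp: length_Suc_conv)
    show "?l \<cdot> tuple V Z [hm X (y, z), hm X (x, y)] fs = ?r \<cdot> tuple V Z [hm X (y, z), hm X (x, y)] fs"
     using R e unfolding fs ev[OF e[unfolded fs]] by simp
   qed
  qed
 qed
 then show ?thesis
  unfolding is_vfunctor_def Let_def g(2,3) using g(1) by (auto simp del: One_nat_def)
qed

lemma vfunctor_mul:
 assumes "is_vfunctor V F" "is_precat V X" "is_precat V Y" "F \<in> gm V X Y"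
  "x \<in> pts X" "y \<in> pts X" "z \<in> pts X" "u \<in> hom V Z (hm X (y, z))" "v \<in> hom V Z (hm X (x, y))"
 shows "fm F (x, z) \<cdot> mul V X Z x y z u v = mul V Y Z (fn F x) (fn F y) (fn F z) (fm F (y, z) \<cdot> u) (fm F (x, y) \<cdot> v)"
 using is_vfunctor_iff[OF assms(2-4)] assms by blast

lemma vfunctor_idt:
 assumes "is_vfunctor V F" "is_precat V X" "is_precat V Y" "F \<in> gm V X Y" "x \<in> pts X"
 shows "fm F (x, x) \<cdot> idt X x = idt Y (fn F x)"
 using is_vfunctor_iff[OF assms(2-4)] assms by blast

lemma vfunctor_unt:
 assumes "is_vfunctor V F" "is_precat V X" "is_precat V Y" "F \<in> gm V X Y" "x \<in> pts X" "Z \<in> Ob V"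
 shows "fm F (x, x) \<cdot> unt V X Z x = unt V Y Z (fn F x)"
 unfolding unt_def
 using Comp_assoc[OF tuple_hom[OF assms(6), of "[]" "[]"] is_precatD(5)[OF assms(2,5)] gm_fm[OF assms(4,5,5)]] vfunctor_idt[OF assms(1-5)]
 by simp

lemma is_vfunctorI:
 assumes X: "is_precat V X" and Y: "is_precat V Y" and F: "F \<in> gm V X Y"
  and "!!x y z Z u v. x \<in> pts X ==> y \<in> pts X ==> z \<in> pts X ==> u \<in> hom V Z (hm X (y, z)) ==>
    v \<in> hom V Z (hm X (x, y)) ==>
    fm F (x, z) \<cdot> mul V X Z x y z u v = mul V Y Z (fn F x) (fn F y) (fn F z) (fm F (y, z) \<cdot> u) (fm F (x, y) \<cdot> v)"
  and "!!x. x \<in> pts X ==> fm F (x, x) \<cdot> idt X x = idt Y (fn F x)"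
 shows "is_vfunctor V F"
 unfolding is_vfunctor_iff[OF X Y F] using assms(4,5) by blast

text \<open>Keeps compatibility with composition as an equation of arrows out of the binary product.
  This form is needed when that product is initial or when its factors are decomposed by a joint
  epimorphism.\<close>

lemma is_vfunctorI':
 assumes X: "is_precat V X" and Y: "is_precat V Y" and F: "F \<in> gm V X Y"
  and m: "!!x y z. x \<in> pts X ==> y \<in> pts X ==> z \<in> pts X ==>
    fm F (x, z) \<cdot> cmp X (x, y, z) = cmp Y (fn F x, fn F y, fn F z) \<cdot>
      prod_map V [hm X (y, z), hm X (x, y)] [hm Y (fn F y, fn F z), hm Y (fn F x, fn F y)] [fm F (y, z), fm F (x, y)]"
  and i: "!!x. x \<in> pts X ==> fm F (x, x) \<cdot> idt X x = idt Y (fn F x)"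
 shows "is_vfunctor V F"
 unfolding is_vfunctor_def Let_def using F m i by (simp add: gm_def)

lemma vfunctor_Id:
 assumes X: "is_precat V X"
 shows "is_vfunctor V (gph_id V X)"
proof (rule is_vfunctorI[OF X X gph_id_gm[OF is_precatD(2)[OF X]]])
 fix x y z Z u v assume p: "x \<in> pts X" "y \<in> pts X" "z \<in> pts X" and u: "u \<in> hom V Z (hm X (y, z))" and v: "v \<in> hom V Z (hm X (x, y))"
 show "fm (gph_id V X) (x, z) \<cdot> mul V X Z x y z u v =
  mul V X Z (fn (gph_id V X) x) (fn (gph_id V X) y) (fn (gph_id V X) z) (fm (gph_id V X) (y, z) \<cdot> u) (fm (gph_id V X) (x, y) \<cdot> v)"
  using homD[OF u] homD[OF v] homD[OF mul_hom[OF X p u v]] p by (simp add: gph_id_fn gph_id_fm)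
next
 fix x assume "x \<in> pts X" then show "fm (gph_id V X) (x, x) \<cdot> idt X x = idt X (fn (gph_id V X) x)"
  using homD[OF is_precatD(5)[OF X, of x]] by (simp add: gph_id_fn gph_id_fm)
qed

lemma vfunctor_Comp:
 assumes X: "is_precat V X" "is_precat V Y" "is_precat V W"
  and F: "F \<in> gm V X Y" "is_vfunctor V F" and G: "G \<in> gm V Y W" "is_vfunctor V G"
 shows "is_vfunctor V (gph_comp V G F)"
proof (rule is_vfunctorI[OF X(1,3) gph_comp_gm[OF F(1) G(1)]])
 fix x y z Z u v assume p: "x \<in> pts X" "y \<in> pts X" "z \<in> pts X" and u: "u \<in> hom V Z (hm X (y, z))" and v: "v \<in> hom V Z (hm X (x, y))"
 note Fp = gm_fn[OF F(1) p(1)] gm_fn[OF F(1) p(2)] gm_fn[OF F(1) p(3)]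
 note m = mul_hom[OF X(1) p u v]
 note Fu = gm_fm[OF F(1) p(2,3)] and Fv = gm_fm[OF F(1) p(1,2)] and Fm = gm_fm[OF F(1) p(1,3)]
 note Gu = gm_fm[OF G(1) Fp(2,3)] and Gv = gm_fm[OF G(1) Fp(1,2)] and Gm = gm_fm[OF G(1) Fp(1,3)]
 show "fm (gph_comp V G F) (x, z) \<cdot> mul V X Z x y z u v =
  mul V W Z (fn (gph_comp V G F) x) (fn (gph_comp V G F) y) (fn (gph_comp V G F) z) (fm (gph_comp V G F) (y, z) \<cdot> u) (fm (gph_comp V G F) (x, y) \<cdot> v)"
  unfolding gph_comp_fn[OF F(1) p(1)] gph_comp_fn[OF F(1) p(2)] gph_comp_fn[OF F(1) p(3)]
   gph_comp_fm[OF F(1) p(1,3)] gph_comp_fm[OF F(1) p(2,3)] gph_comp_fm[OF F(1) p(1,2)]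
   Comp_assoc[OF u Fu Gu] Comp_assoc[OF v Fv Gv] Comp_assoc[OF m Fm Gm]
   vfunctor_mul[OF F(2) X(1,2) F(1) p u v]
   vfunctor_mul[OF G(2) X(2,3) G(1) Fp Comp_hom[OF u Fu] Comp_hom[OF v Fv]] ..
next
 fix x assume x: "x \<in> pts X"
 note Fx = gm_fn[OF F(1) x]
 show "fm (gph_comp V G F) (x, x) \<cdot> idt X x = idt W (fn (gph_comp V G F) x)"
  unfolding gph_comp_fn[OF F(1) x] gph_comp_fm[OF F(1) x x]
   Comp_assoc[OF is_precatD(5)[OF X(1) x] gm_fm[OF F(1) x x] gm_fm[OF G(1) Fx Fx]]
   vfunctor_idt[OF F(2) X(1,2) F(1) x] vfunctor_idt[OF G(2) X(2,3) G(1) Fx] ..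
qed

subsection \<open>Products of enriched categories\<close>

lemma vcat_prod_sel [simp]:
 "pts (vcat_prod V Xs) = prod_pts Xs"
 "p \<in> prod_pts Xs ==> q \<in> prod_pts Xs ==> hm (vcat_prod V Xs) (p, q) = Prod V (prod_homs Xs p q)"
 by (simp_all add: vcat_prod_def Let_def)

lemma vcat_prod_gprod: "is_gprod V Xs (vcat_prod V Xs)"
 by (simp add: is_gprod_def)

context
 fixes Xs assumes Xs: "!!X. X \<in> set Xs ==> is_vcategory V X"
begin

lemma Xs_pc: "r < length Xs ==> is_precat V (Xs ! r)"
 by (rule vcategory_precat[OF Xs[OF nth_mem]])

lemma Xs_pre: "X \<in> set Xs ==> pre_gph V X"
 using Xs vcategory_pre by blast

lemma Xs_Ob: "p \<in> prod_pts Xs ==> q \<in> prod_pts Xs ==> set (prod_homs Xs p q) <= Ob V"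
 using prod_homs_Ob[OF Xs_pre] by blast

lemma Xs_Proj: "p \<in> prod_pts Xs ==> q \<in> prod_pts Xs ==> s < length Xs ==>
  Proj V (prod_homs Xs p q) s \<in> hom V (Prod V (prod_homs Xs p q)) (hm (Xs ! s) (untup p ! s, untup q ! s))"
 using Proj_hom[OF Xs_Ob, of p q s] by simp

lemma vcat_prod_cmp_elems:
 assumes p: "p \<in> prod_pts Xs" "q \<in> prod_pts Xs" "r \<in> prod_pts Xs"
 defines "Hs \<equiv> [Prod V (prod_homs Xs q r), Prod V (prod_homs Xs p q)]"
 shows "set Hs <= Ob V" "elems V (Prod V Hs) (map (\<lambda>s. mul V (Xs ! s) (Prod V Hs) (untup p ! s) (untup q ! s) (untup r ! s)
     (Proj V (prod_homs Xs q r) s \<cdot> Proj V Hs 0) (Proj V (prod_homs Xs p q) s \<cdot> Proj V Hs 1)) [0..<length Xs]) (prod_homs Xs p r)"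
  "cmp (vcat_prod V Xs) (p, q, r) = tuple V (Prod V Hs) (prod_homs Xs p r) (map (\<lambda>s. mul V (Xs ! s) (Prod V Hs) (untup p ! s) (untup q ! s) (untup r ! s)
     (Proj V (prod_homs Xs q r) s \<cdot> Proj V Hs 0) (Proj V (prod_homs Xs p q) s \<cdot> Proj V Hs 1)) [0..<length Xs])"
proof -
 show ob: "set Hs <= Ob V" using Prod_Ob[OF Xs_Ob] p by (simp add: Hs_def)
 have P0: "Proj V Hs 0 \<in> hom V (Prod V Hs) (Prod V (prod_homs Xs q r))" "Proj V Hs 1 \<in> hom V (Prod V Hs) (Prod V (prod_homs Xs p q))"
  using Proj_hom[OF ob, of 0] Proj_hom[OF ob, of 1] by (simp_all add: Hs_def)
 show "elems V (Prod V Hs) (map (\<lambda>s. mul V (Xs ! s) (Prod V Hs) (untup p ! s) (untup q ! s) (untup r ! s)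
     (Proj V (prod_homs Xs q r) s \<cdot> Proj V Hs 0) (Proj V (prod_homs Xs p q) s \<cdot> Proj V Hs 1)) [0..<length Xs]) (prod_homs Xs p r)"
  using mul_hom[OF Xs_pc prod_ptsD(3)[OF p(1)] prod_ptsD(3)[OF p(2)] prod_ptsD(3)[OF p(3)]
    Comp_hom[OF P0(1) Xs_Proj[OF p(2,3)]] Comp_hom[OF P0(2) Xs_Proj[OF p(1,2)]]]
  by (intro elemsI) simp_all
 show "cmp (vcat_prod V Xs) (p, q, r) = tuple V (Prod V Hs) (prod_homs Xs p r) (map (\<lambda>s. mul V (Xs ! s) (Prod V Hs) (untup p ! s) (untup q ! s) (untup r ! s)
     (Proj V (prod_homs Xs q r) s \<cdot> Proj V Hs 0) (Proj V (prod_homs Xs p q) s \<cdot> Proj V Hs 1)) [0..<length Xs])"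
  using p by (simp add: vcat_prod_def Let_def Hs_def mul_def)
qed

lemma vcat_prod_idt:
 assumes p: "p \<in> prod_pts Xs"
 shows "idt (vcat_prod V Xs) p = tuple V (Prod V []) (prod_homs Xs p p) (map (\<lambda>s. idt (Xs ! s) (untup p ! s)) [0..<length Xs])"
  "elems V (Prod V []) (map (\<lambda>s. idt (Xs ! s) (untup p ! s)) [0..<length Xs]) (prod_homs Xs p p)"
 using p is_precatD(5)[OF Xs_pc prod_ptsD(3)[OF p]]
 by (auto simp: vcat_prod_def Let_def intro!: elemsI)

lemma vcat_prod_precat: "is_precat V (vcat_prod V Xs)"
 unfolding is_precat_def
proof (intro conjI ballI)
 show "vcat_prod V Xs = CatOb (pts (vcat_prod V Xs)) (hm (vcat_prod V Xs)) (cmp (vcat_prod V Xs)) (idt (vcat_prod V Xs))"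
  "hm (vcat_prod V Xs) \<in> extensional (pts (vcat_prod V Xs) \<times> pts (vcat_prod V Xs))"
  "cmp (vcat_prod V Xs) \<in> extensional (pts (vcat_prod V Xs) \<times> pts (vcat_prod V Xs) \<times> pts (vcat_prod V Xs))"
  "idt (vcat_prod V Xs) \<in> extensional (pts (vcat_prod V Xs))"
  by (simp_all add: vcat_prod_def Let_def)
 show "pre_gph V (vcat_prod V Xs)" by (rule is_gprod_pre[OF Xs_pre vcat_prod_gprod])
next
 fix p q r assume "p \<in> pts (vcat_prod V Xs)" "q \<in> pts (vcat_prod V Xs)" "r \<in> pts (vcat_prod V Xs)"
 then have p: "p \<in> prod_pts Xs" "q \<in> prod_pts Xs" "r \<in> prod_pts Xs" by simp_all
 note * = vcat_prod_cmp_elems[OF p]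
 show "cmp (vcat_prod V Xs) (p, q, r) \<in> hom V (Prod V [hm (vcat_prod V Xs) (q, r), hm (vcat_prod V Xs) (p, q)]) (hm (vcat_prod V Xs) (p, r))"
  using tuple_hom[OF Prod_Ob[OF *(1)] *(2)] p unfolding *(3) by simp
next
 fix p assume "p \<in> pts (vcat_prod V Xs)"
 then have p: "p \<in> prod_pts Xs" by simp
 show "idt (vcat_prod V Xs) p \<in> hom V (Prod V []) (hm (vcat_prod V Xs) (p, p))"
  unfolding vcat_prod_idt[OF p] using tuple_hom[OF Prod_Ob vcat_prod_idt(2)[OF p]] p by simp
qed

text \<open>Composition in a product is componentwise. As arrows into a product are compared by
  projections, every law of the product category follows from the law in each factor.\<close>

lemma Proj_mul:
 assumes p: "p \<in> prod_pts Xs" "q \<in> prod_pts Xs" "r \<in> prod_pts Xs" and s: "s < length Xs"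
  and u: "u \<in> hom V Z (Prod V (prod_homs Xs q r))" and v: "v \<in> hom V Z (Prod V (prod_homs Xs p q))"
 shows "Proj V (prod_homs Xs p r) s \<cdot> mul V (vcat_prod V Xs) Z p q r u v =
  mul V (Xs ! s) Z (untup p ! s) (untup q ! s) (untup r ! s) (Proj V (prod_homs Xs q r) s \<cdot> u) (Proj V (prod_homs Xs p q) s \<cdot> v)"
proof -
 define Hs where "Hs = [Prod V (prod_homs Xs q r), Prod V (prod_homs Xs p q)]"
 note * = vcat_prod_cmp_elems[OF p, folded Hs_def]
 have Z: "Z \<in> Ob V" using homA(4)[OF u] .
 have e: "elems V Z [u, v] Hs" using u v by (simp add: Hs_def)
 note t = tuple_hom[OF Z e]
 have P0: "Proj V Hs 0 \<in> hom V (Prod V Hs) (Prod V (prod_homs Xs q r))" "Proj V Hs 1 \<in> hom V (Prod V Hs) (Prod V (prod_homs Xs p q))"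
  using Proj_hom[OF *(1), of 0] Proj_hom[OF *(1), of 1] by (simp_all add: Hs_def)
 have pr: "Proj V Hs 0 \<cdot> tuple V Z Hs [u, v] = u" "Proj V Hs 1 \<cdot> tuple V Z Hs [u, v] = v"
  using Proj_tuple[OF Z e, of 0] Proj_tuple[OF Z e, of 1] by (simp_all add: Hs_def)
 note ps = prod_ptsD(3)[OF p(1) s] prod_ptsD(3)[OF p(2) s] prod_ptsD(3)[OF p(3) s]
 have hs: "hm (vcat_prod V Xs) (q, r) = Prod V (prod_homs Xs q r)" "hm (vcat_prod V Xs) (p, q) = Prod V (prod_homs Xs p q)"
  using p by simp_all
 have "mul V (vcat_prod V Xs) Z p q r u v = cmp (vcat_prod V Xs) (p, q, r) \<cdot> tuple V Z Hs [u, v]"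
  unfolding mul_def hs Hs_def ..
 also have "\<dots> = tuple V Z (prod_homs Xs p r) (map (\<lambda>f. f \<cdot> tuple V Z Hs [u, v]) (map (\<lambda>s. mul V (Xs ! s) (Prod V Hs) (untup p ! s) (untup q ! s) (untup r ! s)
     (Proj V (prod_homs Xs q r) s \<cdot> Proj V Hs 0) (Proj V (prod_homs Xs p q) s \<cdot> Proj V Hs 1)) [0..<length Xs]))"
  unfolding *(3) by (rule tuple_comp[OF Prod_Ob[OF *(1)] *(2) t])
 finally have "Proj V (prod_homs Xs p r) s \<cdot> mul V (vcat_prod V Xs) Z p q r u v =
   mul V (Xs ! s) (Prod V Hs) (untup p ! s) (untup q ! s) (untup r ! s)
     (Proj V (prod_homs Xs q r) s \<cdot> Proj V Hs 0) (Proj V (prod_homs Xs p q) s \<cdot> Proj V Hs 1) \<cdot> tuple V Z Hs [u, v]"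
  using Proj_tuple[OF Z elems_comp[OF *(2) t], of s] s by simp
 also have "\<dots> = mul V (Xs ! s) Z (untup p ! s) (untup q ! s) (untup r ! s) (Proj V (prod_homs Xs q r) s \<cdot> u) (Proj V (prod_homs Xs p q) s \<cdot> v)"
  unfolding mul_comp[OF Xs_pc[OF s] ps Comp_hom[OF P0(1) Xs_Proj[OF p(2,3) s]] Comp_hom[OF P0(2) Xs_Proj[OF p(1,2) s]] t]
   Comp_assoc[OF t P0(1) Xs_Proj[OF p(2,3) s]] Comp_assoc[OF t P0(2) Xs_Proj[OF p(1,2) s]] pr ..
 finally show ?thesis .
qed

lemma Proj_idt:
 assumes p: "p \<in> prod_pts Xs" and s: "s < length Xs"
 shows "Proj V (prod_homs Xs p p) s \<cdot> idt (vcat_prod V Xs) p = idt (Xs ! s) (untup p ! s)"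
 unfolding vcat_prod_idt(1)[OF p] using Proj_tuple[OF Prod_Ob vcat_prod_idt(2)[OF p], of s] s by simp

lemma Proj_unt:
 assumes p: "p \<in> prod_pts Xs" and s: "s < length Xs" and Z: "Z \<in> Ob V"
 shows "Proj V (prod_homs Xs p p) s \<cdot> unt V (vcat_prod V Xs) Z p = unt V (Xs ! s) Z (untup p ! s)"
proof -
 have h: "idt (vcat_prod V Xs) p \<in> hom V (Prod V []) (Prod V (prod_homs Xs p p))"
  using is_precatD(5)[OF vcat_prod_precat, of p] p by simp
 have t: "tuple V Z [] [] \<in> hom V Z (Prod V [])" by (rule tuple_hom[OF Z]) simp
 show ?thesis
  unfolding unt_def Comp_assoc[OF t h Xs_Proj[OF p p s], symmetric] Proj_idt[OF p s] ..
qed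

lemma vcat_prod_vcategory: "is_vcategory V (vcat_prod V Xs)"
proof (rule is_vcategoryI[OF vcat_prod_precat])
 note pc = vcat_prod_precat
 fix w x y z Hs Z assume "w \<in> pts (vcat_prod V Xs)" "x \<in> pts (vcat_prod V Xs)" "y \<in> pts (vcat_prod V Xs)" "z \<in> pts (vcat_prod V Xs)"
  and a0: "Proj V Hs 0 \<in> hom V Z (hm (vcat_prod V Xs) (y, z))" and b0: "Proj V Hs 1 \<in> hom V Z (hm (vcat_prod V Xs) (x, y))"
  and c0: "Proj V Hs 2 \<in> hom V Z (hm (vcat_prod V Xs) (w, x))"
 then have p: "w \<in> prod_pts Xs" "x \<in> prod_pts Xs" "y \<in> prod_pts Xs" "z \<in> prod_pts Xs" by simp_all
 define a b c where "a = Proj V Hs 0" and "b = Proj V Hs 1" and "c = Proj V Hs 2"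
 have a: "a \<in> hom V Z (Prod V (prod_homs Xs y z))" and b: "b \<in> hom V Z (Prod V (prod_homs Xs x y))" and c: "c \<in> hom V Z (Prod V (prod_homs Xs w x))"
  using a0 b0 c0 p by (simp_all add: a_def b_def c_def)
 have m: "mul V (vcat_prod V Xs) Z p q r u v \<in> hom V Z (Prod V (prod_homs Xs p r))"
  if "p \<in> prod_pts Xs" "q \<in> prod_pts Xs" "r \<in> prod_pts Xs" "u \<in> hom V Z (Prod V (prod_homs Xs q r))" "v \<in> hom V Z (Prod V (prod_homs Xs p q))" for p q r u v
  using mul_hom[OF pc, of p q r u Z v] that by simp
 have "mul V (vcat_prod V Xs) Z w x z (mul V (vcat_prod V Xs) Z x y z a b) c =
    mul V (vcat_prod V Xs) Z w y z a (mul V (vcat_prod V Xs) Z w x y b c)"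
 proof (rule Prod_eqI[OF Xs_Ob[OF p(1,4)] m[OF p(1,2,4) m[OF p(2,3,4) a b] c] m[OF p(1,3,4) a m[OF p(1,2,3) b c]]])
  fix s assume "s < length (prod_homs Xs w z)"
  then have s: "s < length Xs" by simp
  note ps = prod_ptsD(3)[OF p(1) s] prod_ptsD(3)[OF p(2) s] prod_ptsD(3)[OF p(3) s] prod_ptsD(3)[OF p(4) s]
  have v: "is_vcategory V (Xs ! s)" using Xs s by simp
  show "Proj V (prod_homs Xs w z) s \<cdot> mul V (vcat_prod V Xs) Z w x z (mul V (vcat_prod V Xs) Z x y z a b) c =
    Proj V (prod_homs Xs w z) s \<cdot> mul V (vcat_prod V Xs) Z w y z a (mul V (vcat_prod V Xs) Z w x y b c)"
   unfolding Proj_mul[OF p(1,2,4) s m[OF p(2,3,4) a b] c] Proj_mul[OF p(1,3,4) s a m[OF p(1,2,3) b c]]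
    Proj_mul[OF p(2,3,4) s a b] Proj_mul[OF p(1,2,3) s b c]
   by (rule mul_assoc[OF v ps Comp_hom[OF a Xs_Proj[OF p(3,4) s]] Comp_hom[OF b Xs_Proj[OF p(2,3) s]] Comp_hom[OF c Xs_Proj[OF p(1,2) s]]])
 qed
 then show "mul V (vcat_prod V Xs) Z w x z (mul V (vcat_prod V Xs) Z x y z (Proj V Hs 0) (Proj V Hs 1)) (Proj V Hs 2) =
    mul V (vcat_prod V Xs) Z w y z (Proj V Hs 0) (mul V (vcat_prod V Xs) Z w x y (Proj V Hs 1) (Proj V Hs 2))"
  by (simp add: a_def b_def c_def)
next
 note pc = vcat_prod_precat
 fix x y H assume "x \<in> pts (vcat_prod V Xs)" "y \<in> pts (vcat_prod V Xs)" and H0: "H = hm (vcat_prod V Xs) (x, y)" "H \<in> Ob V"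
 then have p: "x \<in> prod_pts Xs" "y \<in> prod_pts Xs" by simp_all
 have i: "Id V H \<in> hom V H (Prod V (prod_homs Xs x y))" using H0 p Id_hom[OF H0(2)] by simp
 have U: "unt V (vcat_prod V Xs) H x \<in> hom V H (Prod V (prod_homs Xs x x))" if "x \<in> prod_pts Xs" for x
  using unt_hom[OF pc, of x H] that H0 by simp
 have m: "mul V (vcat_prod V Xs) H p q r u v \<in> hom V H (Prod V (prod_homs Xs p r))"
  if "p \<in> prod_pts Xs" "q \<in> prod_pts Xs" "r \<in> prod_pts Xs" "u \<in> hom V H (Prod V (prod_homs Xs q r))" "v \<in> hom V H (Prod V (prod_homs Xs p q))" for p q r u v
  using mul_hom[OF pc, of p q r u H v] that by simp
 show "mul V (vcat_prod V Xs) H x y y (unt V (vcat_prod V Xs) H y) (Id V H) = Id V H &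
  mul V (vcat_prod V Xs) H x x y (Id V H) (unt V (vcat_prod V Xs) H x) = Id V H"
 proof (intro conjI Prod_eqI[OF Xs_Ob[OF p] m[OF p(1,2,2) U[OF p(2)] i] i] Prod_eqI[OF Xs_Ob[OF p] m[OF p(1,1,2) i U[OF p(1)]] i])
  fix s assume "s < length (prod_homs Xs x y)"
  then have s: "s < length Xs" by simp
  note ps = prod_ptsD(3)[OF p(1) s] prod_ptsD(3)[OF p(2) s]
  have v: "is_vcategory V (Xs ! s)" using Xs s by simp
  note h = Comp_hom[OF i Xs_Proj[OF p s]]
  show "Proj V (prod_homs Xs x y) s \<cdot> mul V (vcat_prod V Xs) H x y y (unt V (vcat_prod V Xs) H y) (Id V H) = Proj V (prod_homs Xs x y) s \<cdot> Id V H"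
   unfolding Proj_mul[OF p(1,2,2) s U[OF p(2)] i] Proj_unt[OF p(2) s H0(2)] by (rule mul_unt(1)[OF v ps h])
  show "Proj V (prod_homs Xs x y) s \<cdot> mul V (vcat_prod V Xs) H x x y (Id V H) (unt V (vcat_prod V Xs) H x) = Proj V (prod_homs Xs x y) s \<cdot> Id V H"
   unfolding Proj_mul[OF p(1,1,2) s i U[OF p(1)]] Proj_unt[OF p(1) s H0(2)] by (rule mul_unt(2)[OF v ps h])
 qed
qed

lemma gproj_vfunctor:
 assumes s: "s < length Xs"
 shows "is_vfunctor V (gproj V Xs (vcat_prod V Xs) s)"
proof (rule is_vfunctorI[OF vcat_prod_precat Xs_pc[OF s] gproj_gm[OF Xs_pre vcat_prod_gprod s]])
 fix x y z Z u v assume "x \<in> pts (vcat_prod V Xs)" "y \<in> pts (vcat_prod V Xs)" "z \<in> pts (vcat_prod V Xs)"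
  and u: "u \<in> hom V Z (hm (vcat_prod V Xs) (y, z))" and v: "v \<in> hom V Z (hm (vcat_prod V Xs) (x, y))"
 then have p: "x \<in> prod_pts Xs" "y \<in> prod_pts Xs" "z \<in> prod_pts Xs" by simp_all
 show "fm (gproj V Xs (vcat_prod V Xs) s) (x, z) \<cdot> mul V (vcat_prod V Xs) Z x y z u v =
   mul V (Xs ! s) Z (fn (gproj V Xs (vcat_prod V Xs) s) x) (fn (gproj V Xs (vcat_prod V Xs) s) y) (fn (gproj V Xs (vcat_prod V Xs) s) z)
     (fm (gproj V Xs (vcat_prod V Xs) s) (y, z) \<cdot> u) (fm (gproj V Xs (vcat_prod V Xs) s) (x, y) \<cdot> v)"
  using Proj_mul[OF p s, of u Z v] u v p by (simp add: gproj_fn gproj_fm)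
next
 fix x assume "x \<in> pts (vcat_prod V Xs)"
 then show "fm (gproj V Xs (vcat_prod V Xs) s) (x, x) \<cdot> idt (vcat_prod V Xs) x = idt (Xs ! s) (fn (gproj V Xs (vcat_prod V Xs) s) x)"
  using Proj_idt[OF _ s, of x] by (simp add: gproj_fn gproj_fm)
qed

lemma vcat_prod_tuple_vfunctor:
 assumes Z: "is_precat V W" and F: "F \<in> gm V W (vcat_prod V Xs)"
  and ok: "!!r. r < length Xs ==> is_vfunctor V (gph_comp V (gproj V Xs (vcat_prod V Xs) r) F)"
 shows "is_vfunctor V F"
proof (rule is_vfunctorI[OF Z vcat_prod_precat F])
 note pc = vcat_prod_precat
 have mem: "fn F x \<in> prod_pts Xs" if "x \<in> pts W" for x using gm_fn[OF F that] by simp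
 have g: "gph_comp V (gproj V Xs (vcat_prod V Xs) r) F \<in> gm V W (Xs ! r)" if "r < length Xs" for r
  by (rule gph_comp_gm[OF F gproj_gm[OF Xs_pre vcat_prod_gprod that]])
 {
  fix x y z Z u v assume p: "x \<in> pts W" "y \<in> pts W" "z \<in> pts W" and u: "u \<in> hom V Z (hm W (y, z))" and v: "v \<in> hom V Z (hm W (x, y))"
  note q = mem[OF p(1)] mem[OF p(2)] mem[OF p(3)]
  note Fu = gm_fm[OF F p(2,3)] and Fv = gm_fm[OF F p(1,2)] and Fm = gm_fm[OF F p(1,3)]
  note Fu' = Fu[unfolded vcat_prod_sel(2)[OF q(2,3)]] and Fv' = Fv[unfolded vcat_prod_sel(2)[OF q(1,2)]] and Fm' = Fm[unfolded vcat_prod_sel(2)[OF q(1,3)]]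
  note m = mul_hom[OF Z p u v]
  show "fm F (x, z) \<cdot> mul V W Z x y z u v = mul V (vcat_prod V Xs) Z (fn F x) (fn F y) (fn F z) (fm F (y, z) \<cdot> u) (fm F (x, y) \<cdot> v)"
  proof (rule Prod_eqI[OF Xs_Ob[OF q(1,3)] Comp_hom[OF m Fm'] ])
   show "mul V (vcat_prod V Xs) Z (fn F x) (fn F y) (fn F z) (fm F (y, z) \<cdot> u) (fm F (x, y) \<cdot> v) \<in> hom V Z (Prod V (prod_homs Xs (fn F x) (fn F z)))"
    using mul_hom[OF pc, of "fn F x" "fn F y" "fn F z"] Comp_hom[OF u Fu] Comp_hom[OF v Fv] q by simp
   fix r assume "r < length (prod_homs Xs (fn F x) (fn F z))"
   then have r: "r < length Xs" by simp
   show "Proj V (prod_homs Xs (fn F x) (fn F z)) r \<cdot> (fm F (x, z) \<cdot> mul V W Z x y z u v) =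
    Proj V (prod_homs Xs (fn F x) (fn F z)) r \<cdot> mul V (vcat_prod V Xs) Z (fn F x) (fn F y) (fn F z) (fm F (y, z) \<cdot> u) (fm F (x, y) \<cdot> v)"
    unfolding Proj_mul[OF q r Comp_hom[OF u Fu'] Comp_hom[OF v Fv']]
     Comp_assoc[OF m Fm' Xs_Proj[OF q(1,3) r], symmetric] Comp_assoc[OF u Fu' Xs_Proj[OF q(2,3) r], symmetric]
     Comp_assoc[OF v Fv' Xs_Proj[OF q(1,2) r], symmetric]
    using vfunctor_mul[OF ok[OF r] Z Xs_pc[OF r] g[OF r] p u v] p q
    by (simp add: gph_comp_fn[OF F] gph_comp_fm[OF F] gproj_fn gproj_fm del: Comp_assoc_simp)
  qed
 }
 fix x assume p: "x \<in> pts W"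
 note q = mem[OF p]
 note Fm' = gm_fm[OF F p p, unfolded vcat_prod_sel(2)[OF q q]]
 have i: "idt (vcat_prod V Xs) (fn F x) \<in> hom V (Prod V []) (Prod V (prod_homs Xs (fn F x) (fn F x)))"
  using is_precatD(5)[OF pc, of "fn F x"] q by simp
 show "fm F (x, x) \<cdot> idt W x = idt (vcat_prod V Xs) (fn F x)"
 proof (rule Prod_eqI[OF Xs_Ob[OF q q] Comp_hom[OF is_precatD(5)[OF Z p] Fm'] i])
  fix r assume "r < length (prod_homs Xs (fn F x) (fn F x))"
  then have r: "r < length Xs" by simp
  show "Proj V (prod_homs Xs (fn F x) (fn F x)) r \<cdot> (fm F (x, x) \<cdot> idt W x) = Proj V (prod_homs Xs (fn F x) (fn F x)) r \<cdot> idt (vcat_prod V Xs) (fn F x)"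
   unfolding Proj_idt[OF q r] Comp_assoc[OF is_precatD(5)[OF Z p] Fm' Xs_Proj[OF q q r], symmetric]
   using vfunctor_idt[OF ok[OF r] Z Xs_pc[OF r] g[OF r] p] p q
   by (simp add: gph_comp_fn[OF F] gph_comp_fm[OF F] gproj_fn gproj_fm del: Comp_assoc_simp)
 qed
qed

end

end

subsection \<open>Coproducts of enriched categories\<close>

text \<open>If three points do not lie in one summand, one of the two hom-objects to be composed is
  initial, hence so is their product; the description then denotes the unique arrow out of
  it.\<close>

definition vcat_coprod :: "('a obj, 'a arr, 'a cell, 'z) vcat_scheme => 'a cell set => ('a cell => 'a obj) => 'a obj" where
 "vcat_coprod V I X = (let P = coprod_pts I X; h = hm (gph_coprod V I X) in CatOb P h
   (\<lambda>(p, q, r)\<in>P \<times> P \<times> P. let i = untup p ! 0 in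
    if untup q ! 0 = i & untup r ! 0 = i then cmp (X i) (untup p ! 1, untup q ! 1, untup r ! 1)
    else THE f. f \<in> hom V (Prod V [h (q, r), h (p, q)]) (h (p, r)))
   (\<lambda>p\<in>P. idt (X (untup p ! 0)) (untup p ! 1)))"

text \<open>\<open>VCat\<close> with chosen coproducts added. They are needed one level higher,
  where free categories enriched in \<open>VCat\<close> are formed as coproducts over paths.\<close>

definition VCatC :: "('a obj, 'a arr, 'a cell, 'z) vcat_scheme => 'a cell_vcat" where
 "VCatC V =
   \<lparr>Ob = Ob (VCat V), Ar = Ar (VCat V), Dom = src, Cod = tgt, Id = gph_id V, Comp = gph_comp V,
   Prod = vcat_prod V, Proj = Proj (VCat V), Coprod = vcat_coprod V,
   Inj = \<lambda>I X i. ginj V X (vcat_coprod V I X) i\<rparr>"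

lemma VCatC_sel [simp]:
 "Ob (VCatC V) = {X. is_vcategory V X}" "Dom (VCatC V) = src" "Cod (VCatC V) = tgt"
 "Id (VCatC V) = gph_id V" "Comp (VCatC V) = gph_comp V" "Prod (VCatC V) = vcat_prod V"
 "Coprod (VCatC V) = vcat_coprod V"
 by (simp_all add: VCatC_def VCat_def)

context dcat
begin

lemma initial_pair:
 assumes "a \<in> Ob V" "b \<in> Ob V" "initial V a | initial V b"
 shows "initial V (Prod V [a, b])"
 using initial_Prod[of "[a, b]" 0] initial_Prod[of "[a, b]" 1] assms by auto

lemma initial_triple:
 assumes "a \<in> Ob V" "b \<in> Ob V" "c \<in> Ob V" "initial V a | initial V b | initial V c"
 shows "initial V (Prod V [a, b, c])"
 using initial_Prod[of "[a, b, c]" 0] initial_Prod[of "[a, b, c]" 1] initial_Prod[of "[a, b, c]" 2] assms by auto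

context
 fixes I :: "'a cell set" and X assumes X: "!!i. i \<in> I ==> is_vcategory V (X i)"
begin

lemma vcat_coprod_sel [simp]:
 "pts (vcat_coprod V I X) = coprod_pts I X"
 "i \<in> I ==> x \<in> pts (X i) ==> y \<in> pts (X i) ==> hm (vcat_coprod V I X) (Tup [i, x], Tup [i, y]) = hm (X i) (x, y)"
 "i \<in> I ==> x \<in> pts (X i) ==> y \<in> pts (X i) ==> z \<in> pts (X i) ==>
   cmp (vcat_coprod V I X) (Tup [i, x], Tup [i, y], Tup [i, z]) = cmp (X i) (x, y, z)"
 "i \<in> I ==> x \<in> pts (X i) ==> idt (vcat_coprod V I X) (Tup [i, x]) = idt (X i) x"
 by (simp_all add: vcat_coprod_def Let_def gph_coprod_def)

lemma vcat_coprod_hm_initial: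
 "i \<in> I ==> k \<in> I ==> x \<in> pts (X i) ==> y \<in> pts (X k) ==> i ~= k ==> initial V (hm (vcat_coprod V I X) (Tup [i, x], Tup [k, y]))"
 using initial_Coprod by (simp add: vcat_coprod_def Let_def gph_coprod_def)

lemma vcat_coprod_gcoprod: "is_gcoprod V I X (vcat_coprod V I X)"
 using vcat_coprod_hm_initial by (simp add: is_gcoprod_def)

lemma vcat_coprod_gcocone: "gcocone V I X (vcat_coprod V I X) (ginj V X (vcat_coprod V I X))"
 by (rule gcoprod_gcocone[OF vcat_coprod_gcoprod vcategory_pre[OF X]])

lemma vcat_coprod_precat: "is_precat V (vcat_coprod V I X)"
 unfolding is_precat_def
proof (intro conjI ballI)
 let ?P = "vcat_coprod V I X"
 show "?P = CatOb (pts ?P) (hm ?P) (cmp ?P) (idt ?P)" "hm ?P \<in> extensional (pts ?P \<times> pts ?P)"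
  "cmp ?P \<in> extensional (pts ?P \<times> pts ?P \<times> pts ?P)" "idt ?P \<in> extensional (pts ?P)"
  by (simp_all add: vcat_coprod_def Let_def gph_coprod_def)
 show pre: "pre_gph V ?P" by (rule gcocone_pre[OF vcat_coprod_gcocone])
 fix p assume p0: "p \<in> pts ?P"
 then obtain i x where p: "p = Tup [i, x]" "i \<in> I" "x \<in> pts (X i)" by (auto elim: coprod_ptsE)
 note pc = vcategory_precat[OF X[OF p(2)]]
 show "idt ?P p \<in> hom V (Prod V []) (hm ?P (p, p))" using is_precatD(5)[OF pc p(3)] p by simp
 fix q r assume q0: "q \<in> pts ?P" and r0: "r \<in> pts ?P"
 then obtain j y k z where q: "q = Tup [j, y]" "j \<in> I" "y \<in> pts (X j)" and r: "r = Tup [k, z]" "k \<in> I" "z \<in> pts (X k)" by (auto elim!: coprod_ptsE)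
 show "cmp ?P (p, q, r) \<in> hom V (Prod V [hm ?P (q, r), hm ?P (p, q)]) (hm ?P (p, r))"
 proof (cases "j = i & k = i")
  case True
  then show ?thesis using is_precatD(4)[OF pc p(3)] p q r by simp
 next
  case False
  have ob: "hm ?P (p, q) \<in> Ob V" "hm ?P (q, r) \<in> Ob V" "hm ?P (p, r) \<in> Ob V"
   using pre p0 q0 r0 by (simp_all add: pre_gph_def)
  have "initial V (hm ?P (q, r)) | initial V (hm ?P (p, q))"
   using False vcat_coprod_hm_initial[of i j x y] vcat_coprod_hm_initial[of j k y z] p q r by auto
  then have "initial V (Prod V [hm ?P (q, r), hm ?P (p, q)])" by (rule initial_pair[OF ob(2,1)])
  moreover have "cmp ?P (p, q, r) = (THE f. f \<in> hom V (Prod V [hm ?P (q, r), hm ?P (p, q)]) (hm ?P (p, r)))"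
   using False p q r by (auto simp: vcat_coprod_def Let_def)
  ultimately show ?thesis using initial_hom ob(3) by simp
 qed
qed

lemma vcat_coprod_mul:
 assumes "i \<in> I" "x \<in> pts (X i)" "y \<in> pts (X i)" "z \<in> pts (X i)"
 shows "mul V (vcat_coprod V I X) Z (Tup [i, x]) (Tup [i, y]) (Tup [i, z]) u v = mul V (X i) Z x y z u v"
 using assms by (simp add: mul_def)

lemma vcat_coprod_unt:
 assumes "i \<in> I" "x \<in> pts (X i)"
 shows "unt V (vcat_coprod V I X) Z (Tup [i, x]) = unt V (X i) Z x"
 using assms by (simp add: unt_def)

lemma vcat_coprod_vcategory: "is_vcategory V (vcat_coprod V I X)"
proof (rule is_vcategoryI[OF vcat_coprod_precat])
 let ?P = "vcat_coprod V I X"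
 note pc = vcat_coprod_precat
 fix w x y z Hs Z assume p: "w \<in> pts ?P" "x \<in> pts ?P" "y \<in> pts ?P" "z \<in> pts ?P"
  and Hs: "Hs = [hm ?P (y, z), hm ?P (x, y), hm ?P (w, x)]" "set Hs <= Ob V" "Z = Prod V Hs"
  and a: "Proj V Hs 0 \<in> hom V Z (hm ?P (y, z))" and b: "Proj V Hs 1 \<in> hom V Z (hm ?P (x, y))"
  and c: "Proj V Hs 2 \<in> hom V Z (hm ?P (w, x))"
 obtain i w' j x' k y' l z' where q: "w = Tup [i, w']" "x = Tup [j, x']" "y = Tup [k, y']" "z = Tup [l, z']"
  "i \<in> I" "j \<in> I" "k \<in> I" "l \<in> I" "w' \<in> pts (X i)" "x' \<in> pts (X j)" "y' \<in> pts (X k)" "z' \<in> pts (X l)"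
  using p by (auto elim!: coprod_ptsE)
 show "mul V ?P Z w x z (mul V ?P Z x y z (Proj V Hs 0) (Proj V Hs 1)) (Proj V Hs 2) =
    mul V ?P Z w y z (Proj V Hs 0) (mul V ?P Z w x y (Proj V Hs 1) (Proj V Hs 2))"
 proof (cases "j = i & k = i & l = i")
  case True
  then show ?thesis
   using mul_assoc[OF X[of i], of w' x' y' z' "Proj V Hs 0" Z "Proj V Hs 1" "Proj V Hs 2"] a b c q
   by (simp add: vcat_coprod_mul)
 next
  case False
  \<comment> \<open>A chain that leaves a summand contains an initial hom-object, so the common
    domain of both sides is initial.\<close>
  then have "initial V (hm ?P (y, z)) | initial V (hm ?P (x, y)) | initial V (hm ?P (w, x))"
   using vcat_coprod_hm_initial[of i j w' x'] vcat_coprod_hm_initial[of j k x' y'] vcat_coprod_hm_initial[of k l y' z'] q by auto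
  then have "initial V Z" using initial_triple Hs by simp
  then show ?thesis
   by (rule initial_eqI[OF _ mul_hom[OF pc p(1,2,4) mul_hom[OF pc p(2,3,4) a b] c] mul_hom[OF pc p(1,3,4) a mul_hom[OF pc p(1,2,3) b c]]])
 qed
next
 let ?P = "vcat_coprod V I X"
 note pc = vcat_coprod_precat
 fix x y H assume p: "x \<in> pts ?P" "y \<in> pts ?P" and H: "H = hm ?P (x, y)" "H \<in> Ob V"
 obtain j x' k y' where q: "x = Tup [j, x']" "y = Tup [k, y']" "j \<in> I" "k \<in> I" "x' \<in> pts (X j)" "y' \<in> pts (X k)"
  using p by (auto elim!: coprod_ptsE)
 have i: "Id V H \<in> hom V H (hm ?P (x, y))" using H Id_hom by simp
 show "mul V ?P H x y y (unt V ?P H y) (Id V H) = Id V H & mul V ?P H x x y (Id V H) (unt V ?P H x) = Id V H"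
 proof (cases "j = k")
  case True
  then show ?thesis
   using mul_unt[OF X[of j], of x' y' "Id V H" H] i q by (simp add: vcat_coprod_mul vcat_coprod_unt)
 next
  case False
  then have "initial V H" using vcat_coprod_hm_initial[of j k x' y'] q H by simp
  then show ?thesis
   using initial_eqI[OF _ mul_hom[OF pc p(1,2,2) unt_hom[OF pc p(2) H(2)] i] i]
    initial_eqI[OF _ mul_hom[OF pc p(1,1,2) i unt_hom[OF pc p(1) H(2)]] i] by simp
 qed
qed

lemma ginj_vfunctor:
 assumes i: "i \<in> I"
 shows "is_vfunctor V (ginj V X (vcat_coprod V I X) i)"
proof -
 let ?P = "vcat_coprod V I X" let ?J = "ginj V X ?P i"
 note pc = vcategory_precat[OF X[OF i]]
 have f: "fn ?J x = Tup [i, x]" if "x \<in> pts (X i)" for x using that by (simp add: ginj_def)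
 have g: "fm ?J (x, y) = Id V (hm (X i) (x, y))" if "x \<in> pts (X i)" "y \<in> pts (X i)" for x y using that by (simp add: ginj_def)
 show ?thesis
 proof (rule is_vfunctorI[OF pc vcat_coprod_precat gcocone_gm[OF vcat_coprod_gcocone i]])
  fix x y z Z u v assume p: "x \<in> pts (X i)" "y \<in> pts (X i)" "z \<in> pts (X i)"
   and u: "u \<in> hom V Z (hm (X i) (y, z))" and v: "v \<in> hom V Z (hm (X i) (x, y))"
  show "fm ?J (x, z) \<cdot> mul V (X i) Z x y z u v = mul V ?P Z (fn ?J x) (fn ?J y) (fn ?J z) (fm ?J (y, z) \<cdot> u) (fm ?J (x, y) \<cdot> v)"
   using homD[OF u] homD[OF v] homD[OF mul_hom[OF pc p u v]] p i by (simp add: f g vcat_coprod_mul)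
 next
  fix x assume x: "x \<in> pts (X i)"
  then show "fm ?J (x, x) \<cdot> idt (X i) x = idt ?P (fn ?J x)"
   using homD[OF is_precatD(5)[OF pc x]] i by (simp add: f g)
 qed
qed

end

text \<open>Inside a summand the legs are identities on hom-objects, so composition and the functor
  condition are those of \<open>Q i\<close>; across summands both sides start at an initial
  object.\<close>

lemma gcocone_vfunctor:
 assumes c: "gcocone V I Q P J" and J: "!!i. i \<in> I ==> is_vfunctor V (J i)" "!!i. i \<in> I ==> is_precat V (Q i)"
  and P: "is_precat V P" and Y: "is_precat V Y" and h: "h \<in> gm V P Y"
  and ok: "!!i. i \<in> I ==> is_vfunctor V (gph_comp V h (J i))"
 shows "is_vfunctor V h"
proof (rule is_vfunctorI'[OF P Y h])
 have fmh: "fm (gph_comp V h (J i)) (x, y) = fm h (fn (J i) x, fn (J i) y)"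
  if "i \<in> I" "x \<in> pts (Q i)" "y \<in> pts (Q i)" for i x y
  using gcoconeD(3,4,5)[OF c that(1,2)] gcoconeD(3)[OF c that(1,3)] gph_comp_fm[OF gcocone_gm[OF c that(1)] that(2,3)] homD[OF gm_fm[OF h]] that by simp
 {
  fix x assume x: "x \<in> pts P"
  obtain i x' where i: "i \<in> I" "x' \<in> pts (Q i)" "x = fn (J i) x'" using gcocone_cases[OF c x] by metis
  note gi = gcocone_gm[OF c i(1)]
  have "fm (J i) (x', x') \<cdot> idt (Q i) x' = idt P x"
   using vfunctor_idt[OF J(1)[OF i(1)] J(2)[OF i(1)] P gi i(2)] i by simp
  then have "idt P x = idt (Q i) x'"
   using gcoconeD(5)[OF c i(1,2,2)] homD[OF is_precatD(5)[OF J(2)[OF i(1)] i(2)]] by simp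
  then show "fm h (x, x) \<cdot> idt P x = idt Y (fn h x)"
   using vfunctor_idt[OF ok[OF i(1)] J(2)[OF i(1)] Y gph_comp_gm[OF gi h] i(2)] fmh[OF i(1,2,2)] i
   by (simp add: gph_comp_fn[OF gi])
 }
 fix x y z assume p: "x \<in> pts P" "y \<in> pts P" "z \<in> pts P"
 obtain i x' where i: "i \<in> I" "x' \<in> pts (Q i)" "x = fn (J i) x'" using gcocone_cases[OF c p(1)] by metis
 obtain j y' where j: "j \<in> I" "y' \<in> pts (Q j)" "y = fn (J j) y'" using gcocone_cases[OF c p(2)] by metis
 obtain k z' where k: "k \<in> I" "z' \<in> pts (Q k)" "z = fn (J k) z'" using gcocone_cases[OF c p(3)] by metis
 note hp = gm_fn[OF h p(1)] gm_fn[OF h p(2)] gm_fn[OF h p(3)]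
 let ?H = "[hm P (y, z), hm P (x, y)]" and ?K = "[hm Y (fn h y, fn h z), hm Y (fn h x, fn h y)]" and ?f = "[fm h (y, z), fm h (x, y)]"
 have a: "arrs V ?f ?H ?K" using gm_fm[OF h] p by simp
 note l = Comp_hom[OF is_precatD(4)[OF P p] gm_fm[OF h p(1,3)]] and r = Comp_hom[OF prod_map_hom[OF a] is_precatD(4)[OF Y hp]]
 show "fm h (x, z) \<cdot> cmp P (x, y, z) = cmp Y (fn h x, fn h y, fn h z) \<cdot> prod_map V ?H ?K ?f"
 proof (cases "j = i & k = i")
  case True
  note gi = gcocone_gm[OF c i(1)]
  have q: "x' \<in> pts (Q i)" "y' \<in> pts (Q i)" "z' \<in> pts (Q i)" using i j k True by simp_all
  have e: "x = fn (J i) x'" "y = fn (J i) y'" "z = fn (J i) z'" using i j k True by simp_all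
  have ob: "set ?H <= Ob V" using is_precatD(3)[OF P] p by simp
  have hQ: "hm P (y, z) = hm (Q i) (y', z')" "hm P (x, y) = hm (Q i) (x', y')" "hm P (x, z) = hm (Q i) (x', z')"
   unfolding e using gcoconeD(4)[OF c i(1)] q by simp_all
  show ?thesis
  proof (rule prod_ext[OF ob l r])
   fix Z fs assume Z: "Z \<in> Ob V" and el: "elems V Z fs ?H"
   then obtain u v where fs: "fs = [u, v]" and u: "u \<in> hom V Z (hm P (y, z))" and v: "v \<in> hom V Z (hm P (x, y))"
    using elems_length[OF el] by (auto simp: length_Suc_conv)
   note u' = u[unfolded hQ] and v' = v[unfolded hQ]
   note t = tuple_hom[OF Z el]
   have J1: "mul V (Q i) Z x' y' z' u v = mul V P Z x y z u v"
    using vfunctor_mul[OF J(1)[OF i(1)] J(2)[OF i(1)] P gi q u' v'] homD[OF u'] homD[OF v'] homD[OF mul_hom[OF J(2)[OF i(1)] q u' v']]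
     gcoconeD(5)[OF c i(1) q(1,3)] gcoconeD(5)[OF c i(1) q(2,3)] gcoconeD(5)[OF c i(1) q(1,2)]
    by (simp add: e)
   have J2: "fm h (x, z) \<cdot> mul V (Q i) Z x' y' z' u v = mul V Y Z (fn h x) (fn h y) (fn h z) (fm h (y, z) \<cdot> u) (fm h (x, y) \<cdot> v)"
    using vfunctor_mul[OF ok[OF i(1)] J(2)[OF i(1)] Y gph_comp_gm[OF gi h] q u' v']
    unfolding fmh[OF i(1) q(1,3)] fmh[OF i(1) q(2,3)] fmh[OF i(1) q(1,2)] gph_comp_fn[OF gi q(1)] gph_comp_fn[OF gi q(2)] gph_comp_fn[OF gi q(3)] e .
   have "fm h (x, z) \<cdot> cmp P (x, y, z) \<cdot> tuple V Z ?H fs = fm h (x, z) \<cdot> mul V P Z x y z u v"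
    unfolding fs mul_def Comp_assoc[OF t[unfolded fs] is_precatD(4)[OF P p] gm_fm[OF h p(1,3)]] ..
   also have "\<dots> = mul V Y Z (fn h x) (fn h y) (fn h z) (fm h (y, z) \<cdot> u) (fm h (x, y) \<cdot> v)"
    using J1 J2 by simp
   also have "\<dots> = cmp Y (fn h x, fn h y, fn h z) \<cdot> prod_map V ?H ?K ?f \<cdot> tuple V Z ?H fs"
    unfolding Comp_assoc[OF t prod_map_hom[OF a] is_precatD(4)[OF Y hp]] prod_map_tuple[OF a Z el] mul_def by (simp add: fs)
   finally show "fm h (x, z) \<cdot> cmp P (x, y, z) \<cdot> tuple V Z ?H fs = cmp Y (fn h x, fn h y, fn h z) \<cdot> prod_map V ?H ?K ?f \<cdot> tuple V Z ?H fs" .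
  qed
 next
  case False
  then have "initial V (hm P (y, z)) | initial V (hm P (x, y))"
   using gcoconeD(8)[OF c i(1,2) j(1,2)] gcoconeD(8)[OF c j(1,2) k(1,2)] i j k by auto
  then have "initial V (Prod V ?H)" by (rule initial_pair[OF is_precatD(3)[OF P p(2,3)] is_precatD(3)[OF P p(1,2)]])
  then show ?thesis by (rule initial_eqI[OF _ l r])
 qed
qed

lemma vcat_coprod_cong:
 assumes e: "!!i. i \<in> I ==> X i = Y i"
 shows "vcat_coprod V I X = vcat_coprod V I Y"
proof -
 have c: "coprod_pts I X = coprod_pts I Y" by (rule coprod_pts_cong[OF e])
 have h: "hm (gph_coprod V I X) = hm (gph_coprod V I Y)"
  using c e by (auto simp: gph_coprod_def intro!: restrict_ext elim!: coprod_ptsE)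
 show ?thesis
  unfolding vcat_coprod_def Let_def h c
  using e by (auto intro!: restrict_ext elim!: coprod_ptsE)
qed

lemma VCatC_gphlike: "gphlike V (VCatC V) (is_vfunctor V)"
proof unfold_locales
 fix A assume "A \<in> Ob (VCatC V)" then show "pre_gph V A" using vcategory_pre by simp
next
 fix f show "f \<in> Ar (VCatC V) \<longleftrightarrow> f \<in> gm V (src f) (tgt f) & src f \<in> Ob (VCatC V) & tgt f \<in> Ob (VCatC V) & is_vfunctor V f"
  by (auto simp: VCatC_def VCat_def gm_def is_vfunctor_def)
next
 fix A assume "A \<in> Ob (VCatC V)" then show "is_vfunctor V (gph_id V A)" using vfunctor_Id[OF vcategory_precat] by simp
next
 fix f g assume "f \<in> Ar (VCatC V)" "g \<in> Ar (VCatC V)" "tgt f = src g"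
 then show "is_vfunctor V (gph_comp V g f)"
  using vfunctor_Comp[OF vcategory_precat vcategory_precat vcategory_precat, of "src f" "src g" "tgt g" f g]
  by (simp add: VCatC_def VCat_def gm_def) (simp add: is_vfunctor_def)
next
 fix Xs assume Xs: "set Xs <= Ob (VCatC V)"
 then have X: "!!X. X \<in> set Xs ==> is_vcategory V X" by auto
 show "Prod (VCatC V) Xs \<in> Ob (VCatC V)" using vcat_prod_vcategory[OF X] by simp
 show "is_gprod V Xs (Prod (VCatC V) Xs)" using vcat_prod_gprod by simp
 have pr: "Proj (VCatC V) Xs r = gproj V Xs (Prod (VCatC V) Xs) r" for r
  by (simp add: VCatC_def VCat_def gproj_def)
 show "is_vfunctor V (Proj (VCatC V) Xs r)" if "r < length Xs" for r
  unfolding pr VCatC_sel by (rule gproj_vfunctor[OF X that])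
 fix Z f assume Z: "Z \<in> Ob (VCatC V)" and f: "f \<in> gm V Z (Prod (VCatC V) Xs)"
   and ok: "!!r. r < length Xs ==> is_vfunctor V (gph_comp V (Proj (VCatC V) Xs r) f)"
 have "is_vcategory V Z" using Z by simp
 from vcat_prod_tuple_vfunctor[OF X vcategory_precat[OF this] f[unfolded VCatC_sel] ok[unfolded pr VCatC_sel]]
 show "is_vfunctor V f" by simp
next
 fix Xs r show "Proj (VCatC V) Xs r = gproj V Xs (Prod (VCatC V) Xs) r"
  by (simp add: VCatC_def VCat_def gproj_def)
next
 fix I :: "'a cell set" and X assume X: "!!i. i \<in> I ==> X i \<in> Ob (VCatC V)"
 then have X': "!!i. i \<in> I ==> is_vcategory V (X i)" by simp
 show "Coprod (VCatC V) I X \<in> Ob (VCatC V)" using vcat_coprod_vcategory[OF X'] by simp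
 show "is_gcoprod V I X (Coprod (VCatC V) I X)" using vcat_coprod_gcoprod[OF X'] by simp
 show "is_vfunctor V (Inj (VCatC V) I X i)" if "i \<in> I" for i
  using ginj_vfunctor[OF X' that] by (simp add: VCatC_def)
next
 fix I :: "'a cell set" and X i
 show "Inj (VCatC V) I X i = ginj V X (Coprod (VCatC V) I X) i" by (simp add: VCatC_def)
next
 fix I :: "'a cell set" and Q P J Y h
 assume c: "gcocone V I Q P J" and J: "!!i. i \<in> I ==> J i \<in> Ar (VCatC V)" and P: "P \<in> Ob (VCatC V)" and Y: "Y \<in> Ob (VCatC V)"
  and h: "h \<in> gm V P Y" and ok: "!!i. i \<in> I ==> is_vfunctor V (gph_comp V h (J i))"
 show "is_vfunctor V h"
 proof (rule gcocone_vfunctor[OF c _ _ _ _ h ok])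
  show "is_vfunctor V (J i)" "is_precat V (Q i)" if "i \<in> I" for i
   using J[OF that] gmD(4)[OF gcocone_gm[OF c that]] vcategory_precat[of V "Q i"] by (simp_all add: VCatC_def VCat_def)
  show "is_precat V P" "is_precat V Y" using P Y vcategory_precat[of V P] vcategory_precat[of V Y] by simp_all
 qed
next
 fix I :: "'a cell set" and X X' assume e: "!!i. i \<in> I ==> X i = (X' :: 'a cell => 'a obj) i"
 show "Coprod (VCatC V) I X = Coprod (VCatC V) I X'" unfolding VCatC_sel by (rule vcat_coprod_cong[OF e])
qed simp_all

end

section \<open>Free enriched categories\<close>

text \<open>Lists run from the end of the path to its start, as in \<open>paths\<close>, so
  \<open>last\<close> is the source and \<open>hd\<close> the target. A one-element list is the path
  of length zero.\<close>

definition pth :: "'a obj => 'a cell list => bool" where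
 "pth A as \<longleftrightarrow> as ~= [] & set as <= pts A"

abbreviation (input) "pinj V A as \<equiv> path_inj V A (last as) (hd as) (Tup as)"

text \<open>The generalized element of \<open>fc(A)(a,b)\<close> given by a path \<open>as\<close> from \<open>a\<close> to \<open>b\<close> and elements
 \<open>fs\<close> of the hom-objects along it.\<close>

definition pel :: "('a obj, 'a arr, 'a cell, 'z) vcat_scheme => 'a obj => 'a obj => 'a cell list => 'a arr list => 'a arr" where
 "pel V A Z as fs = pinj V A as \<cdot>\<^bsub>V\<^esub> tuple V Z (legs (hm A) as) fs"

abbreviation fhom :: "('a obj, 'a arr, 'a cell, 'z) vcat_scheme => 'a obj => 'a cell => 'a cell => 'a obj" where
 "fhom V A a b \<equiv> Coprod V (paths (pts A) a b) (path_prod V A)"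

abbreviation (input) "fhoms V A prs \<equiv> map (\<lambda>(a, b). fhom V A a b) prs"

abbreviation (input) "steps as \<equiv> legs (\<lambda>xy. xy) as"

abbreviation (input) "pathss A qs prs \<equiv> list_all2 (\<lambda>q (a, b). q \<in> paths (pts A) a b) qs prs"

abbreviation (input) "path_injs V A prs qs \<equiv> map2 (\<lambda>(a, b) q. path_inj V A a b q) prs qs"

abbreviation (input) "plegs A qs \<equiv> map (legs (hm A) \<circ> untup) qs"

abbreviation (input) "pels V A Z qs fss \<equiv> map2 (pel V A Z) (map untup qs) fss"

lemma pth_simps [simp]: "pth A [a] \<longleftrightarrow> a \<in> pts A" "pth A (b # a # as) \<longleftrightarrow> b \<in> pts A & pth A (a # as)"
 "\<not> pth A []"
 by (auto simp: pth_def)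

lemma pth_hd [simp]: "pth A as ==> hd as \<in> pts A" "pth A as ==> last as \<in> pts A" "pth A as ==> as ~= []"
 by (auto simp: pth_def)

lemma paths_pth: "Tup as \<in> paths (pts A) a b \<longleftrightarrow> pth A as & last as = a & hd as = b"
 by (auto simp: paths_def pth_def)

lemma paths_untup:
 assumes "p \<in> paths (pts A) a b"
 shows "Tup (untup p) = p" "pth A (untup p)" "last (untup p) = a" "hd (untup p) = b" "a \<in> pts A" "b \<in> pts A"
 using assms unfolding paths_def pth_def by (auto simp: last_in_set)

lemma legs_length [simp]: "length (legs h as) = length as - 1"
 by (induction as rule: induct_list012) auto

text \<open>Concatenation drops the last vertex of the first list because the second list begins
  with it; otherwise a spurious leg at the common vertex would appear.\<close>

lemma legs_join: "as ~= [] ==> bs ~= [] ==> last as = hd bs ==> legs h (butlast as @ bs) = legs h as @ legs h bs"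
proof (induction as rule: induct_list012)
 case (3 b a as)
 then show ?case
  by (cases as; cases bs) auto
qed auto

lemma legs_map_out: "map g (legs h as) = legs (\<lambda>xy. g (h xy)) as"
 by (induction as rule: induct_list012) auto

lemma legs_cong: "pth A as ==> (!!x y. x \<in> pts A ==> y \<in> pts A ==> h (x, y) = k (x, y)) ==> legs h as = legs k as"
 by (induction as rule: induct_list012) (auto simp: pth_def)

lemma fc_ob_sel [simp]: "pts (fc_ob V A) = pts A"
 "a \<in> pts A ==> b \<in> pts A ==> hm (fc_ob V A) (a, b) = fhom V A a b"
 by (simp_all add: fc_ob_def)

lemma legs_pre: "pre_gph V A ==> pth A as ==> set (legs (hm A) as) <= Ob V"
 by (induction as rule: induct_list012) (auto simp: pth_def pre_gph_def)

context dcat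
begin

text \<open>Distributivity in the first factor glues over \<open>i\<close> for each fixed
  \<open>l\<close>; distributivity in the second factor then glues over \<open>l\<close>. The result
  is recorded on generalized elements, the form in which it is used.\<close>

lemma bin_ex:
 fixes I K :: "'a cell set"
 assumes C: "is_coprod V I X C j" and D: "is_coprod V K Y D k"
  and f: "!!i l. i \<in> I ==> l \<in> K ==> f i l \<in> hom V (Prod V [X i, Y l]) E" and E: "E \<in> Ob V"
 shows "\<exists>m \<in> hom V (Prod V [C, D]) E. \<forall>i \<in> I. \<forall>l \<in> K. \<forall>Z u v. u \<in> hom V Z (X i) --> v \<in> hom V Z (Y l) -->
   m \<cdot> tuple V Z [C, D] [j i \<cdot> u, k l \<cdot> v] = f i l \<cdot> tuple V Z [X i, Y l] [u, v]"
proof -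
 note oC = is_coprod_Ob(1)[OF C] and oD = is_coprod_Ob(1)[OF D]
 note hj = is_coprod_hom[OF C] and hk = is_coprod_hom[OF D]
 have "\<exists>g \<in> hom V (Prod V [C, Y l]) E. \<forall>i \<in> I. g \<cdot> prod_map V [X i, Y l] [C, Y l] [j i, Id V (Y l)] = f i l" if l: "l \<in> K" for l
 proof -
  note oY = is_coprod_Ob(2)[OF D l]
  have c: "is_coprod V I (\<lambda>i. Prod V [X i, Y l]) (Prod V [C, Y l]) (\<lambda>i. prod_map V [X i, Y l] [C, Y l] [j i, Id V (Y l)])"
   using distrib_is_coprod[of "[C, Y l]" 0 I X j] C oC oY by simp
  show ?thesis using is_coprod_ex[OF c E, of "\<lambda>i. f i l"] f[OF _ l] by metis
 qed
 then obtain g where g: "!!l. l \<in> K ==> g l \<in> hom V (Prod V [C, Y l]) E"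
  "!!l i. l \<in> K ==> i \<in> I ==> g l \<cdot> prod_map V [X i, Y l] [C, Y l] [j i, Id V (Y l)] = f i l" by metis
 have c: "is_coprod V K (\<lambda>l. Prod V [C, Y l]) (Prod V [C, D]) (\<lambda>l. prod_map V [C, Y l] [C, D] [Id V C, k l])"
  using distrib_is_coprod[of "[C, D]" 1 K Y k] D oC oD by simp
 obtain m where m: "m \<in> hom V (Prod V [C, D]) E" "!!l. l \<in> K ==> m \<cdot> prod_map V [C, Y l] [C, D] [Id V C, k l] = g l"
  using is_coprod_ex[OF c E g(1)] by metis
 show ?thesis
 proof (intro bexI[OF _ m(1)] ballI allI impI)
  fix i l Z u v assume i: "i \<in> I" and l: "l \<in> K" and u: "u \<in> hom V Z (X i)" and v: "v \<in> hom V Z (Y l)"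
  have Z: "Z \<in> Ob V" using homA(4)[OF u] .
  note oX = is_coprod_Ob(2)[OF C i] and oY = is_coprod_Ob(2)[OF D l]
  have a1: "arrs V [Id V C, k l] [C, Y l] [C, D]" using hk[OF l] Id_hom[OF oC] by simp
  have a2: "arrs V [j i, Id V (Y l)] [X i, Y l] [C, Y l]" using hj[OF i] Id_hom[OF oY] by simp
  have e2: "elems V Z [u, v] [X i, Y l]" using u v by simp
  have e1: "elems V Z [j i \<cdot> u, v] [C, Y l]" using Comp_hom[OF u hj[OF i]] v by simp
  have t1: "tuple V Z [C, Y l] [j i \<cdot> u, v] = prod_map V [X i, Y l] [C, Y l] [j i, Id V (Y l)] \<cdot> tuple V Z [X i, Y l] [u, v]"
   using prod_map_tuple[OF a2 Z e2] homD[OF v] by simp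
  have t2: "tuple V Z [C, D] [j i \<cdot> u, k l \<cdot> v] = prod_map V [C, Y l] [C, D] [Id V C, k l] \<cdot> tuple V Z [C, Y l] [j i \<cdot> u, v]"
   using prod_map_tuple[OF a1 Z e1] homD[OF Comp_hom[OF u hj[OF i]]] by simp
  have "m \<cdot> tuple V Z [C, D] [j i \<cdot> u, k l \<cdot> v] = g l \<cdot> tuple V Z [C, Y l] [j i \<cdot> u, v]"
   unfolding t2 Comp_assoc[OF tuple_hom[OF Z e1] prod_map_hom[OF a1] m(1), symmetric] m(2)[OF l] ..
  also have "\<dots> = f i l \<cdot> tuple V Z [X i, Y l] [u, v]"
   unfolding t1 Comp_assoc[OF tuple_hom[OF Z e2] prod_map_hom[OF a2] g(1)[OF l], symmetric] g(2)[OF l i] ..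
  finally show "m \<cdot> tuple V Z [C, D] [j i \<cdot> u, k l \<cdot> v] = f i l \<cdot> tuple V Z [X i, Y l] [u, v]" .
 qed
qed

context
 fixes A assumes A: "pre_gph V A"
begin

lemma path_prod_Ob: "p \<in> paths (pts A) a b ==> path_prod V A p \<in> Ob V"
 unfolding path_prod_def using legs_pre[OF A paths_untup(2)] by (rule Prod_Ob)

lemma fhom_is: "is_coprod V (paths (pts A) a b) (path_prod V A) (fhom V A a b) (path_inj V A a b)"
 by (rule Coprod_is) (rule path_prod_Ob)

lemma fhom_Ob: "fhom V A a b \<in> Ob V"
 by (rule is_coprod_Ob(1)[OF fhom_is])

lemma pinj_hom:
 assumes "pth A as"
 shows "pinj V A as \<in> hom V (Prod V (legs (hm A) as)) (fhom V A (last as) (hd as))"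
 using is_coprod_hom[OF fhom_is, of "Tup as" "last as" "hd as"] assms by (simp add: paths_pth path_prod_def)

lemma pel_hom: "pth A as ==> Z \<in> Ob V ==> elems V Z fs (legs (hm A) as) ==> pel V A Z as fs \<in> hom V Z (fhom V A (last as) (hd as))"
 unfolding pel_def by (rule Comp_hom[OF tuple_hom pinj_hom])

lemma pel_comp:
 assumes "pth A as" "elems V Z fs (legs (hm A) as)" "g \<in> hom V W Z"
 shows "pel V A Z as fs \<cdot> g = pel V A W as (map (\<lambda>f. f \<cdot> g) fs)"
proof -
 have Z: "Z \<in> Ob V" using homA(5)[OF assms(3)] .
 show ?thesis
  unfolding pel_def Comp_assoc[OF assms(3) tuple_hom[OF Z assms(2)] pinj_hom[OF assms(1)]] tuple_comp[OF Z assms(2,3)] ..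
qed

text \<open>Since \<open>F\<close> preserves the coproduct over paths, only the images of the
  injections matter, and an injection is itself a formal composite, with the projections as its
  elements.\<close>

lemma fhom_epi:
 assumes F: "cocont V W F"
  and h: "h \<in> hom W (fob F (fhom V A a b)) Y" "k \<in> hom W (fob F (fhom V A a b)) Y"
  and e: "!!Z as fs. pth A as ==> last as = a ==> hd as = b ==> Z \<in> Ob V ==> elems V Z fs (legs (hm A) as) ==>
   h \<cdot>\<^bsub>W\<^esub> far F (pel V A Z as fs) = k \<cdot>\<^bsub>W\<^esub> far F (pel V A Z as fs)"
 shows "h = k"
proof -
 interpret F: cat_functor V W F by (rule cocont_functor[OF F])
 show ?thesis
 proof (rule F.D.is_coprod_eqI[OF cocont_is_coprod[OF F fhom_is] h])
  fix p assume p: "p \<in> paths (pts A) a b"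
  note u = paths_untup[OF p] and ob = legs_pre[OF A paths_untup(2)[OF p]]
  have "pel V A (path_prod V A p) (untup p) (map (Proj V (legs (hm A) (untup p))) [0..<length (legs (hm A) (untup p))]) = path_inj V A a b p"
   using homD[OF pinj_hom[OF u(2)]] u tuple_Proj[OF ob] by (simp add: pel_def path_prod_def)
  then show "h \<cdot>\<^bsub>W\<^esub> far F (path_inj V A a b p) = k \<cdot>\<^bsub>W\<^esub> far F (path_inj V A a b p)"
   using e[OF u(2-4) path_prod_Ob[OF p] elems_projs[OF ob, folded path_prod_def]] by simp
 qed
qed

lemmas fhom_eqI = fhom_epi[OF cocont_id[OF category_axioms], unfolded id_fctr_simps]

lemma prod_map_pinj:
 assumes q: "pathss A qs prs" and Z: "Z \<in> Ob V"
  and fss: "list_all2 (elems V Z) fss (plegs A qs)"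
 shows "arrs V (path_injs V A prs qs) (map (path_prod V A) qs) (fhoms V A prs)"
  "prod_map V (map (path_prod V A) qs) (fhoms V A prs) (path_injs V A prs qs)
    \<cdot> tuple V Z (map (path_prod V A) qs) (map2 (tuple V Z) (plegs A qs) fss) =
   tuple V Z (fhoms V A prs) (pels V A Z qs fss)"
proof -
 have len: "length qs = length prs" "length fss = length qs"
  using q fss by (auto dest: list_all2_lengthD)
 have qr: "qs ! r \<in> paths (pts A) (fst (prs ! r)) (snd (prs ! r))" if "r < length prs" for r
  using q that by (auto simp: all2_nth split: prod.splits)
 show a: "arrs V (path_injs V A prs qs) (map (path_prod V A) qs) (fhoms V A prs)"
  unfolding arrs_def
 proof (intro conjI allI impI)
  fix r assume "r < length (map (path_prod V A) qs)"
  then have r: "r < length prs" using len by simp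
  show "path_injs V A prs qs ! r \<in> hom V (map (path_prod V A) qs ! r) (fhoms V A prs ! r)"
   using is_coprod_hom[OF fhom_is qr[OF r]] r len by (simp add: case_prod_beta)
 qed (simp_all add: len)
 have pp: "map (path_prod V A) qs = map (Prod V) (plegs A qs)"
  by (simp add: path_prod_def)
 have e: "elems V Z (map2 (tuple V Z) (plegs A qs) fss) (map (path_prod V A) qs)"
  unfolding pp by (rule elems_tuples[OF Z fss])
 have "comps V (path_injs V A prs qs) (map2 (tuple V Z) (plegs A qs) fss) =
  pels V A Z qs fss"
 proof (rule nth_equalityI)
  fix r assume "r < length (comps V (path_injs V A prs qs) (map2 (tuple V Z) (plegs A qs) fss))"
  then have r: "r < length prs" using len by simp
  note u = paths_untup[OF qr[OF r]]
  show "comps V (path_injs V A prs qs) (map2 (tuple V Z) (plegs A qs) fss) ! r =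
   pels V A Z qs fss ! r"
   using r len u by (simp add: case_prod_beta pel_def)
 qed (simp add: len)
 then show "prod_map V (map (path_prod V A) qs) (fhoms V A prs) (path_injs V A prs qs)
    \<cdot> tuple V Z (map (path_prod V A) qs) (map2 (tuple V Z) (plegs A qs) fss) =
   tuple V Z (fhoms V A prs) (pels V A Z qs fss)"
  unfolding prod_map_tuple[OF a Z e] by simp
qed

lemma joint_epi_paths:
 assumes F: "cocont V W F" and prs: "!!a b. (a, b) \<in> set prs ==> a \<in> pts A & b \<in> pts A"
  and h: "h \<in> hom W (fob F (Prod V (fhoms V A prs))) Y" "k \<in> hom W (fob F (Prod V (fhoms V A prs))) Y"
  and e: "!!qs. pathss A qs prs ==>
   h \<cdot>\<^bsub>W\<^esub> far F (prod_map V (map (path_prod V A) qs) (fhoms V A prs) (path_injs V A prs qs)) =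
   k \<cdot>\<^bsub>W\<^esub> far F (prod_map V (map (path_prod V A) qs) (fhoms V A prs) (path_injs V A prs qs))"
 shows "h = k"
proof (rule joint_epi[OF F, where Xs = "fhoms V A prs" and
   I = "\<lambda>r. paths (pts A) (fst (prs ! r)) (snd (prs ! r))" and X = "\<lambda>_. path_prod V A" and j = "\<lambda>r. path_inj V A (fst (prs ! r)) (snd (prs ! r))"])
 fix r assume "r < length (fhoms V A prs)"
 then show "is_coprod V (paths (pts A) (fst (prs ! r)) (snd (prs ! r))) (path_prod V A) (fhoms V A prs ! r)
   (path_inj V A (fst (prs ! r)) (snd (prs ! r)))"
  using fhom_is by (simp add: case_prod_beta)
next
 fix qs assume len: "length qs = length (fhoms V A prs)"
  and q: "!!r. r < length (fhoms V A prs) ==> qs ! r \<in> paths (pts A) (fst (prs ! r)) (snd (prs ! r))"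
 have 1: "pathss A qs prs"
  using len q by (auto simp: all2_nth case_prod_beta)
 have 2: "map (\<lambda>r. path_prod V A (qs ! r)) [0..<length (fhoms V A prs)] = map (path_prod V A) qs"
  "map (\<lambda>r. path_inj V A (fst (prs ! r)) (snd (prs ! r)) (qs ! r)) [0..<length (fhoms V A prs)] = path_injs V A prs qs"
  using len by (auto intro!: nth_equalityI simp: case_prod_beta)
 show "h \<cdot>\<^bsub>W\<^esub> far F (prod_map V (map (\<lambda>r. path_prod V A (qs ! r)) [0..<length (fhoms V A prs)]) (fhoms V A prs)
     (map (\<lambda>r. path_inj V A (fst (prs ! r)) (snd (prs ! r)) (qs ! r)) [0..<length (fhoms V A prs)])) =
  k \<cdot>\<^bsub>W\<^esub> far F (prod_map V (map (\<lambda>r. path_prod V A (qs ! r)) [0..<length (fhoms V A prs)]) (fhoms V A prs)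
     (map (\<lambda>r. path_inj V A (fst (prs ! r)) (snd (prs ! r)) (qs ! r)) [0..<length (fhoms V A prs)]))"
  unfolding 2 by (rule e[OF 1])
qed (rule h)+

text \<open>The analogue for products of hom-objects of \<open>fc A\<close>, by distributivity in
  all factors at once. With \<open>F\<close> the identity it tests associativity in the free
  category and functoriality of extensions; with other \<open>F\<close> it tests maps on nested
  composites.\<close>

lemma fhoms_epi:
 assumes F: "cocont V W F" and prs: "!!a b. (a, b) \<in> set prs ==> a \<in> pts A & b \<in> pts A"
  and h: "h \<in> hom W (fob F (Prod V (fhoms V A prs))) Y" "k \<in> hom W (fob F (Prod V (fhoms V A prs))) Y"
  and e: "!!qs Z fss. pathss A qs prs ==> Z \<in> Ob V ==>
    list_all2 (elems V Z) fss (plegs A qs) ==>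
    h \<cdot>\<^bsub>W\<^esub> far F (tuple V Z (fhoms V A prs) (pels V A Z qs fss)) =
    k \<cdot>\<^bsub>W\<^esub> far F (tuple V Z (fhoms V A prs) (pels V A Z qs fss))"
 shows "h = k"
proof (rule joint_epi_paths[OF F prs h])
 fix qs assume q: "pathss A qs prs"
 let ?m = "prod_map V (map (path_prod V A) qs) (fhoms V A prs) (path_injs V A prs qs)"
 let ?Ps = "map (path_prod V A) qs"
 have len: "length qs = length prs" using q by (rule list_all2_lengthD)
 have ob: "set ?Ps <= Ob V"
  using q path_prod_Ob by (fastforce simp: all2_nth in_set_conv_nth case_prod_beta)
 have obl: "set (legs (hm A) (untup (qs ! r))) <= Ob V" if "r < length qs" for r
  using q that len legs_pre[OF A paths_untup(2)] by (fastforce simp: all2_nth case_prod_beta)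
 \<comment> \<open>The projection to the factor \<open>r\<close> is an arrow into a product of legs,
   hence a tuple; its entries serve as generic elements along the path
   \<open>qs ! r\<close>.\<close>
 have "\<exists>fs. elems V (Prod V ?Ps) fs (legs (hm A) (untup (qs ! r))) & Proj V ?Ps r = tuple V (Prod V ?Ps) (legs (hm A) (untup (qs ! r))) fs" if r: "r < length qs" for r
  using tuple_cases[OF obl[OF r], of "Proj V ?Ps r" "Prod V ?Ps"] Proj_hom[OF ob, of r] r by (auto simp: path_prod_def)
 then obtain fr where fr: "!!r. r < length qs ==> elems V (Prod V ?Ps) (fr r) (legs (hm A) (untup (qs ! r)))"
  "!!r. r < length qs ==> Proj V ?Ps r = tuple V (Prod V ?Ps) (legs (hm A) (untup (qs ! r))) (fr r)" by metis
 define fss where "fss = map fr [0..<length qs]"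
 have fss: "list_all2 (elems V (Prod V ?Ps)) fss (plegs A qs)"
  using fr(1) by (simp add: all2_nth fss_def)
 have "map (Proj V ?Ps) [0..<length ?Ps] = map2 (tuple V (Prod V ?Ps)) (plegs A qs) fss"
  using fr(2) by (intro nth_equalityI) (simp_all add: fss_def)
 then have "?m = tuple V (Prod V ?Ps) (fhoms V A prs) (pels V A (Prod V ?Ps) qs fss)"
  using prod_map_pinj(2)[OF q Prod_Ob[OF ob] fss] tuple_Proj[OF ob] homD[OF prod_map_hom[OF prod_map_pinj(1)[OF q Prod_Ob[OF ob] fss]]] by simp
 then show "h \<cdot>\<^bsub>W\<^esub> far F ?m = k \<cdot>\<^bsub>W\<^esub> far F ?m" using e[OF q Prod_Ob[OF ob] fss] by simp
qed

lemmas fhoms_eqI = fhoms_epi[OF cocont_id[OF category_axioms], unfolded id_fctr_simps]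

subsection \<open>Concatenation of paths\<close>

text \<open>Specified by its effect on formal composites, which is concatenation of paths and of
  their elements. Formal composites are jointly epimorphic, so between points of \<open>A\<close>
  the choice is unique; existence is shown in \<open>fcomp_props\<close>.\<close>

definition fcomp :: "'a cell => 'a cell => 'a cell => 'a arr" where
 "fcomp x y z = (SOME m. m \<in> hom V (Prod V [fhom V A y z, fhom V A x y]) (fhom V A x z) &
   (\<forall>Z as bs fs hs. pth A as --> last as = y --> hd as = z --> pth A bs --> last bs = x --> hd bs = y --> Z \<in> Ob V -->
    elems V Z fs (legs (hm A) as) --> elems V Z hs (legs (hm A) bs) -->
    m \<cdot> tuple V Z [fhom V A y z, fhom V A x y] [pel V A Z as fs, pel V A Z bs hs] = pel V A Z (butlast as @ bs) (fs @ hs)))"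

lemma pth_join: "pth A as ==> pth A bs ==> last as = hd bs ==>
  pth A (butlast as @ bs) & hd (butlast as @ bs) = hd as & last (butlast as @ bs) = last bs"
 by (cases as rule: rev_cases) (auto simp: pth_def hd_append)

lemma fcomp_props:
 "fcomp x y z \<in> hom V (Prod V [fhom V A y z, fhom V A x y]) (fhom V A x z) &
   (\<forall>Z as bs fs hs. pth A as --> last as = y --> hd as = z --> pth A bs --> last bs = x --> hd bs = y --> Z \<in> Ob V -->
    elems V Z fs (legs (hm A) as) --> elems V Z hs (legs (hm A) bs) -->
    fcomp x y z \<cdot> tuple V Z [fhom V A y z, fhom V A x y] [pel V A Z as fs, pel V A Z bs hs] = pel V A Z (butlast as @ bs) (fs @ hs))"
 unfolding fcomp_def
proof (rule someI_ex)
 \<comment> \<open>The required map on the summands of two paths: reassociate the two products into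
   the product along the concatenated path, then include it.\<close>
 let ?f = "\<lambda>q p. path_inj V A x z (Tup (butlast (untup q) @ untup p)) \<cdot> flatten V [legs (hm A) (untup q), legs (hm A) (untup p)]"
 have f: "?f q p \<in> hom V (Prod V [path_prod V A q, path_prod V A p]) (fhom V A x z)"
  "flatten V [legs (hm A) (untup q), legs (hm A) (untup p)] \<in> hom V (Prod V [path_prod V A q, path_prod V A p]) (Prod V (legs (hm A) (butlast (untup q) @ untup p)))"
  "path_inj V A x z (Tup (butlast (untup q) @ untup p)) \<in> hom V (Prod V (legs (hm A) (butlast (untup q) @ untup p))) (fhom V A x z)"
  if q: "q \<in> paths (pts A) y z" and p: "p \<in> paths (pts A) x y" for q p
 proof -
  note uq = paths_untup[OF q] and up = paths_untup[OF p]
  have j: "pth A (butlast (untup q) @ untup p) & hd (butlast (untup q) @ untup p) = z & last (butlast (untup q) @ untup p) = x"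
   using pth_join[OF uq(2) up(2)] uq up by simp
  have l: "legs (hm A) (butlast (untup q) @ untup p) = legs (hm A) (untup q) @ legs (hm A) (untup p)"
   by (rule legs_join) (use uq up in auto)
  show 1: "flatten V [legs (hm A) (untup q), legs (hm A) (untup p)] \<in> hom V (Prod V [path_prod V A q, path_prod V A p]) (Prod V (legs (hm A) (butlast (untup q) @ untup p)))"
   using flatten_hom[of "[legs (hm A) (untup q), legs (hm A) (untup p)]"] legs_pre[OF A uq(2)] legs_pre[OF A up(2)]
   by (simp add: l path_prod_def)
  show 2: "path_inj V A x z (Tup (butlast (untup q) @ untup p)) \<in> hom V (Prod V (legs (hm A) (butlast (untup q) @ untup p))) (fhom V A x z)"
   using pinj_hom[of "butlast (untup q) @ untup p"] j by simp
  show "?f q p \<in> hom V (Prod V [path_prod V A q, path_prod V A p]) (fhom V A x z)" by (rule Comp_hom[OF 1 2])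
 qed
 have "\<exists>m \<in> hom V (Prod V [fhom V A y z, fhom V A x y]) (fhom V A x z).
  \<forall>q \<in> paths (pts A) y z. \<forall>p \<in> paths (pts A) x y. \<forall>Z u v. u \<in> hom V Z (path_prod V A q) --> v \<in> hom V Z (path_prod V A p) -->
   m \<cdot> tuple V Z [fhom V A y z, fhom V A x y] [path_inj V A y z q \<cdot> u, path_inj V A x y p \<cdot> v] = ?f q p \<cdot> tuple V Z [path_prod V A q, path_prod V A p] [u, v]"
  by (rule bin_ex[OF fhom_is fhom_is f(1) fhom_Ob])
 then obtain m where m: "m \<in> hom V (Prod V [fhom V A y z, fhom V A x y]) (fhom V A x z)"
  "!!q p Z u v. q \<in> paths (pts A) y z ==> p \<in> paths (pts A) x y ==> u \<in> hom V Z (path_prod V A q) ==> v \<in> hom V Z (path_prod V A p) ==>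
   m \<cdot> tuple V Z [fhom V A y z, fhom V A x y] [path_inj V A y z q \<cdot> u, path_inj V A x y p \<cdot> v] = ?f q p \<cdot> tuple V Z [path_prod V A q, path_prod V A p] [u, v]"
  by blast
 show "\<exists>m. m \<in> hom V (Prod V [fhom V A y z, fhom V A x y]) (fhom V A x z) &
   (\<forall>Z as bs fs hs. pth A as --> last as = y --> hd as = z --> pth A bs --> last bs = x --> hd bs = y --> Z \<in> Ob V -->
    elems V Z fs (legs (hm A) as) --> elems V Z hs (legs (hm A) bs) -->
    m \<cdot> tuple V Z [fhom V A y z, fhom V A x y] [pel V A Z as fs, pel V A Z bs hs] = pel V A Z (butlast as @ bs) (fs @ hs))"
 proof (intro exI[of _ m] conjI m(1) allI impI)
  fix Z as bs fs hs assume as: "pth A as" "last as = y" "hd as = z" and bs: "pth A bs" "last bs = x" "hd bs = y" and Z: "Z \<in> Ob V"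
   and fs: "elems V Z fs (legs (hm A) as)" and hs: "elems V Z hs (legs (hm A) bs)"
  have q: "Tup as \<in> paths (pts A) y z" and p: "Tup bs \<in> paths (pts A) x y" using as bs by (simp_all add: paths_pth)
  have u: "tuple V Z (legs (hm A) as) fs \<in> hom V Z (path_prod V A (Tup as))" and v: "tuple V Z (legs (hm A) bs) hs \<in> hom V Z (path_prod V A (Tup bs))"
   using tuple_hom[OF Z fs] tuple_hom[OF Z hs] by (simp_all add: path_prod_def)
  have fl: "flatten V [legs (hm A) as, legs (hm A) bs] \<cdot> tuple V Z [path_prod V A (Tup as), path_prod V A (Tup bs)] [tuple V Z (legs (hm A) as) fs, tuple V Z (legs (hm A) bs) hs]
    = tuple V Z (legs (hm A) as @ legs (hm A) bs) (fs @ hs)"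
   using flatten_tuple[OF Z, of "[fs, hs]" "[legs (hm A) as, legs (hm A) bs]"] fs hs by (simp add: path_prod_def)
  have e: "elems V Z [tuple V Z (legs (hm A) as) fs, tuple V Z (legs (hm A) bs) hs] [path_prod V A (Tup as), path_prod V A (Tup bs)]"
   using u v by simp
  have j: "hd (butlast as @ bs) = z" "last (butlast as @ bs) = x" using pth_join[OF as(1) bs(1)] as bs by simp_all
  have l: "legs (hm A) (butlast as @ bs) = legs (hm A) as @ legs (hm A) bs" by (rule legs_join) (use as bs in auto)
  show "m \<cdot> tuple V Z [fhom V A y z, fhom V A x y] [pel V A Z as fs, pel V A Z bs hs] = pel V A Z (butlast as @ bs) (fs @ hs)"
   using m(2)[OF q p u v] Comp_assoc[OF tuple_hom[OF Z e] f(2,3)[OF q p]] fl as bs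
   by (simp add: pel_def j l)
 qed
qed

text \<open>The free \<open>V\<close>-category on \<open>A\<close>. The identity at \<open>x\<close>
  is the summand of the path \<open>[x]\<close>, whose product of legs is the empty product, so it
  has the type required of \<open>idt\<close>.\<close>

definition Fr :: "'a obj" where
 "Fr = CatOb (pts A) (hm (fc_ob V A)) (\<lambda>(x, y, z)\<in>pts A \<times> pts A \<times> pts A. fcomp x y z)
   (\<lambda>x\<in>pts A. path_inj V A x x (Tup [x]))"

lemma Fr_sel [simp]: "pts Fr = pts A" "hm Fr = hm (fc_ob V A)"
 "x \<in> pts A ==> y \<in> pts A ==> z \<in> pts A ==> cmp Fr (x, y, z) = fcomp x y z"
 "x \<in> pts A ==> idt Fr x = path_inj V A x x (Tup [x])"
 by (simp_all add: Fr_def)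

lemma Fr_precat: "is_precat V Fr"
 unfolding is_precat_def
proof (intro conjI ballI)
 show "Fr = CatOb (pts Fr) (hm Fr) (cmp Fr) (idt Fr)" "hm Fr \<in> extensional (pts Fr \<times> pts Fr)"
  "cmp Fr \<in> extensional (pts Fr \<times> pts Fr \<times> pts Fr)" "idt Fr \<in> extensional (pts Fr)"
  by (simp_all add: Fr_def fc_ob_def)
 show "pre_gph V Fr" using fhom_Ob by (simp add: pre_gph_def)
 fix x assume x: "x \<in> pts Fr"
 then show "idt Fr x \<in> hom V (Prod V []) (hm Fr (x, x))" using pinj_hom[of "[x]"] by simp
 fix y z assume "y \<in> pts Fr" "z \<in> pts Fr"
 then show "cmp Fr (x, y, z) \<in> hom V (Prod V [hm Fr (y, z), hm Fr (x, y)]) (hm Fr (x, z))"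
  using x fcomp_props[of x y z] by simp
qed

lemma mul_pel:
 assumes "pth A as" "pth A bs" "last as = hd bs" "Z \<in> Ob V" "elems V Z fs (legs (hm A) as)" "elems V Z hs (legs (hm A) bs)"
 shows "mul V Fr Z (last bs) (hd bs) (hd as) (pel V A Z as fs) (pel V A Z bs hs) = pel V A Z (butlast as @ bs) (fs @ hs)"
 using assms fcomp_props[of "last bs" "hd bs" "hd as"] unfolding mul_def by simp

lemma unt_pel: "x \<in> pts A ==> unt V Fr Z x = pel V A Z [x] []"
 by (simp add: unt_def pel_def)

lemma pel_Fr_hom: "pth A as ==> Z \<in> Ob V ==> elems V Z fs (legs (hm A) as) ==> pel V A Z as fs \<in> hom V Z (hm Fr (last as, hd as))"
 using pel_hom by simp

text \<open>On formal composites \<open>mul\<close> is concatenation, so associativity and the unit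
  laws become identities between lists.\<close>

lemma Fr_vcategory: "is_vcategory V Fr"
proof (rule is_vcategoryI[OF Fr_precat])
 note pc = Fr_precat
 fix w x y z Hs Z assume p: "w \<in> pts Fr" "x \<in> pts Fr" "y \<in> pts Fr" "z \<in> pts Fr"
  and Hs: "Hs = [hm Fr (y, z), hm Fr (x, y), hm Fr (w, x)]" "set Hs <= Ob V" "Z = Prod V Hs"
  and a: "Proj V Hs 0 \<in> hom V Z (hm Fr (y, z))" and b: "Proj V Hs 1 \<in> hom V Z (hm Fr (x, y))"
  and c: "Proj V Hs 2 \<in> hom V Z (hm Fr (w, x))"
 have Hs': "Hs = fhoms V A [(y, z), (x, y), (w, x)]" using Hs p by simp
 note l = mul_hom[OF pc p(1,2,4) mul_hom[OF pc p(2,3,4) a b] c] and r = mul_hom[OF pc p(1,3,4) a mul_hom[OF pc p(1,2,3) b c]]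
 show "mul V Fr Z w x z (mul V Fr Z x y z (Proj V Hs 0) (Proj V Hs 1)) (Proj V Hs 2) =
    mul V Fr Z w y z (Proj V Hs 0) (mul V Fr Z w x y (Proj V Hs 1) (Proj V Hs 2))"
 proof (rule fhoms_eqI[of "[(y, z), (x, y), (w, x)]", folded Hs', OF _ l[unfolded Hs(3)] r[unfolded Hs(3)], folded Hs(3)])
  show "!!a b. (a, b) \<in> set [(y, z), (x, y), (w, x)] ==> a \<in> pts A & b \<in> pts A" using p by auto
  fix qs Y fss assume q: "pathss A qs [(y, z), (x, y), (w, x)]" and Y: "Y \<in> Ob V"
   and fss: "list_all2 (elems V Y) fss (plegs A qs)"
  obtain q1 q2 q3 where qs: "qs = [q1, q2, q3]" "q1 \<in> paths (pts A) y z" "q2 \<in> paths (pts A) x y" "q3 \<in> paths (pts A) w x"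
   using q by (auto simp: list_all2_Cons2)
  obtain f1 f2 f3 where fs: "fss = [f1, f2, f3]" "elems V Y f1 (legs (hm A) (untup q1))" "elems V Y f2 (legs (hm A) (untup q2))" "elems V Y f3 (legs (hm A) (untup q3))"
   using fss by (auto simp: qs(1) list_all2_Cons2)
  note u1 = paths_untup[OF qs(2)] and u2 = paths_untup[OF qs(3)] and u3 = paths_untup[OF qs(4)]
  define e1 e2 e3 where "e1 = pel V A Y (untup q1) f1" and "e2 = pel V A Y (untup q2) f2" and "e3 = pel V A Y (untup q3) f3"
  have el: "elems V Y [e1, e2, e3] Hs"
   using pel_Fr_hom[OF u1(2) Y fs(2)] pel_Fr_hom[OF u2(2) Y fs(3)] pel_Fr_hom[OF u3(2) Y fs(4)] u1 u2 u3
   by (simp add: Hs(1) e1_def e2_def e3_def del: Fr_sel)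
  define t where "t = tuple V Y Hs [e1, e2, e3]"
  have t: "t \<in> hom V Y Z" unfolding t_def Hs(3) by (rule tuple_hom[OF Y el])
  have pr: "Proj V Hs 0 \<cdot> t = e1" "Proj V Hs 1 \<cdot> t = e2" "Proj V Hs 2 \<cdot> t = e3"
   unfolding t_def using Proj_tuple[OF Y el, of 0] Proj_tuple[OF Y el, of 1] Proj_tuple[OF Y el, of 2] by (simp_all add: Hs(1))
  have e12: "elems V Y (f1 @ f2) (legs (hm A) (butlast (untup q1) @ untup q2))"
   using elems_append[OF fs(2,3)] legs_join[of "untup q1" "untup q2" "hm A"] u1 u2 by simp
  have e23: "elems V Y (f2 @ f3) (legs (hm A) (butlast (untup q2) @ untup q3))"
   using elems_append[OF fs(3,4)] legs_join[of "untup q2" "untup q3" "hm A"] u2 u3 by simp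
  have j12: "pth A (butlast (untup q1) @ untup q2) & hd (butlast (untup q1) @ untup q2) = z & last (butlast (untup q1) @ untup q2) = x"
   using pth_join[OF u1(2) u2(2)] u1 u2 by simp
  have j23: "pth A (butlast (untup q2) @ untup q3) & hd (butlast (untup q2) @ untup q3) = y & last (butlast (untup q2) @ untup q3) = w"
   using pth_join[OF u2(2) u3(2)] u2 u3 by simp
  have m12: "mul V Fr Y x y z e1 e2 = pel V A Y (butlast (untup q1) @ untup q2) (f1 @ f2)"
   using mul_pel[OF u1(2) u2(2) _ Y fs(2,3)] u1 u2 by (simp add: e1_def e2_def)
  have m23: "mul V Fr Y w x y e2 e3 = pel V A Y (butlast (untup q2) @ untup q3) (f2 @ f3)"
   using mul_pel[OF u2(2) u3(2) _ Y fs(3,4)] u2 u3 by (simp add: e2_def e3_def)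
  have m123: "mul V Fr Y w x z (mul V Fr Y x y z e1 e2) e3 = pel V A Y (butlast (butlast (untup q1) @ untup q2) @ untup q3) ((f1 @ f2) @ f3)"
   using mul_pel[OF conjunct1[OF j12] u3(2) _ Y e12 fs(4)] j12 u3 by (simp add: m12 e3_def)
  have m123': "mul V Fr Y w y z e1 (mul V Fr Y w x y e2 e3) = pel V A Y (butlast (untup q1) @ (butlast (untup q2) @ untup q3)) (f1 @ (f2 @ f3))"
   using mul_pel[OF u1(2) conjunct1[OF j23] _ Y fs(2) e23] j23 u1 by (simp add: m23 e1_def)
  \<comment> \<open>Needs the middle path to be a nonempty list, so that the outer
    \<open>butlast\<close> acts on it and not on the first path.\<close>
  have bb: "butlast (butlast (untup q1) @ untup q2) @ untup q3 = butlast (untup q1) @ (butlast (untup q2) @ untup q3)"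
   using u2(2) by (simp add: butlast_append)
  have T: "tuple V Y Hs (pels V A Y qs fss) = t" by (simp add: qs fs t_def e1_def e2_def e3_def)
  show "mul V Fr Z w x z (mul V Fr Z x y z (Proj V Hs 0) (Proj V Hs 1)) (Proj V Hs 2) \<cdot> tuple V Y Hs (pels V A Y qs fss) =
    mul V Fr Z w y z (Proj V Hs 0) (mul V Fr Z w x y (Proj V Hs 1) (Proj V Hs 2)) \<cdot> tuple V Y Hs (pels V A Y qs fss)"
   unfolding T mul_comp[OF pc p(1,2,4) mul_hom[OF pc p(2,3,4) a b] c t] mul_comp[OF pc p(1,3,4) a mul_hom[OF pc p(1,2,3) b c] t]
    mul_comp[OF pc p(2,3,4) a b t] mul_comp[OF pc p(1,2,3) b c t] pr m123 m123' bb by simp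
 qed
next
 note pc = Fr_precat
 fix x y H assume p: "x \<in> pts Fr" "y \<in> pts Fr" and H: "H = hm Fr (x, y)" "H \<in> Ob V"
 have p': "x \<in> pts A" "y \<in> pts A" using p by simp_all
 have H': "H = fhom V A x y" using H p' by simp
 have i: "Id V H \<in> hom V H (hm Fr (x, y))" using H Id_hom by simp
 note l = mul_hom[OF pc p(1,2,2) unt_hom[OF pc p(2) H(2)] i] and r = mul_hom[OF pc p(1,1,2) i unt_hom[OF pc p(1) H(2)]]
 have "mul V Fr H x y y (unt V Fr H y) (Id V H) \<cdot> pel V A Z as fs = Id V H \<cdot> pel V A Z as fs &
   mul V Fr H x x y (Id V H) (unt V Fr H x) \<cdot> pel V A Z as fs = Id V H \<cdot> pel V A Z as fs"
  if as: "pth A as" "last as = x" "hd as = y" and Z: "Z \<in> Ob V" and fs: "elems V Z fs (legs (hm A) as)" for Z as fs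
 proof -
  have t: "pel V A Z as fs \<in> hom V Z H" using pel_hom[OF as(1) Z fs] as H' by simp
  have it: "Id V H \<cdot> pel V A Z as fs = pel V A Z as fs" using homD[OF t] by simp
  have "mul V Fr Z x y y (pel V A Z [y] []) (pel V A Z as fs) = pel V A Z as fs"
   using mul_pel[of "[y]" as Z "[]" fs] as Z fs p' by simp
  moreover have "mul V Fr Z x x y (pel V A Z as fs) (pel V A Z [x] []) = pel V A Z as fs"
   using mul_pel[of as "[x]" Z fs "[]"] append_butlast_last_id[of as] as Z fs p' by simp
  ultimately show ?thesis
   unfolding mul_comp[OF pc p(1,2,2) unt_hom[OF pc p(2) H(2)] i t] mul_comp[OF pc p(1,1,2) i unt_hom[OF pc p(1) H(2)] t]
   unfolding unt_comp[OF pc p(2) t] unt_comp[OF pc p(1) t] unfolding unt_pel[OF p'(1)] unt_pel[OF p'(2)] it by simp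
 qed
 then show "mul V Fr H x y y (unt V Fr H y) (Id V H) = Id V H & mul V Fr H x x y (Id V H) (unt V Fr H x) = Id V H"
  using fhom_eqI[of "mul V Fr H x y y (unt V Fr H y) (Id V H)" x y H "Id V H"] fhom_eqI[of "mul V Fr H x x y (Id V H) (unt V Fr H x)" x y H "Id V H"]
   l r i H' H(1) by simp
qed

end

end

subsection \<open>The universal property\<close>

text \<open>The composite in \<open>X\<close> of the images under \<open>G\<close> of a path of elements.\<close>

fun ev :: "('a obj, 'a arr, 'z) pcat_scheme => 'a obj => 'a arr => 'a obj => 'a cell list => 'a arr list => 'a arr" where
 "ev V X G Z (b # a # as) fs = mul V X Z (fn G (last (a # as))) (fn G a) (fn G b)
   (fm G (a, b) \<cdot>\<^bsub>V\<^esub> hd fs) (ev V X G Z (a # as) (tl fs))"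
| "ev V X G Z [a] fs = unt V X Z (fn G a)"
| "ev V X G Z [] fs = undefined"

lemma ev_Cons: "as ~= [] ==> ev V X G Z (b # as) fs = mul V X Z (fn G (last as)) (fn G (hd as)) (fn G b)
   (fm G (hd as, b) \<cdot>\<^bsub>V\<^esub> hd fs) (ev V X G Z as (tl fs))"
 by (cases as) auto

text \<open>\<open>gm\<close> without the conditions on the source and target fields and on
  extensionality of \<open>fm\<close>. A graph map into the underlying graph of \<open>X\<close> can
  thus be used as a map into \<open>X\<close> itself.\<close>

definition gma :: "('a obj, 'a arr, 'z) cat_scheme => 'a obj => 'a obj => 'a arr => bool" where
 "gma V A X G \<longleftrightarrow> fn G \<in> pts A \<rightarrow>\<^sub>E pts X &
   (\<forall>a \<in> pts A. \<forall>b \<in> pts A. fm G (a, b) \<in> hom V (hm A (a, b)) (hm X (fn G a, fn G b)))"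

lemma gmaD:
 assumes "gma V A X G"
 shows "fn G \<in> pts A \<rightarrow>\<^sub>E pts X" "a \<in> pts A ==> fn G a \<in> pts X"
  "a \<in> pts A ==> b \<in> pts A ==> fm G (a, b) \<in> hom V (hm A (a, b)) (hm X (fn G a, fn G b))"
 using assms by (auto simp: gma_def)

lemma gm_gma: "G \<in> gm V A B ==> gma V A B G"
 unfolding gma_def by (intro conjI ballI gmD(2) gm_fm)

lemma elems_legs_Cons:
 assumes "elems V Z fs (legs h (b # a # as))"
 obtains f fs' where "fs = f # fs'" "f \<in> hom V Z (h (a, b))" "elems V Z fs' (legs h (a # as))"
 using assms by (cases fs) auto

context dcat
begin

lemma tuple_Nil: "tuple V (Prod V []) [] [] = Id V (Prod V [])"
 using tuple_Proj[of "[]"] by simp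

context
 fixes A X G assumes A: "pre_gph V A" and X: "is_vcategory V X" and G: "gma V A X G"
begin

lemma ev_hom: "pth A as ==> Z \<in> Ob V ==> elems V Z fs (legs (hm A) as) ==>
  ev V X G Z as fs \<in> hom V Z (hm X (fn G (last as), fn G (hd as)))"
proof (induction as arbitrary: fs rule: induct_list012)
 case (2 x)
 then show ?case using unt_hom[OF vcategory_precat[OF X] gmaD(2)[OF G]] by simp
next
 case (3 b a as)
 obtain f fs' where fs: "fs = f # fs'" "f \<in> hom V Z (hm A (a, b))" "elems V Z fs' (legs (hm A) (a # as))"
  using elems_legs_Cons[OF 3(5)] by metis
 have p: "b \<in> pts A" "a \<in> pts A" "pth A (a # as)" "last (a # as) \<in> pts A" using 3(3) pth_hd[of A "a # as"] by (auto simp: pth_def)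
 have "mul V X Z (fn G (last (a # as))) (fn G a) (fn G b) (fm G (a, b) \<cdot> f) (ev V X G Z (a # as) fs') \<in> hom V Z (hm X (fn G (last (a # as)), fn G b))"
  by (rule mul_hom[OF vcategory_precat[OF X] gmaD(2)[OF G p(4)] gmaD(2)[OF G p(2)] gmaD(2)[OF G p(1)]
     Comp_hom[OF fs(2) gmaD(3)[OF G p(2,1)]]]) (use 3(2)[OF p(3) 3(4) fs(3)] in simp)
 then show ?case by (simp add: fs)
qed simp

lemma ev_comp: "pth A as ==> elems V Z fs (legs (hm A) as) ==> g \<in> hom V W Z ==>
  ev V X G Z as fs \<cdot> g = ev V X G W as (map (\<lambda>f. f \<cdot> g) fs)"
proof (induction as arbitrary: fs rule: induct_list012)
 case (2 x)
 then show ?case using unt_comp[OF vcategory_precat[OF X] gmaD(2)[OF G]] by simp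
next
 case (3 b a as)
 obtain f fs' where fs: "fs = f # fs'" "f \<in> hom V Z (hm A (a, b))" "elems V Z fs' (legs (hm A) (a # as))"
  using elems_legs_Cons[OF 3(4)] by metis
 have p: "b \<in> pts A" "a \<in> pts A" "pth A (a # as)" "last (a # as) \<in> pts A" using 3(3) pth_hd[of A "a # as"] by (auto simp: pth_def)
 have Z: "Z \<in> Ob V" using homA(5)[OF 3(5)] .
 have e: "ev V X G Z (a # as) fs' \<in> hom V Z (hm X (fn G (last (a # as)), fn G a))" using ev_hom[OF p(3) Z fs(3)] by simp
 show ?case
  using mul_comp[OF vcategory_precat[OF X] gmaD(2)[OF G p(4)] gmaD(2)[OF G p(2)] gmaD(2)[OF G p(1)]
     Comp_hom[OF fs(2) gmaD(3)[OF G p(2,1)]] e 3(5)] Comp_assoc[OF 3(5) fs(2) gmaD(3)[OF G p(2,1)]] 3(2)[OF p(3) fs(3) 3(5)]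
  by (simp add: fs)
qed simp

text \<open>Induction on the first path; the step is associativity in \<open>X\<close> and the base
  is the left unit law. This is what makes the extension of \<open>G\<close> compatible with
  composition.\<close>

lemma ev_join: "pth A as ==> pth A bs ==> last as = hd bs ==> Z \<in> Ob V ==> elems V Z fs (legs (hm A) as) ==>
  elems V Z hs (legs (hm A) bs) ==>
  ev V X G Z (butlast as @ bs) (fs @ hs) =
  mul V X Z (fn G (last bs)) (fn G (hd bs)) (fn G (hd as)) (ev V X G Z as fs) (ev V X G Z bs hs)"
proof (induction as arbitrary: fs rule: induct_list012)
 case (2 x)
 then show ?case
  using mul_unt(1)[OF X gmaD(2)[OF G pth_hd(2)[OF 2(2)]] gmaD(2)[OF G pth_hd(1)[OF 2(2)]] ev_hom[OF 2(2,4,6)]] by simp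
next
 case (3 b a as)
 obtain f fs' where fs: "fs = f # fs'" "f \<in> hom V Z (hm A (a, b))" "elems V Z fs' (legs (hm A) (a # as))"
  using elems_legs_Cons[OF 3(7)] by metis
 have p: "b \<in> pts A" "a \<in> pts A" "pth A (a # as)" "last (a # as) \<in> pts A" using 3(3) pth_hd[of A "a # as"] by (auto simp: pth_def)
 have l: "last (a # as) = hd bs" using 3(5) by simp
 note j = pth_join[OF A p(3) 3(4) l]
 note q = gmaD(2)[OF G pth_hd(2)[OF 3(4)]] gmaD(2)[OF G p(4)] gmaD(2)[OF G p(2)] gmaD(2)[OF G p(1)]
 have e1: "ev V X G Z (a # as) fs' \<in> hom V Z (hm X (fn G (last (a # as)), fn G a))" using ev_hom[OF p(3) 3(6) fs(3)] by simp
 have e2: "ev V X G Z bs hs \<in> hom V Z (hm X (fn G (last bs), fn G (last (a # as))))" using ev_hom[OF 3(4,6,8)] l by simp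
 have "ev V X G Z (butlast (b # a # as) @ bs) (fs @ hs) = ev V X G Z (b # (butlast (a # as) @ bs)) (f # (fs' @ hs))" by (simp add: fs)
 also have "\<dots> = mul V X Z (fn G (last bs)) (fn G a) (fn G b) (fm G (a, b) \<cdot> f) (ev V X G Z (butlast (a # as) @ bs) (fs' @ hs))"
  using j ev_Cons[of "butlast (a # as) @ bs" V X G Z b "f # (fs' @ hs)"] 3(4) by simp
 also have "\<dots> = mul V X Z (fn G (last bs)) (fn G a) (fn G b) (fm G (a, b) \<cdot> f)
   (mul V X Z (fn G (last bs)) (fn G (last (a # as))) (fn G a) (ev V X G Z (a # as) fs') (ev V X G Z bs hs))"
  using 3(2)[OF p(3) 3(4) l 3(6) fs(3) 3(8)] l by simp
 also have "\<dots> = mul V X Z (fn G (last bs)) (fn G (last (a # as))) (fn G b)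
   (mul V X Z (fn G (last (a # as))) (fn G a) (fn G b) (fm G (a, b) \<cdot> f) (ev V X G Z (a # as) fs')) (ev V X G Z bs hs)"
  by (rule mul_assoc[OF X q Comp_hom[OF fs(2) gmaD(3)[OF G p(2,1)]] e1 e2, symmetric])
 finally show ?case using l by (simp add: fs)
qed simp

text \<open>On the summand of a path the generic elements, which are the projections, are mapped by
  \<open>G\<close> and composed in \<open>X\<close>.\<close>

definition vext :: "'a arr" where
 "vext = GphAr (Fr A) X (fn G) (\<lambda>(a, b)\<in>pts A \<times> pts A. cotuple V (paths (pts A) a b) (path_prod V A) (hm X (fn G a, fn G b))
   (\<lambda>p. ev V X G (path_prod V A p) (untup p) (map (Proj V (legs (hm A) (untup p))) [0..<length (legs (hm A) (untup p))])))"

lemma vext_sel [simp]: "fn vext = fn G" "src vext = Fr A" "tgt vext = X"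
 by (simp_all add: vext_def)

lemma vext_summand:
 assumes "p \<in> paths (pts A) a b"
 shows "ev V X G (path_prod V A p) (untup p) (map (Proj V (legs (hm A) (untup p))) [0..<length (legs (hm A) (untup p))]) \<in>
  hom V (path_prod V A p) (hm X (fn G a, fn G b))"
 using ev_hom[OF paths_untup(2)[OF assms] path_prod_Ob[OF A assms] elems_projs[OF legs_pre[OF A paths_untup(2)[OF assms]], folded path_prod_def]]
 unfolding paths_untup(3,4)[OF assms] .

lemma hmX_Ob: "a \<in> pts A ==> b \<in> pts A ==> hm X (fn G a, fn G b) \<in> Ob V"
 using is_precatD(3)[OF vcategory_precat[OF X]] gmaD(2)[OF G] by simp

lemma vext_gm: "vext \<in> gm V (Fr A) X"
 unfolding vext_def
proof (rule gmI)
 show "fn G \<in> pts (Fr A) \<rightarrow>\<^sub>E pts X" using gmaD(1)[OF G] Fr_sel(1)[OF A] by simp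
 fix a b assume "a \<in> pts (Fr A)" "b \<in> pts (Fr A)"
 then have ab: "a \<in> pts A" "b \<in> pts A" using Fr_sel(1)[OF A] by simp_all
 show "(\<lambda>(a, b)\<in>pts A \<times> pts A. cotuple V (paths (pts A) a b) (path_prod V A) (hm X (fn G a, fn G b))
   (\<lambda>p. ev V X G (path_prod V A p) (untup p) (map (Proj V (legs (hm A) (untup p))) [0..<length (legs (hm A) (untup p))]))) (a, b)
  \<in> hom V (hm (Fr A) (a, b)) (hm X (fn G a, fn G b))"
  using cotuple_hom[OF vext_summand[of _ a b] hmX_Ob[OF ab]] ab Fr_sel(2)[OF A] by simp
qed (use Fr_sel(1)[OF A] in simp)

lemma vext_pel:
 assumes as: "pth A as" and Z: "Z \<in> Ob V" and fs: "elems V Z fs (legs (hm A) as)"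
 shows "fm vext (last as, hd as) \<cdot> pel V A Z as fs = ev V X G Z as fs"
proof -
 let ?a = "last as" and ?b = "hd as"
 have p: "Tup as \<in> paths (pts A) ?a ?b" using as by (simp add: paths_pth)
 note t = tuple_hom[OF Z fs]
 note ab = pth_hd(2)[OF as] pth_hd(1)[OF as]
 have h: "fm vext (?a, ?b) \<in> hom V (fhom V A ?a ?b) (hm X (fn G ?a, fn G ?b))"
  using gm_fm[OF vext_gm, of ?a ?b] ab Fr_sel(1,2)[OF A] by simp
 have "fm vext (?a, ?b) \<cdot> path_inj V A ?a ?b (Tup as) = ev V X G (path_prod V A (Tup as)) as (map (Proj V (legs (hm A) as)) [0..<length (legs (hm A) as)])"
  using cotuple_Inj[OF vext_summand hmX_Ob[OF ab] p] ab by (simp add: vext_def)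
 then have "fm vext (?a, ?b) \<cdot> pel V A Z as fs = ev V X G (path_prod V A (Tup as)) as (map (Proj V (legs (hm A) as)) [0..<length (legs (hm A) as)]) \<cdot> tuple V Z (legs (hm A) as) fs"
  unfolding pel_def Comp_assoc[OF t pinj_hom[OF A as] h, symmetric] by simp
 also have "\<dots> = ev V X G Z as (map (\<lambda>f. f \<cdot> tuple V Z (legs (hm A) as) fs) (map (Proj V (legs (hm A) as)) [0..<length (legs (hm A) as)]))"
  unfolding path_prod_def cell.sel by (rule ev_comp[OF as elems_projs[OF legs_pre[OF A as]] t])
 also have "map (\<lambda>f. f \<cdot> tuple V Z (legs (hm A) as) fs) (map (Proj V (legs (hm A) as)) [0..<length (legs (hm A) as)]) = fs"
  using Proj_tuple[OF Z fs] elems_length[OF fs] by (intro nth_equalityI) simp_all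
 finally show ?thesis .
qed

text \<open>Compatibility with composition is tested on pairs of formal composites, where
  composition in \<open>Fr A\<close> is concatenation, and \<open>ev_join\<close> evaluates a
  concatenation.\<close>

lemma vext_vfunctor: "is_vfunctor V vext"
proof (rule is_vfunctorI'[OF Fr_precat[OF A] vcategory_precat[OF X] vext_gm])
 note pX = vcategory_precat[OF X] and pF = Fr_precat[OF A]
 note F_sel = Fr_sel[OF A]
 {
  fix x assume "x \<in> pts (Fr A)"
  then have x: "x \<in> pts A" using F_sel by simp
  have "pel V A (Prod V []) [x] [] = path_inj V A x x (Tup [x]) \<cdot> Id V (Prod V [])" by (simp add: pel_def tuple_Nil)
  also have "\<dots> = path_inj V A x x (Tup [x])" using homD[OF pinj_hom[OF A, of "[x]"]] x by simp
  finally have 1: "pel V A (Prod V []) [x] [] = path_inj V A x x (Tup [x])" .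
  have 2: "unt V X (Prod V []) (fn G x) = idt X (fn G x)"
   using homD[OF is_precatD(5)[OF pX gmaD(2)[OF G x]]] by (simp add: unt_def tuple_Nil)
  show "fm vext (x, x) \<cdot> idt (Fr A) x = idt X (fn vext x)"
   using vext_pel[of "[x]" "Prod V []" "[]"] x 1 2 Prod_Ob[of "[]"] F_sel by simp
 }
 fix x y z assume "x \<in> pts (Fr A)" "y \<in> pts (Fr A)" "z \<in> pts (Fr A)"
 then have p: "x \<in> pts A" "y \<in> pts A" "z \<in> pts A" using F_sel by simp_all
 have pf: "x \<in> pts (Fr A)" "y \<in> pts (Fr A)" "z \<in> pts (Fr A)" using p F_sel by simp_all
 note g = gmaD(2)[OF G p(1)] gmaD(2)[OF G p(2)] gmaD(2)[OF G p(3)]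
 let ?H = "[hm (Fr A) (y, z), hm (Fr A) (x, y)]" and ?K = "[hm X (fn vext y, fn vext z), hm X (fn vext x, fn vext y)]"
 have H: "?H = fhoms V A [(y, z), (x, y)]" using p F_sel by simp
 have a: "arrs V [fm vext (y, z), fm vext (x, y)] ?H ?K" using gm_fm[OF vext_gm] pf by simp
 have d: "cmp X (fn vext x, fn vext y, fn vext z) \<in> hom V (Prod V ?K) (hm X (fn vext x, fn vext z))" using is_precatD(4)[OF pX g] by simp
 note c = is_precatD(4)[OF pF pf]
 note fxz = gm_fm[OF vext_gm pf(1,3)]
 note l = Comp_hom[OF c fxz] and r = Comp_hom[OF prod_map_hom[OF a] d]
 show "fm vext (x, z) \<cdot> cmp (Fr A) (x, y, z) = cmp X (fn vext x, fn vext y, fn vext z) \<cdot> prod_map V ?H ?K [fm vext (y, z), fm vext (x, y)]"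
 proof (rule fhoms_eqI[OF A, of "[(y, z), (x, y)]", folded H, OF _ l r])
  show "!!a b. (a, b) \<in> set [(y, z), (x, y)] ==> a \<in> pts A & b \<in> pts A" using p by auto
  fix qs Z fss assume q: "pathss A qs [(y, z), (x, y)]" and Z: "Z \<in> Ob V"
   and fss: "list_all2 (elems V Z) fss (plegs A qs)"
  obtain q1 q2 where qs: "qs = [q1, q2]" "q1 \<in> paths (pts A) y z" "q2 \<in> paths (pts A) x y"
   using q by (auto simp: list_all2_Cons2)
  obtain f1 f2 where fs: "fss = [f1, f2]" "elems V Z f1 (legs (hm A) (untup q1))" "elems V Z f2 (legs (hm A) (untup q2))"
   using fss by (auto simp: qs(1) list_all2_Cons2)
  note u1 = paths_untup[OF qs(2)] and u2 = paths_untup[OF qs(3)]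
  have l12: "last (untup q1) = hd (untup q2)" using u1 u2 by simp
  define e1 e2 where "e1 = pel V A Z (untup q1) f1" and "e2 = pel V A Z (untup q2) f2"
  have el: "elems V Z [e1, e2] ?H"
   using pel_Fr_hom[OF A u1(2) Z fs(2)] pel_Fr_hom[OF A u2(2) Z fs(3)] u1 u2 by (simp add: e1_def e2_def)
  note t = tuple_hom[OF Z el]
  have v: "fm vext (y, z) \<cdot> e1 = ev V X G Z (untup q1) f1" "fm vext (x, y) \<cdot> e2 = ev V X G Z (untup q2) f2"
   using vext_pel[OF u1(2) Z fs(2)] vext_pel[OF u2(2) Z fs(3)] u1 u2 by (simp_all add: e1_def e2_def)
  have m: "cmp (Fr A) (x, y, z) \<cdot> tuple V Z ?H [e1, e2] = pel V A Z (butlast (untup q1) @ untup q2) (f1 @ f2)"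
   using mul_pel[OF A u1(2) u2(2) l12 Z fs(2,3)] u1 u2 by (simp add: mul_def e1_def e2_def)
  have j: "pth A (butlast (untup q1) @ untup q2) & hd (butlast (untup q1) @ untup q2) = z & last (butlast (untup q1) @ untup q2) = x"
   using pth_join[OF A u1(2) u2(2) l12] u1 u2 by simp
  have e12: "elems V Z (f1 @ f2) (legs (hm A) (butlast (untup q1) @ untup q2))"
   using elems_append[OF fs(2,3)] legs_join[of "untup q1" "untup q2" "hm A"] u1 u2 l12 by simp
  have L: "fm vext (x, z) \<cdot> cmp (Fr A) (x, y, z) \<cdot> tuple V Z ?H [e1, e2] =
    mul V X Z (fn G x) (fn G y) (fn G z) (ev V X G Z (untup q1) f1) (ev V X G Z (untup q2) f2)"
   unfolding Comp_assoc[OF t c fxz] m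
   using vext_pel[OF conjunct1[OF j] Z e12] j ev_join[OF u1(2) u2(2) l12 Z fs(2,3)] u1 u2 by simp
  have R: "cmp X (fn vext x, fn vext y, fn vext z) \<cdot> prod_map V ?H ?K [fm vext (y, z), fm vext (x, y)] \<cdot> tuple V Z ?H [e1, e2] =
    mul V X Z (fn G x) (fn G y) (fn G z) (ev V X G Z (untup q1) f1) (ev V X G Z (untup q2) f2)"
   unfolding Comp_assoc[OF t prod_map_hom[OF a] d] prod_map_tuple[OF a Z el] by (simp add: mul_def v)
  have T: "pels V A Z qs fss = [e1, e2]" by (simp add: qs fs e1_def e2_def)
  show "fm vext (x, z) \<cdot> cmp (Fr A) (x, y, z) \<cdot> tuple V Z ?H (pels V A Z qs fss) =
   cmp X (fn vext x, fn vext y, fn vext z) \<cdot> prod_map V ?H ?K [fm vext (y, z), fm vext (x, y)] \<cdot> tuple V Z ?H (pels V A Z qs fss)"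
   unfolding T L R ..
 qed
qed

end

lemma fc_unit_sel [simp]: "a \<in> pts A ==> fn (fc_unit V A) a = a" "src (fc_unit V A) = A" "tgt (fc_unit V A) = fc_ob V A"
 by (simp_all add: fc_unit_def)

lemma fc_unit_pel:
 assumes A: "pre_gph V A" and a: "a \<in> pts A" "b \<in> pts A" and f: "f \<in> hom V Z (hm A (a, b))"
 shows "fm (fc_unit V A) (a, b) \<cdot> f = pel V A Z [b, a] [f]"
proof -
 have H: "hm A (a, b) \<in> Ob V" using homA(5)[OF f] .
 have e: "elems V (hm A (a, b)) [Id V (hm A (a, b))] [hm A (a, b)]" using Id_hom[OF H] by simp
 have j: "path_inj V A a b (Tup [b, a]) \<in> hom V (Prod V [hm A (a, b)]) (fhom V A a b)"
  using pinj_hom[OF A, of "[b, a]"] a by simp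
 show ?thesis
  using Comp_assoc[OF f tuple_hom[OF H e] j] tuple_comp[OF H e f] homD[OF f] a by (simp add: fc_unit_def pel_def)
qed

lemma fc_unit_gm:
 assumes A: "pre_gph V A"
 shows "fc_unit V A \<in> gm V A (fc_ob V A)"
 unfolding fc_unit_def
proof (rule gmI)
 fix a b assume a: "a \<in> pts A" "b \<in> pts A"
 then have H: "hm A (a, b) \<in> Ob V" using A by (simp add: pre_gph_def)
 have e: "elems V (hm A (a, b)) [Id V (hm A (a, b))] [hm A (a, b)]" using Id_hom[OF H] by simp
 show "(\<lambda>(a, b)\<in>pts A \<times> pts A. path_inj V A a b (Tup [b, a]) \<cdot> tuple V (hm A (a, b)) [hm A (a, b)] [Id V (hm A (a, b))]) (a, b)
   \<in> hom V (hm A (a, b)) (hm (fc_ob V A) ((\<lambda>a\<in>pts A. a) a, (\<lambda>a\<in>pts A. a) b))"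
  using Comp_hom[OF tuple_hom[OF H e]] pinj_hom[OF A, of "[b, a]"] a by simp
qed auto

text \<open>A formal composite is a product in \<open>Fr A\<close> of one-step composites, and these
  lie in the image of the unit; so functors that agree on the unit agree on all formal composites,
  by induction on the path.\<close>

lemma vfunctor_Fr_unique:
 assumes A: "pre_gph V A" and X: "is_vcategory V X"
  and h: "h \<in> gm V (Fr A) X" "is_vfunctor V h" and k: "k \<in> gm V (Fr A) X" "is_vfunctor V k"
  and e: "gph_comp V h (fc_unit V A) = gph_comp V k (fc_unit V A)"
 shows "h = k"
proof -
 note F_sel = Fr_sel[OF A]
 note pX = vcategory_precat[OF X] and pF = Fr_precat[OF A]
 note u = fc_unit_gm[OF A]
 have ef: "fn h a = fn k a" if "a \<in> pts A" for a
  using arg_cong[OF e, of "\<lambda>h. fn h a"] that by (simp add: gph_comp_fn[OF u])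
 have ee: "fm h (a, b) \<cdot> fm (fc_unit V A) (a, b) = fm k (a, b) \<cdot> fm (fc_unit V A) (a, b)" if "a \<in> pts A" "b \<in> pts A" for a b
  using arg_cong[OF e, of "\<lambda>h. fm h (a, b)"] that by (simp add: gph_comp_fm[OF u])
 have P: "fm h (last as, hd as) \<cdot> pel V A Z as fs = fm k (last as, hd as) \<cdot> pel V A Z as fs"
  if Z: "Z \<in> Ob V" and "pth A as" "elems V Z fs (legs (hm A) as)" for Z as fs
  using that(2,3)
 proof (induction as arbitrary: fs rule: induct_list012)
  case (2 x)
  then have x: "x \<in> pts A" "x \<in> pts (Fr A)" "fs = []" using F_sel by simp_all
  show ?case
   using vfunctor_unt[OF h(2) pF pX h(1) x(2) Z] vfunctor_unt[OF k(2) pF pX k(1) x(2) Z] unt_pel[OF A x(1), of Z] x ef by simp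
 next
  case (3 b a as)
  obtain f fs' where fs: "fs = f # fs'" "f \<in> hom V Z (hm A (a, b))" "elems V Z fs' (legs (hm A) (a # as))"
   using elems_legs_Cons[OF 3(4)] by metis
  have p: "b \<in> pts A" "a \<in> pts A" "pth A (a # as)" "last (a # as) \<in> pts A" using 3(3) pth_hd[of A "a # as"] by (auto simp: pth_def)
  have pf: "last (a # as) \<in> pts (Fr A)" "a \<in> pts (Fr A)" "b \<in> pts (Fr A)" using p F_sel by simp_all
  have f1: "elems V Z [f] (legs (hm A) [b, a])" "pth A [b, a]" using fs p by simp_all
  have e1: "pel V A Z [b, a] [f] \<in> hom V Z (hm (Fr A) (a, b))" using pel_Fr_hom[OF A f1(2) Z f1(1)] by simp
  have e2: "pel V A Z (a # as) fs' \<in> hom V Z (hm (Fr A) (last (a # as), a))" using pel_Fr_hom[OF A p(3) Z fs(3)] by simp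
  have m: "pel V A Z (b # a # as) fs = mul V (Fr A) Z (last (a # as)) a b (pel V A Z [b, a] [f]) (pel V A Z (a # as) fs')"
   using mul_pel[OF A f1(2) p(3) _ Z f1(1) fs(3)] by (simp add: fs)
  have hab: "fm h (a, b) \<in> hom V (fhom V A a b) (hm X (fn h a, fn h b))" "fm k (a, b) \<in> hom V (fhom V A a b) (hm X (fn k a, fn k b))"
   using gm_fm[OF h(1) pf(2,3)] gm_fm[OF k(1) pf(2,3)] p F_sel by simp_all
  have uab: "fm (fc_unit V A) (a, b) \<in> hom V (hm A (a, b)) (fhom V A a b)" using gm_fm[OF u p(2,1)] p by simp
  have 1: "fm h (a, b) \<cdot> pel V A Z [b, a] [f] = fm k (a, b) \<cdot> pel V A Z [b, a] [f]"
   unfolding fc_unit_pel[OF A p(2,1) fs(2), symmetric] Comp_assoc[OF fs(2) uab hab(1), symmetric] Comp_assoc[OF fs(2) uab hab(2), symmetric]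
   by (simp add: ee[OF p(2,1)])
  have 2: "fm h (last (a # as), a) \<cdot> pel V A Z (a # as) fs' = fm k (last (a # as), a) \<cdot> pel V A Z (a # as) fs'"
   using 3(2)[OF p(3) fs(3)] by simp
  have "fm h (last (a # as), b) \<cdot> pel V A Z (b # a # as) fs = fm k (last (a # as), b) \<cdot> pel V A Z (b # a # as) fs"
   unfolding m vfunctor_mul[OF h(2) pF pX h(1) pf e1 e2] vfunctor_mul[OF k(2) pF pX k(1) pf e1 e2] 1 2
   by (simp only: ef[OF p(1)] ef[OF p(2)] ef[OF p(4)])
  then show ?case by simp
 qed simp
 show ?thesis
 proof (rule gm_eqI[OF h(1) k(1)])
  fix a assume "a \<in> pts (Fr A)" then show "fn h a = fn k a" using ef F_sel by simp
  fix b assume "a \<in> pts (Fr A)" "b \<in> pts (Fr A)"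
  then have ab: "a \<in> pts A" "b \<in> pts A" "a \<in> pts (Fr A)" "b \<in> pts (Fr A)" using F_sel by simp_all
  have hh: "fm h (a, b) \<in> hom V (fhom V A a b) (hm X (fn h a, fn h b))" "fm k (a, b) \<in> hom V (fhom V A a b) (hm X (fn h a, fn h b))"
   using gm_fm[OF h(1) ab(3,4)] gm_fm[OF k(1) ab(3,4)] ab F_sel ef by simp_all
  show "fm h (a, b) = fm k (a, b)"
   by (rule fhom_eqI[OF A hh]) (use P in blast)
 qed
qed

lemma VC_hom: "f \<in> hom (VCatC V) X Y \<longleftrightarrow> f \<in> gm V X Y & is_vcategory V X & is_vcategory V Y & is_vfunctor V f"
 using gphlike.hom_iff[OF VCatC_gphlike] by simp

lemma VC_dcat: "dcat (VCatC V)"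
proof -
 interpret VC: gphlike V "VCatC V" "is_vfunctor V" by (rule VCatC_gphlike)
 show ?thesis by (rule VC.dcat_axioms)
qed

lemma underlying_sel [simp]: "pts (fob underlying X) = pts X" "hm (fob underlying X) = hm X"
 "fn (far underlying f) = fn f" "fm (far underlying f) = fm f"
 "src (far underlying f) = fob underlying (src f)" "tgt (far underlying f) = fob underlying (tgt f)"
 by (simp_all add: underlying_def)

lemma underlying_gph: "is_vcategory V X ==> is_gph V (fob underlying X)"
 using vcategory_precat[of V X] is_precatD(3)[of V X] unfolding underlying_def
 by (auto intro!: is_gphI simp: is_precat_def)

lemma underlying_gm: "f \<in> gm V X Y ==> far underlying f \<in> gm V (fob underlying X) (fob underlying Y)"
proof -
 assume f: "f \<in> gm V X Y"
 show ?thesis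
  unfolding underlying_def fctr.simps gmD(4,5)[OF f]
  by (rule gmI) (use gmD(2,3)[OF f] gm_fm[OF f] in auto)
qed

lemma underlying_functor: "cat_functor (VCatC V) (VGph V) underlying"
proof -
 interpret VC: dcat "VCatC V" by (rule VC_dcat)
 interpret VG: dcat "VGph V" by (rule VGph_dcat[OF dcat_axioms])
 show ?thesis
 proof
  fix X assume "X \<in> Ob (VCatC V)" then show "fob underlying X \<in> Ob (VGph V)" using underlying_gph by simp
  show "far underlying (Id (VCatC V) X) = Id (VGph V) (fob underlying X)"
   by (simp add: underlying_def gph_id_def)
 next
  fix f X Y assume f: "f \<in> hom (VCatC V) X Y"
  then show "far underlying f \<in> hom (VGph V) (fob underlying X) (fob underlying Y)"
   using underlying_gm underlying_gph unfolding VC_hom VGph_hom by blast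
  fix g W assume g: "g \<in> hom (VCatC V) Y W"
  show "far underlying (g \<cdot>\<^bsub>VCatC V\<^esub> f) = far underlying g \<cdot>\<^bsub>VGph V\<^esub> far underlying f"
   by (simp add: underlying_def gph_comp_def)
 qed
qed

lemma underlying_Fr: "pre_gph V A ==> fob underlying (Fr A) = fc_ob V A"
 by (simp add: underlying_def fc_ob_def)

lemma free_universal: "universal_arrows (VGph V) (VCatC V) underlying Fr (fc_unit V) vext"
proof (intro universal_arrows.intro underlying_functor universal_arrows_axioms.intro)
 fix A assume "A \<in> Ob (VGph V)"
 then have A: "pre_gph V A" "is_gph V A" by (simp_all add: is_gph_pre)
 show "Fr A \<in> Ob (VCatC V)" using Fr_vcategory[OF A(1)] by simp
 show "fc_unit V A \<in> hom (VGph V) A (fob underlying (Fr A))"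
  using fc_unit_gm[OF A(1)] A(2) underlying_gph[OF Fr_vcategory[OF A(1)]] underlying_Fr[OF A(1)] by (simp add: VGph_hom)
 fix X assume "X \<in> Ob (VCatC V)" then have X: "is_vcategory V X" by simp
 {
  fix G assume "G \<in> hom (VGph V) A (fob underlying X)"
  then have G': "G \<in> gm V A (fob underlying X)" by (simp add: VGph_hom)
  then have G: "gma V A X G" using gm_gma[OF G'] by (simp add: gma_def)
  show "vext A X G \<in> hom (VCatC V) (Fr A) X"
   using vext_gm[OF A(1) X G] vext_vfunctor[OF A(1) X G] X Fr_vcategory[OF A(1)] by (simp add: VC_hom)
  have v: "far underlying (vext A X G) \<in> gm V (fc_ob V A) (fob underlying X)"
   using underlying_gm[OF vext_gm[OF A(1) X G]] by (simp add: underlying_Fr[OF A(1)])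
  note u = fc_unit_gm[OF A(1)]
  show "far underlying (vext A X G) \<cdot>\<^bsub>VGph V\<^esub> fc_unit V A = G"
   unfolding VGph_sel
  proof (rule gm_eqI[OF gph_comp_gm[OF u v] G'])
   fix a assume a: "a \<in> pts A"
   then show "fn (gph_comp V (far underlying (vext A X G)) (fc_unit V A)) a = fn G a"
    by (simp add: gph_comp_fn[OF u] vext_sel[OF A(1) X G])
   fix b assume b: "b \<in> pts A"
   have H: "hm A (a, b) \<in> Ob V" using A(1) a b by (simp add: pre_gph_def)
   have e: "elems V (hm A (a, b)) [Id V (hm A (a, b))] (legs (hm A) [b, a])" using Id_hom[OF H] by simp
   have p: "pth A [b, a]" using a b by simp
   note g = gmaD(3)[OF G a b]
   have ua: "fm (fc_unit V A) (a, b) = pel V A (hm A (a, b)) [b, a] [Id V (hm A (a, b))]"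
    using fc_unit_pel[OF A(1) a b Id_hom[OF H]] homD[OF gm_fm[OF u a b]] by simp
   have "fm (vext A X G) (a, b) \<cdot> fm (fc_unit V A) (a, b) = ev V X G (hm A (a, b)) [b, a] [Id V (hm A (a, b))]"
    unfolding ua using vext_pel[OF A(1) X G p H e] by simp
   also have "\<dots> = fm G (a, b)"
    using mul_unt(2)[OF X gmaD(2)[OF G a] gmaD(2)[OF G b] g] homD[OF g] by simp
   finally show "fm (gph_comp V (far underlying (vext A X G)) (fc_unit V A)) (a, b) = fm G (a, b)"
    using a b by (simp add: gph_comp_fm[OF u])
  qed
 }
 fix h k assume h: "h \<in> hom (VCatC V) (Fr A) X" and k: "k \<in> hom (VCatC V) (Fr A) X"
  and e: "far underlying h \<cdot>\<^bsub>VGph V\<^esub> fc_unit V A = far underlying k \<cdot>\<^bsub>VGph V\<^esub> fc_unit V A"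
 have h': "h \<in> gm V (Fr A) X" "is_vfunctor V h" and k': "k \<in> gm V (Fr A) X" "is_vfunctor V k" using h k by (simp_all add: VC_hom)
 \<comment> \<open>An arrow into \<open>X\<close> and its image under \<open>underlying\<close>
   differ, after composing with the unit, only in the target field; the equation for the underlying
   maps can therefore be lifted.\<close>
 have c: "gph_comp V f (fc_unit V A) = GphAr (src (fc_unit V A)) (tgt f) (fn (gph_comp V (far underlying f) (fc_unit V A))) (fm (gph_comp V (far underlying f) (fc_unit V A)))" for f
  by (simp add: gph_comp_def)
 have "gph_comp V h (fc_unit V A) = gph_comp V k (fc_unit V A)"
  unfolding c[of h] c[of k] using e gmD(5)[OF h'(1)] gmD(5)[OF k'(1)] by simp
 then show "h = k" by (rule vfunctor_Fr_unique[OF A(1) X h' k'])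
qed

end

section \<open>The monad \<open>fc\<close>\<close>

lemma (in fprod) prod_tuples_ext:
 assumes ob: "set (concat Xss) <= Ob V" and h: "h \<in> hom V (Prod V (map (Prod V) Xss)) Y" "k \<in> hom V (Prod V (map (Prod V) Xss)) Y"
  and e: "!!Z fss. Z \<in> Ob V ==> list_all2 (elems V Z) fss Xss ==>
   h \<cdot> tuple V Z (map (Prod V) Xss) (map2 (tuple V Z) Xss fss) = k \<cdot> tuple V Z (map (Prod V) Xss) (map2 (tuple V Z) Xss fss)"
 shows "h = k"
proof -
 have obr: "set (Xss ! r) <= Ob V" if "r < length Xss" for r using ob that by (force simp: subset_iff)
 have ob': "set (map (Prod V) Xss) <= Ob V" using ob by (auto intro!: Prod_Ob)
 show ?thesis
 proof (rule prod_ext[OF ob' h])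
  fix Z es assume Z: "Z \<in> Ob V" and es: "elems V Z es (map (Prod V) Xss)"
  have "\<exists>fs. elems V Z fs (Xss ! r) & es ! r = tuple V Z (Xss ! r) fs" if r: "r < length Xss" for r
   using tuple_cases[OF obr[OF r], of "es ! r" Z] elems_nth[OF es, of r] r by auto
  then obtain fr where fr: "!!r. r < length Xss ==> elems V Z (fr r) (Xss ! r)"
   "!!r. r < length Xss ==> es ! r = tuple V Z (Xss ! r) (fr r)" by metis
  define fss where "fss = map fr [0..<length Xss]"
  have fss: "list_all2 (elems V Z) fss Xss"
   using fr(1) by (simp add: all2_nth fss_def)
  have es': "es = map2 (tuple V Z) Xss fss"
   using fr(2) elems_length[OF es] by (intro nth_equalityI) (simp_all add: fss_def)
  show "h \<cdot> tuple V Z (map (Prod V) Xss) es = k \<cdot> tuple V Z (map (Prod V) Xss) es"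
   unfolding es' by (rule e[OF Z fss])
 qed
qed

text \<open>The list underlying \<open>join\<close>. Dropping the last entry of each inner path
  removes the repeated vertices, and the start of the whole path is put back at the end.\<close>

definition jn :: "'a cell list => 'a cell list => 'a cell list" where
 "jn as qs = concat (map (butlast \<circ> untup) qs) @ [last as]"

definition nest :: "'a obj => 'a cell list => 'a cell list => bool" where
 "nest A as qs \<longleftrightarrow> list_all2 (\<in>) qs (legs (\<lambda>(x, y). paths (pts A) x y) as)"

lemma join_jn: "join as qs = Tup (jn as qs)"
 by (simp add: join_def jn_def)

lemma nest_prs: "nest A as qs \<longleftrightarrow> pathss A qs (steps as)"
proof -
 have "legs (\<lambda>(x, y). paths (pts A) x y) as = map (\<lambda>(x, y). paths (pts A) x y) (steps as)"
  by (simp add: legs_map_out)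
 then show ?thesis unfolding nest_def by (simp add: list_all2_map2 case_prod_unfold)
qed

lemma nest_simps: "nest A [a] qs \<longleftrightarrow> qs = []"
 "nest A (b # a # as) qs \<longleftrightarrow> (\<exists>q qs'. qs = q # qs' & q \<in> paths (pts A) a b & nest A (a # as) qs')"
 by (auto simp: nest_def list_all2_Cons2)

lemma jn_Cons: "jn (b # a # as) (q # qs) = butlast (untup q) @ jn (a # as) qs"
 by (simp add: jn_def)

lemma set_legs_pairs: "pth A as ==> (a, b) \<in> set (steps as) ==> a \<in> pts A & b \<in> pts A"
 by (induction as rule: induct_list012) (auto simp: pth_def)

context dcat
begin

definition Free :: "'a endo" where
 "Free = universal_arrows.Ff (VGph V) Fr (fc_unit V) vext"

definition freecou :: "'a obj => 'a arr" where
 "freecou = universal_arrows.cou (VGph V) underlying vext"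

lemma free_adjunction: "adjunction (VGph V) (VCatC V) Free underlying (fc_unit V) freecou"
 unfolding Free_def freecou_def by (rule universal_arrows.adjunction[OF free_universal])

lemma Free_sel [simp]: "fob Free A = Fr A"
 "far Free f = vext (src f) (Fr (tgt f)) (gph_comp V (fc_unit V (tgt f)) f)"
 unfolding Free_def universal_arrows.Ff_def[OF free_universal] by simp_all

lemma freecou_eq: "freecou X = vext (fob underlying X) X (gph_id V (fob underlying X))"
 unfolding freecou_def universal_arrows.cou_def[OF free_universal] by simp

lemma fc_pre: "pre_gph V A ==> pre_gph V (fc_ob V A)"
 using fhom_Ob by (simp add: pre_gph_def)

lemma arrs_legs:
 assumes f: "f \<in> gm V A B"
 shows "pth A as ==> arrs V (legs (fm f) as) (legs (hm A) as) (legs (hm B) (map (fn f) as)) & pth B (map (fn f) as)"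
proof (induction as rule: induct_list012)
 case (2 x)
 then show ?case using gm_fn[OF f] by simp
next
 case (3 b a as)
 then have p: "b \<in> pts A" "a \<in> pts A" "pth A (a # as)" by (auto simp: pth_def)
 show ?case using 3(2)[OF p(3)] gm_fm[OF f p(2,1)] gm_fn[OF f p(1)] p by simp
qed simp

lemma fc_ar_summand:
 assumes f: "f \<in> gm V A B" and A: "pre_gph V A" and B: "pre_gph V B" and p: "p \<in> paths (pts A) a b"
 shows "path_inj V B (fn f a) (fn f b) (Tup (map (fn f) (untup p))) \<cdot>
   prod_map V (legs (hm A) (untup p)) (legs (hm B) (map (fn f) (untup p))) (legs (fm f) (untup p))
   \<in> hom V (path_prod V A p) (fhom V B (fn f a) (fn f b))"
proof -
 note u = paths_untup[OF p] and l = arrs_legs[OF f paths_untup(2)[OF p]]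
 have ne: "untup p ~= []" using u(2) by auto
 show ?thesis
  using Comp_hom[OF prod_map_hom[OF conjunct1[OF l]] pinj_hom[OF B conjunct2[OF l]]] u ne
  by (simp add: path_prod_def last_map hd_map)
qed

lemma fc_ar_sel:
 assumes f: "f \<in> gm V A B"
 shows "fc_ar V f = GphAr (fc_ob V A) (fc_ob V B) (fn f)
    (\<lambda>(a, b)\<in>pts A \<times> pts A.
      cotuple V (paths (pts A) a b) (path_prod V A) (hm (fc_ob V B) (fn f a, fn f b))
       (\<lambda>p. path_inj V B (fn f a) (fn f b) (Tup (map (fn f) (untup p))) \<cdot>
         prod_map V (legs (hm A) (untup p)) (legs (hm B) (map (fn f) (untup p)))
          (legs (fm f) (untup p))))"
 unfolding fc_ar_def Let_def gmD(4,5)[OF f] ..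

lemma fc_ar_gm:
 assumes f: "f \<in> gm V A B" and A: "pre_gph V A" and B: "pre_gph V B"
 shows "fc_ar V f \<in> gm V (fc_ob V A) (fc_ob V B)" "fn (fc_ar V f) = fn f"
proof -
 show "fn (fc_ar V f) = fn f" unfolding fc_ar_sel[OF f] by simp
 show "fc_ar V f \<in> gm V (fc_ob V A) (fc_ob V B)"
  unfolding fc_ar_sel[OF f]
 proof (rule gmI)
  show "fn f \<in> pts (fc_ob V A) \<rightarrow>\<^sub>E pts (fc_ob V B)" using gmD(2)[OF f] by simp
  fix a b assume "a \<in> pts (fc_ob V A)" "b \<in> pts (fc_ob V A)"
  then have ab: "a \<in> pts A" "b \<in> pts A" by simp_all
  show "(\<lambda>(a, b)\<in>pts A \<times> pts A.
      cotuple V (paths (pts A) a b) (path_prod V A) (hm (fc_ob V B) (fn f a, fn f b))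
       (\<lambda>p. path_inj V B (fn f a) (fn f b) (Tup (map (fn f) (untup p))) \<cdot>
         prod_map V (legs (hm A) (untup p)) (legs (hm B) (map (fn f) (untup p)))
          (legs (fm f) (untup p)))) (a, b) \<in> hom V (hm (fc_ob V A) (a, b)) (hm (fc_ob V B) (fn f a, fn f b))"
   using cotuple_hom[OF fc_ar_summand[OF f A B, of _ a b] fhom_Ob[OF B]] ab gm_fn[OF f] by simp
 qed simp
qed

lemma fc_ar_pinj:
 assumes f: "f \<in> gm V A B" and A: "pre_gph V A" and B: "pre_gph V B" and as: "pth A as"
 shows "fm (fc_ar V f) (last as, hd as) \<cdot> pinj V A as =
  path_inj V B (fn f (last as)) (fn f (hd as)) (Tup (map (fn f) as)) \<cdot> prod_map V (legs (hm A) as) (legs (hm B) (map (fn f) as)) (legs (fm f) as)"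
proof -
 have p: "Tup as \<in> paths (pts A) (last as) (hd as)" using as by (simp add: paths_pth)
 note ab = pth_hd(2)[OF as] pth_hd(1)[OF as]
 show ?thesis
  unfolding fc_ar_sel[OF f] using cotuple_Inj[OF fc_ar_summand[OF f A B, of _ "last as" "hd as"] fhom_Ob[OF B] p] ab gm_fn[OF f] by simp
qed

lemma fc_ar_pel:
 assumes f: "f \<in> gm V A B" and A: "pre_gph V A" and B: "pre_gph V B" and as: "pth A as" and Z: "Z \<in> Ob V"
  and fs: "elems V Z fs (legs (hm A) as)"
 shows "fm (fc_ar V f) (last as, hd as) \<cdot> pel V A Z as fs = pel V B Z (map (fn f) as) (comps V (legs (fm f) as) fs)"
proof -
 note l = arrs_legs[OF f as]
 note t = tuple_hom[OF Z fs]
 have ne: "as ~= []" using as by auto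
 have h: "fm (fc_ar V f) (last as, hd as) \<in> hom V (fhom V A (last as) (hd as)) (fhom V B (fn f (last as)) (fn f (hd as)))"
  using gm_fm[OF fc_ar_gm(1)[OF f A B], of "last as" "hd as"] as gm_fn[OF f] by (simp add: fc_ar_gm(2)[OF f A B])
 have j: "path_inj V B (fn f (last as)) (fn f (hd as)) (Tup (map (fn f) as)) \<in> hom V (Prod V (legs (hm B) (map (fn f) as))) (fhom V B (fn f (last as)) (fn f (hd as)))"
  using pinj_hom[OF B conjunct2[OF l]] ne by (simp add: last_map hd_map)
 show ?thesis
  unfolding pel_def Comp_assoc[OF t pinj_hom[OF A as] h, symmetric] fc_ar_pinj[OF f A B as]
   Comp_assoc[OF t prod_map_hom[OF conjunct1[OF l]] j] prod_map_tuple[OF conjunct1[OF l] Z fs]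
  using ne by (simp add: last_map hd_map)
qed

text \<open>Identifies, on formal composites, the action on arrows forced by the universal property
  with the explicit \<open>fc_ar\<close>: each step of the path contributes a one-step composite,
  and these concatenate.\<close>

lemma ev_unit_comp:
 assumes f: "f \<in> gm V A B" and A: "pre_gph V A" and B: "pre_gph V B" and Z: "Z \<in> Ob V"
 shows "pth A as ==> elems V Z fs (legs (hm A) as) ==>
  ev V (Fr B) (gph_comp V (fc_unit V B) f) Z as fs = pel V B Z (map (fn f) as) (comps V (legs (fm f) as) fs)"
proof (induction as arbitrary: fs rule: induct_list012)
 case (2 x)
 then show ?case using gm_fn[OF f, of x] unt_pel[OF B, of "fn f x" Z] by (simp add: gph_comp_fn[OF f])
next
 case (3 b a as)
 obtain g fs' where fs: "fs = g # fs'" "g \<in> hom V Z (hm A (a, b))" "elems V Z fs' (legs (hm A) (a # as))"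
  using elems_legs_Cons[OF 3(4)] by metis
 have p: "b \<in> pts A" "a \<in> pts A" "pth A (a # as)" "last (a # as) \<in> pts A" using 3(3) pth_hd[of A "a # as"] by (auto simp: pth_def)
 note q = gm_fn[OF f p(1)] gm_fn[OF f p(2)] gm_fn[OF f p(4)]
 note l = arrs_legs[OF f p(3)]
 have fg: "fm f (a, b) \<cdot> g \<in> hom V Z (hm B (fn f a, fn f b))" by (rule Comp_hom[OF fs(2) gm_fm[OF f p(2,1)]])
 have 1: "fm (gph_comp V (fc_unit V B) f) (a, b) \<cdot> g = pel V B Z [fn f b, fn f a] [fm f (a, b) \<cdot> g]"
  using Comp_assoc[OF fs(2) gm_fm[OF f p(2,1)] gm_fm[OF fc_unit_gm[OF B] q(2,1)]] fc_unit_pel[OF B q(2,1) fg] p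
  by (simp add: gph_comp_fm[OF f])
 have e1: "elems V Z [fm f (a, b) \<cdot> g] (legs (hm B) [fn f b, fn f a])" "pth B [fn f b, fn f a]" using fg q by simp_all
 have e2: "elems V Z (comps V (legs (fm f) (a # as)) fs') (legs (hm B) (map (fn f) (a # as)))"
  by (rule elems_map2[OF fs(3) conjunct1[OF l]])
 have lm: "last (map (fn f) (a # as)) = fn f (last (a # as))" by (simp add: last_map)
 have gfn: "fn (gph_comp V (fc_unit V B) f) x = fn f x" if "x \<in> pts A" for x using that gm_fn[OF f that] by (simp add: gph_comp_fn[OF f])
 have IH: "ev V (Fr B) (gph_comp V (fc_unit V B) f) Z (a # as) fs' = pel V B Z (map (fn f) (a # as)) (comps V (legs (fm f) (a # as)) fs')"
  by (rule 3(2)[OF p(3) fs(3)])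
 have "ev V (Fr B) (gph_comp V (fc_unit V B) f) Z (b # a # as) fs =
   mul V (Fr B) Z (fn f (last (a # as))) (fn f a) (fn f b) (pel V B Z [fn f b, fn f a] [fm f (a, b) \<cdot> g])
    (pel V B Z (map (fn f) (a # as)) (comps V (legs (fm f) (a # as)) fs'))"
  unfolding fs(1) ev.simps list.sel gfn[OF p(1)] gfn[OF p(2)] gfn[OF p(4)] IH 1 ..
 also have "\<dots> = pel V B Z (butlast [fn f b, fn f a] @ map (fn f) (a # as)) ([fm f (a, b) \<cdot> g] @ comps V (legs (fm f) (a # as)) fs')"
  using mul_pel[OF B e1(2) conjunct2[OF l] _ Z e1(1) e2] lm by simp
 finally show ?case by (simp add: fs)
qed simp

lemma fc_fctr_eq: "fctr_eq (VGph V) (underlying \<odot> Free) (Fun (fc V))"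
 unfolding fctr_eq_def
proof (intro conjI ballI)
 fix A assume "A \<in> Ob (VGph V)"
 then show "fob (underlying \<odot> Free) A = mob (fc V) A"
  using underlying_Fr[OF is_gph_pre] by (simp add: fc_def)
next
 fix f assume "f \<in> Ar (VGph V)"
 then obtain A B where f: "f \<in> gm V A B" and A: "is_gph V A" and B: "is_gph V B" by (auto simp: VGph_def gm_def)
 note pA = is_gph_pre[OF A] and pB = is_gph_pre[OF B]
 let ?G = "gph_comp V (fc_unit V B) f"
 have G: "gma V A (Fr B) ?G"
  using gm_gma[OF gph_comp_gm[OF f fc_unit_gm[OF pB]]] Fr_sel(1,2)[OF pB] by (simp add: gma_def)
 have v: "far underlying (vext A (Fr B) ?G) \<in> gm V (fc_ob V A) (fc_ob V B)"
  using underlying_gm[OF vext_gm[OF pA Fr_vcategory[OF pB] G]] by (simp add: underlying_Fr pA pB)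
 have gfn: "fn ?G x = fn f x" if "x \<in> pts A" for x using that gm_fn[OF f that] by (simp add: gph_comp_fn[OF f])
 have "far underlying (vext A (Fr B) ?G) = fc_ar V f"
 proof (rule gm_eqI[OF v fc_ar_gm(1)[OF f pA pB]])
  fix a assume "a \<in> pts (fc_ob V A)"
  then show "fn (far underlying (vext A (Fr B) ?G)) a = fn (fc_ar V f) a"
   using gfn by (simp add: fc_ar_gm(2)[OF f pA pB] vext_sel[OF pA Fr_vcategory[OF pB] G])
  fix b assume "a \<in> pts (fc_ob V A)" "b \<in> pts (fc_ob V A)"
  then have ab: "a \<in> pts A" "b \<in> pts A" by simp_all
  show "fm (far underlying (vext A (Fr B) ?G)) (a, b) = fm (fc_ar V f) (a, b)"
  proof (rule fhom_eqI[OF pA, of _ a b "fhom V B (fn f a) (fn f b)"])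
   show "fm (fc_ar V f) (a, b) \<in> hom V (fhom V A a b) (fhom V B (fn f a) (fn f b))"
    using gm_fm[OF fc_ar_gm(1)[OF f pA pB], of a b] ab gm_fn[OF f] by (simp add: fc_ar_gm(2)[OF f pA pB])
   show "fm (far underlying (vext A (Fr B) ?G)) (a, b) \<in> hom V (fhom V A a b) (fhom V B (fn f a) (fn f b))"
    using gm_fm[OF v, of a b] ab gm_fn[OF f] by (simp add: gfn vext_sel[OF pA Fr_vcategory[OF pB] G])
   fix Z as fs assume as: "pth A as" "last as = a" "hd as = b" and Z: "Z \<in> Ob V" and fs: "elems V Z fs (legs (hm A) as)"
   show "fm (far underlying (vext A (Fr B) ?G)) (a, b) \<cdot> pel V A Z as fs = fm (fc_ar V f) (a, b) \<cdot> pel V A Z as fs"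
    using vext_pel[OF pA Fr_vcategory[OF pB] G as(1) Z fs] ev_unit_comp[OF f pA pB Z as(1) fs] fc_ar_pel[OF f pA pB as(1) Z fs]
    unfolding as by simp
  qed
 qed
 then show "far (underlying \<odot> Free) f = mar (fc V) f" by (simp add: fc_def gmD(4,5)[OF f])
qed

lemma jn_props:
 assumes A: "pre_gph V A"
 shows "pth A as ==> nest A as qs ==> pth A (jn as qs) & hd (jn as qs) = hd as & last (jn as qs) = last as &
   legs h (jn as qs) = concat (map (legs h \<circ> untup) qs)"
proof (induction as arbitrary: qs rule: induct_list012)
 case (2 x)
 then show ?case by (simp add: nest_simps jn_def)
next
 case (3 b a as)
 obtain q qs' where q: "qs = q # qs'" "q \<in> paths (pts A) a b" "nest A (a # as) qs'" using 3(4) by (auto simp: nest_simps)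
 have "pth A (a # as)" using 3(3) by (auto simp: pth_def)
 note IH = 3(2)[OF this q(3)]
 note u = paths_untup[OF q(2)]
 have l: "last (untup q) = hd (jn (a # as) qs')" using IH u by simp
 show ?case
  using pth_join[OF A u(2) conjunct1[OF IH] l] legs_join[OF pth_hd(3)[OF u(2)] pth_hd(3)[OF conjunct1[OF IH]] l, of h] IH u(2) u(4)
  by (simp add: q(1) jn_Cons)
qed simp

lemma nest_elems:
 assumes A: "pre_gph V A" and Z: "Z \<in> Ob V"
 shows "pth A as ==> nest A as qs ==> list_all2 (elems V Z) fss (plegs A qs) ==>
  elems V Z (pels V A Z qs fss) (legs (hm (fc_ob V A)) as)"
proof (induction as arbitrary: qs fss rule: induct_list012)
 case (3 b a as)
 obtain q qs' where q: "qs = q # qs'" "q \<in> paths (pts A) a b" "nest A (a # as) qs'" using 3(4) by (auto simp: nest_simps)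
 obtain fs fss' where fs: "fss = fs # fss'" "elems V Z fs (legs (hm A) (untup q))" "list_all2 (elems V Z) fss' (plegs A qs')"
  using 3(5) by (auto simp: q(1) list_all2_Cons2 comp_def)
 have p: "pth A (a # as)" "a \<in> pts A" "b \<in> pts A" using 3(3) by (auto simp: pth_def)
 note u = paths_untup[OF q(2)]
 show ?case using 3(2)[OF p(1) q(3) fs(3)] pel_hom[OF A u(2) Z fs(2)] u p by (simp add: q fs)
qed (auto simp: nest_simps)

text \<open>Composing the inner paths in \<open>Fr A\<close> concatenates them, so extending the
  identity along a nested composite flattens it.\<close>

lemma ev_nest:
 assumes A: "pre_gph V A" and Z: "Z \<in> Ob V"
 shows "pth A as ==> nest A as qs ==> list_all2 (elems V Z) fss (plegs A qs) ==>
  ev V (Fr A) (gph_id V (fc_ob V A)) Z as (pels V A Z qs fss) = pel V A Z (jn as qs) (concat fss)"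
proof (induction as arbitrary: qs fss rule: induct_list012)
 case (2 x)
 then have qs: "qs = []" "fss = []" and x: "x \<in> pts A" by (simp_all add: nest_simps)
 show ?case using unt_pel[OF A x, of Z] x by (simp add: qs jn_def gph_id_fn)
next
 case (3 b a as)
 obtain q qs' where q: "qs = q # qs'" "q \<in> paths (pts A) a b" "nest A (a # as) qs'" using 3(4) by (auto simp: nest_simps)
 obtain fs fss' where fs: "fss = fs # fss'" "elems V Z fs (legs (hm A) (untup q))" "list_all2 (elems V Z) fss' (plegs A qs')"
  using 3(5) by (auto simp: q(1) list_all2_Cons2 comp_def)
 have p: "pth A (a # as)" "a \<in> pts A" "b \<in> pts A" "last (a # as) \<in> pts A" using 3(3) pth_hd[of A "a # as"] by (auto simp: pth_def)
 note u = paths_untup[OF q(2)]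
 note j = jn_props[OF A p(1) q(3), of "hm A"]
 have l: "last (untup q) = hd (jn (a # as) qs')" using j u by simp
 have e: "elems V Z (concat fss') (legs (hm A) (jn (a # as) qs'))" using elems_concat[OF fs(3)] j by simp
 have g: "fn (gph_id V (fc_ob V A)) x = x" if "x \<in> pts A" for x using that by (simp add: gph_id_fn)
 have i: "fm (gph_id V (fc_ob V A)) (a, b) \<cdot> pel V A Z (untup q) fs = pel V A Z (untup q) fs"
  using homD[OF pel_hom[OF A u(2) Z fs(2)]] p u by (simp add: gph_id_fm)
 have "ev V (Fr A) (gph_id V (fc_ob V A)) Z (b # a # as) (pels V A Z qs fss) =
   mul V (Fr A) Z (last (a # as)) a b (pel V A Z (untup q) fs) (pel V A Z (jn (a # as) qs') (concat fss'))"
  unfolding ev.simps g[OF p(2)] g[OF p(3)] g[OF p(4)] using i 3(2)[OF p(1) q(3) fs(3)] by (simp add: q fs)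
 also have "\<dots> = pel V A Z (butlast (untup q) @ jn (a # as) qs') (fs @ concat fss')"
  using mul_pel[OF A u(2) conjunct1[OF j] l Z fs(2) e] j u by simp
 finally show ?case by (simp add: q fs jn_Cons)
qed simp

context
 fixes A assumes A: "is_gph V A"
begin

lemma A_pre: "pre_gph V A"
 using A by (rule is_gph_pre)

lemma id_gma: "gma V (fc_ob V A) (Fr A) (gph_id V (fc_ob V A))"
 using gm_gma[OF gph_id_gm[OF fc_pre[OF A_pre]]] Fr_sel(1,2)[OF A_pre] by (simp add: gma_def)

text \<open>The counit of the free category adjunction at \<open>Fr A\<close>; its underlying graph
  map is the candidate for the multiplication of \<open>fc\<close>.\<close>

abbreviation (input) mu :: "'a arr" where "mu \<equiv> vext (fc_ob V A) (Fr A) (gph_id V (fc_ob V A))"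

lemma mu_gm: "mu \<in> gm V (Fr (fc_ob V A)) (Fr A)"
 by (rule vext_gm[OF fc_pre[OF A_pre] Fr_vcategory[OF A_pre] id_gma])

lemma mu_hom: "a \<in> pts A ==> b \<in> pts A ==> fm mu (a, b) \<in> hom V (fhom V (fc_ob V A) a b) (fhom V A a b)"
 using gm_fm[OF mu_gm, of a b] Fr_sel(1,2)[OF A_pre] Fr_sel(1,2)[OF fc_pre[OF A_pre]]
 by (simp add: vext_sel[OF fc_pre[OF A_pre] Fr_vcategory[OF A_pre] id_gma] gph_id_fn)

lemma mu_pel:
 assumes as: "pth A as" and q: "nest A as qs" and Z: "Z \<in> Ob V" and fss: "list_all2 (elems V Z) fss (plegs A qs)"
 shows "fm mu (last as, hd as) \<cdot> pel V (fc_ob V A) Z as (pels V A Z qs fss) = pel V A Z (jn as qs) (concat fss)"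
proof -
 have "pth (fc_ob V A) as" using as by (simp add: pth_def)
 from vext_pel[OF fc_pre[OF A_pre] Fr_vcategory[OF A_pre] id_gma this Z nest_elems[OF A_pre Z as q fss]]
 show ?thesis by (simp only: ev_nest[OF A_pre Z as q fss])
qed

lemma nest_legs: "pth A as ==> legs (hm (fc_ob V A)) as = fhoms V A (steps as)"
 unfolding legs_map_out by (rule legs_cong) auto

lemma nest_injs: "map2 (\<lambda>j q. j q) (legs (\<lambda>(x, y). path_inj V A x y) as) qs = path_injs V A (steps as) qs"
proof -
 have "legs (\<lambda>(x, y). path_inj V A x y) as = map (\<lambda>(x, y). path_inj V A x y) (steps as)"
  by (simp add: legs_map_out)
 then show ?thesis by (simp add: zip_map1 case_prod_beta comp_def)
qed

lemma nest_Ob: "nest A as qs ==> set (concat (plegs A qs)) <= Ob V"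
 using legs_pre[OF A_pre paths_untup(2)] unfolding nest_prs
 by (fastforce simp: all2_nth in_set_conv_nth case_prod_beta)

text \<open>This is the property by which \<open>fc_mult_hom\<close> is described. Both sides are
  arrows out of a product of products and are compared on tuples of tuples, where
  \<open>flatten\<close> is concatenation.\<close>

lemma mu_prod_map:
 assumes as: "pth A as" "last as = a" "hd as = b" and q: "nest A as qs"
 shows "fm mu (a, b) \<cdot> (path_inj V (fc_ob V A) a b (Tup as) \<cdot> prod_map V (map (path_prod V A) qs) (legs (hm (fc_ob V A)) as)
   (map2 (\<lambda>j q. j q) (legs (\<lambda>(x, y). path_inj V A x y) as) qs)) = path_inj V A a b (join as qs) \<cdot> flatten V (plegs A qs)"
proof -
 have q': "pathss A qs (steps as)" using q by (simp add: nest_prs)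
 let ?Xss = "plegs A qs"
 have pp: "map (path_prod V A) qs = map (Prod V) ?Xss" by (simp add: path_prod_def)
 have ab: "a \<in> pts A" "b \<in> pts A" using as by auto
 note ob = nest_Ob[OF q]
 have asB: "pth (fc_ob V A) as" using as by (simp add: pth_def)
 note jB = pinj_hom[OF fc_pre[OF A_pre] asB, unfolded as(2,3)]
 note j = jn_props[OF A_pre as(1) q, of "hm A"]
 have jA: "path_inj V A a b (Tup (jn as qs)) \<in> hom V (Prod V (concat ?Xss)) (fhom V A a b)"
  using pinj_hom[OF A_pre conjunct1[OF j]] j as by simp
 let ?m = "prod_map V (map (path_prod V A) qs) (fhoms V A (steps as)) (path_injs V A (steps as) qs)"
 have "arrs V (path_injs V A (steps as) qs) (map (path_prod V A) qs) (fhoms V A (steps as))"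
  unfolding arrs_def using is_coprod_hom[OF fhom_is[OF A_pre]] q' by (auto simp: all2_nth case_prod_beta)
 note mh = prod_map_hom[OF this]
 note jB' = jB[unfolded nest_legs[OF as(1)]]
 have "fm mu (a, b) \<cdot> (path_inj V (fc_ob V A) a b (Tup as) \<cdot> ?m) = path_inj V A a b (Tup (jn as qs)) \<cdot> flatten V ?Xss"
 proof (rule prod_tuples_ext[OF ob])
  show "fm mu (a, b) \<cdot> (path_inj V (fc_ob V A) a b (Tup as) \<cdot> ?m) \<in> hom V (Prod V (map (Prod V) ?Xss)) (fhom V A a b)"
   using Comp_hom[OF Comp_hom[OF mh jB'] mu_hom[OF ab]] unfolding pp .
  show "path_inj V A a b (Tup (jn as qs)) \<cdot> flatten V ?Xss \<in> hom V (Prod V (map (Prod V) ?Xss)) (fhom V A a b)"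
   by (rule Comp_hom[OF flatten_hom[OF ob] jA])
  fix Z fss assume Z: "Z \<in> Ob V" and fss: "list_all2 (elems V Z) fss ?Xss"
  define t where "t = tuple V Z (map (Prod V) ?Xss) (map2 (tuple V Z) ?Xss fss)"
  have t: "t \<in> hom V Z (Prod V (map (Prod V) ?Xss))" unfolding t_def by (rule tuple_hom[OF Z elems_tuples[OF Z fss]])
  have t': "t \<in> hom V Z (Prod V (map (path_prod V A) qs))" using t unfolding pp .
  have mt: "?m \<cdot> t = tuple V Z (legs (hm (fc_ob V A)) as) (pels V A Z qs fss)"
   using prod_map_pinj(2)[OF A_pre q' Z fss] unfolding nest_legs[OF as(1)] t_def pp .
  have "fm mu (a, b) \<cdot> (path_inj V (fc_ob V A) a b (Tup as) \<cdot> ?m) \<cdot> t = fm mu (a, b) \<cdot> (path_inj V (fc_ob V A) a b (Tup as) \<cdot> (?m \<cdot> t))"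
   unfolding Comp_assoc[OF t' Comp_hom[OF mh jB'] mu_hom[OF ab]] Comp_assoc[OF t' mh jB'] ..
  also have "\<dots> = fm mu (a, b) \<cdot> pel V (fc_ob V A) Z as (pels V A Z qs fss)"
   unfolding mt pel_def as ..
  also have "\<dots> = pel V A Z (jn as qs) (concat fss)"
   using mu_pel[OF as(1) q Z fss] unfolding as .
  also have "\<dots> = path_inj V A a b (Tup (jn as qs)) \<cdot> tuple V Z (concat ?Xss) (concat fss)"
   using j as by (simp add: pel_def)
  also have "\<dots> = path_inj V A a b (Tup (jn as qs)) \<cdot> flatten V ?Xss \<cdot> t"
   unfolding Comp_assoc[OF t flatten_hom[OF ob] jA] unfolding t_def flatten_tuple[OF Z fss] ..
  finally show "fm mu (a, b) \<cdot> (path_inj V (fc_ob V A) a b (Tup as) \<cdot> ?m) \<cdot> tuple V Z (map (Prod V) ?Xss) (map2 (tuple V Z) ?Xss fss) =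
    path_inj V A a b (Tup (jn as qs)) \<cdot> flatten V ?Xss \<cdot> tuple V Z (map (Prod V) ?Xss) (map2 (tuple V Z) ?Xss fss)"
   unfolding t_def .
 qed
 then show ?thesis unfolding nest_injs nest_legs[OF as(1)] join_jn .
qed

text \<open>Joint epimorphism is applied twice: over the outer paths, then, by distributivity, over
  the families of inner paths. Hence the description in \<open>fc_mult_hom\<close> has at most one
  solution.\<close>

lemma fc_mult_hom_unique:
 assumes ab: "a \<in> pts A" "b \<in> pts A" and mh: "m \<in> hom V (fhom V (fc_ob V A) a b) (fhom V A a b)"
  and m: "!!as qs. pth A as ==> last as = a ==> hd as = b ==> nest A as qs ==>
   m \<cdot> (path_inj V (fc_ob V A) a b (Tup as) \<cdot> prod_map V (map (path_prod V A) qs) (legs (hm (fc_ob V A)) as)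
   (map2 (\<lambda>j q. j q) (legs (\<lambda>(x, y). path_inj V A x y) as) qs)) = path_inj V A a b (join as qs) \<cdot> flatten V (plegs A qs)"
 shows "m = fm mu (a, b)"
proof (rule is_coprod_eqI[OF fhom_is[OF fc_pre[OF A_pre]] mh mu_hom[OF ab]])
 fix p assume "p \<in> paths (pts (fc_ob V A)) a b"
 then have p: "p \<in> paths (pts A) a b" by simp
 note u = paths_untup[OF p]
 let ?as = "untup p"
 have asB: "pth (fc_ob V A) ?as" using u by (simp add: pth_def)
 note jB = pinj_hom[OF fc_pre[OF A_pre] asB, unfolded u(1,3,4) nest_legs[OF u(2)]]
 show "m \<cdot> path_inj V (fc_ob V A) a b p = fm mu (a, b) \<cdot> path_inj V (fc_ob V A) a b p"
 proof (rule joint_epi_paths[OF A_pre cocont_id[OF category_axioms], of "steps ?as", unfolded id_fctr_simps, OF _ Comp_hom[OF jB mh] Comp_hom[OF jB mu_hom[OF ab]]])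
  show "!!a b. (a, b) \<in> set (steps (untup p)) ==> a \<in> pts A & b \<in> pts A" by (rule set_legs_pairs[OF u(2)])
  fix qs assume q: "pathss A qs (steps ?as)"
  let ?m = "prod_map V (map (path_prod V A) qs) (fhoms V A (steps ?as)) (path_injs V A (steps ?as) qs)"
  have "arrs V (path_injs V A (steps ?as) qs) (map (path_prod V A) qs) (fhoms V A (steps ?as))"
   unfolding arrs_def using is_coprod_hom[OF fhom_is[OF A_pre]] q by (auto simp: all2_nth case_prod_beta)
  note pm = prod_map_hom[OF this]
  note n = q[folded nest_prs]
  have "m \<cdot> (path_inj V (fc_ob V A) a b p \<cdot> ?m) = fm mu (a, b) \<cdot> (path_inj V (fc_ob V A) a b p \<cdot> ?m)"
   using m[OF u(2-4) n] mu_prod_map[OF u(2-4) n] unfolding nest_injs nest_legs[OF u(2)] u(1) by simp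
  then show "m \<cdot> path_inj V (fc_ob V A) a b p \<cdot> ?m = fm mu (a, b) \<cdot> path_inj V (fc_ob V A) a b p \<cdot> ?m"
   unfolding Comp_assoc[OF pm jB mh] Comp_assoc[OF pm jB mu_hom[OF ab]] .
 qed
qed

lemma fc_mult_hom_eq:
 assumes ab: "a \<in> pts A" "b \<in> pts A"
 shows "fc_mult_hom V A a b = fm mu (a, b)"
proof -
 have ab': "a \<in> pts (fc_ob V A)" "b \<in> pts (fc_ob V A)" using ab by simp_all
 show ?thesis
  unfolding fc_mult_hom_def fc_ob_sel(2)[OF ab] fc_ob_sel(2)[OF ab'] paths_pth nest_def[symmetric]
 proof (rule the_equality, intro conjI allI impI, goal_cases)
  case (2 as qs)
  then show ?case by (elim conjE) (rule mu_prod_map)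
 next
  case (3 m)
  show ?case
   by (rule fc_mult_hom_unique[OF ab conjunct1[OF 3]], rule conjunct2[OF 3, rule_format], intro conjI)
 qed (rule mu_hom[OF ab])
qed

lemma fc_mult_eq: "Mult (fc V) A = far underlying mu"
proof -
 have v: "far underlying mu \<in> gm V (fc_ob V (fc_ob V A)) (fc_ob V A)"
  using underlying_gm[OF mu_gm] by (simp add: underlying_Fr A_pre fc_pre)
 note s = vext_sel[OF fc_pre[OF A_pre] Fr_vcategory[OF A_pre] id_gma]
 have g: "Mult (fc V) A \<in> gm V (fc_ob V (fc_ob V A)) (fc_ob V A)"
  unfolding fc_def monad.simps using mu_hom by (intro gmI) (auto simp: fc_mult_hom_eq)
 show ?thesis
  by (rule gm_eqI[OF g v]) (simp_all add: fc_def fc_mult_hom_eq s gph_id_fn)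
qed

lemma fc_mult_gm: "Mult (fc V) A \<in> gm V (fc_ob V (fc_ob V A)) (fc_ob V A)"
 and fc_mult_fn: "a \<in> pts A ==> fn (Mult (fc V) A) a = a"
 and fc_mult_fm: "a \<in> pts A ==> b \<in> pts A ==> fm (Mult (fc V) A) (a, b) \<in> hom V (fhom V (fc_ob V A) a b) (fhom V A a b)"
 using underlying_gm[OF mu_gm] mu_hom
 by (simp_all add: fc_mult_eq underlying_Fr A_pre fc_pre vext_sel[OF fc_pre[OF A_pre] Fr_vcategory[OF A_pre] id_gma] gph_id_fn)

lemma fc_mult_pel:
 assumes "pth A as" "nest A as qs" "Z \<in> Ob V" "list_all2 (elems V Z) fss (plegs A qs)"
 shows "fm (Mult (fc V) A) (last as, hd as) \<cdot> pel V (fc_ob V A) Z as (pels V A Z qs fss) = pel V A Z (jn as qs) (concat fss)"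
 using mu_pel[OF assms] by (simp add: fc_mult_eq)

end

text \<open>The laws are not checked on paths: \<open>fc\<close> agrees with the monad of the free
  category adjunction, and the laws are transported from there.\<close>

lemma fc_monad: "monad (VGph V) (fc V)"
proof (rule monad_cong[OF adjunction_is_monad[OF free_adjunction]])
 show "fctr_eq (VGph V) (Fun (adjunction_monad Free underlying (fc_unit V) freecou)) (Fun (fc V))"
  using fc_fctr_eq by (simp add: adjunction_monad_def)
 fix A assume "A \<in> Ob (VGph V)"
 then have A: "is_gph V A" by simp
 show "Unit (fc V) A = Unit (adjunction_monad Free underlying (fc_unit V) freecou) A"
  by (simp add: fc_def adjunction_monad_def)
 show "Mult (fc V) A = Mult (adjunction_monad Free underlying (fc_unit V) freecou) A"
  using fc_mult_eq[OF A] by (simp add: adjunction_monad_def freecou_eq underlying_Fr is_gph_pre[OF A])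
qed

text \<open>Being a \<open>gcocone\<close> involves only points and hom-objects, so the coproduct
  cocone of categories remains one after composition is forgotten.\<close>

lemma underlying_cocont: "cocont (VCatC V) (VGph V) underlying"
proof (rule cocontI[OF underlying_functor])
 interpret VC: gphlike V "VCatC V" "is_vfunctor V" by (rule VCatC_gphlike)
 interpret VG: gphlike V "VGph V" "\<lambda>_. True" by (rule VGph_gphlike[OF dcat_axioms])
 interpret U: cat_functor "VCatC V" "VGph V" underlying by (rule underlying_functor)
 fix I :: "'a cell set" and X assume X: "!!i. i \<in> I ==> X i \<in> Ob (VCatC V)"
 let ?P = "Coprod (VCatC V) I X" and ?J = "Inj (VCatC V) I X"
 have c: "is_coprod (VCatC V) I X ?P ?J" by (rule VC.Coprod_is[OF X])
 have g: "gcocone V I X ?P ?J" by (rule VC.Coprod_gcocone[OF X])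
 have pre: "pre_gph V (fob underlying Y) \<longleftrightarrow> pre_gph V Y" for Y by (simp add: pre_gph_def)
 have "gcocone V I (\<lambda>i. fob underlying (X i)) (fob underlying ?P) (\<lambda>i. far underlying (?J i))"
  using g underlying_gm unfolding gcocone_def underlying_sel pre by blast
 from VG.gcocone_is_coprod[OF this U.far_hom[OF VC.Inj_hom'[OF X]] U.fob_Ob[OF VC.Coprod_Ob[OF X]]]
 show "\<exists>P j. is_coprod (VCatC V) I X P j &
   is_coprod (VGph V) I (\<lambda>i. fob underlying (X i)) (fob underlying P) (\<lambda>i. far underlying (j i))"
  using c by blast
qed

text \<open>A direct argument would have to deal with the products along paths. Instead
  \<open>fc\<close> is a left adjoint followed by \<open>underlying\<close>, and both preserve
  coproducts.\<close>

lemma fc_cocont: "cocont (VGph V) (VGph V) (Fun (fc V))"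
proof -
 interpret adjunction "VGph V" "VCatC V" Free underlying "fc_unit V" freecou by (rule free_adjunction)
 have "cocont (VGph V) (VCatC V) Free"
  unfolding cocont_def using F.cat_functor_axioms left_adjoint_is_coprod by blast
 from cocont_cong[OF cocont_comp[OF this underlying_cocont] fc_fctr_eq] show ?thesis .
qed

end

section \<open>Interchange\<close>

abbreviation (input) "ich \<equiv> interchange0"

lemma interchange0_sel [simp]:
 "a \<in> pts A ==> fn (ich V T A) a = a"
 "a \<in> pts A ==> b \<in> pts A ==> fm (ich V T A) (a, b) = interchange0_hom V T A a b"
 "src (ich V T A) = fob (star T) (fc_ob V A)" "tgt (ich V T A) = fc_ob V (fob (star T) A)"
 by (simp_all add: interchange0_def)

lemma legs_star: "pth A as ==> legs (hm (fob (star T) A)) as = map (fob T) (legs (hm A) as)"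
 unfolding legs_map_out by (rule legs_cong) auto

lemma legs_far_star: "f \<in> gm V A B ==> pth A as ==> legs (fm (far (star T) f)) as = map (far T) (legs (fm f) as)"
 unfolding legs_map_out by (rule legs_cong) (auto dest: gmD(4))

lemma pth_star [simp]: "pth (fob (star T) A) as \<longleftrightarrow> pth A as" "pth (fc_ob V A) as \<longleftrightarrow> pth A as"
 by (simp_all add: pth_def)

lemma map_fn_id: "(!!a. a \<in> pts A ==> fn f a = a) ==> pth A as ==> map (fn f) as = as"
 by (intro map_idI) (auto simp: pth_def)

context cat_functor
begin

lemma elems_far: "elems C Z fs Xs ==> elems D (fob F Z) (map (far F) fs) (map (fob F) Xs)"
 using far_hom by (simp add: elems_def all2_nth)

lemma far_comps:
 assumes hs: "arrs C hs Xs Ys" and fs: "elems C Z fs Xs"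
 shows "map (far F) (comps C hs fs) = comps D (map (far F) hs) (map (far F) fs)"
 using far_Comp[OF elems_nth[OF fs] arrs_nth[OF hs]] arrs_length[OF hs] elems_length[OF fs] by (intro nth_equalityI) simp_all

end

lemma star_fm_comp:
 assumes T: "cat_functor V W T" and f: "f \<in> gm V A B" and a: "a \<in> pts A" "b \<in> pts A" and x: "x \<in> hom V Z (hm A (a, b))"
 shows "fm (far (star T) f) (a, b) \<cdot>\<^bsub>W\<^esub> far T x = far T (fm f (a, b) \<cdot>\<^bsub>V\<^esub> x)"
 using cat_functor.far_Comp[OF T x gm_fm[OF f a]] a gmD(4)[OF f] by simp

context dcat
begin

lemma gph_comp_fm_comp:
 assumes f: "f \<in> gm V A B" and g: "g \<in> gm V B D" and a: "a \<in> pts A" "b \<in> pts A" and x: "x \<in> hom V Z (hm A (a, b))"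
 shows "fm (gph_comp V g f) (a, b) \<cdot> x = fm g (fn f a, fn f b) \<cdot> (fm f (a, b) \<cdot> x)"
 unfolding gph_comp_fm[OF f a] by (rule Comp_assoc[OF x gm_fm[OF f a] gm_fm[OF g gm_fn[OF f a(1)] gm_fn[OF f a(2)]]])

lemma pel_hm: "pre_gph V A ==> pth A as ==> Z \<in> Ob V ==> elems V Z fs (legs (hm A) as) ==> pel V A Z as fs \<in> hom V Z (hm (fc_ob V A) (last as, hd as))"
 using pel_hom by simp

text \<open>As \<open>F\<close> preserves coproducts, graph maps out of \<open>F\<^sub>*(fc A)\<close> and \<open>F\<^sub>*(fc(fc A))\<close> are determined by
 their effect on the images under \<open>F\<close> of formal composites.\<close>

lemma star_fc_eqI:
 assumes F: "cocont V W F" and A: "pre_gph V A"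
  and h: "h \<in> gm W (fob (star F) (fc_ob V A)) Y" and k: "k \<in> gm W (fob (star F) (fc_ob V A)) Y"
  and fn: "!!a. a \<in> pts A ==> fn h a = fn k a"
  and e: "!!Z as fs. pth A as ==> Z \<in> Ob V ==> elems V Z fs (legs (hm A) as) ==>
   fm h (last as, hd as) \<cdot>\<^bsub>W\<^esub> far F (pel V A Z as fs) = fm k (last as, hd as) \<cdot>\<^bsub>W\<^esub> far F (pel V A Z as fs)"
 shows "h = k"
proof (rule gm_eqI[OF h k])
 fix a b assume "a \<in> pts (fob (star F) (fc_ob V A))" "b \<in> pts (fob (star F) (fc_ob V A))"
 then have ab: "a \<in> pts A" "b \<in> pts A" by simp_all
 show "fm h (a, b) = fm k (a, b)"
 proof (rule fhom_epi[OF A F])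
  show "fm h (a, b) \<in> hom W (fob F (fhom V A a b)) (hm Y (fn k a, fn k b))"
   "fm k (a, b) \<in> hom W (fob F (fhom V A a b)) (hm Y (fn k a, fn k b))"
   using gm_fm[OF h, of a b] gm_fm[OF k, of a b] ab fn by simp_all
  fix Z as fs assume as: "pth A as" "last as = a" "hd as = b" "Z \<in> Ob V" "elems V Z fs (legs (hm A) as)"
  show "fm h (a, b) \<cdot>\<^bsub>W\<^esub> far F (pel V A Z as fs) = fm k (a, b) \<cdot>\<^bsub>W\<^esub> far F (pel V A Z as fs)"
   using e[OF as(1,4,5)] unfolding as(2,3) .
 qed
qed (simp add: fn)

lemma star_fc2_eqI:
 assumes F: "cocont V W F" and A: "is_gph V A"
  and h: "h \<in> gm W (fob (star F) (fc_ob V (fc_ob V A))) Y" and k: "k \<in> gm W (fob (star F) (fc_ob V (fc_ob V A))) Y"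
  and fn: "!!a. a \<in> pts A ==> fn h a = fn k a"
  and e: "!!Z as qs fss. pth A as ==> nest A as qs ==> Z \<in> Ob V ==> list_all2 (elems V Z) fss (plegs A qs) ==>
   fm h (last as, hd as) \<cdot>\<^bsub>W\<^esub> far F (pel V (fc_ob V A) Z as (pels V A Z qs fss)) =
   fm k (last as, hd as) \<cdot>\<^bsub>W\<^esub> far F (pel V (fc_ob V A) Z as (pels V A Z qs fss))"
 shows "h = k"
proof (rule gm_eqI[OF h k])
 interpret F: cat_functor V W F by (rule cocont_functor[OF F])
 note pA = is_gph_pre[OF A]
 note pB = fc_pre[OF pA]
 fix a b assume "a \<in> pts (fob (star F) (fc_ob V (fc_ob V A)))" "b \<in> pts (fob (star F) (fc_ob V (fc_ob V A)))"
 then have ab: "a \<in> pts A" "b \<in> pts A" by simp_all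
 have hk: "fm h (a, b) \<in> hom W (fob F (fhom V (fc_ob V A) a b)) (hm Y (fn k a, fn k b))"
  "fm k (a, b) \<in> hom W (fob F (fhom V (fc_ob V A) a b)) (hm Y (fn k a, fn k b))"
  using gm_fm[OF h, of a b] gm_fm[OF k, of a b] ab fn by simp_all
 show "fm h (a, b) = fm k (a, b)"
 proof (rule F.D.is_coprod_eqI[OF cocont_is_coprod[OF F fhom_is[OF pB]] hk])
  fix p assume "p \<in> paths (pts (fc_ob V A)) a b"
  then have p: "p \<in> paths (pts A) a b" by simp
  note u = paths_untup[OF p]
  have uB: "pth (fc_ob V A) (untup p)" using u by simp
  note nl = nest_legs[OF A u(2)]
  note j = pinj_hom[OF pB uB, unfolded u(1,3,4) nl]
  note Fj = F.far_hom[OF j]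
  show "fm h (a, b) \<cdot>\<^bsub>W\<^esub> far F (path_inj V (fc_ob V A) a b p) = fm k (a, b) \<cdot>\<^bsub>W\<^esub> far F (path_inj V (fc_ob V A) a b p)"
  proof (rule fhoms_epi[OF pA F set_legs_pairs[OF u(2)] F.D.Comp_hom[OF Fj hk(1)] F.D.Comp_hom[OF Fj hk(2)]])
   fix qs Z fss assume "pathss A qs (steps (untup p))"
    and Z: "Z \<in> Ob V" and fss: "list_all2 (elems V Z) fss (plegs A qs)"
   then have n: "nest A (untup p) qs" by (simp add: nest_prs)
   let ?t = "tuple V Z (fhoms V A (steps (untup p))) (pels V A Z qs fss)"
   have t: "?t \<in> hom V Z (Prod V (fhoms V A (steps (untup p))))"
    using tuple_hom[OF Z nest_elems[OF pA Z u(2) n fss]] unfolding nl .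
   have "path_inj V (fc_ob V A) a b p \<cdot> ?t = pel V (fc_ob V A) Z (untup p) (pels V A Z qs fss)"
    unfolding pel_def[of V "fc_ob V A"] u nl ..
   then show "fm h (a, b) \<cdot>\<^bsub>W\<^esub> far F (path_inj V (fc_ob V A) a b p) \<cdot>\<^bsub>W\<^esub> far F ?t = fm k (a, b) \<cdot>\<^bsub>W\<^esub> far F (path_inj V (fc_ob V A) a b p) \<cdot>\<^bsub>W\<^esub> far F ?t"
    using e[OF u(2) n Z fss] F.far_Comp[OF t j] F.D.Comp_assoc[OF F.far_hom[OF t] Fj hk(1)] F.D.Comp_assoc[OF F.far_hom[OF t] Fj hk(2)] unfolding u by simp
  qed
 qed
qed (simp add: fn)

context
 fixes T assumes T: "cocont V V T"
begin

abbreviation (input) Ts where "Ts \<equiv> star T"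

interpretation T: cat_functor V V T by (rule cocont_functor[OF T])

lemma star_pre: "pre_gph V A ==> pre_gph V (fob Ts A)"
 using T.fob_Ob by (simp add: pre_gph_def)

lemma star_elems: "pth A as ==> elems V Z fs (legs (hm A) as) ==> elems V (fob T Z) (map (far T) fs) (legs (hm (fob Ts A)) as)"
 using T.elems_far legs_star by metis

text \<open>Because \<open>T\<close> preserves the coproduct over paths, the description in
  \<open>interchange0_hom\<close> has exactly one solution. On the summand of \<open>p\<close> it is
  the formal composite of the images under \<open>T\<close> of the projections, which is the
  canonical comparison map followed by the injection; the value at other elements follows by
  composing with their tuple.\<close>

lemma interchange0_hom_props:
 assumes A: "pre_gph V A" and ab: "a \<in> pts A" "b \<in> pts A"
 shows "interchange0_hom V T A a b \<in> hom V (fob T (fhom V A a b)) (fhom V (fob Ts A) a b)" (is ?h)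
  "pth A as ==> last as = a ==> hd as = b ==> Z \<in> Ob V ==> elems V Z fs (legs (hm A) as) ==>
   interchange0_hom V T A a b \<cdot> far T (pel V A Z as fs) = pel V (fob Ts A) (fob T Z) as (map (far T) fs)"
proof -
 let ?A = "fob Ts A" and ?ps = "\<lambda>p. map (Proj V (legs (hm A) (untup p))) [0..<length (legs (hm A) (untup p))]"
 define f where "f p = pel V ?A (fob T (path_prod V A p)) (untup p) (map (far T) (?ps p))" for p
 have ps: "elems V (path_prod V A p) (?ps p) (legs (hm A) (untup p))" if "p \<in> paths (pts A) a b" for p
  using elems_projs[OF legs_pre[OF A paths_untup(2)[OF that]]] by (simp add: path_prod_def)
 have pp: "path_prod V A p \<in> Ob V" if "p \<in> paths (pts A) a b" for p by (rule path_prod_Ob[OF A that])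
 have f: "f p \<in> hom V (fob T (path_prod V A p)) (fhom V ?A a b)" if p: "p \<in> paths (pts A) a b" for p
  using pel_hom[OF star_pre[OF A] _ T.fob_Ob[OF pp[OF p]] star_elems[OF _ ps[OF p]]] paths_untup[OF p] by (simp add: f_def)
 have c: "is_coprod V (paths (pts A) a b) (\<lambda>p. fob T (path_prod V A p)) (fob T (fhom V A a b)) (\<lambda>p. far T (path_inj V A a b p))"
  by (rule cocont_is_coprod[OF T fhom_is[OF A]])
 have ex: "\<exists>!m. m \<in> hom V (fob T (fhom V A a b)) (fhom V ?A a b) & (\<forall>p \<in> paths (pts A) a b. m \<cdot> far T (path_inj V A a b p) = f p)"
  by (rule conjunct2[OF conjunct2[OF c[unfolded is_coprod_def]], rule_format, OF fhom_Ob[OF star_pre[OF A]] f])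
 have f': "path_inj V ?A a b p \<cdot> (let Xs = legs (hm A) (untup p) in tuple V (fob T (Prod V Xs)) (map (fob T) Xs) (map (\<lambda>r. far T (Proj V Xs r)) [0..<length Xs])) = f p"
  if "p \<in> paths (pts A) a b" for p
  using paths_untup[OF that] legs_star[of A "untup p" T] by (simp add: f_def pel_def path_prod_def comp_def Let_def)
 have e: "interchange0_hom V T A a b = (THE m. m \<in> hom V (fob T (fhom V A a b)) (fhom V ?A a b) & (\<forall>p \<in> paths (pts A) a b. m \<cdot> far T (path_inj V A a b p) = f p))"
  unfolding interchange0_hom_def using ab f' by (simp cong: conj_cong ball_cong)
 note * = theI'[OF ex, folded e]
 show h: ?h using * by blast
 assume as: "pth A as" "last as = a" "hd as = b" and Z: "Z \<in> Ob V" and fs: "elems V Z fs (legs (hm A) as)"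
 have p: "Tup as \<in> paths (pts A) a b" using as by (simp add: paths_pth)
 note j = pinj_hom[OF A as(1), unfolded as(2,3)] and t = tuple_hom[OF Z fs]
 note Pt = Proj_tuple[OF Z fs] and ob = legs_pre[OF A as(1)]
 have "interchange0_hom V T A a b \<cdot> far T (pel V A Z as fs) = f (Tup as) \<cdot> far T (tuple V Z (legs (hm A) as) fs)"
  unfolding pel_def as(2,3) T.far_Comp[OF t j] bspec[OF conjunct2[OF *] p, symmetric]
  by (rule Comp_assoc[OF T.far_hom[OF t] T.far_hom[OF j] h, symmetric])
 also have "\<dots> = pel V ?A (fob T Z) as (map (\<lambda>g. g \<cdot> far T (tuple V Z (legs (hm A) as) fs)) (map (far T) (?ps (Tup as))))"
  unfolding f_def by (subst pel_comp[OF star_pre[OF A] _ star_elems[OF _ ps[OF p]]]) (use as T.far_hom[OF t] in \<open>simp_all add: path_prod_def\<close>)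
 also have "map (\<lambda>g. g \<cdot> far T (tuple V Z (legs (hm A) as) fs)) (map (far T) (?ps (Tup as))) = map (far T) fs"
  using Pt elems_length[OF fs] T.far_Comp[OF t Proj_hom[OF ob]] by (intro nth_equalityI) (simp_all flip: T.far_Comp[OF t Proj_hom[OF ob]])
 finally show "interchange0_hom V T A a b \<cdot> far T (pel V A Z as fs) = pel V ?A (fob T Z) as (map (far T) fs)" .
qed

lemma interchange0_gm:
 assumes A: "pre_gph V A"
 shows "ich V T A \<in> gm V (fob Ts (fc_ob V A)) (fc_ob V (fob Ts A))"
 unfolding interchange0_def by (rule gmI) (use interchange0_hom_props(1)[OF A] in auto)

text \<open>The computation rule for interchange: \<open>T\<close> moves from a formal composite to
  each of its elements while the path stays. The laws below are obtained by evaluating both sides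
  with it.\<close>

lemma ich_pel:
 assumes "pre_gph V A" "pth A as" "Z \<in> Ob V" "elems V Z fs (legs (hm A) as)"
 shows "fm (ich V T A) (last as, hd as) \<cdot> far T (pel V A Z as fs) = pel V (fob Ts A) (fob T Z) as (map (far T) fs)"
 using interchange0_hom_props(2)[OF assms(1) _ _ assms(2)] assms by simp

lemma ich_nat:
 assumes f: "f \<in> gm V A B" and A: "pre_gph V A" and B: "pre_gph V B"
 shows "gph_comp V (ich V T B) (far Ts (fc_ar V f)) = gph_comp V (fc_ar V (far Ts f)) (ich V T A)"
proof -
 note F = fc_ar_gm[OF f A B] and Tf = star_gm[OF T.cat_functor_axioms f]
 note FT = fc_ar_gm[OF Tf star_pre[OF A] star_pre[OF B]] and TF = star_gm[OF T.cat_functor_axioms F(1)]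
 note IA = interchange0_gm[OF A] and IB = interchange0_gm[OF B]
 show ?thesis
 proof (rule star_fc_eqI[OF T A gph_comp_gm[OF TF IB] gph_comp_gm[OF IA FT(1)]])
  show "fn (gph_comp V (ich V T B) (far Ts (fc_ar V f))) a = fn (gph_comp V (fc_ar V (far Ts f)) (ich V T A)) a" if "a \<in> pts A" for a
   using that gm_fn[OF f] by (simp add: gph_comp_fn[OF TF] gph_comp_fn[OF IA] F FT)
  fix Z as fs assume as: "pth A as" and Z: "Z \<in> Ob V" and fs: "elems V Z fs (legs (hm A) as)"
  let ?fs = "comps V (legs (fm f) as) fs"
  note l = arrs_legs[OF f as] and p = pel_hm[OF A as Z fs]
  note ab = pth_hd(2,1)[OF as]
  have "fm (ich V T B) (fn f (last as), fn f (hd as)) \<cdot> far T (fm (fc_ar V f) (last as, hd as) \<cdot> pel V A Z as fs) =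
    pel V (fob Ts B) (fob T Z) (map (fn f) as) (map (far T) ?fs)"
   using ich_pel[OF B conjunct2[OF l] Z elems_map2[OF fs conjunct1[OF l]]] fc_ar_pel[OF f A B as Z fs] as by (simp add: last_map hd_map)
  moreover have "fm (fc_ar V (far Ts f)) (last as, hd as) \<cdot> (fm (ich V T A) (last as, hd as) \<cdot> far T (pel V A Z as fs)) =
    pel V (fob Ts B) (fob T Z) (map (fn f) as) (map (far T) ?fs)"
   using fc_ar_pel[OF Tf star_pre[OF A] star_pre[OF B] _ T.fob_Ob[OF Z] star_elems[OF as fs]] as
   unfolding ich_pel[OF A as Z fs] T.far_comps[OF conjunct1[OF l] fs] legs_far_star[OF f as] by simp
  ultimately show "fm (gph_comp V (ich V T B) (far Ts (fc_ar V f))) (last as, hd as) \<cdot> far T (pel V A Z as fs) =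
    fm (gph_comp V (fc_ar V (far Ts f)) (ich V T A)) (last as, hd as) \<cdot> far T (pel V A Z as fs)"
   using gph_comp_fm_comp[OF TF IB, of "last as" "hd as" "far T (pel V A Z as fs)" "fob T Z"] gph_comp_fm_comp[OF IA FT(1), of "last as" "hd as" "far T (pel V A Z as fs)" "fob T Z"]
    star_fm_comp[OF T.cat_functor_axioms F(1) _ _ p] T.far_hom[OF p] ab by (simp add: F del: interchange0_sel(2))
 qed
qed

end

text \<open>Naturality of interchange in the functor, for any transformation between
  coproduct-preserving functors. With the unit or the multiplication of \<open>T\<close> as \<alpha>
  it gives two axioms of a distributive law; with another distributive law as \<alpha> it gives the
  Yang-Baxter equation.\<close>

lemma ich_trans:
 assumes \<alpha>: "nat_trans V V F G \<alpha>" and F: "cocont V V F" and G: "cocont V V G" and A: "pre_gph V A"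
 shows "gph_comp V (fc_ar V (star_trans F G \<alpha> A)) (ich V F A) = gph_comp V (ich V G A) (star_trans F G \<alpha> (fc_ob V A))"
proof -
 interpret \<alpha>: nat_trans V V F G \<alpha> by (rule \<alpha>)
 note s = star_trans_gm[OF \<alpha> A] and S = star_trans_gm[OF \<alpha> fc_pre[OF A]]
 note pF = star_pre[OF F A] and pG = star_pre[OF G A]
 note fs = fc_ar_gm[OF s pF pG]
 note IF = interchange0_gm[OF F A] and IG = interchange0_gm[OF G A]
 show ?thesis
 proof (rule star_fc_eqI[OF F A gph_comp_gm[OF IF fs(1)] gph_comp_gm[OF S IG]])
  show "fn (gph_comp V (fc_ar V (star_trans F G \<alpha> A)) (ich V F A)) a = fn (gph_comp V (ich V G A) (star_trans F G \<alpha> (fc_ob V A))) a"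
   if "a \<in> pts A" for a
   using that by (simp add: gph_comp_fn[OF IF] gph_comp_fn[OF S] fs)
  fix Z as es assume as: "pth A as" and Z: "Z \<in> Ob V" and es: "elems V Z es (legs (hm A) as)"
  note ab = pth_hd(2,1)[OF as] and p = pel_hm[OF A as Z es]
  note Fp = \<alpha>.F.far_hom[OF p] and Gp = \<alpha>.G.far_hom[OF p]
  have hG: "fm (ich V G A) (last as, hd as) \<in> hom V (fob G (hm (fc_ob V A) (last as, hd as))) (fhom V (fob (star G) A) (last as) (hd as))"
   using gm_fm[OF IG, of "last as" "hd as"] ab by simp
  have \<alpha>p: "\<alpha> (fhom V A (last as) (hd as)) \<cdot> far F (pel V A Z as es) = far G (pel V A Z as es) \<cdot> \<alpha> Z"
   using \<alpha>.natural[OF p] ab by simp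
  have "comps V (legs (fm (star_trans F G \<alpha> A)) as) (map (far F) es) = map (\<lambda>f. f \<cdot> \<alpha> Z) (map (far G) es)"
  proof -
   have "legs (fm (star_trans F G \<alpha> A)) as = map \<alpha> (legs (hm A) as)"
    unfolding legs_map_out by (rule legs_cong[OF as]) simp
   then show ?thesis using \<alpha>.natural[OF elems_nth[OF es]] elems_length[OF es] by (intro nth_equalityI) simp_all
  qed
  then have "fm (fc_ar V (star_trans F G \<alpha> A)) (last as, hd as) \<cdot> pel V (fob (star F) A) (fob F Z) as (map (far F) es) =
    pel V (fob (star G) A) (fob G Z) as (map (far G) es) \<cdot> \<alpha> Z"
   using fc_ar_pel[OF s pF pG _ \<alpha>.F.fob_Ob[OF Z] star_elems[OF F as es]] as pel_comp[OF pG _ star_elems[OF G as es] \<alpha>.component[OF Z]] map_fn_id[OF _ as, of "star_trans F G \<alpha> A"] by simp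
  then show "fm (gph_comp V (fc_ar V (star_trans F G \<alpha> A)) (ich V F A)) (last as, hd as) \<cdot> far F (pel V A Z as es) =
   fm (gph_comp V (ich V G A) (star_trans F G \<alpha> (fc_ob V A))) (last as, hd as) \<cdot> far F (pel V A Z as es)"
   using gph_comp_fm_comp[OF IF fs(1), of "last as" "hd as" _ "fob F Z"] gph_comp_fm_comp[OF S IG, of "last as" "hd as" _ "fob F Z"] ab Fp \<alpha>p
    Comp_assoc[OF \<alpha>.component[OF Z] Gp hG] by (simp add: ich_pel[OF F A as Z es] ich_pel[OF G A as Z es, symmetric] del: interchange0_sel(2))
 qed
qed

text \<open>Interchanging \<open>T\<close> and then \<open>S\<close> with \<open>fc\<close> applies
  both functors to each element of a formal composite, just as interchanging
  \<open>S \<odot> T\<close> at once does.\<close>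

lemma ich_comp:
 assumes S: "cocont V V S" and T: "cocont V V T" and A: "pre_gph V A"
 shows "ich V (S \<odot> T) A = gph_comp V (ich V S (fob (star T) A)) (far (star S) (ich V T A))"
proof -
 interpret S: cat_functor V V S by (rule cocont_functor[OF S])
 interpret T: cat_functor V V T by (rule cocont_functor[OF T])
 note ST = cocont_comp[OF T S] and TA = star_pre[OF T A]
 note I = interchange0_gm[OF T A] and IS = interchange0_gm[OF S TA]
 note SI = star_gm[OF S.cat_functor_axioms I]
 show ?thesis
 proof (rule star_fc_eqI[OF ST A interchange0_gm[OF ST A] gph_comp_gm[OF SI IS, unfolded star_comp_ob]])
  show "fn (ich V (S \<odot> T) A) a = fn (gph_comp V (ich V S (fob (star T) A)) (far (star S) (ich V T A))) a" if "a \<in> pts A" for a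
   using that by (simp add: gph_comp_fn[OF SI])
  fix Z as fs assume as: "pth A as" and Z: "Z \<in> Ob V" and fs: "elems V Z fs (legs (hm A) as)"
  note ab = pth_hd(2,1)[OF as] and p = T.far_hom[OF pel_hm[OF A as Z fs]]
  have m: "map (far (S \<odot> T)) fs = map (far S) (map (far T) fs)" by simp
  show "fm (ich V (S \<odot> T) A) (last as, hd as) \<cdot> far (S \<odot> T) (pel V A Z as fs) =
   fm (gph_comp V (ich V S (fob (star T) A)) (far (star S) (ich V T A))) (last as, hd as) \<cdot> far (S \<odot> T) (pel V A Z as fs)"
   using gph_comp_fm_comp[OF SI IS, of "last as" "hd as" "far S (far T (pel V A Z as fs))" "fob S (fob T Z)"] star_fm_comp[OF S.cat_functor_axioms I, of "last as" "hd as" _ "fob T Z"] ab p S.far_hom[OF p]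
    ich_pel[OF S TA _ T.fob_Ob[OF Z] star_elems[OF T as fs]] as ich_pel[OF ST A as Z fs, unfolded m]
   by (simp add: ich_pel[OF T A as Z fs] star_comp_ob comp_def del: interchange0_sel(2))
 qed
qed

lemma ich_id:
 assumes A: "is_gph V A"
 shows "ich V id_fctr A = gph_id V (fc_ob V A)"
proof -
 note pA = is_gph_pre[OF A]
 note I = cocont_id[OF category_axioms]
 have "is_gph V (fc_ob V A)" using underlying_gph[OF Fr_vcategory[OF pA]] underlying_Fr[OF pA] by simp
 then have o: "fob (star id_fctr) (fc_ob V A) = fc_ob V A" "fob (star id_fctr) A = A" using star_id_ob A by blast+
 have i: "map (far id_fctr) fs = fs" for fs :: "'a arr list" by (intro map_idI) simp
 show ?thesis
 proof (rule star_fc_eqI[OF I pA, unfolded o, OF interchange0_gm[OF I pA, unfolded o] gph_id_gm[OF fc_pre[OF pA]]])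
  fix Z as fs assume as: "pth A as" and x: "Z \<in> Ob V" "elems V Z fs (legs (hm A) as)"
  show "fm (ich V id_fctr A) (last as, hd as) \<cdot> far id_fctr (pel V A Z as fs) = fm (gph_id V (fc_ob V A)) (last as, hd as) \<cdot> far id_fctr (pel V A Z as fs)"
   using ich_pel[OF I pA as x] pth_hd(1,2)[OF as] Id_Comp[OF pel_hm[OF pA as x]] by (simp add: gph_id_fm o i)
 qed (simp add: gph_id_fn)
qed

end

lemma fc_sel [simp]: "mob (fc V) A = fc_ob V A" "mar (fc V) f = fc_ar V f" "Unit (fc V) = fc_unit V"
 by (simp_all add: fc_def)

lemma star_monad_sel [simp]: "Fun (star_monad T) = star (Fun T)" "Unit (star_monad T) = star_trans id_fctr (Fun T) (Unit T)"
  "Mult (star_monad T) = star_trans (Fun T \<odot> Fun T) (Fun T) (Mult T)"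
 by (simp_all add: star_monad_def)

context dcat
begin

lemma fc_is_gph: "is_gph V A ==> is_gph V (fc_ob V A)"
 using underlying_gph[OF Fr_vcategory[OF is_gph_pre]] underlying_Fr[OF is_gph_pre] by metis

context
 fixes T assumes T: "cocont V V T"
begin

interpretation T: cat_functor V V T by (rule cocont_functor[OF T])

lemma ich_nat_trans: "nat_trans (VGph V) (VGph V) (star T \<odot> Fun (fc V)) (Fun (fc V) \<odot> star T) (ich V T)"
proof (rule nat_transI)
 interpret two_dcats V V by (rule two_dcats)
 note sT = star_functor[OF T.cat_functor_axioms] and fcF = cocont_functor[OF fc_cocont]
 show "cat_functor (VGph V) (VGph V) (star T \<odot> Fun (fc V))" "cat_functor (VGph V) (VGph V) (Fun (fc V) \<odot> star T)"
  by (rule cat_functor_comp[OF fcF sT] cat_functor_comp[OF sT fcF])+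
 fix A assume "A \<in> Ob (VGph V)"
 then have A: "is_gph V A" by simp
 show "ich V T A \<in> hom (VGph V) (fob (star T \<odot> Fun (fc V)) A) (fob (Fun (fc V) \<odot> star T) A)"
  using interchange0_gm[OF T is_gph_pre[OF A]] star_is_gph[OF T.cat_functor_axioms] fc_is_gph A by (simp add: VGph_hom)
next
 fix f A B assume "f \<in> hom (VGph V) A B"
 then show "ich V T B \<cdot>\<^bsub>VGph V\<^esub> far (star T \<odot> Fun (fc V)) f = far (Fun (fc V) \<odot> star T) f \<cdot>\<^bsub>VGph V\<^esub> ich V T A"
  using ich_nat[OF T, of f A B] is_gph_pre[of V A] is_gph_pre[of V B] by (simp add: VGph_hom)
qed

text \<open>The unit at a hom-object is the one-step composite with an identity as its element, and
  \<open>T\<close> preserves identities.\<close>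

lemma ich_unit:
 assumes A: "pre_gph V A"
 shows "gph_comp V (ich V T A) (far (star T) (fc_unit V A)) = fc_unit V (fob (star T) A)"
proof -
 note u = fc_unit_gm[OF A] and TA = star_pre[OF T A] and I = interchange0_gm[OF T A]
 note Tu = star_gm[OF T.cat_functor_axioms u]
 show ?thesis
 proof (rule gm_eqI[OF gph_comp_gm[OF Tu I] fc_unit_gm[OF TA]])
  show "fn (gph_comp V (ich V T A) (far (star T) (fc_unit V A))) a = fn (fc_unit V (fob (star T) A)) a" if "a \<in> pts (fob (star T) A)" for a
   using that by (simp add: gph_comp_fn[OF Tu])
  fix a b assume "a \<in> pts (fob (star T) A)" "b \<in> pts (fob (star T) A)"
  then have ab: "a \<in> pts A" "b \<in> pts A" by simp_all
  have H: "hm A (a, b) \<in> Ob V" using A ab by (simp add: pre_gph_def)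
  have e: "fm (fc_unit V A) (a, b) = pel V A (hm A (a, b)) [b, a] [Id V (hm A (a, b))]"
   "fm (fc_unit V (fob (star T) A)) (a, b) = pel V (fob (star T) A) (fob T (hm A (a, b))) [b, a] [Id V (fob T (hm A (a, b)))]"
   using ab by (simp_all add: fc_unit_def pel_def)
  show "fm (gph_comp V (ich V T A) (far (star T) (fc_unit V A))) (a, b) = fm (fc_unit V (fob (star T) A)) (a, b)"
   using ich_pel[OF T A, of "[b, a]" "hm A (a, b)" "[Id V (hm A (a, b))]"] ab H Id_hom[OF H] T.far_Id[OF H]
   by (simp add: gph_comp_fm[OF Tu] e del: interchange0_sel(2))
 qed
qed

text \<open>Both sides send a nested composite to the flattened one with \<open>T\<close> applied to
  all elements. On the left it is flattened first; on the right interchange acts on the outer path,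
  then on each inner path, and flattening comes last.\<close>

lemma ich_mult:
 assumes A: "is_gph V A"
 shows "gph_comp V (ich V T A) (far (star T) (Mult (fc V) A)) =
  gph_comp V (gph_comp V (Mult (fc V) (fob (star T) A)) (fc_ar V (ich V T A))) (ich V T (fc_ob V A))"
proof -
 let ?TA = "fob (star T) A" and ?B = "fc_ob V A" and ?I = "ich V T A"
 have TA: "is_gph V ?TA" by (rule star_is_gph[OF T.cat_functor_axioms A])
 note pA = is_gph_pre[OF A] and pTA = is_gph_pre[OF TA]
 note pB = fc_pre[OF pA] and pFTA = fc_pre[OF pTA]
 note pTB = star_pre[OF T pB]
 note I = interchange0_gm[OF T pA] and IB = interchange0_gm[OF T pB]
 note M = fc_mult_gm[OF A] and MT = fc_mult_gm[OF TA]
 note TM = star_gm[OF T.cat_functor_axioms M] and FI = fc_ar_gm[OF I pTB pFTA]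
 note MFI = gph_comp_gm[OF FI(1) MT]
 show ?thesis
 proof (rule star_fc2_eqI[OF T A gph_comp_gm[OF TM I] gph_comp_gm[OF IB MFI]])
  show "fn (gph_comp V ?I (far (star T) (Mult (fc V) A))) a = fn (gph_comp V (gph_comp V (Mult (fc V) ?TA) (fc_ar V ?I)) (ich V T ?B)) a"
   if "a \<in> pts A" for a
   using that by (simp add: gph_comp_fn[OF TM] gph_comp_fn[OF IB] gph_comp_fn[OF FI(1)] FI fc_mult_fn[OF A] fc_mult_fn[OF TA])
  fix Z as qs fss assume as: "pth A as" and n: "nest A as qs" and Z: "Z \<in> Ob V" and fss: "list_all2 (elems V Z) fss (plegs A qs)"
  let ?ps = "pels V A Z qs fss" and ?Tfss = "map (map (far T)) fss"
  have asB: "pth ?B as" using as by simp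
  note ab = pth_hd(2,1)[OF as] and ps = nest_elems[OF pA Z as n fss]
  note x = pel_hm[OF pB asB Z ps] and TZ = T.fob_Ob[OF Z]
  note j = jn_props[OF pA as n, of "hm A"]
  have cs: "elems V Z (concat fss) (legs (hm A) (jn as qs))" using elems_concat[OF fss] j by simp
  have L: "fm ?I (last as, hd as) \<cdot> far T (fm (Mult (fc V) A) (last as, hd as) \<cdot> pel V ?B Z as ?ps) = pel V ?TA (fob T Z) (jn as qs) (concat ?Tfss)"
   using fc_mult_pel[OF A as n Z fss] ich_pel[OF T pA conjunct1[OF j] Z cs] j by (simp add: map_concat)
  have nT: "nest ?TA as qs" using n by (simp add: nest_def)
  have q: "qs ! r \<in> paths (pts A) (fst (steps as ! r)) (snd (steps as ! r))" if "r < length qs" for r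
   using n that by (auto simp: nest_prs all2_nth case_prod_beta)
  have len: "length qs = length as - 1" "length fss = length qs"
   using list_all2_lengthD[OF n[unfolded nest_def]] list_all2_lengthD[OF fss] by simp_all
  have fr: "elems V Z (fss ! r) (legs (hm A) (untup (qs ! r)))" if "r < length qs" for r
   using list_all2_nthD2[OF fss, of r] that by simp
  have Tfss: "list_all2 (elems V (fob T Z)) ?Tfss (plegs ?TA qs)"
   using star_elems[OF T paths_untup(2)[OF q] fr] len by (simp add: all2_nth)
  have "comps V (legs (fm ?I) as) (map (far T) ?ps) = pels V ?TA (fob T Z) qs ?Tfss"
  proof (rule nth_equalityI)
   fix r assume "r < length (comps V (legs (fm ?I) as) (map (far T) ?ps))"
   then have r: "r < length qs" "r < length as - 1" using len by simp_all
   note u = paths_untup[OF q[OF r(1)]]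
   have "legs (fm ?I) as ! r = fm ?I (steps as ! r)" using r legs_map_out[of "fm ?I" "\<lambda>xy. xy" as] by (metis legs_length nth_map)
   then show "comps V (legs (fm ?I) as) (map (far T) ?ps) ! r = pels V ?TA (fob T Z) qs ?Tfss ! r"
    using ich_pel[OF T pA u(2) Z fr[OF r(1)]] r len unfolding u by (simp del: interchange0_sel(2))
  qed (use len in simp)
  then have R: "fm (fc_ar V ?I) (last as, hd as) \<cdot> pel V (fob (star T) ?B) (fob T Z) as (map (far T) ?ps) =
    pel V (fc_ob V ?TA) (fob T Z) as (pels V ?TA (fob T Z) qs ?Tfss)"
   using fc_ar_pel[OF I pTB pFTA _ TZ star_elems[OF T asB ps]] as map_fn_id[OF _ as, of ?I] by simp
  have y: "pel V (fob (star T) ?B) (fob T Z) as (map (far T) ?ps) \<in> hom V (fob T Z) (hm (fc_ob V (fob (star T) ?B)) (last as, hd as))"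
   using pel_hm[OF pTB _ TZ star_elems[OF T asB ps]] as by simp
  show "fm (gph_comp V ?I (far (star T) (Mult (fc V) A))) (last as, hd as) \<cdot> far T (pel V ?B Z as ?ps) =
   fm (gph_comp V (gph_comp V (Mult (fc V) ?TA) (fc_ar V ?I)) (ich V T ?B)) (last as, hd as) \<cdot> far T (pel V ?B Z as ?ps)"
  proof -
   have "fm (gph_comp V ?I (far (star T) (Mult (fc V) A))) (last as, hd as) \<cdot> far T (pel V ?B Z as ?ps) = pel V ?TA (fob T Z) (jn as qs) (concat ?Tfss)"
    using gph_comp_fm_comp[OF TM I, of "last as" "hd as" _ "fob T Z"] star_fm_comp[OF T.cat_functor_axioms M _ _ x] ab T.far_hom[OF x] L fc_mult_fn[OF A]
    by (simp del: interchange0_sel(2))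
   moreover have "fm (gph_comp V (gph_comp V (Mult (fc V) ?TA) (fc_ar V ?I)) (ich V T ?B)) (last as, hd as) \<cdot> far T (pel V ?B Z as ?ps) = pel V ?TA (fob T Z) (jn as qs) (concat ?Tfss)"
    using gph_comp_fm_comp[OF IB MFI, of "last as" "hd as" _ "fob T Z"] gph_comp_fm_comp[OF FI(1) MT, of "last as" "hd as" _ "fob T Z"] ab T.far_hom[OF x] y R ich_pel[OF T pB asB Z ps]
     fc_mult_pel[OF TA _ nT TZ Tfss] as by (simp add: FI del: interchange0_sel(2))
   ultimately show ?thesis by simp
  qed
 qed
qed

end

text \<open>The axioms for the unit and multiplication of \<open>T\<close> are
  \<open>ich_trans\<close> for these transformations, rewritten with \<open>ich_id\<close> and
  \<open>ich_comp\<close>; those for \<open>fc\<close> are \<open>ich_unit\<close> and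
  \<open>ich_mult\<close>.\<close>

lemma interchange_law:
 assumes "monad V T" and T: "cocont V V (Fun T)"
 shows "distributive_law (VGph V) (star_monad T) (fc V) (ich V (Fun T))"
proof -
 interpret monad V T by (rule assms(1))
 interpret VG: dcat "VGph V" by (rule VGph_dcat[OF dcat_axioms])
 note TT = cocont_comp[OF T T]
 show ?thesis
 proof (intro distributive_law.intro distributive_law_axioms.intro)
  show "monad (VGph V) (star_monad T)" by (rule star_monad[OF assms(1)])
  show "monad (VGph V) (fc V)" by (rule fc_monad)
  show "nat_trans (VGph V) (VGph V) (Fun (star_monad T) \<odot> Fun (fc V)) (Fun (fc V) \<odot> Fun (star_monad T)) (ich V (Fun T))"
   using ich_nat_trans[OF T] by simp
 next
  fix A assume "A \<in> Ob (VGph V)"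
  then have A: "is_gph V A" by simp
  note pA = is_gph_pre[OF A]
  have u: "star_trans id_fctr (Fun T) (Unit T) A \<in> gm V A (fob (star (Fun T)) A)"
   using star_trans_gm[OF unit.nat_trans_axioms pA] star_id_ob[OF A] by simp
  have "gph_comp V (fc_ar V (star_trans id_fctr (Fun T) (Unit T) A)) (gph_id V (fc_ob V A)) =
    gph_comp V (ich V (Fun T) A) (star_trans id_fctr (Fun T) (Unit T) (fc_ob V A))"
   using ich_trans[OF unit.nat_trans_axioms cocont_id[OF category_axioms] T pA] ich_id[OF A] by simp
  then show "ich V (Fun T) A \<cdot>\<^bsub>VGph V\<^esub> Unit (star_monad T) (mob (fc V) A) = mar (fc V) (Unit (star_monad T) A)"
   using gph_comp_id[OF fc_ar_gm(1)[OF u pA star_pre[OF T pA]] fc_pre[OF pA]] by simp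
  show "ich V (Fun T) A \<cdot>\<^bsub>VGph V\<^esub> mar (star_monad T) (Unit (fc V) A) = Unit (fc V) (mob (star_monad T) A)"
   using ich_unit[OF T pA] by simp
  show "ich V (Fun T) A \<cdot>\<^bsub>VGph V\<^esub> mar (star_monad T) (Mult (fc V) A) =
   Mult (fc V) (mob (star_monad T) A) \<cdot>\<^bsub>VGph V\<^esub> mar (fc V) (ich V (Fun T) A) \<cdot>\<^bsub>VGph V\<^esub> ich V (Fun T) (mob (fc V) A)"
   using ich_mult[OF T A] by simp
  have m: "star_trans (Fun T \<odot> Fun T) (Fun T) (Mult T) A \<in> gm V (fob (star (Fun T)) (fob (star (Fun T)) A)) (fob (star (Fun T)) A)"
   using star_trans_gm[OF mult.nat_trans_axioms pA] by (simp add: star_comp_ob)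
  note pTA = star_pre[OF T pA]
  note pTTA = star_pre[OF T pTA]
  show "ich V (Fun T) A \<cdot>\<^bsub>VGph V\<^esub> Mult (star_monad T) (mob (fc V) A) =
   mar (fc V) (Mult (star_monad T) A) \<cdot>\<^bsub>VGph V\<^esub> ich V (Fun T) (mob (star_monad T) A) \<cdot>\<^bsub>VGph V\<^esub> mar (star_monad T) (ich V (Fun T) A)"
   using ich_trans[OF mult.nat_trans_axioms TT T pA] ich_comp[OF T T pA]
    gph_comp_assoc[OF star_gm[OF cocont_functor[OF T] interchange0_gm[OF T pA]] interchange0_gm[OF T pTA] fc_ar_gm(1)[OF m pTTA pTA]]
   by simp
 qed
qed

text \<open>This is \<open>ich_trans\<close> for \<open>l\<close>: by \<open>ich_comp\<close> the
  interchange maps of \<open>S \<odot> T\<close> and of \<open>T \<odot> S\<close> with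
  \<open>fc\<close> are the composites of interchanges on the two sides.\<close>

lemma interchange_Yang_Baxter:
 assumes S: "cocont V V S" and T: "cocont V V T" and l: "nat_trans V V (S \<odot> T) (T \<odot> S) l" and A: "is_gph V A"
 shows "ich V T (fob (star S) A) \<cdot>\<^bsub>VGph V\<^esub> far (star T) (ich V S A) \<cdot>\<^bsub>VGph V\<^esub> star_trans (S \<odot> T) (T \<odot> S) l (fc_ob V A) =
   fc_ar V (star_trans (S \<odot> T) (T \<odot> S) l A) \<cdot>\<^bsub>VGph V\<^esub> ich V S (fob (star T) A) \<cdot>\<^bsub>VGph V\<^esub> far (star S) (ich V T A)"
proof -
 note pA = is_gph_pre[OF A]
 note ST = cocont_comp[OF T S] and TS = cocont_comp[OF S T]
 have m: "star_trans (S \<odot> T) (T \<odot> S) l A \<in> gm V (fob (star S) (fob (star T) A)) (fob (star (T \<odot> S)) A)"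
  using star_trans_gm[OF l pA] by (simp add: star_comp_ob)
 show ?thesis
  using ich_trans[OF l ST TS pA] ich_comp[OF T S pA] ich_comp[OF S T pA]
   gph_comp_assoc[OF star_gm[OF cocont_functor[OF S] interchange0_gm[OF T pA]] interchange0_gm[OF S star_pre[OF T pA]]
    fc_ar_gm(1)[OF m star_pre[OF S star_pre[OF T pA]] star_pre[OF TS pA]]]
  by simp
qed

end

section \<open>The composite of the series\<close>

text \<open>The functor \<open>T\<^sub>0 T\<^sub>0 \<cdots> T\<^sub>k\<^sub>-\<^sub>1 T\<^sub>k\<^sub>-\<^sub>1\<close>.\<close>

primrec dbl :: "(nat => ('o, 'm) monad) => nat => ('o, 'm, 'o, 'm) fctr" where
 "dbl T 0 = id_fctr"
| "dbl T (Suc k) = dbl T k \<odot> (Fun (T k) \<odot> Fun (T k))"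

section \<open>Types of the arrows that make up the composite of a series\<close>

context distributive_series
begin

lemma T_functor: "i < n ==> cat_functor C C (Fun (T i))"
 using monads[of i] by (simp add: monad_def nat_trans_def)

lemma R_functor: "k \<le> n ==> cat_functor C C (series_fctr T k)"
proof (induction k)
 case 0
 then show ?case using cat_functor_id[OF category_axioms] by simp
next
 case (Suc k)
 then show ?case using cat_functor_comp[OF T_functor[of k] Suc.IH] by simp
qed

lemma T_Ob: "i < n ==> A \<in> Ob C ==> mob (T i) A \<in> Ob C"
 by (rule cat_functor.fob_Ob[OF T_functor])

lemma T_unit: "i < n ==> A \<in> Ob C ==> Unit (T i) A \<in> hom C A (mob (T i) A)"
 using monads[of i] nat_trans.component[of C C id_fctr "Fun (T i)" "Unit (T i)" A] by (simp add: monad_def)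

lemma T_mult: "i < n ==> A \<in> Ob C ==> Mult (T i) A \<in> hom C (mob (T i) (mob (T i) A)) (mob (T i) A)"
 using monads[of i] nat_trans.component[of C C "Fun (T i) \<odot> Fun (T i)" "Fun (T i)" "Mult (T i)" A] by (simp add: monad_def)

lemma T_law: "j < i ==> i < n ==> A \<in> Ob C ==> l i j A \<in> hom C (mob (T i) (mob (T j) A)) (mob (T j) (mob (T i) A))"
 using laws[of j i] nat_trans.component[of C C "Fun (T i) \<odot> Fun (T j)" "Fun (T j) \<odot> Fun (T i)" "l i j" A]
 by (simp add: distributive_law_def)

lemma series_unit_hom: "k \<le> n ==> A \<in> Ob C ==> series_unit C T k A \<in> hom C A (fob (series_fctr T k) A)"
proof (induction k arbitrary: A)
 case 0
 then show ?case using Id_hom by simp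
next
 case (Suc k)
 then show ?case using Comp_hom[OF T_unit[of k A] Suc.IH[of "mob (T k) A"]] T_Ob[of k A] by simp
qed

lemma move_hom: "k \<le> i ==> i < n ==> A \<in> Ob C ==>
  move C T l i k A \<in> hom C (mob (T i) (fob (series_fctr T k) A)) (fob (series_fctr T k) (mob (T i) A))"
proof (induction k arbitrary: A)
 case 0
 then show ?case using Id_hom T_Ob by simp
next
 case (Suc k)
 then show ?case
  using Comp_hom[OF Suc.IH[of "mob (T k) A"] cat_functor.far_hom[OF R_functor[of k] T_law[of k i A]]] T_Ob[of k A] by simp
qed

lemma shuffle_hom: "k \<le> n ==> A \<in> Ob C ==>
  shuffle C T l k A \<in> hom C (fob (series_fctr T k) (fob (series_fctr T k) A)) (fob (dbl T k) A)"
proof (induction k arbitrary: A)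
 case 0
 then show ?case using Id_hom by simp
next
 case (Suc k)
 then show ?case
  using Comp_hom[OF cat_functor.far_hom[OF R_functor[of k] move_hom[of k k "mob (T k) A"]] Suc.IH[of "mob (T k) (mob (T k) A)"]] T_Ob[of k] by simp
qed

lemma doubled_mult_hom: "k \<le> n ==> A \<in> Ob C ==>
  doubled_mult C T k A \<in> hom C (fob (dbl T k) A) (fob (series_fctr T k) A)"
proof (induction k arbitrary: A)
 case 0
 then show ?case using Id_hom by simp
next
 case (Suc k)
 then show ?case
  using Comp_hom[OF Suc.IH[of "mob (T k) (mob (T k) A)"] cat_functor.far_hom[OF R_functor[of k] T_mult[of k A]]] T_Ob[of k] by simp
qed

end

section \<open>The composite of a series after starring it and adding \<open>fc\<close>\<close>

context dcat
begin

text \<open>Asks only for the types of the components. The families \<open>move\<close>,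
  \<open>shuffle\<close> and \<open>doubled_mult\<close> can therefore be starred without proving
  them natural.\<close>

lemma star_trans_hom:
 assumes A: "is_gph V A" and \<alpha>: "!!X. X \<in> Ob V ==> \<alpha> X \<in> hom V (fob F X) (fob G X)"
 shows "star_trans F G \<alpha> A \<in> hom (VGph V) (fob (star F) A) (fob (star G) A)"
proof -
 have o: "fob F X \<in> Ob V" "fob G X \<in> Ob V" if "X \<in> Ob V" for X using homA(4,5)[OF \<alpha>[OF that]] by simp_all
 have "is_gph V (fob (star F) A)" "is_gph V (fob (star G) A)"
  unfolding star_ob using o is_gphD(3)[OF A] by (auto intro!: is_gphI)
 moreover have "star_trans F G \<alpha> A \<in> gm V (fob (star F) A) (fob (star G) A)"
  unfolding star_trans_def using \<alpha> is_gphD(3)[OF A] by (intro gmI) auto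
 ultimately show ?thesis by (simp add: VGph_hom)
qed

lemma star_trans_Id': "is_gph V A ==> fob (star G) A = fob (star F) A ==> (!!X. X \<in> Ob V ==> \<alpha> X = Id V (fob F X)) ==>
  star_trans F G \<alpha> A = Id (VGph V) (fob (star F) A)"
 using star_trans_cong[OF is_gph_pre, of V A \<alpha> "\<lambda>X. Id V (fob F X)" F F G G] star_trans_Id[of G A F V] by simp

abbreviation (input) G where "G \<equiv> VGph V"

interpretation VG: dcat "VGph V" by (rule VGph_dcat[OF dcat_axioms])

interpretation fcF: cat_functor "VGph V" "VGph V" "Fun (fc V)" by (rule cocont_functor[OF fc_cocont])

interpretation fcM: monad "VGph V" "fc V" by (rule fc_monad)

lemma fc_comp: "f \<in> hom G A B ==> g \<in> hom G B D ==> fc_ar V (g \<cdot>\<^bsub>G\<^esub> f) = fc_ar V g \<cdot>\<^bsub>G\<^esub> fc_ar V f"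
 using fcF.far_Comp by simp

lemma fc_hom: "f \<in> hom G A B ==> fc_ar V f \<in> hom G (fc_ob V A) (fc_ob V B)"
 using fcF.far_hom by simp

lemma fc_Id: "is_gph V A ==> fc_ar V (Id G A) = Id G (fc_ob V A)"
 using fcF.far_Id[of A] by simp

lemma fcu_hom: "is_gph V A ==> fc_unit V A \<in> hom G A (fc_ob V A)"
 using fcM.unit.component[of A] by simp

lemma fcm_hom: "is_gph V A ==> Mult (fc V) A \<in> hom G (fc_ob V (fc_ob V A)) (fc_ob V A)"
 using fcM.mult.component[of A] by simp

lemma I_hom: "cocont V V F ==> is_gph V A ==> ich V F A \<in> hom G (fob (star F) (fc_ob V A)) (fc_ob V (fob (star F) A))"
 using nat_trans.component[OF ich_nat_trans[of F], of A] by simp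

lemma I_nat: "cocont V V F ==> f \<in> hom G A B ==>
  ich V F B \<cdot>\<^bsub>G\<^esub> far (star F) (fc_ar V f) = fc_ar V (far (star F) f) \<cdot>\<^bsub>G\<^esub> ich V F A"
 using nat_trans.natural[OF ich_nat_trans[of F], of f A B] by simp

lemma star_far_hom: "cat_functor V V F ==> f \<in> hom G A B ==> far (star F) f \<in> hom G (fob (star F) A) (fob (star F) B)"
 using cat_functor.far_hom[OF two_dcats.star_functor[OF two_dcats]] .

lemma star_far_comp: "cat_functor V V F ==> f \<in> hom G A B ==> g \<in> hom G B D ==>
  far (star F) (g \<cdot>\<^bsub>G\<^esub> f) = far (star F) g \<cdot>\<^bsub>G\<^esub> far (star F) f"
 using cat_functor.far_Comp[OF two_dcats.star_functor[OF two_dcats]] .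

text \<open>A series \<open>T'\<close> on \<open>V\<close> is starred, its indices are shifted by
  one, and \<open>fc\<close> is put in front; this is how the monads of dimension n + 1 arise from
  those of dimension n. The aim is to express the new composite through the old composite,
  \<open>fc\<close> and a single interchange map.\<close>

context
 fixes n :: nat and T' :: "nat => 'a cell_monad" and l' and T :: "nat => 'a cell_monad" and l
 assumes ds: "distributive_series V n T' l'" and coc: "!!i. i < n ==> cocont V V (Fun (T' i))"
  and T: "T 0 = fc V" "!!i. T (Suc i) = star_monad (T' i)"
  and l: "!!i. l (Suc i) 0 = ich V (Fun (T' i))"
    "!!i j. l (Suc i) (Suc j) = star_trans (Fun (T' i) \<odot> Fun (T' j)) (Fun (T' j) \<odot> Fun (T' i)) (l' i j)"
begin

interpretation ds: distributive_series V n T' l' by (rule ds)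

abbreviation (input) R where "R \<equiv> series_fctr T'"

abbreviation (input) Rk where "Rk k \<equiv> star (R k)"

abbreviation (input) Tk where "Tk k \<equiv> star (Fun (T' k))"

lemma R_cocont: "k \<le> n ==> cocont V V (R k)"
proof (induction k)
 case 0
 then show ?case using cocont_id[OF category_axioms] by simp
next
 case (Suc k)
 then show ?case using cocont_comp[OF coc[of k] Suc.IH] by simp
qed

text \<open>Agreement holds only on graphs: for an empty old series it already compares the identity
  with \<open>star id_fctr\<close>.\<close>

lemma series_star_fctr: "k \<le> n ==> fctr_eq G (series_fctr T (Suc k)) (Fun (fc V) \<odot> Rk k)"
proof (induction k)
 case 0
 have "fctr_eq G (Fun (fc V) \<odot> id_fctr) (Fun (fc V) \<odot> star id_fctr)"
  using star_id[of V] unfolding fctr_eq_def by simp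
 then show ?case by (simp add: T)
next
 case (Suc k)
 interpret two_dcats V V by (rule two_dcats)
 have "cat_functor G G (Tk k)" using star_functor[OF ds.T_functor] Suc by simp
 from fctr_eq_comp[OF fctr_eq_refl Suc.IH[OF Suc_leD[OF Suc.prems]] this]
 show ?case by (simp add: T star_comp comp_fctr_assoc)
qed

lemma R_gph: "k \<le> n ==> is_gph V A ==> is_gph V (fob (Rk k) A)"
 by (rule star_is_gph[OF ds.R_functor])

lemma T_gph: "k < n ==> is_gph V A ==> is_gph V (fob (Tk k) A)"
 by (rule star_is_gph[OF ds.T_functor])

lemma series_star_far: "k \<le> n ==> f \<in> Ar G ==> far (series_fctr T (Suc k)) f = fc_ar V (far (Rk k) f)"
 using series_star_fctr[of k] by (simp add: fctr_eq_def)

lemma series_star_unit: "k \<le> n ==> is_gph V A ==>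
  series_unit G T (Suc k) A = fc_unit V (fob (Rk k) A) \<cdot>\<^bsub>G\<^esub> star_trans id_fctr (R k) (series_unit V T' k) A"
proof (induction k arbitrary: A)
 case 0
 have 1: "star_trans id_fctr (R 0) (series_unit V T' 0) A = Id G A"
  using star_trans_Id'[OF 0(2), of id_fctr id_fctr "series_unit V T' 0"] star_id_ob[OF 0(2)] by simp
 show ?case
  unfolding 1 using VG.homD[OF fcu_hom[OF 0(2)]] star_id_ob[OF 0(2)] by (simp add: T del: VGph_sel)
next
 case (Suc k)
 note A = Suc.prems(2)
 have k: "k < n" "k \<le> n" using Suc.prems by simp_all
 note tA = T_gph[OF k(1) A]
 have u: "star_trans id_fctr (Fun (T' k)) (Unit (T' k)) A \<in> hom G A (fob (Tk k) A)"
  using star_trans_hom[OF A, of "Unit (T' k)" id_fctr "Fun (T' k)"] ds.T_unit[OF k(1)] star_id_ob[OF A] by simp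
 have s: "star_trans id_fctr (R k) (series_unit V T' k) (fob (Tk k) A) \<in> hom G (fob (Tk k) A) (fob (Rk k) (fob (Tk k) A))"
  using star_trans_hom[OF tA, of "series_unit V T' k" id_fctr "R k"] ds.series_unit_hom[OF k(2)] star_id_ob[OF tA] by simp
 have "series_unit G T (Suc (Suc k)) A = series_unit G T (Suc k) (fob (Tk k) A) \<cdot>\<^bsub>G\<^esub> star_trans id_fctr (Fun (T' k)) (Unit (T' k)) A"
  by (simp add: T)
 also have "\<dots> = fc_unit V (fob (Rk k) (fob (Tk k) A)) \<cdot>\<^bsub>G\<^esub>
   (star_trans id_fctr (R k) (series_unit V T' k) (fob (Tk k) A) \<cdot>\<^bsub>G\<^esub> star_trans id_fctr (Fun (T' k)) (Unit (T' k)) A)"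
  unfolding Suc.IH[OF k(2) tA] by (rule VG.Comp_assoc[OF u s fcu_hom[OF R_gph[OF k(2) tA]]])
 also have "star_trans id_fctr (R k) (series_unit V T' k) (fob (Tk k) A) \<cdot>\<^bsub>G\<^esub> star_trans id_fctr (Fun (T' k)) (Unit (T' k)) A =
   star_trans id_fctr (R (Suc k)) (series_unit V T' (Suc k)) A"
  unfolding VGph_sel star_trans_fob star_trans_comp by (rule star_trans_cong[OF is_gph_pre[OF A]]) simp_all
 finally show ?case by (simp only: star_comp_ob series_fctr.simps dbl.simps)
qed

text \<open>The first swap of the monad with index \<open>Suc i\<close> is the interchange with
  \<open>fc\<close>; all later swaps take place inside \<open>fc\<close> and are starred swaps of
  the old series.\<close>

lemma series_star_move: "k \<le> i ==> i < n ==> is_gph V A ==>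
  move G T l (Suc i) (Suc k) A = fc_ar V (star_trans (Fun (T' i) \<odot> R k) (R k \<odot> Fun (T' i)) (move V T' l' i k) A) \<cdot>\<^bsub>G\<^esub>
   ich V (Fun (T' i)) (fob (Rk k) A)"
proof (induction k arbitrary: A)
 case 0
 have 1: "star_trans (Fun (T' i) \<odot> R 0) (R 0 \<odot> Fun (T' i)) (move V T' l' i 0) A = Id G (fob (Tk i) A)"
  using star_trans_Id'[OF 0(3), of "Fun (T' i)" "Fun (T' i)" "move V T' l' i 0"] by simp
 show ?case
  unfolding 1 fc_Id[OF T_gph[OF 0(2,3)]] using VG.homD[OF I_hom[OF coc[OF 0(2)] 0(3)]] star_id_ob[OF 0(3)] fc_is_gph[OF 0(3)] T_gph[OF 0(2) fc_is_gph[OF 0(3)]]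
  by (simp add: T l del: VGph_sel)
next
 case (Suc k)
 note A = Suc.prems(3) and i = Suc.prems(2)
 have k: "k < n" "k \<le> n" "k \<le> i" "k < i" using Suc.prems by simp_all
 note tA = T_gph[OF k(1) A]
 let ?t = "Tk k"
 let ?L = "star_trans (Fun (T' i) \<odot> Fun (T' k)) (Fun (T' k) \<odot> Fun (T' i)) (l' i k) A"
 let ?M = "star_trans (Fun (T' i) \<odot> R k) (R k \<odot> Fun (T' i)) (move V T' l' i k)"
 have L: "?L \<in> hom G (fob (star (Fun (T' i) \<odot> Fun (T' k))) A) (fob (star (Fun (T' k) \<odot> Fun (T' i))) A)"
  using star_trans_hom[OF A] ds.T_law[OF k(4) i] by simp
 have RL: "far (Rk k) ?L \<in> hom G (fob (star (R k \<odot> Fun (T' i) \<odot> Fun (T' k))) A) (fob (star (R k \<odot> Fun (T' k) \<odot> Fun (T' i))) A)"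
  using star_far_hom[OF ds.R_functor[OF k(2)] L] by (simp add: star_comp_ob)
 have M: "?M (fob ?t A) \<in> hom G (fob (star (Fun (T' i) \<odot> R k \<odot> Fun (T' k))) A) (fob (star (R k \<odot> Fun (T' i) \<odot> Fun (T' k))) A)"
  using star_trans_hom[OF tA, of "move V T' l' i k" "Fun (T' i) \<odot> R k" "R k \<odot> Fun (T' i)"] ds.move_hom[OF k(3) i] by (simp add: star_comp_ob comp_fctr_assoc)
 have I: "ich V (Fun (T' i)) (fob (Rk k) (fob ?t A)) \<in> hom G (fob (Tk i) (fc_ob V (fob (Rk k) (fob ?t A)))) (fc_ob V (fob (star (Fun (T' i) \<odot> R k \<odot> Fun (T' k))) A))"
  using I_hom[OF coc[OF i] R_gph[OF k(2) tA]] by (simp add: star_comp_ob)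
 have "move G T l (Suc i) (Suc (Suc k)) A = fc_ar V (far (Rk k) ?L) \<cdot>\<^bsub>G\<^esub> (fc_ar V (?M (fob ?t A)) \<cdot>\<^bsub>G\<^esub> ich V (Fun (T' i)) (fob (Rk k) (fob ?t A)))"
  using series_star_far[OF k(2) VG.homD(1)[OF L]] Suc.IH[OF k(3) i tA] by (simp add: T l)
 also have "\<dots> = fc_ar V (far (Rk k) ?L \<cdot>\<^bsub>G\<^esub> ?M (fob ?t A)) \<cdot>\<^bsub>G\<^esub> ich V (Fun (T' i)) (fob (Rk k) (fob ?t A))"
  unfolding fc_comp[OF M RL] by (rule VG.Comp_assoc[OF I fc_hom[OF M] fc_hom[OF RL], symmetric])
 also have "far (Rk k) ?L \<cdot>\<^bsub>G\<^esub> ?M (fob ?t A) = star_trans (Fun (T' i) \<odot> R (Suc k)) (R (Suc k) \<odot> Fun (T' i)) (move V T' l' i (Suc k)) A"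
  unfolding VGph_sel star_trans_fob star_trans_far star_trans_comp by (rule star_trans_cong[OF is_gph_pre[OF A]]) (simp_all add: comp_fctr_assoc)
 finally show ?case by (simp only: star_comp_ob series_fctr.simps dbl.simps)
qed

lemma series_star_doubled_mult: "k \<le> n ==> is_gph V A ==>
  doubled_mult G T (Suc k) A = fc_ar V (star_trans (dbl T' k) (R k) (doubled_mult V T' k) A) \<cdot>\<^bsub>G\<^esub> Mult (fc V) (fob (star (dbl T' k)) A)"
proof (induction k arbitrary: A)
 case 0
 have 1: "star_trans (dbl T' 0) (R 0) (doubled_mult V T' 0) A = Id G A"
  using star_trans_Id'[OF 0(2), of id_fctr id_fctr "doubled_mult V T' 0"] star_id_ob[OF 0(2)] by simp
 show ?case
  unfolding 1 fc_Id[OF 0(2)] using VG.homD[OF fcm_hom[OF 0(2)]] star_id_ob[OF 0(2)] by (simp add: T del: VGph_sel)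
next
 case (Suc k)
 note A = Suc.prems(2)
 have k: "k < n" "k \<le> n" using Suc.prems by simp_all
 let ?t = "Tk k"
 note tA = T_gph[OF k(1) A]
 note ttA = T_gph[OF k(1) tA]
 let ?L = "star_trans (Fun (T' k) \<odot> Fun (T' k)) (Fun (T' k)) (Mult (T' k)) A"
 let ?D = "star_trans (dbl T' k) (R k) (doubled_mult V T' k)"
 have L: "?L \<in> hom G (fob (star (Fun (T' k) \<odot> Fun (T' k))) A) (fob ?t A)"
  using star_trans_hom[OF A] ds.T_mult[OF k(1)] by simp
 have RL: "far (Rk k) ?L \<in> hom G (fob (star (R k \<odot> Fun (T' k) \<odot> Fun (T' k))) A) (fob (star (R k \<odot> Fun (T' k))) A)"
  using star_far_hom[OF ds.R_functor[OF k(2)] L] by (simp add: star_comp_ob)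
 have D: "?D (fob ?t (fob ?t A)) \<in> hom G (fob (star (dbl T' (Suc k))) A) (fob (star (R k \<odot> Fun (T' k) \<odot> Fun (T' k))) A)"
  using star_trans_hom[OF ttA, of "doubled_mult V T' k" "dbl T' k" "R k"] ds.doubled_mult_hom[OF k(2)] by (simp add: star_comp_ob comp_fctr_assoc)
 have dg: "is_gph V (fob (star (dbl T' (Suc k))) A)" using D by (simp add: VGph_hom)
 have M: "Mult (fc V) (fob (star (dbl T' k)) (fob ?t (fob ?t A))) \<in> hom G (fc_ob V (fc_ob V (fob (star (dbl T' (Suc k))) A))) (fc_ob V (fob (star (dbl T' (Suc k))) A))"
  using fcm_hom[OF dg] by (simp add: star_comp_ob)
 have "doubled_mult G T (Suc (Suc k)) A = fc_ar V (far (Rk k) ?L) \<cdot>\<^bsub>G\<^esub> (fc_ar V (?D (fob ?t (fob ?t A))) \<cdot>\<^bsub>G\<^esub> Mult (fc V) (fob (star (dbl T' k)) (fob ?t (fob ?t A))))"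
  using series_star_far[OF k(2) VG.homD(1)[OF L]] Suc.IH[OF k(2) ttA] by (simp add: T)
 also have "\<dots> = fc_ar V (far (Rk k) ?L \<cdot>\<^bsub>G\<^esub> ?D (fob ?t (fob ?t A))) \<cdot>\<^bsub>G\<^esub> Mult (fc V) (fob (star (dbl T' k)) (fob ?t (fob ?t A)))"
  unfolding fc_comp[OF D RL] by (rule VG.Comp_assoc[OF M fc_hom[OF D] fc_hom[OF RL], symmetric])
 also have "far (Rk k) ?L \<cdot>\<^bsub>G\<^esub> ?D (fob ?t (fob ?t A)) = star_trans (dbl T' (Suc k)) (R (Suc k)) (doubled_mult V T' (Suc k)) A"
  unfolding VGph_sel star_trans_fob star_trans_far star_trans_comp by (rule star_trans_cong[OF is_gph_pre[OF A]]) (simp_all add: comp_fctr_assoc)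
 finally show ?case by (simp only: star_comp_ob series_fctr.simps dbl.simps)
qed

text \<open>The interchanges of the single monads with the second copy of \<open>fc\<close> add up
  to one interchange with their composite: naturality of interchange lets the old swaps pass, and
  \<open>ich_comp\<close> merges the interchange maps that have become adjacent.\<close>

lemma series_star_shuffle: "k \<le> n ==> is_gph V A ==>
  shuffle G T l (Suc k) A = fc_ar V (fc_ar V (star_trans (R k \<odot> R k) (dbl T' k) (shuffle V T' l' k) A) \<cdot>\<^bsub>G\<^esub> ich V (R k) (fob (Rk k) A))"
proof (induction k arbitrary: A)
 case 0
 note fA = fc_is_gph[OF 0(2)]
 have 1: "star_trans (R 0 \<odot> R 0) (dbl T' 0) (shuffle V T' l' 0) A = Id G A"
  using star_trans_Id'[OF 0(2), of id_fctr id_fctr "shuffle V T' l' 0"] star_id_ob[OF 0(2)] by simp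
 have 2: "ich V (R 0) (fob (star (R 0)) A) = Id G (fc_ob V A)" using ich_id[OF 0(2)] star_id_ob[OF 0(2)] by simp
 have i: "Id G (fc_ob V A) \<cdot>\<^bsub>G\<^esub> Id G (fc_ob V A) = Id G (fc_ob V A)" if "is_gph V A" for A
  using fc_is_gph[OF that] VG.homD[OF VG.Id_hom, of "fc_ob V A"] VG.Id_Comp_simp[of "Id G (fc_ob V A)" "fc_ob V A"] by simp
 show ?case
  unfolding 1 2 fc_Id[OF 0(2)] i[OF 0(2)] fc_Id[OF fA] using i[OF fA] by (simp add: T del: VGph_sel)
next
 case (Suc k)
 note A = Suc.prems(2)
 have k: "k < n" "k \<le> n" using Suc.prems by simp_all
 let ?t = "Tk k" and ?r = "Rk k"
 note tA = T_gph[OF k(1) A]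
 note ttA = T_gph[OF k(1) tA]
 let ?M = "star_trans (Fun (T' k) \<odot> R k) (R k \<odot> Fun (T' k)) (move V T' l' k k) (fob ?t A)"
 let ?S = "star_trans (R k \<odot> R k) (dbl T' k) (shuffle V T' l' k) (fob ?t (fob ?t A))"
 let ?Y = "fob (star (R (Suc k))) A"
 have Yg: "is_gph V ?Y" by (rule R_gph[OF Suc.prems(1) A])
 have Y: "fob ?r (fob ?t A) = ?Y" by (simp add: star_comp_ob)
 note rf = ds.R_functor[OF k(2)]
 have M: "?M \<in> hom G (fob ?t ?Y) (fob ?r (fob ?t (fob ?t A)))"
  using star_trans_hom[OF tA, of "move V T' l' k k" "Fun (T' k) \<odot> R k" "R k \<odot> Fun (T' k)"] ds.move_hom[OF order_refl k(1)] by (simp add: star_comp_ob comp_fctr_assoc)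
 have rM: "far ?r ?M \<in> hom G (fob ?r (fob ?t ?Y)) (fob ?r (fob ?r (fob ?t (fob ?t A))))" by (rule star_far_hom[OF rf M])
 have S: "?S \<in> hom G (fob ?r (fob ?r (fob ?t (fob ?t A)))) (fob (star (dbl T' k)) (fob ?t (fob ?t A)))"
  using star_trans_hom[OF ttA, of "shuffle V T' l' k" "R k \<odot> R k" "dbl T' k"] ds.shuffle_hom[OF k(2)] by (simp add: star_comp_ob comp_fctr_assoc)
 have IT: "ich V (Fun (T' k)) ?Y \<in> hom G (fob ?t (fc_ob V ?Y)) (fc_ob V (fob ?t ?Y))" by (rule I_hom[OF coc[OF k(1)] Yg])
 have rIT: "far ?r (ich V (Fun (T' k)) ?Y) \<in> hom G (fob ?r (fob ?t (fc_ob V ?Y))) (fob ?r (fc_ob V (fob ?t ?Y)))" by (rule star_far_hom[OF rf IT])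
 have IR1: "ich V (R k) (fob ?r (fob ?t (fob ?t A))) \<in> hom G (fob ?r (fc_ob V (fob ?r (fob ?t (fob ?t A))))) (fc_ob V (fob ?r (fob ?r (fob ?t (fob ?t A)))))"
  by (rule I_hom[OF R_cocont[OF k(2)] R_gph[OF k(2) ttA]])
 have IR2: "ich V (R k) (fob ?t ?Y) \<in> hom G (fob ?r (fc_ob V (fob ?t ?Y))) (fc_ob V (fob ?r (fob ?t ?Y)))"
  by (rule I_hom[OF R_cocont[OF k(2)] T_gph[OF k(1) Yg]])
 note fM = fc_hom[OF M]
 note rfM = star_far_hom[OF rf fM]
 have mv: "move G T l (Suc k) (Suc k) (fob ?t A) = fc_ar V ?M \<cdot>\<^bsub>G\<^esub> ich V (Fun (T' k)) ?Y"
  using series_star_move[OF order_refl k(1) tA] unfolding Y .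
 note mvh = VG.Comp_hom[OF IT fM]
 have "shuffle G T l (Suc (Suc k)) A = shuffle G T l (Suc k) (fob ?t (fob ?t A)) \<cdot>\<^bsub>G\<^esub> far (series_fctr T (Suc k)) (move G T l (Suc k) (Suc k) (fob ?t A))"
  unfolding shuffle.simps(2)[of G T l "Suc k"] by (simp only: T star_monad_sel)
 also have "\<dots> = fc_ar V (fc_ar V ?S \<cdot>\<^bsub>G\<^esub> ich V (R k) (fob ?r (fob ?t (fob ?t A)))) \<cdot>\<^bsub>G\<^esub> fc_ar V (far ?r (fc_ar V ?M \<cdot>\<^bsub>G\<^esub> ich V (Fun (T' k)) ?Y))"
  unfolding mv Suc.IH[OF k(2) ttA] series_star_far[OF k(2) VG.homD(1)[OF mvh]] ..
 also have "\<dots> = fc_ar V (fc_ar V ?S \<cdot>\<^bsub>G\<^esub> ich V (R k) (fob ?r (fob ?t (fob ?t A))) \<cdot>\<^bsub>G\<^esub> (far ?r (fc_ar V ?M) \<cdot>\<^bsub>G\<^esub> far ?r (ich V (Fun (T' k)) ?Y)))"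
  unfolding star_far_comp[OF rf IT fM] by (rule fc_comp[OF VG.Comp_hom[OF rIT rfM] VG.Comp_hom[OF IR1 fc_hom[OF S]], symmetric])
 also have "fc_ar V ?S \<cdot>\<^bsub>G\<^esub> ich V (R k) (fob ?r (fob ?t (fob ?t A))) \<cdot>\<^bsub>G\<^esub> (far ?r (fc_ar V ?M) \<cdot>\<^bsub>G\<^esub> far ?r (ich V (Fun (T' k)) ?Y)) =
   fc_ar V ?S \<cdot>\<^bsub>G\<^esub> ((ich V (R k) (fob ?r (fob ?t (fob ?t A))) \<cdot>\<^bsub>G\<^esub> far ?r (fc_ar V ?M)) \<cdot>\<^bsub>G\<^esub> far ?r (ich V (Fun (T' k)) ?Y))"
  unfolding VG.Comp_assoc[OF rIT rfM IR1] VG.Comp_assoc[OF VG.Comp_hom[OF rIT rfM] IR1 fc_hom[OF S]] ..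
 also have "ich V (R k) (fob ?r (fob ?t (fob ?t A))) \<cdot>\<^bsub>G\<^esub> far ?r (fc_ar V ?M) = fc_ar V (far ?r ?M) \<cdot>\<^bsub>G\<^esub> ich V (R k) (fob ?t ?Y)"
  by (rule I_nat[OF R_cocont[OF k(2)] M])
 also have "fc_ar V ?S \<cdot>\<^bsub>G\<^esub> (fc_ar V (far ?r ?M) \<cdot>\<^bsub>G\<^esub> ich V (R k) (fob ?t ?Y) \<cdot>\<^bsub>G\<^esub> far ?r (ich V (Fun (T' k)) ?Y)) =
   fc_ar V (?S \<cdot>\<^bsub>G\<^esub> far ?r ?M) \<cdot>\<^bsub>G\<^esub> (ich V (R k) (fob ?t ?Y) \<cdot>\<^bsub>G\<^esub> far ?r (ich V (Fun (T' k)) ?Y))"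
  unfolding fc_comp[OF rM S] VG.Comp_assoc[OF rIT IR2 fc_hom[OF rM]] VG.Comp_assoc[OF VG.Comp_hom[OF rIT IR2] fc_hom[OF rM] fc_hom[OF S]] ..
 also have "ich V (R k) (fob ?t ?Y) \<cdot>\<^bsub>G\<^esub> far ?r (ich V (Fun (T' k)) ?Y) = ich V (R (Suc k)) ?Y"
  using ich_comp[OF R_cocont[OF k(2)] coc[OF k(1)] is_gph_pre[OF Yg]] by simp
 also have "?S \<cdot>\<^bsub>G\<^esub> far ?r ?M = star_trans (R (Suc k) \<odot> R (Suc k)) (dbl T' (Suc k)) (shuffle V T' l' (Suc k)) A"
  unfolding VGph_sel star_trans_fob star_trans_far star_trans_comp by (rule star_trans_cong[OF is_gph_pre[OF A]]) (simp_all add: comp_fctr_assoc)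
 finally show ?case .
qed

text \<open>Naturality of the multiplication of \<open>fc\<close> moves the old shuffle past it,
  where it joins the old doubled multiplication to form the multiplication of the old
  composite.\<close>

lemma series_star_mult:
 assumes A: "is_gph V A"
 shows "Mult (composite_monad G (Suc n) T l) A =
  fc_ar V (star_trans (R n \<odot> R n) (R n) (Mult (composite_monad V n T' l')) A) \<cdot>\<^bsub>G\<^esub>
   (Mult (fc V) (fob (star (R n \<odot> R n)) A) \<cdot>\<^bsub>G\<^esub> fc_ar V (ich V (R n) (fob (Rk n) A)))"
proof -
 let ?S = "star_trans (R n \<odot> R n) (dbl T' n) (shuffle V T' l' n) A" and ?D = "star_trans (dbl T' n) (R n) (doubled_mult V T' n) A"
 let ?I = "ich V (R n) (fob (Rk n) A)"
 note rA = R_gph[OF order_refl A]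
 have S: "?S \<in> hom G (fob (star (R n \<odot> R n)) A) (fob (star (dbl T' n)) A)"
  using star_trans_hom[OF A] ds.shuffle_hom[OF order_refl] by simp
 have D: "?D \<in> hom G (fob (star (dbl T' n)) A) (fob (Rk n) A)"
  using star_trans_hom[OF A] ds.doubled_mult_hom[OF order_refl] by simp
 have g: "is_gph V (fob (star (dbl T' n)) A)" "is_gph V (fob (star (R n \<odot> R n)) A)" using S by (simp_all add: VGph_hom)
 have I: "?I \<in> hom G (fob (Rk n) (fc_ob V (fob (Rk n) A))) (fc_ob V (fob (star (R n \<odot> R n)) A))"
  using I_hom[OF R_cocont[OF order_refl] rA] by (simp add: star_comp_ob)
 note fS = fc_hom[OF S] and fD = fc_hom[OF D]
 note ffS = fc_hom[OF fS] and fI = fc_hom[OF I]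
 note M = fcm_hom[OF g(1)] and M2 = fcm_hom[OF g(2)]
 have nat: "Mult (fc V) (fob (star (dbl T' n)) A) \<cdot>\<^bsub>G\<^esub> fc_ar V (fc_ar V ?S) = fc_ar V ?S \<cdot>\<^bsub>G\<^esub> Mult (fc V) (fob (star (R n \<odot> R n)) A)"
  using fcM.mult.natural[OF S] by simp
 have "Mult (composite_monad G (Suc n) T l) A = fc_ar V ?D \<cdot>\<^bsub>G\<^esub> Mult (fc V) (fob (star (dbl T' n)) A) \<cdot>\<^bsub>G\<^esub> fc_ar V (fc_ar V ?S \<cdot>\<^bsub>G\<^esub> ?I)"
  unfolding composite_monad_def monad.simps series_star_doubled_mult[OF order_refl A] series_star_shuffle[OF order_refl A] ..
 also have "\<dots> = fc_ar V ?D \<cdot>\<^bsub>G\<^esub> (Mult (fc V) (fob (star (dbl T' n)) A) \<cdot>\<^bsub>G\<^esub> fc_ar V (fc_ar V ?S) \<cdot>\<^bsub>G\<^esub> fc_ar V ?I)"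
  unfolding fc_comp[OF I fS] VG.Comp_assoc[OF VG.Comp_hom[OF fI ffS] M fD] VG.Comp_assoc[OF fI ffS M] ..
 also have "\<dots> = fc_ar V (?D \<cdot>\<^bsub>G\<^esub> ?S) \<cdot>\<^bsub>G\<^esub> (Mult (fc V) (fob (star (R n \<odot> R n)) A) \<cdot>\<^bsub>G\<^esub> fc_ar V ?I)"
  unfolding nat fc_comp[OF S D] VG.Comp_assoc[OF fI M2 fS] VG.Comp_assoc[OF VG.Comp_hom[OF fI M2] fS fD] ..
 also have "?D \<cdot>\<^bsub>G\<^esub> ?S = star_trans (R n \<odot> R n) (R n) (Mult (composite_monad V n T' l')) A"
  unfolding VGph_sel star_trans_comp composite_monad_def monad.simps ..
 finally show ?thesis .
qed

lemma series_star_Fun: "fctr_eq G (Fun (composite_monad G (Suc n) T l)) (Fun (fc V) \<odot> star (Fun (composite_monad V n T' l')))"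
 using series_star_fctr[OF order_refl] by (simp add: composite_monad_def)

lemma series_star_Unit: "is_gph V A ==> Unit (composite_monad G (Suc n) T l) A =
  fc_unit V (fob (Rk n) A) \<cdot>\<^bsub>G\<^esub> star_trans id_fctr (R n) (Unit (composite_monad V n T' l')) A"
 using series_star_unit[OF order_refl] by (simp add: composite_monad_def)

end

end

section \<open>The series of the monads for free composition\<close>

lemma nGph_dcat: "dcat (nGph n)"
 by (induction n) (auto simp: set_dcat VGph_dcat)

lemma comp_monad_props: "i < n ==> monad (nGph n :: 'a cell_vcat) (comp_monad n i) & cocont (nGph n :: 'a cell_vcat) (nGph n) (Fun (comp_monad n i))"
proof (induction n i rule: comp_monad.induct)
 case (1 n)
 interpret dcat "nGph n :: 'a cell_vcat" by (rule nGph_dcat)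
 show ?case using fc_monad fc_cocont by simp
next
 case (2 n i)
 interpret dcat "nGph n :: 'a cell_vcat" by (rule nGph_dcat)
 show ?case using 2 star_monad two_dcats.star_cocont[OF two_dcats] by simp
qed simp

lemma comp_monad_law: "j < i ==> i < n ==>
  distributive_law (nGph n :: 'a cell_vcat) (comp_monad n i) (comp_monad n j) (interchange n i j)"
proof (induction n arbitrary: i j)
 case (Suc n)
 interpret dcat "nGph n :: 'a cell_vcat" by (rule nGph_dcat)
 obtain i' where i: "i = Suc i'" "i' < n" using Suc.prems by (cases i) auto
 note p = comp_monad_props[OF i(2)]
 show ?case
 proof (cases j)
  case 0
  then show ?thesis using interchange_law[OF conjunct1[OF p] conjunct2[OF p]] i by simp
 next
  case (Suc j')
  then show ?thesis using star_distributive_law[OF Suc.IH[of j' i']] Suc.prems i by simp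
 qed
qed simp

text \<open>Only triples that contain the index 0 involve interchange with \<open>fc\<close>
  directly; all others are starred from the dimension below.\<close>

lemma comp_monad_Yang_Baxter: "k < j ==> j < i ==> i < n ==> A \<in> Ob (nGph n :: 'a cell_vcat) ==>
   interchange n j k (mob (comp_monad n i) A) \<cdot>\<^bsub>nGph n :: 'a cell_vcat\<^esub> mar (comp_monad n j) (interchange n i k A) \<cdot>\<^bsub>nGph n :: 'a cell_vcat\<^esub> interchange n i j (mob (comp_monad n k) A) =
   mar (comp_monad n k) (interchange n i j A) \<cdot>\<^bsub>nGph n :: 'a cell_vcat\<^esub> interchange n i k (mob (comp_monad n j) A) \<cdot>\<^bsub>nGph n :: 'a cell_vcat\<^esub> mar (comp_monad n i) (interchange n j k A)"
proof (induction n arbitrary: i j k A)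
 case (Suc n)
 interpret dcat "nGph n :: 'a cell_vcat" by (rule nGph_dcat)
 obtain i' j' where i: "i = Suc i'" "i' < n" and j: "j = Suc j'" "j' < i'" "j' < n" using Suc.prems by (cases i; cases j) auto
 have A: "is_gph (nGph n) A" using Suc.prems(4) by simp
 note pi = comp_monad_props[OF i(2)] and pj = comp_monad_props[OF j(3)]
 interpret law: distributive_law "nGph n" "comp_monad n i'" "comp_monad n j'" "interchange n i' j'"
  by (rule comp_monad_law[OF j(2) i(2)])
 show ?case
 proof (cases k)
  case 0
  then show ?thesis
   using interchange_Yang_Baxter[OF conjunct2[OF pi] conjunct2[OF pj] law.nat_trans_axioms A] i j by simp
 next
  case (Suc k')
  then have k: "k' < j'" using Suc.prems j by simp
  show ?thesis
   unfolding i(1) j(1) Suc interchange.simps comp_monad.simps star_monad_sel nGph.simps VGph_sel star_trans_fob star_trans_far star_trans_comp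
   by (rule star_trans_cong[OF is_gph_pre[OF A] Suc.IH[OF k j(2) i(2)]]) (simp_all add: comp_fctr_assoc)
 qed
qed simp

lemma comp_monad_series: "distributive_series (nGph n :: 'a cell_vcat) n (comp_monad n) (interchange n)"
proof -
 interpret dcat "nGph n :: 'a cell_vcat" by (rule nGph_dcat)
 show ?thesis
  by (intro distributive_series.intro distributive_series_axioms.intro category_axioms conjunct1[OF comp_monad_props] comp_monad_law comp_monad_Yang_Baxter)
qed

section \<open>Functors preserving the chosen products and coproducts\<close>

text \<open>With equalities instead of isomorphisms no coherence maps appear: tuples, path summands
  and formal composites in \<open>W\<close> are sent to those in \<open>V\<close>, so maps out of
  \<open>fc\<close> can be compared after applying \<open>U\<close>.\<close>

locale strict_functor = W: dcat W + V: dcat V + U: cat_functor W V U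
 for W :: "('a obj, 'a arr, 'a cell, 'z) vcat_scheme" and V :: "('a obj, 'a arr, 'a cell, 'y) vcat_scheme" and U +
 assumes Prod: "set Xs <= Ob W ==> fob U (Prod W Xs) = Prod V (map (fob U) Xs)"
  and Proj: "set Xs <= Ob W ==> r < length Xs ==> far U (Proj W Xs r) = Proj V (map (fob U) Xs) r"
  and Coprod: "(!!i. i \<in> I ==> X i \<in> Ob W) ==> fob U (Coprod W I X) = Coprod V I (\<lambda>i. fob U (X i))"
  and Inj: "(!!i. i \<in> I ==> X i \<in> Ob W) ==> i \<in> I ==> far U (Inj W I X i) = Inj V I (\<lambda>i. fob U (X i)) i"
begin

abbreviation (input) Us where "Us \<equiv> star U"

lemma map_Ob: "set Xs <= Ob W ==> set (map (fob U) Xs) <= Ob V"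
 using U.fob_Ob by auto

lemma tuple:
 assumes Z: "Z \<in> Ob W" and fs: "elems W Z fs Xs"
 shows "far U (tuple W Z Xs fs) = tuple V (fob U Z) (map (fob U) Xs) (map (far U) fs)"
proof (rule V.tuple_eqI)
 note Xs = W.elems_Ob[OF fs] and t = W.tuple_hom[OF Z fs] and l = elems_length[OF fs]
 show "set (map (fob U) Xs) <= Ob V" by (rule map_Ob[OF Xs])
 show "far U (tuple W Z Xs fs) \<in> hom V (fob U Z) (Prod V (map (fob U) Xs))"
  using U.far_hom[OF t] Prod[OF Xs] by simp
 show "length (map (far U) fs) = length (map (fob U) Xs)" using l by simp
 fix r assume "r < length (map (fob U) Xs)"
 then have r: "r < length Xs" by simp
 show "Proj V (map (fob U) Xs) r \<cdot>\<^bsub>V\<^esub> far U (tuple W Z Xs fs) = map (far U) fs ! r"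
  using U.far_Comp[OF t W.Proj_hom[OF Xs r]] W.Proj_tuple[OF Z fs r] r l Proj[OF Xs r] by simp
qed

lemma pre: "pre_gph W A ==> pre_gph V (fob Us A)"
 using U.fob_Ob by (simp add: pre_gph_def)

lemma gph: "is_gph W A ==> is_gph V (fob Us A)"
 by (rule star_is_gph[OF U.cat_functor_axioms])

context
 fixes A assumes A: "pre_gph W A"
begin

lemma path_prod: "p \<in> paths (pts A) a b ==> fob U (path_prod W A p) = path_prod V (fob Us A) p"
 using Prod[OF legs_pre[OF A paths_untup(2)]] legs_star[OF paths_untup(2), of p A a b U] by (simp add: path_prod_def)

text \<open>The summands are known to correspond only for actual paths; the congruence axiom for
  chosen coproducts closes the gap between the two families.\<close>

lemma fhom: "fob U (fhom W A a b) = fhom V (fob Us A) a b"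
 using Coprod[of "paths (pts A) a b" "path_prod W A", OF W.path_prod_Ob[OF A]] V.Coprod_cong[of "paths (pts A) a b", OF path_prod] by simp

lemma path_inj: "p \<in> paths (pts A) a b ==> far U (path_inj W A a b p) = path_inj V (fob Us A) a b p"
 using Inj[of "paths (pts A) a b" "path_prod W A" p, OF W.path_prod_Ob[OF A]] V.Inj_cong[of "paths (pts A) a b" _ _ p, OF path_prod] by simp

lemma star_fc_ob: "fob Us (fc_ob W A) = fc_ob V (fob Us A)"
 using fhom by (auto simp: star_ob[of U "fc_ob W A"] fc_ob_def[of V] intro!: restrict_ext)

lemma star_elems: "pth A as ==> elems W Z fs (legs (hm A) as) ==> elems V (fob U Z) (map (far U) fs) (legs (hm (fob Us A)) as)"
 using U.elems_far legs_star by metis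

lemma pel:
 assumes as: "pth A as" and Z: "Z \<in> Ob W" and fs: "elems W Z fs (legs (hm A) as)"
 shows "far U (pel W A Z as fs) = pel V (fob Us A) (fob U Z) as (map (far U) fs)"
 using U.far_Comp[OF W.tuple_hom[OF Z fs] W.pinj_hom[OF A as]] path_inj[of "Tup as" "last as" "hd as"] as tuple[OF Z fs] legs_star[OF as, of U]
 by (simp add: pel_def paths_pth)

lemma star_fc_unit: "far Us (fc_unit W A) = fc_unit V (fob Us A)"
proof -
 have "far U (pel W A (hm A (a, b)) [b, a] [Id W (hm A (a, b))]) = pel V (fob Us A) (fob U (hm A (a, b))) [b, a] [Id V (fob U (hm A (a, b)))]"
  if ab: "a \<in> pts A" "b \<in> pts A" for a b
 proof -
  have h: "hm A (a, b) \<in> Ob W" using A ab by (simp add: pre_gph_def)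
  show ?thesis using pel[of "[b, a]" "hm A (a, b)" "[Id W (hm A (a, b))]"] ab h W.Id_hom[OF h] U.far_Id[OF h] by simp
 qed
 then show ?thesis using star_fc_ob by (auto simp: star_ar fc_unit_def star_ob[of U A] pel_def intro!: restrict_ext)
qed

end

lemma cocont: "cocont W V U"
proof (rule cocontI[OF U.cat_functor_axioms], intro exI conjI)
 fix I :: "'a cell set" and X assume X: "!!i. i \<in> I ==> X i \<in> Ob W"
 show "is_coprod W I X (Coprod W I X) (Inj W I X)" by (rule W.Coprod_is[OF X])
 show "is_coprod V I (\<lambda>i. fob U (X i)) (fob U (Coprod W I X)) (\<lambda>i. far U (Inj W I X i))"
  using is_coprod_cong[OF V.Coprod_is[of I "\<lambda>i. fob U (X i)", OF U.fob_Ob[OF X]] refl Inj[of I X, OF X, symmetric]] Coprod[of I X, OF X] by simp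
qed

lemma star_fc_ar:
 assumes f: "f \<in> gm W A B" and A: "pre_gph W A" and B: "pre_gph W B"
 shows "far Us (fc_ar W f) = fc_ar V (far Us f)"
proof -
 note F = W.fc_ar_gm[OF f A B] and Uf = star_gm[OF U.cat_functor_axioms f]
 note FU = V.fc_ar_gm[OF Uf pre[OF A] pre[OF B]]
 note UF = star_gm[OF U.cat_functor_axioms F(1), unfolded star_fc_ob[OF B]]
 show ?thesis
 proof (rule W.star_fc_eqI[OF cocont A UF FU(1)[folded star_fc_ob[OF A]]])
  fix Z as fs assume as: "pth A as" and Z: "Z \<in> Ob W" and fs: "elems W Z fs (legs (hm A) as)"
  note l = W.arrs_legs[OF f as] and ab = pth_hd(2,1)[OF as]
  show "fm (far Us (fc_ar W f)) (last as, hd as) \<cdot>\<^bsub>V\<^esub> far U (pel W A Z as fs) = fm (fc_ar V (far Us f)) (last as, hd as) \<cdot>\<^bsub>V\<^esub> far U (pel W A Z as fs)"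
   using star_fm_comp[OF U.cat_functor_axioms F(1) _ _ W.pel_hm[OF A as Z fs]] ab W.fc_ar_pel[OF f A B as Z fs]
    pel[OF B conjunct2[OF l] Z W.elems_map2[OF fs conjunct1[OF l]], unfolded U.far_comps[OF conjunct1[OF l] fs]] V.fc_ar_pel[OF Uf pre[OF A] pre[OF B] _ U.fob_Ob[OF Z] star_elems[OF A as fs]] as
   by (simp add: pel[OF A as Z fs] legs_far_star[OF f as])
 qed (simp add: F FU)
qed

text \<open>Both sides flatten a nested composite, and \<open>U\<close> commutes with formal
  composites and with the concatenation of their elements.\<close>

lemma star_fc_mult:
 assumes A: "is_gph W A"
 shows "far Us (Mult (fc W) A) = Mult (fc V) (fob Us A)"
proof -
 note pA = is_gph_pre[OF A] and UA = gph[OF A] and M = W.fc_mult_gm[OF A]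
 note pB = W.fc_pre[OF pA]
 note e = star_fc_ob[OF pB] star_fc_ob[OF pA]
 show ?thesis
 proof (rule W.star_fc2_eqI[OF cocont A star_gm[OF U.cat_functor_axioms M] V.fc_mult_gm[OF UA, folded e]])
  show "fn (far Us (Mult (fc W) A)) a = fn (Mult (fc V) (fob Us A)) a" if "a \<in> pts A" for a
   using that W.fc_mult_fn[OF A] V.fc_mult_fn[OF UA] by simp
  fix Z as qs fss assume as: "pth A as" and n: "nest A as qs" and Z: "Z \<in> Ob W" and fss: "list_all2 (elems W Z) fss (plegs A qs)"
  let ?ps = "pels W A Z qs fss" and ?Ufss = "map (map (far U)) fss"
  have asB: "pth (fc_ob W A) as" using as by simp
  note ab = pth_hd(2,1)[OF as] and ps = W.nest_elems[OF pA Z as n fss] and j = W.jn_props[OF pA as n, of "hm A"]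
  have nU: "nest (fob Us A) as qs" using n by (simp add: nest_def)
  have q: "pth A (untup (qs ! r))" if "r < length qs" for r
   using n that paths_untup(2) by (fastforce simp: nest_prs all2_nth case_prod_beta)
  have len: "length fss = length qs" using list_all2_lengthD[OF fss] by simp
  have fr: "elems W Z (fss ! r) (legs (hm A) (untup (qs ! r)))" if "r < length qs" for r
   using list_all2_nthD2[OF fss, of r] that by simp
  have Ufss: "list_all2 (elems V (fob U Z)) ?Ufss (plegs (fob Us A) qs)"
   using star_elems[OF pA q fr] len by (simp add: all2_nth)
  have "map (far U) ?ps = pels V (fob Us A) (fob U Z) qs ?Ufss"
   using pel[OF pA q Z fr] len by (intro nth_equalityI) simp_all
  then show "fm (far Us (Mult (fc W) A)) (last as, hd as) \<cdot>\<^bsub>V\<^esub> far U (pel W (fc_ob W A) Z as ?ps) =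
    fm (Mult (fc V) (fob Us A)) (last as, hd as) \<cdot>\<^bsub>V\<^esub> far U (pel W (fc_ob W A) Z as ?ps)"
   using star_fm_comp[OF U.cat_functor_axioms M _ _ W.pel_hm[OF pB asB Z ps]] ab W.fc_mult_pel[OF A as n Z fss] pel[OF pA conjunct1[OF j] Z] elems_concat[OF fss] j
    V.fc_mult_pel[OF UA _ nU U.fob_Ob[OF Z] Ufss] as by (simp add: pel[OF pB asB Z ps] e map_concat)
 qed
qed

text \<open>\<open>R\<close>, \<open>u\<close> and \<open>m\<close> stand for the functor, unit and
  multiplication of a monad given by formulas which agrees on \<open>V\<close> with the monad of the
  adjunction. In the application it is the composite of the series in dimension n.\<close>

context
 fixes F \<eta> \<epsilon> R u m
 assumes adj: "adjunction V W F U \<eta> \<epsilon>" and R: "cocont V V R" and UF: "fctr_eq V (U \<odot> F) R"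
  and u: "\<forall>A \<in> Ob V. \<eta> A = u A" and m: "\<forall>A \<in> Ob V. far U (\<epsilon> (fob F A)) = m A"
begin

abbreviation (input) Rs where "Rs \<equiv> star R"

abbreviation (input) Fs where "Fs \<equiv> star F"

interpretation adj: adjunction V W F U \<eta> \<epsilon> by (rule adj)
interpretation R: cat_functor V V R by (rule cocont_functor[OF R])
interpretation VW: two_dcats V W by unfold_locales
interpretation VV: two_dcats V V by unfold_locales
interpretation WG: dcat "VGph W" by (rule VGph_dcat[OF W.dcat_axioms])
interpretation VG: dcat "VGph V" by (rule VGph_dcat[OF V.dcat_axioms])

lemma UF_ob: "A \<in> Ob V ==> fob U (fob F A) = fob R A" and UF_ar: "f \<in> hom V A B ==> far U (far F f) = far R f"
 using UF V.homD(1) by (auto simp: fctr_eq_def)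

lemma star_UF_ob: "is_gph V A ==> fob Us (fob Fs A) = fob Rs A"
 using UF_ob is_gphD(3)[of V A] by (auto simp: star_comp_ob star_ob intro!: restrict_ext)

lemma star_UF_ar:
 assumes "f \<in> hom (VGph V) A B"
 shows "far Us (far Fs f) = far Rs f"
proof -
 have f: "f \<in> gm V A B" and A: "is_gph V A" and B: "is_gph V B" using assms by (simp_all add: VGph_hom)
 show ?thesis
  using UF_ar[OF gm_fm[OF f]] star_UF_ob[OF A] star_UF_ob[OF B] by (auto simp: star_ar gmD(4,5)[OF f] intro!: restrict_ext)
qed

lemma mult_hom: "X \<in> Ob V ==> m X \<in> hom V (fob R (fob R X)) (fob R X)"
 using U.far_hom[OF adj.counit.component[OF adj.F.fob_Ob]] m UF_ob R.fob_Ob by simp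

text \<open>A formal composite is compatible with the change of stage along the counit. Naturality
  of the counit at the whole composite gives the left side; naturality at its elements gives the
  right side, where interchange has moved \<open>R\<close> from the composite to the
  elements.\<close>

lemma star_counit_fc:
 assumes A: "is_gph V A"
 shows "far Us (star_trans (F \<odot> U) id_fctr \<epsilon> (fc_ob W (fob Fs A))) =
  gph_comp V (fc_ar V (star_trans (R \<odot> R) R m A)) (ich V R (fob Rs A))"
proof -
 let ?B = "fob Fs A" and ?A = "fob Rs A" and ?s = "star_trans (R \<odot> R) R m A"
 note B = star_is_gph[OF adj.F.cat_functor_axioms A] and RA = star_is_gph[OF R.cat_functor_axioms A]
 note pB = is_gph_pre[OF B] and pRA = is_gph_pre[OF RA]
 note pRRA = is_gph_pre[OF star_is_gph[OF R.cat_functor_axioms RA]]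
 note UB = star_UF_ob[OF A]
 have fA: "is_gph V (fc_ob V ?A)" and fB: "is_gph W (fc_ob W ?B)" by (rule V.fc_is_gph[OF RA] W.fc_is_gph[OF B])+
 note k = star_trans_gm[OF adj.counit.nat_trans_axioms is_gph_pre[OF fB]]
 have UfB: "fob Us (fc_ob W ?B) = fc_ob V ?A" using star_fc_ob[OF pB] unfolding UB .
 have s: "?s \<in> gm V (fob Rs ?A) ?A" using V.star_trans_hom[OF A, of m "R \<odot> R" R] mult_hom by (simp add: VGph_hom star_comp_ob)
 note fs = V.fc_ar_gm[OF s pRRA pRA] and I = V.interchange0_gm[OF R pRA]
 have K: "far Us (star_trans (F \<odot> U) id_fctr \<epsilon> (fc_ob W ?B)) \<in> gm V (fob (star (R \<odot> U)) (fc_ob W ?B)) (fc_ob V ?A)"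
  using star_gm[OF U.cat_functor_axioms k] UfB star_UF_ob[OF fA] by (simp add: star_comp_ob[symmetric] star_id_ob[OF fB])
 have dom: "fob (star (R \<odot> U)) (fc_ob W ?B) = fob Rs (fc_ob V ?A)" unfolding star_comp_ob[symmetric] UfB ..
 show ?thesis
 proof (rule W.star_fc_eqI[OF cocont_comp[OF cocont R] pB K V.gph_comp_gm[OF I fs(1), folded dom]])
  show "fn (far Us (star_trans (F \<odot> U) id_fctr \<epsilon> (fc_ob W ?B))) a = fn (gph_comp V (fc_ar V ?s) (ich V R ?A)) a" if "a \<in> pts ?B" for a
   using that by (simp add: gph_comp_fn[OF I] fs)
  fix Z as es assume as: "pth ?B as" and Z: "Z \<in> Ob W" and es: "elems W Z es (legs (hm ?B) as)"
  have asA: "pth A as" using as by simp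
  note x = W.pel_hm[OF pB as Z es] and ab = pth_hd(2,1)[OF asA] and UZ = U.fob_Ob[OF Z]
  note \<epsilon> = adj.counit.component[unfolded far_comp_fctr id_fctr_simps]
  have Ux: "far U (pel W ?B Z as es) = pel V ?A (fob U Z) as (map (far U) es)" using pel[OF pB as Z es] unfolding UB .
  have Ues: "elems V (fob U Z) (map (far U) es) (legs (hm ?A) as)" using star_elems[OF pB as es] unfolding UB .
  \<comment> \<open>Naturality of the counit at \<open>f\<close>, read in \<open>V\<close>:
    composing with \<open>\<epsilon> Z\<close> before \<open>f\<close> becomes applying
    \<open>R\<close> and composing with the counit at \<open>X\<close> afterwards. It is used for
    the formal composite and for each of its elements.\<close>
  have x\<epsilon>: "far U (f \<cdot>\<^bsub>W\<^esub> \<epsilon> Z) = far U (\<epsilon> X) \<cdot>\<^bsub>V\<^esub> far R (far U f)" if f: "f \<in> hom W Z X" for f X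
  proof -
   have X: "X \<in> Ob W" using W.homA(5)[OF f] .
   show ?thesis
    using U.far_Comp[OF adj.F.far_hom[OF U.far_hom[OF f]] \<epsilon>[OF X]] adj.counit.natural[OF f] UF_ar[OF U.far_hom[OF f]] by simp
  qed
  have es\<epsilon>: "elems W (fob F (fob U Z)) (map (\<lambda>f. f \<cdot>\<^bsub>W\<^esub> \<epsilon> Z) es) (legs (hm ?B) as)" by (rule W.elems_comp[OF es \<epsilon>[OF Z]])
  have "map (far U) (map (\<lambda>f. f \<cdot>\<^bsub>W\<^esub> \<epsilon> Z) es) = comps V (legs (fm ?s) as) (map (far R) (map (far U) es))"
  proof (rule nth_equalityI)
   have l: "legs (fm ?s) as = map (\<lambda>Y. far U (\<epsilon> Y)) (legs (hm ?B) as)"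
    unfolding legs_map_out using m is_gphD(3)[OF A] by (intro legs_cong[OF asA]) simp
   fix r assume "r < length (map (far U) (map (\<lambda>f. f \<cdot>\<^bsub>W\<^esub> \<epsilon> Z) es))"
   then have r: "r < length es" "r < length as - 1" using elems_length[OF es] by simp_all
   show "map (far U) (map (\<lambda>f. f \<cdot>\<^bsub>W\<^esub> \<epsilon> Z) es) ! r = comps V (legs (fm ?s) as) (map (far R) (map (far U) es)) ! r"
    using x\<epsilon>[OF elems_nth[OF es, of r]] r l by simp
  qed (simp add: elems_length[OF es])
  then have "far U (pel W ?B Z as es \<cdot>\<^bsub>W\<^esub> \<epsilon> Z) = fm (fc_ar V ?s) (last as, hd as) \<cdot>\<^bsub>V\<^esub> pel V (fob Rs ?A) (fob R (fob U Z)) as (map (far R) (map (far U) es))"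
   using pel[OF pB as W.homA(4)[OF \<epsilon>[OF Z]] es\<epsilon>] V.fc_ar_pel[OF s pRRA pRA _ R.fob_Ob[OF UZ] V.star_elems[OF R _ Ues]] asA map_fn_id[OF _ asA, of ?s] UF_ob[OF UZ]
   unfolding W.pel_comp[OF pB as es \<epsilon>[OF Z]] UB by simp
  also have "pel V (fob Rs ?A) (fob R (fob U Z)) as (map (far R) (map (far U) es)) = fm (ich V R ?A) (last as, hd as) \<cdot>\<^bsub>V\<^esub> far R (far U (pel W ?B Z as es))"
   unfolding Ux using V.ich_pel[OF R pRA _ UZ Ues] asA by simp
  finally show "fm (far Us (star_trans (F \<odot> U) id_fctr \<epsilon> (fc_ob W ?B))) (last as, hd as) \<cdot>\<^bsub>V\<^esub> far (R \<odot> U) (pel W ?B Z as es) =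
    fm (gph_comp V (fc_ar V ?s) (ich V R ?A)) (last as, hd as) \<cdot>\<^bsub>V\<^esub> far (R \<odot> U) (pel W ?B Z as es)"
   using x\<epsilon>[OF x] V.gph_comp_fm_comp[OF I fs(1), of "last as" "hd as" "far R (far U (pel W ?B Z as es))" "fob R (fob U Z)"] R.far_hom[OF U.far_hom[OF x]] fhom[OF pB] ab
   by (simp add: UB del: interchange0_sel(2))
 qed
qed

text \<open>The formulas for unit and multiplication are the ones that adding a dimension produces
  for the composite of a series, so that adjunction and series can be matched by induction.\<close>

lemma enriched_adjunction:
 "\<exists>\<eta>' \<epsilon>'. adjunction (VGph V) (VCatC W) (W.Free \<odot> star F) (star U \<odot> underlying) \<eta>' \<epsilon>' &
   fctr_eq (VGph V) ((star U \<odot> underlying) \<odot> (W.Free \<odot> star F)) (Fun (fc V) \<odot> star R) &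
   (\<forall>A. is_gph V A --> \<eta>' A = fc_unit V (fob Rs A) \<cdot>\<^bsub>VGph V\<^esub> star_trans id_fctr R u A) &
   (\<forall>A. is_gph V A --> far (star U \<odot> underlying) (\<epsilon>' (fob (W.Free \<odot> star F) A)) =
    fc_ar V (star_trans (R \<odot> R) R m A) \<cdot>\<^bsub>VGph V\<^esub> (Mult (fc V) (fob (star (R \<odot> R)) A) \<cdot>\<^bsub>VGph V\<^esub> fc_ar V (ich V R (fob Rs A))))"
proof (intro exI conjI allI impI)
 show "adjunction (VGph V) (VCatC W) (W.Free \<odot> star F) (star U \<odot> underlying)
   (\<lambda>A. far Us (fc_unit W (fob Fs A)) \<cdot>\<^bsub>VGph V\<^esub> star_trans id_fctr (U \<odot> F) \<eta> A)
   (\<lambda>X. W.freecou X \<cdot>\<^bsub>VCatC W\<^esub> far W.Free (star_trans (F \<odot> U) id_fctr \<epsilon> (fob underlying X)))"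
  by (rule adjunction_comp[OF VW.star_adjunction[OF adj] W.free_adjunction])
next
 note F' = VW.star_functor[OF adj.F.cat_functor_axioms]
 have fW: "fob underlying (W.Fr B) = fc_ob W B" if "is_gph W B" for B using W.underlying_Fr[OF is_gph_pre[OF that]] .
 have fF: "far underlying (far W.Free f) = fc_ar W f" if "f \<in> hom (VGph W) A B" for f A B
  using W.fc_fctr_eq WG.homD(1)[OF that] by (simp add: fctr_eq_def del: W.Free_sel)
 show "fctr_eq (VGph V) ((star U \<odot> underlying) \<odot> (W.Free \<odot> star F)) (Fun (fc V) \<odot> star R)"
  unfolding fctr_eq_def
 proof (intro conjI ballI)
  fix A assume "A \<in> Ob (VGph V)"
  then have A: "is_gph V A" by simp
  note B = star_is_gph[OF adj.F.cat_functor_axioms A]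
  show "fob ((star U \<odot> underlying) \<odot> (W.Free \<odot> star F)) A = fob (Fun (fc V) \<odot> star R) A"
   by (simp add: fW[OF B] star_fc_ob[OF is_gph_pre[OF B]] star_UF_ob[OF A])
 next
  fix f assume "f \<in> Ar (VGph V)"
  then have f: "f \<in> hom (VGph V) (src f) (tgt f)" using VG.Ar_hom by simp
  have Ff: "far Fs f \<in> hom (VGph W) (fob Fs (src f)) (fob Fs (tgt f))" by (rule cat_functor.far_hom[OF F' f])
  then have g: "far Fs f \<in> gm W (fob Fs (src f)) (fob Fs (tgt f))" "pre_gph W (fob Fs (src f))" "pre_gph W (fob Fs (tgt f))"
   by (simp_all add: VGph_hom is_gph_pre)
  show "far ((star U \<odot> underlying) \<odot> (W.Free \<odot> star F)) f = far (Fun (fc V) \<odot> star R) f"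
   using fF[OF Ff] star_fc_ar[OF g] star_UF_ar[OF f] by simp
 qed
 fix A assume A: "is_gph V A"
 let ?B = "fob Fs A" and ?A = "fob Rs A"
 let ?k = "star_trans (F \<odot> U) id_fctr \<epsilon> (fc_ob W ?B)" and ?s = "star_trans (R \<odot> R) R m A"
 note B = star_is_gph[OF adj.F.cat_functor_axioms A] and RA = star_is_gph[OF R.cat_functor_axioms A]
 note RRA = star_is_gph[OF R.cat_functor_axioms RA]
 show "far Us (fc_unit W ?B) \<cdot>\<^bsub>VGph V\<^esub> star_trans id_fctr (U \<odot> F) \<eta> A = fc_unit V ?A \<cdot>\<^bsub>VGph V\<^esub> star_trans id_fctr R u A"
  unfolding star_fc_unit[OF is_gph_pre[OF B]] star_UF_ob[OF A]
  by (intro arg_cong2[where f = "Comp (VGph V)"] star_trans_cong[OF is_gph_pre[OF A]] bspec[OF u] refl) (simp_all add: star_comp_ob[symmetric] star_UF_ob[OF A])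
 have fB: "is_gph W (fc_ob W ?B)" by (rule W.fc_is_gph[OF B])
 have k: "?k \<in> hom (VGph W) (fob (star (F \<odot> U)) (fc_ob W ?B)) (fc_ob W ?B)"
  using W.star_trans_hom[OF fB, of \<epsilon> "F \<odot> U" id_fctr] adj.counit.component star_id_ob[OF fB] by simp
 have kg: "?k \<in> gm W (fob (star (F \<odot> U)) (fc_ob W ?B)) (fc_ob W ?B)" "is_gph W (fob (star (F \<odot> U)) (fc_ob W ?B))" using k by (simp_all add: VGph_hom)
 interpret free: adjunction "VGph W" "VCatC W" W.Free underlying "fc_unit W" W.freecou by (rule W.free_adjunction)
 have M: "far underlying (W.freecou (W.Fr ?B)) = Mult (fc W) ?B"
  unfolding W.freecou_eq W.fc_mult_eq[OF B] fW[OF B] ..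
 note c = free.counit.component[of "W.Fr ?B", unfolded far_comp_fctr id_fctr_simps fW[OF B]]
 have Frv: "W.Fr ?B \<in> Ob (VCatC W)" using W.Fr_vcategory[OF is_gph_pre[OF B]] by simp
 have "far underlying (W.freecou (W.Fr ?B) \<cdot>\<^bsub>VCatC W\<^esub> far W.Free ?k) = Mult (fc W) ?B \<cdot>\<^bsub>VGph W\<^esub> fc_ar W ?k"
  unfolding M[symmetric] fF[OF k, symmetric] by (rule free.U.far_Comp[OF free.F.far_hom[OF k] c[OF Frv]])
 then have "far (star U \<odot> underlying) (W.freecou (W.Fr ?B) \<cdot>\<^bsub>VCatC W\<^esub> far W.Free ?k) = far Us (Mult (fc W) ?B \<cdot>\<^bsub>VGph W\<^esub> fc_ar W ?k)" by simp
 also have "\<dots> = far Us (Mult (fc W) ?B) \<cdot>\<^bsub>VGph V\<^esub> far Us (fc_ar W ?k)"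
 proof (rule cat_functor.far_Comp[OF two_dcats.star_functor[OF two_dcats.intro[OF W.dcat_axioms V.dcat_axioms] U.cat_functor_axioms]])
  show "fc_ar W ?k \<in> hom (VGph W) (fc_ob W (fob (star (F \<odot> U)) (fc_ob W ?B))) (fc_ob W (fc_ob W ?B))"
   by (rule W.fc_hom[OF k])
  show "Mult (fc W) ?B \<in> hom (VGph W) (fc_ob W (fc_ob W ?B)) (fc_ob W ?B)" by (rule W.fcm_hom[OF B])
 qed
 also have "\<dots> = Mult (fc V) ?A \<cdot>\<^bsub>VGph V\<^esub> fc_ar V (fc_ar V ?s \<cdot>\<^bsub>VGph V\<^esub> ich V R ?A)"
  unfolding star_fc_mult[OF B] star_UF_ob[OF A] star_fc_ar[OF kg(1) is_gph_pre[OF kg(2)] is_gph_pre[OF fB]] star_counit_fc[OF A] VGph_sel ..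
 also have "\<dots> = Mult (fc V) ?A \<cdot>\<^bsub>VGph V\<^esub> (fc_ar V (fc_ar V ?s) \<cdot>\<^bsub>VGph V\<^esub> fc_ar V (ich V R ?A))"
 proof -
  have s: "?s \<in> hom (VGph V) (fob Rs ?A) ?A" using V.star_trans_hom[OF A, of m "R \<odot> R" R] mult_hom by (simp add: star_comp_ob)
  show ?thesis unfolding V.fc_comp[OF V.I_hom[OF R RA] V.fc_hom[OF s]] ..
 qed
 also have "\<dots> = fc_ar V ?s \<cdot>\<^bsub>VGph V\<^esub> (Mult (fc V) (fob Rs ?A) \<cdot>\<^bsub>VGph V\<^esub> fc_ar V (ich V R ?A))"
 proof -
  interpret fcM: monad "VGph V" "fc V" by (rule V.fc_monad)
  have s: "?s \<in> hom (VGph V) (fob Rs ?A) ?A" using V.star_trans_hom[OF A, of m "R \<odot> R" R] mult_hom by (simp add: star_comp_ob)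
  have n: "Mult (fc V) ?A \<cdot>\<^bsub>VGph V\<^esub> fc_ar V (fc_ar V ?s) = fc_ar V ?s \<cdot>\<^bsub>VGph V\<^esub> Mult (fc V) (fob Rs ?A)"
   using fcM.mult.natural[OF s] by simp
  note i = V.fc_hom[OF V.I_hom[OF R RA]]
  show ?thesis
   unfolding VG.Comp_assoc[OF i V.fc_hom[OF V.fc_hom[OF s]] V.fcm_hom[OF RA], symmetric] n
   by (rule VG.Comp_assoc[OF i V.fcm_hom[OF RRA] V.fc_hom[OF s]])
 qed
 finally show "far (star U \<odot> underlying) (W.freecou (fob (W.Free \<odot> star F) A) \<cdot>\<^bsub>VCatC W\<^esub> far W.Free (star_trans (F \<odot> U) id_fctr \<epsilon> (fob underlying (fob (W.Free \<odot> star F) A)))) =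
   fc_ar V ?s \<cdot>\<^bsub>VGph V\<^esub> (Mult (fc V) (fob (star (R \<odot> R)) A) \<cdot>\<^bsub>VGph V\<^esub> fc_ar V (ich V R ?A))"
  by (simp add: fW[OF B] star_comp_ob)
qed

end

end

section \<open>The free strict n-category monad\<close>

text \<open>\<open>nCat\<close> with chosen coproducts in every dimension; \<open>nCat_eq\<close>
  shows that leaving them out gives back \<open>nCat\<close>.\<close>

primrec nVCat :: "nat => 'a cell_vcat" where
 "nVCat 0 = set_cat"
| "nVCat (Suc n) = VCatC (nVCat n)"

lemma truncate_sel [simp]:
 "Ob (pcat.truncate V) = Ob V" "Ar (pcat.truncate V) = Ar V" "Dom (pcat.truncate V) = Dom V" "Cod (pcat.truncate V) = Cod V"
 "Id (pcat.truncate V) = Id V" "Comp (pcat.truncate V) = Comp V" "Prod (pcat.truncate V) = Prod V" "Proj (pcat.truncate V) = Proj V"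
 by (simp_all add: pcat.truncate_def)

lemma truncate_hom [simp]: "hom (pcat.truncate V) = hom V"
 by (intro ext) (simp add: hom_def)

lemma truncate_tuple [simp]: "tuple (pcat.truncate V) = tuple V"
 by (intro ext) (simp add: tuple_def)

lemma VCat_truncate: "VCat (pcat.truncate V) = VCat V"
proof -
 have [simp]: "prod_map (pcat.truncate V) = prod_map V" by (intro ext) (simp add: prod_map_def)
 have [simp]: "is_vcategory (pcat.truncate V) = is_vcategory V" by (intro ext) (simp add: is_vcategory_def)
 have [simp]: "is_gph_map (pcat.truncate V) = is_gph_map V" by (intro ext) (simp add: is_gph_map_def)
 have [simp]: "is_vfunctor (pcat.truncate V) = is_vfunctor V" by (intro ext) (simp add: is_vfunctor_def)
 have [simp]: "gph_id (pcat.truncate V) = gph_id V" "gph_comp (pcat.truncate V) = gph_comp V"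
  "proj_homs (pcat.truncate V) = proj_homs V" "vcat_prod (pcat.truncate V) = vcat_prod V"
  by (intro ext; simp add: gph_id_def gph_comp_def proj_homs_def vcat_prod_def)+
 show ?thesis by (simp add: VCat_def)
qed

lemma nCat_eq: "nCat n = pcat.truncate (nVCat n)"
proof (induction n)
 case (Suc n)
 have "pcat.truncate (VCatC V) = VCat V" for V :: "'a cell_vcat"
  by (simp add: pcat.truncate_def VCatC_def VCat_def)
 then show ?case using Suc by (simp add: VCat_truncate)
qed simp

lemma truncate_adjunction: "adjunction C (pcat.truncate D) F U \<eta> \<epsilon> = adjunction C D F U \<eta> \<epsilon>"
 by (simp add: adjunction_def adjunction_axioms_def nat_trans_def nat_trans_axioms_def cat_functor_def cat_functor_axioms_def category_def)

lemma set_strict_functor: "strict_functor set_cat set_cat id_fctr"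
 by (intro strict_functor.intro strict_functor_axioms.intro set_dcat cat_functor_id set_cat_category) (simp_all add: id_fctr_def)

context strict_functor
begin

abbreviation (input) K where "K \<equiv> star U \<odot> underlying"

lemma K_prod_pts: "prod_pts (map (fob K) Xs) = prod_pts Xs"
 by (simp add: prod_pts_def list_all2_map2)

lemma K_prod_homs: "p \<in> prod_pts Xs ==> q \<in> prod_pts Xs ==> prod_homs (map (fob K) Xs) p q = map (fob U) (prod_homs Xs p q)"
 using prod_ptsD(3)[of p Xs] prod_ptsD(3)[of q Xs] by (simp add: prod_homs_def)

lemma K_coprod_pts: "coprod_pts I (\<lambda>i. fob K (X i)) = coprod_pts I X"
 by (simp add: coprod_pts_def)

lemma K_Prod:
 assumes Xs: "set Xs <= Ob (VCatC W)"
 shows "fob K (Prod (VCatC W) Xs) = Prod (VGph V) (map (fob K) Xs)"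
proof -
 have v: "X \<in> set Xs ==> pre_gph W X" for X using Xs vcategory_pre by auto
 have "fob U (Prod W (prod_homs Xs p q)) = Prod V (prod_homs (map (fob K) Xs) p q)" if "p \<in> prod_pts Xs" "q \<in> prod_pts Xs" for p q
  using Prod[OF W.prod_homs_Ob[OF v that]] K_prod_homs[OF that] by simp
 then show ?thesis
  using K_prod_pts[of Xs] by (auto simp: gph_prod_def star_ob intro!: restrict_ext)
qed

lemma K_Coprod:
 assumes X: "!!i. i \<in> I ==> X i \<in> Ob (VCatC W)"
 shows "fob K (Coprod (VCatC W) I X) = Coprod (VGph V) I (\<lambda>i. fob K (X i))"
proof -
 \<comment> \<open>The empty coproduct is formed with the constant family \<open>undefined\<close>,
   which \<open>U\<close> need not preserve; chosen coproducts ignore the family when the index set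
   is empty.\<close>
 have i: "fob U (Coprod W {} (\<lambda>_. undefined)) = Coprod V {} (\<lambda>_. undefined)"
  using Coprod[of "{}" "\<lambda>_. undefined"] V.Coprod_cong[of "{}" "\<lambda>_. fob U undefined" "\<lambda>_. undefined"] by simp
 show ?thesis
  using K_coprod_pts[of I X] i by (auto simp: gph_coprod_def vcat_coprod_def Let_def star_ob elim!: coprod_ptsE intro!: restrict_ext)
qed

text \<open>Points of the chosen products and coproducts are tuples and tagged points, built in the
  same way for categories and for graphs; the hom-objects are handled by strictness of
  \<open>U\<close>. This is the step from one dimension to the next.\<close>

lemma strict_functor_K: "strict_functor (VCatC W) (VGph V) K"
proof (intro strict_functor.intro strict_functor_axioms.intro)
 interpret WV: two_dcats W V by unfold_locales
 interpret VC: gphlike W "VCatC W" "is_vfunctor W" by (rule W.VCatC_gphlike)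
 show "dcat (VCatC W)" "dcat (VGph V)" by (rule W.VC_dcat, rule VGph_dcat[OF V.dcat_axioms])
 show "cat_functor (VCatC W) (VGph V) K"
  by (rule cat_functor_comp[OF W.underlying_functor WV.star_functor[OF U.cat_functor_axioms]])
next
 fix Xs r assume Xs: "set Xs <= Ob (VCatC W)" and r: "r < length Xs"
 have v: "X \<in> set Xs ==> pre_gph W X" for X using Xs vcategory_pre by auto
 have "far U (Proj W (prod_homs Xs p q) r) = Proj V (prod_homs (map (fob K) Xs) p q) r" if "p \<in> prod_pts Xs" "q \<in> prod_pts Xs" for p q
  using Proj[OF W.prod_homs_Ob[OF v that], of r] r K_prod_homs[OF that] by simp
 then show "far K (Proj (VCatC W) Xs r) = Proj (VGph V) (map (fob K) Xs) r"
  using K_Prod[OF Xs] K_prod_pts[of Xs] r by (auto simp: VGph_def VCatC_def VCat_def proj_homs_def star_ar intro!: restrict_ext)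
next
 fix I :: "'a cell set" and X i assume X: "!!i. i \<in> I ==> X i \<in> Ob (VCatC W)" and i: "i \<in> I"
 have h: "hm (X i) (a, b) \<in> Ob W" if "a \<in> pts (X i)" "b \<in> pts (X i)" for a b
  using vcategory_pre[of W "X i"] X[OF i] that by (simp add: pre_gph_def)
 show "far K (Inj (VCatC W) I X i) = Inj (VGph V) I (\<lambda>i. fob K (X i)) i"
  using K_Coprod[OF X] U.far_Id[OF h] by (auto simp: VGph_def VCatC_def ginj_def star_ar intro!: restrict_ext)
qed (rule K_Prod K_Coprod; assumption)+

end

lemma forget_strict_functor: "strict_functor (nVCat n :: 'a cell_vcat) (nGph n) (forget n)"
proof (induction n)
 case 0
 show ?case using set_strict_functor by simp
next
 case (Suc n)
 then interpret strict_functor "nVCat n :: 'a cell_vcat" "nGph n" "forget n" .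
 show ?case using strict_functor_K by simp
qed

text \<open>Unit and multiplication are required to equal those of the composite on all objects, not
  merely up to isomorphism, so that the induction hypothesis can be fed into
  \<open>enriched_adjunction\<close>. In dimension 0 the series is empty and both categories are the
  category of sets.\<close>

lemma nVCat_adjunction:
 fixes M :: "nat => 'a cell_monad"
 defines "M \<equiv> \<lambda>n. composite_monad (nGph n) n (comp_monad n) (interchange n)"
 shows "\<exists>F \<eta> \<epsilon>. adjunction (nGph n) (nVCat n) F (forget n) \<eta> \<epsilon> & fctr_eq (nGph n) (forget n \<odot> F) (Fun (M n)) &
  (\<forall>A \<in> Ob (nGph n). \<eta> A = Unit (M n) A) & (\<forall>A \<in> Ob (nGph n). far (forget n) (\<epsilon> (fob F A)) = Mult (M n) A)"
proof (induction n)
 case 0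
 interpret category "set_cat :: 'a cell_vcat" by (rule set_cat_category)
 have n: "nat_trans set_cat (set_cat :: 'a cell_vcat) id_fctr id_fctr (Id set_cat)"
  by (rule nat_transI[OF cat_functor_id[OF category_axioms] cat_functor_id[OF category_axioms]])
   (simp_all add: Id_hom Comp_Id Id_Comp)
 have "adjunction set_cat (set_cat :: 'a cell_vcat) id_fctr id_fctr (Id set_cat) (Id set_cat)"
  by (intro adjunction.intro adjunction_axioms.intro) (simp_all add: n cat_functor_id[OF category_axioms] Id_Comp[OF Id_hom])
 then show ?case
  by (intro exI[of _ id_fctr] exI[of _ "Id set_cat"]) (simp add: M_def composite_monad_def Id_Comp[OF Id_hom] cong: conj_cong)
next
 case (Suc n)
 interpret strict_functor "nVCat n :: 'a cell_vcat" "nGph n" "forget n" by (rule forget_strict_functor)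
 have ds: "distributive_series (nGph n :: 'a cell_vcat) n (comp_monad n) (interchange n)" by (rule comp_monad_series)
 have c: "i < n ==> cocont (nGph n :: 'a cell_vcat) (nGph n) (Fun (comp_monad n i))" for i using comp_monad_props by blast
 note * = ds c comp_monad.simps(1,2)[of n] interchange.simps(1,2)[of n]
 have R: "cocont (nGph n) (nGph n) (Fun (M n))"
  using V.R_cocont[OF * order_refl] by (simp add: M_def composite_monad_def)
 obtain F \<eta> \<epsilon> where a: "adjunction (nGph n) (nVCat n) F (forget n) \<eta> \<epsilon>" "fctr_eq (nGph n) (forget n \<odot> F) (Fun (M n))"
  "\<forall>A \<in> Ob (nGph n). \<eta> A = Unit (M n) A" "\<forall>A \<in> Ob (nGph n). far (forget n) (\<epsilon> (fob F A)) = Mult (M n) A"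
  using Suc.IH by blast
 have Fe: "fctr_eq (VGph (nGph n)) (Fun (fc (nGph n)) \<odot> star (Fun (M n))) (Fun (M (Suc n)))"
  using V.series_star_Fun[OF *] unfolding M_def fctr_eq_def by simp
 have R': "series_fctr (comp_monad n) n = Fun (M n)" by (simp add: M_def composite_monad_def)
 from enriched_adjunction[OF a(1) R a(2-4)] obtain \<eta>' \<epsilon>' where
  b: "adjunction (VGph (nGph n)) (VCatC (nVCat n)) (W.Free \<odot> star F) (star (forget n) \<odot> underlying) \<eta>' \<epsilon>'"
   "fctr_eq (VGph (nGph n)) ((star (forget n) \<odot> underlying) \<odot> (W.Free \<odot> star F)) (Fun (fc (nGph n)) \<odot> star (Fun (M n)))"
  and b': "\<forall>A. is_gph (nGph n) A --> \<eta>' A = fc_unit (nGph n) (fob (star (Fun (M n))) A) \<cdot>\<^bsub>VGph (nGph n)\<^esub> star_trans id_fctr (Fun (M n)) (Unit (M n)) A"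
   "\<forall>A. is_gph (nGph n) A --> far (star (forget n) \<odot> underlying) (\<epsilon>' (fob (W.Free \<odot> star F) A)) =
    fc_ar (nGph n) (star_trans (Fun (M n) \<odot> Fun (M n)) (Fun (M n)) (Mult (M n)) A) \<cdot>\<^bsub>VGph (nGph n)\<^esub>
     (Mult (fc (nGph n)) (fob (star (Fun (M n) \<odot> Fun (M n))) A) \<cdot>\<^bsub>VGph (nGph n)\<^esub> fc_ar (nGph n) (ich (nGph n) (Fun (M n)) (fob (star (Fun (M n))) A)))"
  by (elim exE conjE)
 have e: "\<eta>' A = Unit (M (Suc n)) A" "far (star (forget n) \<odot> underlying) (\<epsilon>' (fob (W.Free \<odot> star F) A)) = Mult (M (Suc n)) A"
  if A: "is_gph (nGph n) A" for A
  using b'[rule_format, OF A] V.series_star_Unit[OF *, OF _ A] V.series_star_mult[OF *, OF _ A] unfolding R' by (simp_all add: M_def)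
 have "fctr_eq (VGph (nGph n)) ((star (forget n) \<odot> underlying) \<odot> (W.Free \<odot> star F)) (Fun (M (Suc n)))"
  using b(2) Fe unfolding fctr_eq_def by simp
 with b(1) e show ?case by (intro exI[of _ "W.Free \<odot> star F"] exI[of _ \<eta>'] exI[of _ \<epsilon>']) simp
qed

lemma isomorphic_monads_eq:
 assumes S: "monad C S" and e: "fctr_eq C (Fun S) (Fun T)"
  and "!!A. A \<in> Ob C ==> Unit T A = Unit S A" "!!A. A \<in> Ob C ==> Mult T A = Mult S A"
 shows "isomorphic_monads C T S"
proof -
 interpret S: monad C S by (rule S)
 have T: "monad C T" by (rule monad_cong[OF assms])
 interpret T: monad C T by (rule T)
 note c = S.unit.F.C.category_axioms
 have ob: "A \<in> Ob C ==> mob T A = mob S A" for A using e by (simp add: fctr_eq_def)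
 have n: "nat_trans C C (Fun T) (Fun S) (\<lambda>A. Id C (mob S A))"
 proof (rule nat_transI[OF T.unit.G.cat_functor_axioms S.unit.G.cat_functor_axioms])
  fix f A B assume f: "f \<in> hom C A B"
  have "far (Fun T) f = mar S f" using e S.unit.F.C.homD(1)[OF f] by (simp add: fctr_eq_def)
  then show "Id C (mob S B) \<cdot>\<^bsub>C\<^esub> mar T f = mar S f \<cdot>\<^bsub>C\<^esub> Id C (mob S A)"
   using category.Id_Comp[OF c S.unit.G.far_hom[OF f]] category.Comp_Id[OF c S.unit.G.far_hom[OF f]] by simp
 qed (simp add: ob category.Id_hom[OF c S.unit.G.fob_Ob])
 show ?thesis
  unfolding isomorphic_monads_def
 proof (intro conjI exI[of _ "\<lambda>A. Id C (mob S A)"] ballI S T n)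
  fix A assume A: "A \<in> Ob C"
  note SA = S.unit.G.fob_Ob[OF A]
  note SSA = S.unit.G.fob_Ob[OF SA]
  note i = category.Id_hom[OF c SA]
  show "iso_arrow C (Id C (mob S A))"
   using category.homD[OF c i] category.Id_Comp[OF c i] by (auto simp: iso_arrow_def intro: bexI[OF _ i])
  show "Id C (mob S A) \<cdot>\<^bsub>C\<^esub> Unit T A = Unit S A"
   using category.Id_Comp[OF c S.unit.component[OF A]] assms(3)[OF A] by simp
  show "Id C (mob S A) \<cdot>\<^bsub>C\<^esub> Mult T A = Mult S A \<cdot>\<^bsub>C\<^esub> mar S (Id C (mob S A)) \<cdot>\<^bsub>C\<^esub> Id C (mob S (mob T A))"
   using S.mult.component[OF A] S.unit.G.far_Id[OF SA] category.Id_Comp[OF c S.mult.component[OF A]] category.Comp_Id[OF c S.mult.component[OF A]]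
   by (simp add: assms(4)[OF A] ob[OF A])
 qed
qed

lemma composite_is_free: "is_free_ncat_monad n (composite_monad (nGph n :: 'a cell_vcat) n (comp_monad n) (interchange n))"
proof -
 obtain F \<eta> \<epsilon> where a: "adjunction (nGph n :: 'a cell_vcat) (nVCat n) F (forget n) \<eta> \<epsilon>"
  and b: "fctr_eq (nGph n) (forget n \<odot> F) (Fun (composite_monad (nGph n) n (comp_monad n) (interchange n)))"
   "!!A. A \<in> Ob (nGph n) ==> \<eta> A = Unit (composite_monad (nGph n) n (comp_monad n) (interchange n)) A"
   "!!A. A \<in> Ob (nGph n) ==> far (forget n) (\<epsilon> (fob F A)) = Mult (composite_monad (nGph n) n (comp_monad n) (interchange n)) A"
  using nVCat_adjunction[of n] by blast
 have "isomorphic_monads (nGph n) (composite_monad (nGph n) n (comp_monad n) (interchange n)) (adjunction_monad F (forget n) \<eta> \<epsilon>)"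
  by (rule isomorphic_monads_eq[OF adjunction_is_monad[OF a]]) (use b in \<open>simp_all add: adjunction_monad_def\<close>)
 then show ?thesis
  unfolding is_free_ncat_monad_def nCat_eq truncate_adjunction using a by blast
qed

section \<open>Globular sets as iterated graphs\<close>

lemma nGSet_hom: "f \<in> hom (nGSet n) A B \<longleftrightarrow> is_gmap f & gdom f = A & gcod f = B & is_glob n A & is_glob n B"
 by (auto simp: hom_def nGSet_def)

lemma nGSet_sel [simp]: "Ob (nGSet n) = {A. is_glob n A}"
 "gdom (Comp (nGSet n) g f) = gdom f" "gcod (Comp (nGSet n) g f) = gcod g"
 "gfn (Comp (nGSet n) g f) = (\<lambda>m. \<lambda>x\<in>cells (gdom f) m. gfn g m (gfn f m x))"
 "gdom (Id (nGSet n) A) = A" "gcod (Id (nGSet n) A) = A" "gfn (Id (nGSet n) A) = (\<lambda>m. \<lambda>x\<in>cells A m. x)"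
 by (simp_all add: nGSet_def)

lemma globD:
 assumes "is_glob n A"
 shows "m > n ==> cells A m = {}" "gs A m \<in> cells A (Suc m) \<rightarrow>\<^sub>E cells A m" "gt A m \<in> cells A (Suc m) \<rightarrow>\<^sub>E cells A m"
  "x \<in> cells A (Suc m) ==> gs A m x \<in> cells A m" "x \<in> cells A (Suc m) ==> gt A m x \<in> cells A m"
  "x \<in> cells A (Suc (Suc m)) ==> gs A m (gt A (Suc m) x) = gs A m (gs A (Suc m) x)"
  "x \<in> cells A (Suc (Suc m)) ==> gt A m (gt A (Suc m) x) = gt A m (gs A (Suc m) x)"
 using assms unfolding is_glob_def by (blast, blast, blast, blast, blast, metis, metis)

lemma gmapD:
 assumes "f \<in> hom (nGSet n) A B"
 shows "gdom f = A" "gcod f = B" "is_glob n A" "is_glob n B" "gfn f m \<in> cells A m \<rightarrow>\<^sub>E cells B m"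
  "x \<in> cells A m ==> gfn f m x \<in> cells B m"
  "x \<in> cells A (Suc m) ==> gs B m (gfn f (Suc m) x) = gfn f m (gs A m x)"
  "x \<in> cells A (Suc m) ==> gt B m (gfn f (Suc m) x) = gfn f m (gt A m x)"
 using assms unfolding nGSet_hom is_gmap_def by blast+

lemma gmap_homI:
 assumes "is_glob n A" "is_glob n B" "gdom f = A" "gcod f = B" "!!m. gfn f m \<in> cells A m \<rightarrow>\<^sub>E cells B m"
  "!!m x. x \<in> cells A (Suc m) ==> gs B m (gfn f (Suc m) x) = gfn f m (gs A m x) & gt B m (gfn f (Suc m) x) = gfn f m (gt A m x)"
 shows "f \<in> hom (nGSet n) A B"
 using assms by (simp add: nGSet_hom is_gmap_def)

lemma gmap_eqI:
 assumes f: "f \<in> hom (nGSet n) A B" and g: "g \<in> hom (nGSet n) A B" and e: "!!m x. x \<in> cells A m ==> gfn f m x = gfn g m x"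
 shows "f = g"
proof -
 have "gfn f m = gfn g m" for m using PiE_ext[OF gmapD(5)[OF f] gmapD(5)[OF g] e] .
 then show ?thesis using gmapD(1,2)[OF f] gmapD(1,2)[OF g] by (intro gmap.equality) auto
qed

lemma nGSet_Id_hom: "is_glob n A ==> Id (nGSet n) A \<in> hom (nGSet n) A A"
 by (rule gmap_homI) (simp_all add: globD)

lemma nGSet_Comp_hom:
 assumes f: "f \<in> hom (nGSet n) A B" and g: "g \<in> hom (nGSet n) B D"
 shows "g \<cdot>\<^bsub>nGSet n\<^esub> f \<in> hom (nGSet n) A D"
 using gmapD(6)[OF f] gmapD(6)[OF g]
 by (intro gmap_homI gmapD(3)[OF f] gmapD(4)[OF g])
  (auto simp: gmapD(1,2)[OF f] gmapD(2)[OF g] gmapD(7,8)[OF f] gmapD(7,8)[OF g] globD(4,5)[OF gmapD(3)[OF f]])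

lemma nGSet_category: "category (nGSet n)"
proof
 fix f assume "f \<in> Ar (nGSet n)"
 then show "Dom (nGSet n) f \<in> Ob (nGSet n)" "Cod (nGSet n) f \<in> Ob (nGSet n)" by (simp_all add: nGSet_def)
next
 fix A assume "A \<in> Ob (nGSet n)" then show "Id (nGSet n) A \<in> hom (nGSet n) A A" by (simp add: nGSet_Id_hom)
next
 fix f A B assume f: "f \<in> hom (nGSet n) A B"
 note i = nGSet_Id_hom[OF gmapD(3)[OF f]] nGSet_Id_hom[OF gmapD(4)[OF f]]
 show "f \<cdot>\<^bsub>nGSet n\<^esub> Id (nGSet n) A = f"
  by (rule gmap_eqI[OF nGSet_Comp_hom[OF i(1) f] f]) (simp add: gmapD(1)[OF f])
 show "Id (nGSet n) B \<cdot>\<^bsub>nGSet n\<^esub> f = f"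
  by (rule gmap_eqI[OF nGSet_Comp_hom[OF f i(2)] f]) (simp add: gmapD(1,6)[OF f])
 fix g D assume g: "g \<in> hom (nGSet n) B D"
 show "g \<cdot>\<^bsub>nGSet n\<^esub> f \<in> hom (nGSet n) A D" by (rule nGSet_Comp_hom[OF f g])
 fix h E assume h: "h \<in> hom (nGSet n) D E"
 show "h \<cdot>\<^bsub>nGSet n\<^esub> g \<cdot>\<^bsub>nGSet n\<^esub> f = h \<cdot>\<^bsub>nGSet n\<^esub> (g \<cdot>\<^bsub>nGSet n\<^esub> f)"
  by (rule gmap_eqI[OF nGSet_Comp_hom[OF f nGSet_Comp_hom[OF g h]] nGSet_Comp_hom[OF nGSet_Comp_hom[OF f g] h]])
   (simp add: gmapD(1)[OF f] gmapD(1)[OF g] gmapD(6)[OF f])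
qed

section \<open>Hom globular sets and the comparison functor on arrows\<close>

lemma hom_glob_sel [simp]:
 "cells (hom_glob A a b) m = {x \<in> cells A (Suc m). src0 A (Suc m) x = a & tgt0 A (Suc m) x = b}"
 "x \<in> cells (hom_glob A a b) (Suc m) ==> gs (hom_glob A a b) m x = gs A (Suc m) x"
 "x \<in> cells (hom_glob A a b) (Suc m) ==> gt (hom_glob A a b) m x = gt A (Suc m) x"
 by (simp_all add: hom_glob_def Let_def)

declare src0.simps(2) [simp del] tgt0.simps(2) [simp del]

lemma src0_cells: "is_glob n A ==> x \<in> cells A m ==> src0 A m x \<in> cells A 0"
 by (induction m arbitrary: x) (auto simp: globD src0.simps(2))

lemma tgt0_cells: "is_glob n A ==> x \<in> cells A m ==> tgt0 A m x \<in> cells A 0"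
 by (induction m arbitrary: x) (auto simp: globD tgt0.simps(2))

text \<open>This makes hom globular sets closed under faces. One application of the globular
  identities in the top dimensions suffices, since \<open>src0\<close> and \<open>tgt0\<close>
  iterate from the top.\<close>

lemma src0_face:
 assumes "is_glob n A" "x \<in> cells A (Suc (Suc m))"
 shows "src0 A (Suc m) (gs A (Suc m) x) = src0 A (Suc (Suc m)) x" "src0 A (Suc m) (gt A (Suc m) x) = src0 A (Suc (Suc m)) x"
  "tgt0 A (Suc m) (gs A (Suc m) x) = tgt0 A (Suc (Suc m)) x" "tgt0 A (Suc m) (gt A (Suc m) x) = tgt0 A (Suc (Suc m)) x"
 using globD(6,7)[OF assms] by (simp_all add: src0.simps(2) tgt0.simps(2))

lemma hom_glob_is_glob:
 assumes A: "is_glob (Suc n) A" shows "is_glob n (hom_glob A a b)"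
 unfolding is_glob_def
proof (intro conjI allI impI ballI)
 show "gs (hom_glob A a b) m \<in> cells (hom_glob A a b) (Suc m) \<rightarrow>\<^sub>E cells (hom_glob A a b) m"
  "gt (hom_glob A a b) m \<in> cells (hom_glob A a b) (Suc m) \<rightarrow>\<^sub>E cells (hom_glob A a b) m" for m
  using globD(4,5)[OF A] src0_face[OF A] by (auto simp: hom_glob_def Let_def)
 fix m x assume x: "x \<in> cells (hom_glob A a b) (Suc (Suc m))"
 then have "gs A (Suc (Suc m)) x \<in> cells (hom_glob A a b) (Suc m)" "gt A (Suc (Suc m)) x \<in> cells (hom_glob A a b) (Suc m)"
  using globD(4,5)[OF A] src0_face[OF A] by auto
 then show "gs (hom_glob A a b) m (gs (hom_glob A a b) (Suc m) x) = gs (hom_glob A a b) m (gt (hom_glob A a b) (Suc m) x)"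
  "gt (hom_glob A a b) m (gs (hom_glob A a b) (Suc m) x) = gt (hom_glob A a b) m (gt (hom_glob A a b) (Suc m) x)"
  using x globD(6,7)[OF A, of x "Suc m"] by (simp_all del: hom_glob_sel(1)) (auto simp: hom_glob_sel(1))
qed (use globD(1)[OF A] in auto)

lemma gmap_src0:
 assumes f: "f \<in> hom (nGSet n) A B"
 shows "x \<in> cells A m ==> src0 B m (gfn f m x) = gfn f 0 (src0 A m x)" "x \<in> cells A m ==> tgt0 B m (gfn f m x) = gfn f 0 (tgt0 A m x)"
proof (induction m arbitrary: x)
 case (Suc m)
 note A = gmapD(3)[OF f]
 { case 1 then show ?case using Suc.IH(1)[OF globD(4)[OF A 1]] gmapD(7)[OF f 1] by (simp add: src0.simps(2)) }
 { case 2 then show ?case using Suc.IH(2)[OF globD(5)[OF A 2]] gmapD(8)[OF f 2] by (simp add: tgt0.simps(2)) }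
qed simp_all

lemma hom_gmap_sel [simp]: "gdom (hom_gmap f a b) = hom_glob (gdom f) a b" "gcod (hom_gmap f a b) = hom_glob (gcod f) (gfn f 0 a) (gfn f 0 b)"
 "gfn (hom_gmap f a b) m = restrict (gfn f (Suc m)) (cells (hom_glob (gdom f) a b) m)"
 by (simp_all add: hom_gmap_def)

lemma hom_gmap_hom:
 assumes f: "f \<in> hom (nGSet (Suc n)) A B"
 shows "hom_gmap f a b \<in> hom (nGSet n) (hom_glob A a b) (hom_glob B (gfn f 0 a) (gfn f 0 b))"
proof (rule gmap_homI)
 note A = gmapD(3)[OF f] and B = gmapD(4)[OF f]
 show "is_glob n (hom_glob A a b)" "is_glob n (hom_glob B (gfn f 0 a) (gfn f 0 b))"
  by (rule hom_glob_is_glob[OF A], rule hom_glob_is_glob[OF B])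
 show "gdom (hom_gmap f a b) = hom_glob A a b" "gcod (hom_gmap f a b) = hom_glob B (gfn f 0 a) (gfn f 0 b)"
  by (simp_all add: gmapD(1,2)[OF f])
 show *: "gfn (hom_gmap f a b) m \<in> cells (hom_glob A a b) m \<rightarrow>\<^sub>E cells (hom_glob B (gfn f 0 a) (gfn f 0 b)) m" for m
  using gmapD(6)[OF f] gmap_src0[OF f] by (auto simp: gmapD(1)[OF f])
 fix m x assume x: "x \<in> cells (hom_glob A a b) (Suc m)"
 then have x': "x \<in> cells A (Suc (Suc m))" "gs A (Suc m) x \<in> cells (hom_glob A a b) m" "gt A (Suc m) x \<in> cells (hom_glob A a b) m"
  using globD(4,5)[OF A] src0_face[OF A] by auto
 have y: "gfn f (Suc (Suc m)) x \<in> cells (hom_glob B (gfn f 0 a) (gfn f 0 b)) (Suc m)"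
  using PiE_mem[OF *[of "Suc m"] x] x by (simp add: gmapD(1)[OF f])
 show "gs (hom_glob B (gfn f 0 a) (gfn f 0 b)) m (gfn (hom_gmap f a b) (Suc m) x) = gfn (hom_gmap f a b) m (gs (hom_glob A a b) m x) &
   gt (hom_glob B (gfn f 0 a) (gfn f 0 b)) m (gfn (hom_gmap f a b) (Suc m) x) = gfn (hom_gmap f a b) m (gt (hom_glob A a b) m x)"
  using x x' y gmapD(7,8)[OF f x'(1)] by (simp add: gmapD(1)[OF f] del: hom_glob_sel(1))
qed

lemma glob_to_gph_Ob: "is_glob n A ==> glob_to_gph n A \<in> Ob (nGph n)"
 by (induction n arbitrary: A) (auto intro!: is_gphI simp: hom_glob_is_glob)

lemma gmap_to_arr_hom: "f \<in> hom (nGSet n) A B ==> gmap_to_arr n f \<in> hom (nGph n) (glob_to_gph n A) (glob_to_gph n B)"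
proof (induction n arbitrary: f A B)
 case 0
 then show ?case using gmapD(1,2,5)[OF 0] by (simp add: set_hom)
next
 case (Suc n)
 note f = Suc.prems
 have "gmap_to_arr (Suc n) f \<in> gm (nGph n) (glob_to_gph (Suc n) A) (glob_to_gph (Suc n) B)"
  unfolding gmap_to_arr.simps gmapD(1,2)[OF f]
  using gmapD(5)[OF f, of 0] gmapD(6)[OF f, of _ 0] Suc.IH[OF hom_gmap_hom[OF f]] by (intro gmI) auto
 then show ?case using glob_to_gph_Ob[OF gmapD(3)[OF f]] glob_to_gph_Ob[OF gmapD(4)[OF f]] by (simp add: VGph_hom)
qed

lemma hom_glob_mem: "x \<in> cells A (Suc m) ==> x \<in> cells (hom_glob A (src0 A (Suc m) x) (tgt0 A (Suc m) x)) m"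
 by simp

text \<open>A cell of positive dimension lies in the hom globular set of its bounding 0-cells, so a
  map is determined by its action on 0-cells and on hom globular sets.\<close>

lemma gmap_to_arr_inj: "f \<in> hom (nGSet n) A B ==> g \<in> hom (nGSet n) A B ==> gmap_to_arr n f = gmap_to_arr n g ==> f = g"
proof (induction n arbitrary: f g A B)
 case 0
 show ?case
 proof (rule gmap_eqI[OF 0(1,2)])
  fix m x assume "x \<in> cells A m"
  then show "gfn f m x = gfn g m x" using 0(3) globD(1)[OF gmapD(3)[OF 0(1)], of m] by (cases m) auto
 qed
next
 case (Suc n)
 note f = Suc.prems(1) and g = Suc.prems(2)
 show ?case
 proof (rule gmap_eqI[OF f g])
  fix m x assume x: "x \<in> cells A m"
  have 0: "gfn f 0 = gfn g 0" using Suc.prems(3) by simp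
  show "gfn f m x = gfn g m x"
  proof (cases m)
   case (Suc k)
   let ?a = "src0 A m x" and ?b = "tgt0 A m x"
   have ab: "?a \<in> cells A 0" "?b \<in> cells A 0" using src0_cells[OF gmapD(3)[OF f] x] tgt0_cells[OF gmapD(3)[OF f] x] by simp_all
   have "gmap_to_arr n (hom_gmap f ?a ?b) = gmap_to_arr n (hom_gmap g ?a ?b)"
    using fun_cong[OF arg_cong[OF Suc.prems(3), of fm], of "(?a, ?b)"] ab by (simp add: gmapD(1)[OF f] gmapD(1)[OF g])
   from Suc.IH[OF hom_gmap_hom[OF f] hom_gmap_hom[OF g, folded 0] this] have "gfn (hom_gmap f ?a ?b) k x = gfn (hom_gmap g ?a ?b) k x" by simp
   then show ?thesis using hom_glob_mem[of x A k] x by (simp add: Suc gmapD(1)[OF f] gmapD(1)[OF g])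
  qed (simp add: 0)
 qed
qed

lemma gmap_to_arr_surj: "is_glob n A ==> is_glob n B ==> \<phi> \<in> hom (nGph n) (glob_to_gph n A) (glob_to_gph n B) ==>
  \<exists>f \<in> hom (nGSet n) A B. gmap_to_arr n f = \<phi>"
proof (induction n arbitrary: A B \<phi>)
 case 0
 have p: "\<phi> = SetAr (SetOb (cells A 0)) (SetOb (cells B 0)) (fn \<phi>)" "fn \<phi> \<in> cells A 0 \<rightarrow>\<^sub>E cells B 0"
  using 0(3) by (simp_all add: set_hom)
 \<comment> \<open>There are no cells in positive dimensions, so extensionality forces the value
   \<open>undefined\<close> there.\<close>
 let ?f = "\<lparr>gdom = A, gcod = B, gfn = \<lambda>m. if m = 0 then fn \<phi> else (\<lambda>_. undefined)\<rparr>"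
 have "?f \<in> hom (nGSet 0) A B"
  using p(2) globD(1)[OF 0(1)] by (intro gmap_homI 0(1,2)) auto
 then show ?case using p(1) by (intro bexI[of _ ?f]) simp_all
next
 case (Suc n)
 note A = Suc.prems(1) and B = Suc.prems(2)
 have p: "\<phi> \<in> gm (nGph n) (glob_to_gph (Suc n) A) (glob_to_gph (Suc n) B)" using Suc.prems(3) by (simp add: VGph_hom)
 have fn: "fn \<phi> \<in> cells A 0 \<rightarrow>\<^sub>E cells B 0" using gmD(2)[OF p] by simp
 have "\<exists>g \<in> hom (nGSet n) (hom_glob A a b) (hom_glob B (fn \<phi> a) (fn \<phi> b)). gmap_to_arr n g = fm \<phi> (a, b)"
  if "a \<in> cells A 0" "b \<in> cells A 0" for a b
  using Suc.IH[OF hom_glob_is_glob[OF A] hom_glob_is_glob[OF B]] gm_fm[OF p, of a b] gm_fn[OF p] that by simp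
 then obtain g where g: "!!a b. a \<in> cells A 0 ==> b \<in> cells A 0 ==> g a b \<in> hom (nGSet n) (hom_glob A a b) (hom_glob B (fn \<phi> a) (fn \<phi> b))"
  and g': "!!a b. a \<in> cells A 0 ==> b \<in> cells A 0 ==> gmap_to_arr n (g a b) = fm \<phi> (a, b)"
  by metis
 let ?s = "src0 A" and ?t = "tgt0 A"
 \<comment> \<open>Each cell of positive dimension belongs to exactly one hom globular set, that of
   its bounding 0-cells, so the maps \<open>g a b\<close> given by induction fit together.\<close>
 define f where "f = \<lparr>gdom = A, gcod = B, gfn = \<lambda>m. case m of 0 => fn \<phi> | Suc k => \<lambda>x\<in>cells A m. gfn (g (?s m x) (?t m x)) k x\<rparr>"
 have fs: "gdom f = A" "gcod f = B" "gfn f 0 = fn \<phi>" "!!k x. x \<in> cells A (Suc k) ==> gfn f (Suc k) x = gfn (g (?s (Suc k) x) (?t (Suc k) x)) k x"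
  by (simp_all add: f_def)
 have gx: "gfn f (Suc k) x \<in> cells (hom_glob B (fn \<phi> (?s (Suc k) x)) (fn \<phi> (?t (Suc k) x))) k" if x: "x \<in> cells A (Suc k)" for k x
  using gmapD(6)[OF g[OF src0_cells[OF A x] tgt0_cells[OF A x]] hom_glob_mem[OF x]] unfolding fs(4)[OF x] .
 have f: "f \<in> hom (nGSet (Suc n)) A B"
 proof (rule gmap_homI[OF A B fs(1,2)])
  fix m show "gfn f m \<in> cells A m \<rightarrow>\<^sub>E cells B m"
   using fn gx by (cases m) (auto simp: f_def)
  fix x assume x: "x \<in> cells A (Suc m)"
  show "gs B m (gfn f (Suc m) x) = gfn f m (gs A m x) & gt B m (gfn f (Suc m) x) = gfn f m (gt A m x)"
  proof (cases m)
   case 0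
   \<comment> \<open>For a 1-cell the claim is that its image has the right endpoints, which is
     membership in the hom globular set.\<close>
   then show ?thesis using gx[OF x] fs(3) by (simp add: src0.simps tgt0.simps)
  next
   case (Suc k)
   let ?a = "?s (Suc m) x" and ?b = "?t (Suc m) x"
   note gg = g[OF src0_cells[OF A x] tgt0_cells[OF A x]]
   have xk: "x \<in> cells (hom_glob A ?a ?b) (Suc k)" using x by (simp add: Suc)
   have x2: "x \<in> cells A (Suc (Suc k))" using x by (simp add: Suc)
   have y: "gfn (g ?a ?b) (Suc k) x \<in> cells (hom_glob B (fn \<phi> ?a) (fn \<phi> ?b)) (Suc k)" by (rule gmapD(6)[OF gg xk])
   show ?thesis
    using gmapD(7,8)[OF gg xk] fs(4)[OF x] fs(4)[OF globD(4)[OF A x2]] fs(4)[OF globD(5)[OF A x2]] src0_face[OF A x2]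
    unfolding hom_glob_sel(2,3)[OF xk] hom_glob_sel(2,3)[OF y] by (simp add: Suc)
  qed
 qed
 have e: "hom_gmap f a b = g a b" if "a \<in> cells A 0" "b \<in> cells A 0" for a b
  by (rule gmap_eqI[OF hom_gmap_hom[OF f, unfolded fs(3)] g[OF that]]) (auto simp: fs(1,4))
 have "gmap_to_arr (Suc n) f = \<phi>"
  by (rule gm_eqI[OF _ p]) (use gmap_to_arr_hom[OF f] in \<open>simp_all add: VGph_hom fs e g'\<close>)
 then show ?case using f by blast
qed

lemma gmap_to_arr_Id: "is_glob n A ==> gmap_to_arr n (Id (nGSet n) A) = Id (nGph n) (glob_to_gph n A)"
proof (induction n arbitrary: A)
 case (Suc n)
 have "hom_gmap (Id (nGSet (Suc n)) A) a b = Id (nGSet n) (hom_glob A a b)" if "a \<in> cells A 0" "b \<in> cells A 0" for a b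
  by (rule gmap_eqI[OF hom_gmap_hom[OF nGSet_Id_hom[OF Suc.prems], of a b, simplified nGSet_sel restrict_apply'[OF that(1)] restrict_apply'[OF that(2)]] nGSet_Id_hom[OF hom_glob_is_glob[OF Suc.prems]]]) simp
 then show ?case using Suc.IH[OF hom_glob_is_glob[OF Suc.prems]] by (auto simp: gph_id_def intro!: restrict_ext)
qed (simp add: set_Id)

lemma gmap_to_arr_Comp: "f \<in> hom (nGSet n) A B ==> g \<in> hom (nGSet n) B D ==>
  gmap_to_arr n (g \<cdot>\<^bsub>nGSet n\<^esub> f) = gmap_to_arr n g \<cdot>\<^bsub>nGph n\<^esub> gmap_to_arr n f"
proof (induction n arbitrary: f g A B D)
 case 0
 note f = gmap_to_arr_hom[OF 0(1)] and g = gmap_to_arr_hom[OF 0(2)]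
 show ?case using set_comp[OF f[unfolded nGph.simps] g[unfolded nGph.simps]] gmapD(1,2)[OF 0(1)] gmapD(2)[OF 0(2)] by simp
next
 case (Suc n)
 note f = Suc.prems(1) and g = Suc.prems(2)
 have e: "hom_gmap (g \<cdot>\<^bsub>nGSet (Suc n)\<^esub> f) a b = hom_gmap g (gfn f 0 a) (gfn f 0 b) \<cdot>\<^bsub>nGSet n\<^esub> hom_gmap f a b"
  if ab: "a \<in> cells A 0" "b \<in> cells A 0" for a b
 proof (rule gmap_eqI[OF _ nGSet_Comp_hom[OF hom_gmap_hom[OF f] hom_gmap_hom[OF g]]])
  show "hom_gmap (g \<cdot>\<^bsub>nGSet (Suc n)\<^esub> f) a b \<in> hom (nGSet n) (hom_glob A a b) (hom_glob D (gfn g 0 (gfn f 0 a)) (gfn g 0 (gfn f 0 b)))"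
   using hom_gmap_hom[OF nGSet_Comp_hom[OF f g], of a b] ab by (simp add: gmapD(1)[OF f])
  show "gfn (hom_gmap (g \<cdot>\<^bsub>nGSet (Suc n)\<^esub> f) a b) m x = gfn (hom_gmap g (gfn f 0 a) (gfn f 0 b) \<cdot>\<^bsub>nGSet n\<^esub> hom_gmap f a b) m x"
   if "x \<in> cells (hom_glob A a b) m" for m x
   using that gmap_src0[OF f, of x "Suc m"] gmapD(6)[OF f] by (simp add: gmapD(1)[OF f] gmapD(1)[OF g])
 qed
 show ?case
  using gmapD(6)[OF f, of _ 0] by (auto simp: gph_comp_def e Suc.IH[OF hom_gmap_hom[OF f] hom_gmap_hom[OF g]] gmapD(1,2)[OF f] gmapD(1,2)[OF g] intro!: restrict_ext)
qed

lemma comparison_functor: "cat_functor (nGSet n) (nGph n) (comparison n)"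
proof -
 interpret dcat "nGph n" by (rule nGph_dcat)
 show ?thesis
  by (intro cat_functor.intro cat_functor_axioms.intro nGSet_category category_axioms)
   (simp_all add: comparison_def glob_to_gph_Ob gmap_to_arr_hom gmap_to_arr_Id gmap_to_arr_Comp)
qed

section \<open>Essential surjectivity of the comparison\<close>

definition inverses :: "('o, 'm, 'z) cat_scheme => 'o => 'o => 'm => 'm => bool" where
 "inverses C A B f g \<longleftrightarrow> f \<in> hom C A B & g \<in> hom C B A & g \<cdot>\<^bsub>C\<^esub> f = Id C A & f \<cdot>\<^bsub>C\<^esub> g = Id C B"

lemma (in category) inverses_comp:
 assumes f: "inverses C A B f f'" and g: "inverses C B D g g'"
 shows "inverses C A D (g \<cdot> f) (f' \<cdot> g')"
proof -
 have h: "f \<in> hom C A B" "f' \<in> hom C B A" "g \<in> hom C B D" "g' \<in> hom C D B"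
  and e: "f' \<cdot> f = Id C A" "f \<cdot> f' = Id C B" "g' \<cdot> g = Id C B" "g \<cdot> g' = Id C D"
  using f g by (simp_all add: inverses_def)
 have "f' \<cdot> g' \<cdot> (g \<cdot> f) = f' \<cdot> (g' \<cdot> g \<cdot> f)" "g \<cdot> f \<cdot> (f' \<cdot> g') = g \<cdot> (f \<cdot> f' \<cdot> g')"
  using Comp_assoc[OF Comp_hom[OF h(1,3)] h(4,2)] Comp_assoc[OF h(1,3,4)] Comp_assoc[OF Comp_hom[OF h(4,2)] h(1,3)] Comp_assoc[OF h(4,2,1)] by simp_all
 then show ?thesis
  using Comp_hom[OF h(1,3)] Comp_hom[OF h(4,2)] e Id_Comp[OF h(1)] Id_Comp[OF h(4)] by (simp add: inverses_def)
qed

lemma inverses_functor: "cat_functor C D F ==> inverses C A B f g ==> A \<in> Ob C ==> B \<in> Ob C ==> inverses D (fob F A) (fob F B) (far F f) (far F g)"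
 using cat_functor.far_hom[of C D F] cat_functor.far_Comp[of C D F f A B g A] cat_functor.far_Comp[of C D F g B A f B] cat_functor.far_Id[of C D F] by (simp add: inverses_def)

text \<open>Used to replace each hom-object by an isomorphic one without touching the
  points.\<close>

lemma (in dcat) inverses_gph:
 assumes A: "is_gph V A" and B: "is_gph V B" and e: "pts B = pts A"
  and i: "!!a b. a \<in> pts A ==> b \<in> pts A ==> inverses V (hm A (a, b)) (hm B (a, b)) (f (a, b)) (g (a, b))"
 shows "inverses (VGph V) A B (GphAr A B (\<lambda>a\<in>pts A. a) (restrict f (pts A \<times> pts A))) (GphAr B A (\<lambda>a\<in>pts A. a) (restrict g (pts A \<times> pts A)))"
  (is "inverses _ _ _ ?f ?g")
proof -
 have f: "?f \<in> gm V A B" and g: "?g \<in> gm V B A" using i e by (auto intro!: gmI simp: inverses_def)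
 have "gph_comp V ?g ?f = gph_id V A" "gph_comp V ?f ?g = gph_id V B"
  using i e by (auto simp: gph_comp_def gph_id_def inverses_def intro!: restrict_ext)
 then show ?thesis using f g A B by (simp add: inverses_def VGph_hom)
qed

text \<open>Assembles a globular set from 0-cells and prescribed hom globular sets. Each cell stores
  its endpoints, because the given hom globular sets may overlap while a cell of a globular set
  determines its endpoints. A graph is therefore reached only up to isomorphism.\<close>

definition sum_glob :: "'a cell set => ('a cell => 'a cell => 'a glob) => 'a glob" where
 "sum_glob P H = (let K = \<lambda>m. case m of 0 => P | Suc k => {Tup [a, b, x] | a b x. a \<in> P & b \<in> P & x \<in> cells (H a b) k};
   face = \<lambda>d s m. \<lambda>y\<in>K (Suc m). case m of 0 => untup y ! d
    | Suc k => Tup [untup y ! 0, untup y ! 1, s (H (untup y ! 0) (untup y ! 1)) k (untup y ! 2)]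
  in \<lparr>cells = K, gs = face 0 gs, gt = face 1 gt\<rparr>)"

context
 fixes n P and H :: "'a cell => 'a cell => 'a glob"
 assumes H: "!!a b. a \<in> P ==> b \<in> P ==> is_glob n (H a b)"
begin

lemma sum_glob_sel: "cells (sum_glob P H) 0 = P"
 "y \<in> cells (sum_glob P H) (Suc m) \<longleftrightarrow> (\<exists>a b x. y = Tup [a, b, x] & a \<in> P & b \<in> P & x \<in> cells (H a b) m)"
 by (auto simp: sum_glob_def Let_def)

lemma sum_glob_face:
 assumes "a \<in> P" "b \<in> P"
 shows "x \<in> cells (H a b) 0 ==> gs (sum_glob P H) 0 (Tup [a, b, x]) = a" "x \<in> cells (H a b) 0 ==> gt (sum_glob P H) 0 (Tup [a, b, x]) = b"
  "x \<in> cells (H a b) (Suc m) ==> gs (sum_glob P H) (Suc m) (Tup [a, b, x]) = Tup [a, b, gs (H a b) m x]"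
  "x \<in> cells (H a b) (Suc m) ==> gt (sum_glob P H) (Suc m) (Tup [a, b, x]) = Tup [a, b, gt (H a b) m x]"
 using assms by (auto simp: sum_glob_def Let_def)

lemma sum_glob_is_glob: "is_glob (Suc n) (sum_glob P H)"
 unfolding is_glob_def
proof (intro conjI allI impI ballI)
 fix m
 show "gs (sum_glob P H) m \<in> cells (sum_glob P H) (Suc m) \<rightarrow>\<^sub>E cells (sum_glob P H) m"
 proof (rule PiE_I)
  fix y assume "y \<in> cells (sum_glob P H) (Suc m)"
  then show "gs (sum_glob P H) m y \<in> cells (sum_glob P H) m"
   using globD(4)[OF H] by (cases m) (auto simp: sum_glob_sel sum_glob_face)
 qed (simp add: sum_glob_def Let_def, blast)
 show "gt (sum_glob P H) m \<in> cells (sum_glob P H) (Suc m) \<rightarrow>\<^sub>E cells (sum_glob P H) m"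
 proof (rule PiE_I)
  fix y assume "y \<in> cells (sum_glob P H) (Suc m)"
  then show "gt (sum_glob P H) m y \<in> cells (sum_glob P H) m"
   using globD(5)[OF H] by (cases m) (auto simp: sum_glob_sel sum_glob_face)
 qed (simp add: sum_glob_def Let_def, blast)
 show "cells (sum_glob P H) m = {}" if "Suc n < m"
  using globD(1)[OF H] that by (cases m) (auto simp: sum_glob_sel)
 fix y assume "y \<in> cells (sum_glob P H) (Suc (Suc m))"
 then obtain a b x where y: "y = Tup [a, b, x]" "a \<in> P" "b \<in> P" "x \<in> cells (H a b) (Suc m)" by (auto simp: sum_glob_sel)
 note h = H[OF y(2,3)]
 show "gs (sum_glob P H) m (gs (sum_glob P H) (Suc m) y) = gs (sum_glob P H) m (gt (sum_glob P H) (Suc m) y)"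
  "gt (sum_glob P H) m (gs (sum_glob P H) (Suc m) y) = gt (sum_glob P H) m (gt (sum_glob P H) (Suc m) y)"
  using y globD(4,5)[OF h y(4)] globD(6,7)[OF h] by (cases m; simp add: sum_glob_face)+
qed

lemma sum_glob_src0: "a \<in> P ==> b \<in> P ==> x \<in> cells (H a b) m ==>
  src0 (sum_glob P H) (Suc m) (Tup [a, b, x]) = a & tgt0 (sum_glob P H) (Suc m) (Tup [a, b, x]) = b"
proof (induction m arbitrary: x)
 case 0
 then show ?case by (simp add: src0.simps(2) tgt0.simps(2) sum_glob_face)
next
 case (Suc m)
 then show ?case
  using globD(4,5)[OF H[OF Suc.prems(1,2)] Suc.prems(3)] by (simp add: src0.simps(2)[of _ "Suc m"] tgt0.simps(2)[of _ "Suc m"] sum_glob_face)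
qed

lemma sum_glob_hom: "a \<in> P ==> b \<in> P ==> cells (hom_glob (sum_glob P H) a b) m = (\<lambda>x. Tup [a, b, x]) ` cells (H a b) m"
 using sum_glob_src0 by (auto simp: sum_glob_sel)

lemma sum_glob_inverses:
 assumes ab: "a \<in> P" "b \<in> P"
 shows "\<exists>u v. inverses (nGSet n) (hom_glob (sum_glob P H) a b) (H a b) u v"
proof -
 let ?S = "hom_glob (sum_glob P H) a b"
 let ?u = "\<lparr>gdom = ?S, gcod = H a b, gfn = \<lambda>m. \<lambda>y\<in>cells ?S m. untup y ! 2\<rparr>"
 let ?v = "\<lparr>gdom = H a b, gcod = ?S, gfn = \<lambda>m. \<lambda>x\<in>cells (H a b) m. Tup [a, b, x]\<rparr>"
 note h = H[OF ab] and s = hom_glob_is_glob[OF sum_glob_is_glob, of a b]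
 note c = sum_glob_hom[OF ab]
 have m: "Tup [a, b, x] \<in> cells ?S m" if "x \<in> cells (H a b) m" for x m using that unfolding c by simp
 have f: "gs ?S m (Tup [a, b, x]) = Tup [a, b, gs (H a b) m x]" "gt ?S m (Tup [a, b, x]) = Tup [a, b, gt (H a b) m x]"
  if "x \<in> cells (H a b) (Suc m)" for x m
  using hom_glob_sel(2,3)[OF m[OF that]] sum_glob_face(3,4)[OF ab that] by simp_all
 have u: "?u \<in> hom (nGSet n) ?S (H a b)"
  using globD(4,5)[OF h] by (intro gmap_homI[OF s h]) (auto simp del: hom_glob_sel simp: c f)
 have v: "?v \<in> hom (nGSet n) (H a b) ?S"
  using globD(4,5)[OF h] by (intro gmap_homI[OF h s]) (auto simp del: hom_glob_sel simp: c f)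
 have "?v \<cdot>\<^bsub>nGSet n\<^esub> ?u = Id (nGSet n) ?S"
  by (rule gmap_eqI[OF nGSet_Comp_hom[OF u v] nGSet_Id_hom[OF s]]) (auto simp del: hom_glob_sel simp: c)
 moreover have "?u \<cdot>\<^bsub>nGSet n\<^esub> ?v = Id (nGSet n) (H a b)"
  by (rule gmap_eqI[OF nGSet_Comp_hom[OF v u] nGSet_Id_hom[OF h]]) (auto simp del: hom_glob_sel simp: c)
 ultimately show ?thesis using u v unfolding inverses_def by blast
qed

end

lemma comparison_ess_surj: "Y \<in> Ob (nGph n) ==> \<exists>A f g. is_glob n A & inverses (nGph n) (glob_to_gph n A) Y f g"
proof (induction n arbitrary: Y)
 case 0
 let ?A = "\<lparr>cells = \<lambda>m. if m = 0 then pts Y else {}, gs = \<lambda>m _. undefined, gt = \<lambda>m _. undefined\<rparr>"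
 have Y: "Y = SetOb (pts Y)" using 0 by (simp add: set_Ob)
 then have "glob_to_gph 0 ?A = Y" by simp
 moreover have "inverses set_cat Y Y (Id set_cat Y) (Id set_cat Y)"
  using 0 category.Id_hom[OF set_cat_category] category.Id_Comp[OF set_cat_category] by (auto simp: inverses_def)
 moreover have "is_glob 0 ?A" by (auto simp: is_glob_def)
 ultimately show ?case by (metis nGph.simps(1))
next
 case (Suc n)
 then have Y: "is_gph (nGph n) Y" by simp
 interpret dcat "nGph n" by (rule nGph_dcat)
 \<comment> \<open>The two mutually inverse arrows are packed into one pair \<open>p\<close>, so
   that a single choice function supplies both.\<close>
 have "\<exists>A p. is_glob n A & inverses (nGph n) (glob_to_gph n A) (hm Y (a, b)) (fst p) (snd p)" if "a \<in> pts Y" "b \<in> pts Y" for a b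
  using Suc.IH[OF is_gphD(3)[OF Y that]] by auto
 then obtain H p where H: "!!a b. a \<in> pts Y ==> b \<in> pts Y ==> is_glob n (H a b)"
  and p: "!!a b. a \<in> pts Y ==> b \<in> pts Y ==> inverses (nGph n) (glob_to_gph n (H a b)) (hm Y (a, b)) (fst (p a b)) (snd (p a b))"
  by metis
 let ?S = "sum_glob (pts Y) H"
 note S = sum_glob_is_glob[of "pts Y" n H, OF H]
 have "\<exists>q. inverses (nGph n) (hm (glob_to_gph (Suc n) ?S) (a, b)) (hm Y (a, b)) (fst q) (snd q)" if ab: "a \<in> pts Y" "b \<in> pts Y" for a b
 proof -
  obtain u v where "inverses (nGSet n) (hom_glob ?S a b) (H a b) u v" using sum_glob_inverses[of "pts Y" n H, OF H ab] by blast
  from inverses_functor[OF comparison_functor this] have "inverses (nGph n) (glob_to_gph n (hom_glob ?S a b)) (glob_to_gph n (H a b)) (gmap_to_arr n u) (gmap_to_arr n v)"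
   using hom_glob_is_glob[OF S] H[OF ab] by (simp add: comparison_def)
  from inverses_comp[OF this p[OF ab]] show ?thesis
   using ab by (intro exI[of _ "(_, _)"]) (simp add: sum_glob_sel[of "pts Y" n H, OF H])
 qed
 then obtain q where q: "!!a b. a \<in> pts Y ==> b \<in> pts Y ==> inverses (nGph n) (hm (glob_to_gph (Suc n) ?S) (a, b)) (hm Y (a, b)) (fst (q a b)) (snd (q a b))"
  by metis
 have "is_gph (nGph n) (glob_to_gph (Suc n) ?S)" using glob_to_gph_Ob[OF S] by simp
 from inverses_gph[OF this Y, of "\<lambda>(a, b). fst (q a b)" "\<lambda>(a, b). snd (q a b)"] q show ?case
  by (intro exI[of _ ?S] exI conjI S) (auto simp: sum_glob_sel[of "pts Y" n H, OF H])
qed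

lemma comparison_equivalence: "equivalence (nGSet n) (nGph n) (comparison n)"
 unfolding equivalence_def
proof (intro conjI ballI)
 show "cat_functor (nGSet n) (nGph n) (comparison n)" by (rule comparison_functor)
next
 fix A B :: "'a glob" assume "A \<in> Ob (nGSet n)" "B \<in> Ob (nGSet n)"
 then show "bij_betw (far (comparison n)) (hom (nGSet n) A B) (hom (nGph n) (fob (comparison n) A) (fob (comparison n) B))"
  using gmap_to_arr_inj[of _ n A B] gmap_to_arr_hom[of _ n A B] gmap_to_arr_surj[of n A B]
  unfolding comparison_def bij_betw_def inj_on_def by (simp, blast)
next
 fix Y :: "'a obj" assume Y: "Y \<in> Ob (nGph n)"
 obtain A f g where "is_glob n A" "inverses (nGph n) (glob_to_gph n A) Y f g" using comparison_ess_surj[OF Y] by blast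
 moreover from this(2) have "iso_arrow (nGph n) f" by (auto simp: inverses_def iso_arrow_def hom_def)
 ultimately show "\<exists>A\<in>Ob (nGSet n). \<exists>f\<in>hom (nGph n) (fob (comparison n) A) Y. iso_arrow (nGph n) f"
  by (auto simp: comparison_def inverses_def)
qed

theorem theorem4p10:
  fixes n :: nat
  assumes "n \<ge> 1"
  shows "equivalence (nGSet n :: ('a glob, 'a gmap) cat) (nGph n :: 'a cell_vcat) (comparison n)
    \<and> distributive_series (nGph n :: 'a cell_vcat) n (comp_monad n) (interchange n)
    \<and> is_free_ncat_monad n
        (composite_monad (nGph n :: 'a cell_vcat) n (comp_monad n) (interchange n))"
  using comparison_equivalence comp_monad_series composite_is_free by blast

end
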